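(* For each integer $\ell\geq1$ the free boundary minimal solid torus $$A_\ell=\frac{1}{r_\ell}\bigl(A\cap\{|x|\leq r_\ell\}\bigr)\subset\mathbb{B}^4$$ has $G$-equivariant Morse index at least $\ell$.
   Context: $\mathbb{B}^4$ is the closed unit ball in $\mathbb{R}^4$. $G\cong\mathrm{O}(2)\times\mathrm{O}(2)$ is the group of all isometries of $\mathbb{R}^4$ setwise preserving each of the planes $\{x^3=x^4=0\}$ and $\{x^1=x^2=0\}$. Its orbits are the origin, circles in these two planes, and tori. Let $C=\{x\in\mathbb{R}^4:(x^1)^2+(x^2)^2=(x^3)^2+(x^4)^2\}$. $A$ denotes the complete embedded $G$-invariant minimal hypersurface in $\mathbb{R}^4$ constructed by Alencar, homeomorphic to $\mathbb{R}^2\times\mathbb{S}^1$, containing precisely one circular orbit of $G$, asymptotic to $C$, and having nontrivial intersection with $C$ outside every compact subset of $\mathbb{R}^4$; $A$ does not contain the origin. Let $\nu=(\nu^1,\dots,\nu^4)$ be a unit normal of $A$ and $x^k\nu_k=\sum_{k=1}^4x^k\nu^k$. The zero set of $x^k\nu_k$ on $A$ is $\{x\in A: x^k\nu_k(x)=0\}=\bigcup_{m=1}^\infty\{x\in A:|x|=r_m\}$, a union of disjoint $G$-invariant tori, where $\{r_m\}_{m\geq1}$ is a strictly increasing, diverging sequence of positive reals; this defines $r_\ell$. $A_\ell$ is a free boundary minimal hypersurface in $\mathbb{B}^4$ diffeomorphic to $\mathbb{B}^2\times\mathbb{S}^1$. The Jacobi (stability) form of $A_\ell$ is $Q(u,u)=\int_{A_\ell}(|\nabla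 u|^2-|\mathrm{II}|^2u^2)-\int_{\partial A_\ell}u^2$ on $H^1(A_\ell)$, with $\mathrm{II}$ the second fundamental form. The $G$-equivariant Morse index is the number of negative eigenvalues (with multiplicity) of $Q$ on the space of $G$-equivariant functions, i.e. functions $u$ with $\mathrm{sgn}_\nu(g)\,u(g^{-1}.p)=u(p)$ for all $g\in G$, where $\mathrm{sgn}_\nu(g)=\pm1$ according to $g_*\nu=\pm\nu$. Here $\mathrm{sgn}_\nu\equiv1$, so $G$-equivariant functions are the same as $G$-invariant ones. *)

theory Defs
  imports "HOL-Analysis.Analysis"
begin

section \<open>Smooth submanifolds of Euclidean space\<close>

text \<open>\<open>C_k_on k U f\<close> says that \<open>f\<close> is of class \<open>C\<^sup>k\<close> on \<open>U\<close>; it is meant for open \<open>U\<close>.\<close>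

primrec C_k_on ::
  "nat \<Rightarrow> 'a::euclidean_space set \<Rightarrow> ('a \<Rightarrow> 'b::real_normed_vector) \<Rightarrow> bool" where
  "C_k_on 0 U f = continuous_on U f"
| "C_k_on (Suc k) U f =
     ((\<forall>x\<in>U. f differentiable (at x)) \<and>
      (\<forall>v. C_k_on k U (\<lambda>x. frechet_derivative f (at x) v)))"

definition smooth_on ::
  "'a::euclidean_space set \<Rightarrow> ('a \<Rightarrow> 'b::real_normed_vector) \<Rightarrow> bool" where
  "smooth_on U f \<longleftrightarrow> (\<forall>k. C_k_on k U f)"

definition local_param ::
  "(real^'n) set \<Rightarrow> (real^'k) set \<Rightarrow> (real^'k \<Rightarrow> real^'n) \<Rightarrow> bool" where
  "local_param M U \<phi> \<longleftrightarrow>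
     open U \<and> smooth_on U \<phi> \<and> (\<forall>x\<in>U. inj (frechet_derivative \<phi> (at x))) \<and>
     (\<exists>\<psi>. homeomorphism U (\<phi> ` U) \<phi> \<psi>) \<and> openin (top_of_set M) (\<phi> ` U)"

text \<open>
  The type argument carries the dimension. For an embedded \<open>k\<close>-dimensional manifold with
  boundary, the next two sets are the interior and the boundary in the sense of manifolds
  (not in the sense of the topology of the ambient space).
\<close>

definition mfd_interior :: "'k::finite itself \<Rightarrow> (real^'n) set \<Rightarrow> (real^'n) set" where
  "mfd_interior K M = {p. \<exists>(U :: (real^'k) set) \<phi>. local_param M U \<phi> \<and> p \<in> \<phi> ` U}"

definition mfd_boundary :: "'k::finite itself \<Rightarrow> (real^'n) set \<Rightarrow> (real^'n) set" where
  "mfd_boundary K M = M - mfd_interior K M"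

definition embedded_submanifold :: "'k::finite itself \<Rightarrow> (real^'n) set \<Rightarrow> bool" where
  "embedded_submanifold K M \<longleftrightarrow> M \<subseteq> mfd_interior K M"

definition jacobian :: "(real^'k \<Rightarrow> real^'n) \<Rightarrow> real^'k \<Rightarrow> real" where
  "jacobian \<phi> x =
     sqrt (det (\<chi> i j. frechet_derivative \<phi> (at x) (axis i 1) \<bullet>
                       frechet_derivative \<phi> (at x) (axis j 1)))"

text \<open>
  The Riemannian \<open>k\<close>-dimensional volume measure, living on the interior of \<open>M\<close> (the boundary of
  a manifold with boundary being negligible). It is the unique measure
  given by the area formula in every local parametrization.
\<close>

definition area_measure :: "'k::finite itself \<Rightarrow> (real^'n) set \<Rightarrow> (real^'n) measure" where
  "area_measure K M =
     (THE \<mu>. sets \<mu> = sets (restrict_space borel (mfd_interior K M)) \<and>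
        (\<forall>(U :: (real^'k) set) \<phi> E. local_param M U \<phi> \<and> E \<in> sets borel \<and> E \<subseteq> U \<longrightarrow>
           emeasure \<mu> (\<phi> ` E) = (\<integral>\<^sup>+x\<in>E. ennreal (jacobian \<phi> x) \<partial>lborel)))"

text \<open>Infimum of the lengths of piecewise \<open>C\<^sup>1\<close> curves; meaningful for connected \<open>M\<close>.\<close>

definition intrinsic_dist ::
  "'a::real_normed_vector set \<Rightarrow> 'a \<Rightarrow> 'a \<Rightarrow> real" where
  "intrinsic_dist M p q =
     Inf {integral {0..1} (\<lambda>t. norm (vector_derivative \<gamma> (at t))) | \<gamma>.
            valid_path \<gamma> \<and> path_image \<gamma> \<subseteq> M \<and> pathstart \<gamma> = p \<and> pathfinish \<gamma> = q}"

definition intrinsically_complete :: "'a::real_normed_vector set \<Rightarrow> bool" where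
  "intrinsically_complete M \<longleftrightarrow>
     (\<forall>X::nat \<Rightarrow> 'a. range X \<subseteq> M \<and>
        (\<forall>e>0. \<exists>N. \<forall>m\<ge>N. \<forall>n\<ge>N. intrinsic_dist M (X m) (X n) < e) \<longrightarrow>
        (\<exists>p\<in>M. (\<lambda>n. intrinsic_dist M (X n) p) \<longlonglongrightarrow> 0))"


section \<open>Hypersurfaces of \<open>\<real>\<^sup>4\<close>\<close>

text \<open>
  A hypersurface is an embedded three-dimensional manifold, possibly with boundary; all the
  pointwise notions below are only meant at interior points.
\<close>

definition tangent_space :: "(real^4) set \<Rightarrow> real^4 \<Rightarrow> (real^4) set" where
  "tangent_space M p =
     {v. \<exists>(U :: (real^3) set) \<phi> x. local_param M U \<phi> \<and> x \<in> U \<and> \<phi> x = p \<and>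
           v \<in> range (frechet_derivative \<phi> (at x))}"

text \<open>
  The differential of \<open>f\<close> along \<open>M\<close>. A derivative relative to \<open>M\<close> is determined
  on the tangent space only; it is extended by zero to the normal line.
\<close>

definition tangential_deriv ::
  "(real^4) set \<Rightarrow> (real^4 \<Rightarrow> 'b::real_normed_vector) \<Rightarrow> real^4 \<Rightarrow> real^4 \<Rightarrow> 'b" where
  "tangential_deriv M f p =
     (THE L. (f has_derivative L) (at p within M) \<and>
             (\<forall>w. (\<forall>v\<in>tangent_space M p. w \<bullet> v = 0) \<longrightarrow> L w = 0))"

definition tangential_grad ::
  "(real^4) set \<Rightarrow> (real^4 \<Rightarrow> real) \<Rightarrow> real^4 \<Rightarrow> real^4" where
  "tangential_grad M f p = (\<Sum>b\<in>Basis. tangential_deriv M f p b *\<^sub>R b)"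

definition unit_normal :: "(real^4) set \<Rightarrow> (real^4 \<Rightarrow> real^4) \<Rightarrow> bool" where
  "unit_normal M \<nu> \<longleftrightarrow> continuous_on M \<nu> \<and>
     (\<forall>p\<in>M. norm (\<nu> p) = 1 \<and> (\<forall>v\<in>tangent_space M p. \<nu> p \<bullet> v = 0))"

text \<open>
  The second fundamental form with respect to \<open>\<nu>\<close>, again extended by zero to the normal
  line. Because of this, its trace and squared norm over an orthonormal basis of the tangent
  space coincide with those over any orthonormal basis of \<open>\<real>\<^sup>4\<close>.
\<close>

definition second_ff ::
  "(real^4) set \<Rightarrow> (real^4 \<Rightarrow> real^4) \<Rightarrow> real^4 \<Rightarrow> real^4 \<Rightarrow> real^4 \<Rightarrow> real" where
  "second_ff M \<nu> p v w = - (tangential_deriv M \<nu> p v \<bullet> w)"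

definition mean_curvature ::
  "(real^4) set \<Rightarrow> (real^4 \<Rightarrow> real^4) \<Rightarrow> real^4 \<Rightarrow> real" where
  "mean_curvature M \<nu> p = (\<Sum>b\<in>Basis. second_ff M \<nu> p b b)"

definition second_ff_norm2 ::
  "(real^4) set \<Rightarrow> (real^4 \<Rightarrow> real^4) \<Rightarrow> real^4 \<Rightarrow> real" where
  "second_ff_norm2 M \<nu> p = (\<Sum>b\<in>Basis. \<Sum>c\<in>Basis. (second_ff M \<nu> p b c)\<^sup>2)"


section \<open>The Sobolev space \<open>H\<^sup>1\<close> and the Jacobi form\<close>

text \<open>
  Throughout this section \<open>\<Sigma>\<close> is a compact hypersurface with boundary, and a function on
  \<open>\<Sigma>\<close> is represented by a function on \<open>\<real>\<^sup>4\<close> whose values off \<open>\<Sigma>\<close> are irrelevant.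
\<close>

abbreviation "vol \<Sigma> \<equiv> area_measure TYPE(3) (\<Sigma> :: (real^4) set)"

abbreviation "bdry_area \<Sigma> \<equiv>
  area_measure TYPE(2) (mfd_boundary TYPE(3) (\<Sigma> :: (real^4) set))"

definition L2_tendsto ::
  "'a measure \<Rightarrow> (nat \<Rightarrow> 'a \<Rightarrow> 'b::euclidean_space) \<Rightarrow> ('a \<Rightarrow> 'b) \<Rightarrow> bool" where
  "L2_tendsto \<mu> f u \<longleftrightarrow> u \<in> borel_measurable \<mu> \<and>
     (\<lambda>n. \<integral>\<^sup>+p. ennreal ((norm (f n p - u p))\<^sup>2) \<partial>\<mu>) \<longlonglongrightarrow> 0"

text \<open>
  \<open>H\<^sup>1(\<Sigma>)\<close> is the completion of the smooth functions on \<open>\<Sigma>\<close> (restrictions of smooth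
  functions on \<open>\<real>\<^sup>4\<close>) for the \<open>H\<^sup>1\<close> norm. In \<open>H1_data \<Sigma> u X t\<close>, \<open>X\<close> is the weak gradient
  and \<open>t\<close> the boundary trace of \<open>u\<close>; both are unique up to null sets, and the convergence to
  \<open>t\<close> is automatic by the trace theorem.
\<close>

definition H1_data ::
  "(real^4) set \<Rightarrow> (real^4 \<Rightarrow> real) \<Rightarrow> (real^4 \<Rightarrow> real^4) \<Rightarrow> (real^4 \<Rightarrow> real) \<Rightarrow> bool" where
  "H1_data \<Sigma> u X t \<longleftrightarrow>
     (\<exists>f. (\<forall>n. smooth_on UNIV (f n)) \<and>
        L2_tendsto (vol \<Sigma>) f u \<and>
        L2_tendsto (vol \<Sigma>) (\<lambda>n. tangential_grad \<Sigma> (f n)) X \<and>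
        L2_tendsto (bdry_area \<Sigma>) f t)"

definition H1 :: "(real^4) set \<Rightarrow> (real^4 \<Rightarrow> real) set" where
  "H1 \<Sigma> = {u. \<exists>X t. H1_data \<Sigma> u X t}"

definition weak_grad :: "(real^4) set \<Rightarrow> (real^4 \<Rightarrow> real) \<Rightarrow> real^4 \<Rightarrow> real^4" where
  "weak_grad \<Sigma> u = (SOME X. \<exists>t. H1_data \<Sigma> u X t)"

definition bdry_trace :: "(real^4) set \<Rightarrow> (real^4 \<Rightarrow> real) \<Rightarrow> real^4 \<Rightarrow> real" where
  "bdry_trace \<Sigma> u = (SOME t. \<exists>X. H1_data \<Sigma> u X t)"

text \<open>The Jacobi form of a free boundary minimal hypersurface \<open>\<Sigma>\<close> of the unit ball.\<close>

definition jacobi_form ::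
  "(real^4) set \<Rightarrow> (real^4 \<Rightarrow> real^4) \<Rightarrow> (real^4 \<Rightarrow> real) \<Rightarrow> (real^4 \<Rightarrow> real) \<Rightarrow> real" where
  "jacobi_form \<Sigma> \<nu> u v =
     (LINT p|vol \<Sigma>. weak_grad \<Sigma> u p \<bullet> weak_grad \<Sigma> v p - second_ff_norm2 \<Sigma> \<nu> p * u p * v p) -
     (LINT p|bdry_area \<Sigma>. bdry_trace \<Sigma> u p * bdry_trace \<Sigma> v p)"


section \<open>Equivariant Morse index\<close>

text \<open>
  Here \<open>\<Gamma>\<close> is a group of linear isometries preserving \<open>\<Sigma>\<close>, so that
  \<open>(g\<^sub>* \<nu>)(p) = g (\<nu> (g\<inverse> p))\<close>, and each \<open>g\<close> either fixes \<open>\<nu>\<close> or reverses it.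
\<close>

definition normal_sgn ::
  "(real^4) set \<Rightarrow> (real^4 \<Rightarrow> real^4) \<Rightarrow> (real^4 \<Rightarrow> real^4) \<Rightarrow> real" where
  "normal_sgn \<Sigma> \<nu> g = (if \<forall>p\<in>\<Sigma>. g (\<nu> (inv g p)) = \<nu> p then 1 else - 1)"

definition equivariant_H1 ::
  "(real^4 \<Rightarrow> real^4) set \<Rightarrow> (real^4) set \<Rightarrow> (real^4 \<Rightarrow> real^4) \<Rightarrow> (real^4 \<Rightarrow> real) set" where
  "equivariant_H1 \<Gamma> \<Sigma> \<nu> =
     {u \<in> H1 \<Sigma>. \<forall>g\<in>\<Gamma>. AE p in vol \<Sigma>. normal_sgn \<Sigma> \<nu> g * u (inv g p) = u p}"

definition eigenspace ::
  "(real^4 \<Rightarrow> real^4) set \<Rightarrow> (real^4) set \<Rightarrow> (real^4 \<Rightarrow> real^4) \<Rightarrow> real \<Rightarrow> (real^4 \<Rightarrow> real) set"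
  where
  "eigenspace \<Gamma> \<Sigma> \<nu> \<kappa> =
     {u \<in> equivariant_H1 \<Gamma> \<Sigma> \<nu>. \<forall>v\<in>equivariant_H1 \<Gamma> \<Sigma> \<nu>.
        jacobi_form \<Sigma> \<nu> u v = \<kappa> * (LINT p|vol \<Sigma>. u p * v p)}"

definition AE_independent :: "'a measure \<Rightarrow> ('a \<Rightarrow> real) set \<Rightarrow> bool" where
  "AE_independent \<mu> B \<longleftrightarrow>
     (\<forall>c. (AE p in \<mu>. (\<Sum>u\<in>B. c u * u p) = 0) \<longrightarrow> (\<forall>u\<in>B. c u = 0))"

text \<open>Dimension of a space of functions, functions equal almost everywhere being identified.\<close>

definition AE_dim :: "'a measure \<Rightarrow> ('a \<Rightarrow> real) set \<Rightarrow> enat" where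
  "AE_dim \<mu> V = (SUP B\<in>{B. finite B \<and> B \<subseteq> V \<and> AE_independent \<mu> B}. enat (card B))"

text \<open>
  Number of negative eigenvalues, counted with multiplicity: the summand vanishes if \<open>\<kappa>\<close> is
  not an eigenvalue.
\<close>

definition equivariant_index ::
  "(real^4 \<Rightarrow> real^4) set \<Rightarrow> (real^4) set \<Rightarrow> (real^4 \<Rightarrow> real^4) \<Rightarrow> enat" where
  "equivariant_index \<Gamma> \<Sigma> \<nu> =
     (\<Sum>\<^sub>\<infinity>\<kappa>\<in>{..<0}. AE_dim (vol \<Sigma>) (eigenspace \<Gamma> \<Sigma> \<nu> \<kappa>))"


section \<open>The symmetry group, the cone and the truncated hypersurfaces\<close>

definition plane12 :: "(real^4) set" where
  "plane12 = {x. x $ 3 = 0 \<and> x $ 4 = 0}"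

definition plane34 :: "(real^4) set" where
  "plane34 = {x. x $ 1 = 0 \<and> x $ 2 = 0}"

definition G :: "(real^4 \<Rightarrow> real^4) set" where
  "G = {g. (\<forall>x y. dist (g x) (g y) = dist x y) \<and>
           g ` plane12 = plane12 \<and> g ` plane34 = plane34}"

definition G_orbit :: "real^4 \<Rightarrow> (real^4) set" where
  "G_orbit p = {g p | g. g \<in> G}"

definition circular_orbit :: "(real^4) set \<Rightarrow> bool" where
  "circular_orbit S \<longleftrightarrow> (\<exists>p \<in> plane12 \<union> plane34. p \<noteq> 0 \<and> S = G_orbit p)"

definition toral_orbit :: "(real^4) set \<Rightarrow> bool" where
  "toral_orbit S \<longleftrightarrow> (\<exists>p. p \<notin> plane12 \<union> plane34 \<and> S = G_orbit p)"

definition Ccone :: "(real^4) set" where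
  "Ccone = {x. (x $ 1)\<^sup>2 + (x $ 2)\<^sup>2 = (x $ 3)\<^sup>2 + (x $ 4)\<^sup>2}"

definition asymptotic_sets :: "'a::real_normed_vector set \<Rightarrow> 'a set \<Rightarrow> bool" where
  "asymptotic_sets S T \<longleftrightarrow>
     (\<forall>e>0. \<exists>R. (\<forall>x\<in>S. norm x \<ge> R \<longrightarrow> infdist x T < e) \<and>
                (\<forall>x\<in>T. norm x \<ge> R \<longrightarrow> infdist x S < e))"

text \<open>
  The hypersurface constructed by Alencar enters through its properties; being intrinsic to it,
  completeness is required of the induced length metric.
\<close>

definition alencar_hypersurface :: "(real^4) set \<Rightarrow> (real^4 \<Rightarrow> real^4) \<Rightarrow> bool" where
  "alencar_hypersurface A \<nu> \<longleftrightarrow>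
     embedded_submanifold TYPE(3) A \<and>
     intrinsically_complete A \<and>
     (\<forall>g\<in>G. g ` A = A) \<and>
     unit_normal A \<nu> \<and>
     (\<forall>p\<in>A. mean_curvature A \<nu> p = 0) \<and>
     A homeomorphic ((UNIV :: (real^2) set) \<times> sphere (0::real^2) 1) \<and>
     (\<exists>!S. circular_orbit S \<and> S \<subseteq> A) \<and>
     asymptotic_sets A Ccone \<and>
     (\<forall>K. compact K \<longrightarrow> A \<inter> Ccone - K \<noteq> {}) \<and>
     0 \<notin> A"

definition truncation :: "(real^4) set \<Rightarrow> real \<Rightarrow> (real^4) set" where
  "truncation A \<rho> = (\<lambda>x. (1 / \<rho>) *\<^sub>R x) ` (A \<inter> {x. norm x \<le> \<rho>})"

end

theory Submission
  imports Defs
begin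

text \<open>
  A meridian of \<open>A\<close>, starting on the circular orbit, is parametrised by \<open>t = |x|\<^sup>2\<close>: minimality makes
  \<open>F = p |\<nabla> |x|\<^sup>2|\<close>, with \<open>p\<close> the area of the torus orbit up to a factor, strictly increasing, so \<open>|x|\<^sup>2\<close>
  has no further critical point. On radial functions the Jacobi form becomes a singular Sturm--Liouville form in
  \<open>t\<close>, regular at the circular orbit. Dilations make \<open>x \<bullet> \<nu>\<close> a Jacobi function, and it vanishes exactly at
  \<open>r\<^sub>1\<^sup>2 < r\<^sub>2\<^sup>2 < \<dots>\<close>. Shooting with the Pruefer angle of the regular solution, these zeros produce \<open>l\<close>
  negative Robin eigenvalues on \<open>t \<le> r\<^sub>l\<^sup>2\<close>, and the resulting radial functions are
  eigenfunctions of the Jacobi form in \<open>H\<^sup>1\<close>.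
\<close>

text \<open>The index counts eigenvalues, so trial functions cut out of
  \<open>x \<bullet> \<nu>\<close> between its zeros would still need a spectral theorem for the
  form. Shooting avoids this: it yields eigenfunctions with distinct negative eigenvalues outright.
  In the variable t the radial equation is (F u')' + m (W + \<lambda>) u = 0 with F' = 6 m and F = 0
  at the circular orbit, the 6 being the Laplacian of |x|^2 on a minimal hypersurface of dimension
  3; its regular solutions are fixed points of a Volterra operator. The boundary term of the form
  becomes a Robin condition F u' = c u with c > 0, whose angle lies strictly between 0 and \<pi>/2;
  therefore the zero on the boundary counts as well, and the bound is \<open>l\<close> and not
  \<open>l - 1\<close>. Much of the remaining work is forced by the definitions:
  \<open>area_measure\<close> is a definite description, so a measure must be constructed, and
  \<open>weak_grad\<close> and \<open>bdry_trace\<close> are arbitrary choices, so they must be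
  shown unique up to null sets before the form can be computed.\<close>

abbreviation "FD f x \<equiv> frechet_derivative f (at x)"
abbreviation "mfd_int \<equiv> mfd_interior TYPE(3)"
type_synonym real3 = "real \<times> real \<times> real"

text \<open>Differentiability of \<open>Psi\<close> at a single point and continuity of
  \<open>y\<close> suffice. \<open>P\<close> is only a left inverse of the partial derivative in
  \<open>y\<close>, so the equation may be overdetermined, as it is for a chart with values in a
  larger space.\<close>

lemma implicit_has_derivative:
 fixes Psi :: "'a::real_normed_vector \<times> 'b::real_normed_vector => 'c::real_normed_vector"
  and y :: "'a => 'b"
 assumes D: "(Psi has_derivative D) (at (x0, y x0) within S \<times> UNIV)"
  and cont: "(y \<longlongrightarrow> y x0) (at x0 within S)"
  and eq: "\<forall>\<^sub>F x in at x0 within S. Psi (x, y x) = Psi (x0, y x0)"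
  and P: "bounded_linear P" "!!w. P (D (0, w)) = w"
 shows "(y has_derivative (%h. - P (D (h, 0)))) (at x0 within S)"
proof -
 interpret P: bounded_linear P by fact
 interpret D: bounded_linear D using D by (rule has_derivative_bounded_linear)
 have blPD: "bounded_linear (%h. P (D (h, 0)))"
  using bounded_linear_compose[OF P(1) bounded_linear_compose[OF D.bounded_linear_axioms bounded_linear_Pair[OF bounded_linear_ident bounded_linear_zero]]]
  by simp
 obtain K where K: "K > 0" "!!z. norm (P z) <= norm z * K"
  using P.pos_bounded by blast
 obtain C where C: "C > 0" "!!h. norm (P (D (h, 0))) <= norm h * C"
  using bounded_linear.pos_bounded[OF blPD] by blast
 let ?F = "at x0 within S"
 let ?dl = "%x. y x - y x0"
 have flim: "filterlim (%x. (x, y x)) (at (x0, y x0) within S \<times> UNIV) ?F"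
  unfolding filterlim_at
 proof (intro conjI)
  show "\<forall>\<^sub>F x in ?F. (x, y x) : S \<times> UNIV & (x, y x) ~= (x0, y x0)"
   using eventually_at_topological by (auto simp: eventually_at_filter)
  show "((%x. (x, y x)) \<longlongrightarrow> (x0, y x0)) ?F"
   by (intro tendsto_Pair cont tendsto_ident_at)
 qed
 have est: "\<forall>\<^sub>F x in ?F. norm (?dl x + P (D (x - x0, 0))) <= K * e * (norm (x - x0) + norm (?dl x))"
  if "e > 0" for e
 proof -
  have "\<forall>\<^sub>F z in at (x0, y x0) within S \<times> UNIV.
    norm (Psi z - Psi (x0, y x0) - D (z - (x0, y x0))) <= e * norm (z - (x0, y x0))"
   using D that unfolding has_derivative_within_alt2 by blast
  hence "\<forall>\<^sub>F x in ?F.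
    norm (Psi (x, y x) - Psi (x0, y x0) - D ((x, y x) - (x0, y x0))) <= e * norm ((x, y x) - (x0, y x0))"
   by (rule eventually_compose_filterlim[OF _ flim])
  with eq show ?thesis
  proof eventually_elim
   case (elim x)
   have "norm (D (x - x0, ?dl x)) <= e * norm (x - x0, ?dl x)"
    using elim by (simp add: norm_minus_commute)
   also have "... <= e * (norm (x - x0) + norm (?dl x))"
    using that by (intro mult_left_mono norm_Pair_le) auto
   finally have 1: "norm (D (x - x0, ?dl x)) <= e * (norm (x - x0) + norm (?dl x))" .
   have "D (x - x0, ?dl x) = D (x - x0, 0) + D (0, ?dl x)"
    by (simp flip: D.add)
   hence "P (D (x - x0, ?dl x)) = P (D (x - x0, 0)) + ?dl x"
    using P(2) by (simp add: P.add)
   hence "norm (?dl x + P (D (x - x0, 0))) = norm (P (D (x - x0, ?dl x)))"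
    by (simp add: add.commute)
   also have "... <= norm (D (x - x0, ?dl x)) * K" by (rule K)
   also have "... <= e * (norm (x - x0) + norm (?dl x)) * K"
    using 1 K(1) by (intro mult_right_mono) auto
   finally show ?case by (simp add: ac_simps)
  qed
 qed
 \<comment> \<open>With \<open>e = 1 / (2 * K)\<close> the increment of \<open>y\<close> appears on
   the right with factor 1/2 and can be absorbed. This Lipschitz bound then makes the error in
   \<open>est\<close> small compared with \<open>norm (x - x0)\<close>.\<close>
 have lip: "\<forall>\<^sub>F x in ?F. norm (?dl x) <= (2 * C + 1) * norm (x - x0)"
 proof -
  have "\<forall>\<^sub>F x in ?F. norm (?dl x + P (D (x - x0, 0))) <= (1 / 2) * (norm (x - x0) + norm (?dl x))"
   using est[of "1 / (2 * K)"] K by simp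
  thus ?thesis
  proof eventually_elim
   case (elim x)
   have "norm (?dl x) <= norm (?dl x + P (D (x - x0, 0))) + norm (P (D (x - x0, 0)))"
    by (metis add_diff_cancel_right' norm_triangle_ineq4)
   also have "... <= (norm (x - x0) + norm (?dl x)) / 2 + norm (x - x0) * C"
    using elim C(2)[of "x - x0"] by (simp add: add_mono)
   finally have "norm (?dl x) <= norm (x - x0) + 2 * (norm (x - x0) * C)" by (simp add: field_simps)
   thus ?case by (simp add: algebra_simps)
  qed
 qed
 show ?thesis
  unfolding has_derivative_within_alt2
 proof (intro conjI allI impI)
  show "bounded_linear (%h. - P (D (h, 0)))" by (rule bounded_linear_minus[OF blPD])
  fix e :: real assume e: "e > 0"
  define e' where "e' = e / (K * (2 * C + 2))"
  have e': "e' > 0" "K * e' * (2 * C + 2) = e" using e K C by (auto simp: e'_def add_pos_pos)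
  show "\<forall>\<^sub>F x in ?F. norm (y x - y x0 - - P (D (x - x0, 0))) <= e * norm (x - x0)"
   using est[OF e'(1)] lip
  proof eventually_elim
   case (elim x)
   have "norm (y x - y x0 - - P (D (x - x0, 0))) <= K * e' * (norm (x - x0) + norm (?dl x))"
    using elim by simp
   also have "... <= K * e' * ((2 * C + 2) * norm (x - x0))"
    using elim K e' by (intro mult_left_mono) (auto simp: algebra_simps)
   also have "... = e * norm (x - x0)" using e'(2) by (simp flip: mult.assoc)
   finally show ?case .
  qed
 qed
qed

text \<open>The inverse is that of \<open>adjoint f \<circ> f\<close> applied after
  \<open>adjoint f\<close>, so \<open>f \<circ> P\<close> is the orthogonal projection onto the
  range. For the derivative of a chart, vanishing of \<open>P\<close> on normal vectors is exactly
  the normalisation required in \<open>tangential_deriv\<close>.\<close>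

lemma inj_linear_orthogonal_left_inverse:
 fixes f :: "'a::euclidean_space => 'b::euclidean_space"
 assumes f: "linear f" "inj f"
 obtains P where "linear P" "!!x. P (f x) = x"
  "!!w. (!!x. w \<bullet> f x = 0) ==> P w = 0" "!!w x. (w - f (P w)) \<bullet> f x = 0"
proof -
 let ?M = "adjoint f \<circ> f"
 have adj: "linear (adjoint f)" using f(1) by (rule adjoint_linear)
 have linM: "linear ?M" by (rule linear_compose[OF f(1) adj])
 have injM: "inj ?M"
 proof (rule linear_injective_0[THEN iffD2, OF linM, rule_format])
  fix x assume "?M x = 0"
  hence "x \<bullet> adjoint f (f x) = 0" by simp
  hence "f x \<bullet> f x = 0" by (simp add: adjoint_works[OF f(1)])
  thus "x = 0" using f linear_injective_0 by auto
 qed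
 obtain g where g: "linear g" "g \<circ> ?M = id" using linear_injective_left_inverse[OF linM injM] by blast
 have g': "?M \<circ> g = id" using linear_inverse_left[OF linM g(1)] g(2) by blast
 show thesis
 proof (rule that)
  show "linear (g \<circ> adjoint f)" by (rule linear_compose[OF adj g(1)])
  show "(g \<circ> adjoint f) (f x) = x" for x using g(2) by (simp add: o_def fun_eq_iff)
  show "(g \<circ> adjoint f) w = 0" if "!!x. w \<bullet> f x = 0" for w
  proof -
   have "adjoint f w \<bullet> adjoint f w = 0"
    using that[of "adjoint f w"] adjoint_works[OF f(1), of "adjoint f w" w]
    by (simp add: inner_commute)
   thus ?thesis using linear_0[OF g(1)] by simp
  qed
  show "(w - f ((g \<circ> adjoint f) w)) \<bullet> f x = 0" for w x
  proof -
   have "?M (g (adjoint f w)) = adjoint f w" using g' by (metis comp_apply id_apply)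
   hence "x \<bullet> adjoint f (f (g (adjoint f w))) = x \<bullet> adjoint f w" by simp
   thus ?thesis by (simp add: adjoint_works[OF f(1)] inner_diff_left inner_diff_right inner_commute)
  qed
 qed
qed

section \<open>Charts, tangent spaces and derivatives along a submanifold\<close>

lemma local_param_has_derivative:
 assumes "local_param M U phi" "x : U"
 shows "(phi has_derivative FD phi x) (at x)"
proof -
 have "C_k_on (Suc 0) U phi" using assms(1) unfolding local_param_def smooth_on_def by blast
 thus ?thesis using assms(2) frechet_derivative_works by auto
qed

lemma local_param_linear:
 assumes "local_param M U phi" "x : U"
 shows "linear (FD phi x)" "inj (FD phi x)"
 using local_param_has_derivative[OF assms] has_derivative_linear assms
 unfolding local_param_def by auto

lemma local_param_deriv_differentiable:
 assumes "local_param M U phi" "x : U"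
 shows "(%x. FD phi x v) differentiable (at x)"
proof -
 have "C_k_on (Suc (Suc 0)) U phi" using assms(1) unfolding local_param_def smooth_on_def by blast
 thus ?thesis using assms(2) by auto
qed

lemma local_param_deriv_continuous:
 assumes "local_param M U phi"
 shows "continuous_on U (%x. FD phi x v)"
 unfolding continuous_on_eq_continuous_within
 using differentiable_imp_continuous_within[OF differentiable_at_withinI[OF local_param_deriv_differentiable[OF assms]]] by blast

lemma local_paramE:
 assumes "local_param M U phi"
 obtains psi where "open U" "inj_on phi U" "continuous_on U phi" "continuous_on (phi ` U) psi"
  "!!x. x : U ==> psi (phi x) = x" "!!p. p : phi ` U ==> psi p : U & phi (psi p) = p"
  "openin (top_of_set M) (phi ` U)" "phi ` U <= M"
proof -
 obtain psi where h: "homeomorphism U (phi ` U) phi psi" using assms unfolding local_param_def by blast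
 show thesis
 proof (rule that[of psi])
  show "open U" "openin (top_of_set M) (phi ` U)" using assms unfolding local_param_def by auto
  thus "phi ` U <= M" using openin_imp_subset by blast
  show "inj_on phi U" using h unfolding homeomorphism_def by (metis inj_on_def)
 qed (use h in "auto simp: homeomorphism_def")
qed

text \<open>Implicit differentiation of \<open>phi y - k x\<close>. Continuity of \<open>tau\<close>
  comes from the homeomorphism clause of \<open>local_param\<close> together with relative openness
  of the chart image, so the inverse chart is never extended off \<open>M\<close>.\<close>

lemma chart_pullback:
 fixes k :: "'a::real_normed_vector => real^'n" and phi :: "real^'k => real^'n"
 assumes lp: "local_param M U phi" and y0: "y0 : U" "phi y0 = k x0"
  and k: "(k has_derivative k') (at x0 within S)" "k ` S <= M"
  and P: "linear P" "!!w. P (FD phi y0 w) = w"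
  and tau: "ALL x:S. k x : phi ` U --> tau x : U & phi (tau x) = k x" "tau x0 = y0"
 shows "(tau has_derivative (%h. P (k' h))) (at x0 within S)"
  and "\<forall>\<^sub>F x in at x0 within S. tau x : U & phi (tau x) = k x"
proof -
 obtain psi where psi: "open U" "inj_on phi U" "continuous_on U phi" "continuous_on (phi ` U) psi"
  "!!x. x : U ==> psi (phi x) = x" "!!p. p : phi ` U ==> psi p : U & phi (psi p) = p"
  "openin (top_of_set M) (phi ` U)" "phi ` U <= M" using local_paramE[OF lp] by blast
 have kx0: "k x0 : phi ` U" using y0 by force
 have ck: "(k \<longlongrightarrow> k x0) (at x0 within S)"
  using has_derivative_continuous[OF k(1)] by (simp add: continuous_within)
 obtain O' where O': "open O'" "phi ` U = M Int O'" using psi(7) openin_open by metis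
 have evO: "\<forall>\<^sub>F x in at x0 within S. k x : O'"
  using topological_tendstoD[OF ck O'(1)] kx0 O'(2) by blast
 have evS: "\<forall>\<^sub>F x in at x0 within S. x : S" by (simp add: eventually_at_filter)
 have ev: "\<forall>\<^sub>F x in at x0 within S. k x : phi ` U"
  using evO evS by eventually_elim (use k(2) O'(2) in blast)
 show ev2: "\<forall>\<^sub>F x in at x0 within S. tau x : U & phi (tau x) = k x"
  using ev evS by eventually_elim (use tau(1) in blast)
 have "((%x. psi (k x)) \<longlongrightarrow> psi (k x0)) (at x0 within S)"
 proof (rule continuous_on_tendsto_compose[OF psi(4) ck kx0 ev])
 qed
 moreover have "psi (k x0) = y0" using y0 psi(5) by metis
 moreover have "\<forall>\<^sub>F x in at x0 within S. psi (k x) = tau x"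
  using ev2 by eventually_elim (use psi(5) in metis)
 ultimately have "(tau \<longlongrightarrow> y0) (at x0 within S)"
  by (auto intro: Lim_transform_eventually)
 hence ct: "(tau \<longlongrightarrow> tau x0) (at x0 within S)" using tau(2) by simp
 let ?Psi = "%(x, y). phi y - k x"
 have dphi: "(phi has_derivative FD phi y0) (at y0 within V)" for V
  using local_param_has_derivative[OF lp y0(1)] has_derivative_at_withinI by blast
 have "((%z. phi (snd z) - k (fst z)) has_derivative (%z. FD phi y0 (snd z) - k' (fst z)))
   (at (x0, y0) within S \<times> UNIV)"
 proof (intro has_derivative_diff)
  show "((%z. phi (snd z)) has_derivative (%z. FD phi y0 (snd z))) (at (x0, y0) within S \<times> UNIV)"
   by (rule has_derivative_in_compose[of snd snd "(x0, y0)" "S \<times> UNIV" phi])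
     (simp_all only: snd_conv dphi has_derivative_snd[OF has_derivative_ident])
  show "((%z. k (fst z)) has_derivative (%z. k' (fst z))) (at (x0, y0) within S \<times> UNIV)"
   using k(1) y0(1) by (intro has_derivative_in_compose[of fst fst "(x0, y0)" "S \<times> UNIV" k])
     (auto intro!: has_derivative_fst has_derivative_ident)
 qed
 hence D: "(?Psi has_derivative (%z. FD phi y0 (snd z) - k' (fst z)))
   (at (x0, tau x0) within S \<times> UNIV)"
  using tau(2) by (simp add: case_prod_beta')
 have k'0: "k' 0 = 0" using k(1) has_derivative_linear linear_0 by blast
 have f0: "FD phi y0 0 = 0" using local_param_linear[OF lp y0(1)] linear_0 by blast
 have "(tau has_derivative (%h. - P (FD phi y0 (snd (h, 0::real^'k)) - k' (fst (h, 0::real^'k))))) (at x0 within S)"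
 proof (rule implicit_has_derivative[OF D ct])
  show "\<forall>\<^sub>F x in at x0 within S. ?Psi (x, tau x) = ?Psi (x0, tau x0)"
   using ev2 by eventually_elim (use y0 tau(2) in simp)
  show "bounded_linear P" using P(1) linear_conv_bounded_linear by blast
 qed (simp add: P(2) k'0)
 thus "(tau has_derivative (%h. P (k' h))) (at x0 within S)"
  using linear_neg[OF P(1)] by (simp add: f0)
qed

text \<open>A differentiable map into \<open>M\<close> lifts differentiably through every chart.\<close>

lemma chart_lift:
 fixes k :: "'a::euclidean_space => real^'n" and phi :: "real^'k => real^'n"
 assumes lp: "local_param M U phi" and S: "open S" "x0 : S" and y0: "y0 : U" "phi y0 = k x0"
  and k: "(k has_derivative k') (at x0)" "k ` S <= M"
  and tau: "ALL x:S. k x : phi ` U --> tau x : U & phi (tau x) = k x"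
 obtains tau' where "(tau has_derivative tau') (at x0)" "k' = FD phi y0 \<circ> tau'"
proof -
 obtain psi where psi: "inj_on phi U" using local_paramE[OF lp] by metis
 have tau0: "tau x0 = y0" using tau S(2) y0 psi by (metis image_eqI inj_onD)
 obtain P where P: "linear P" "!!w. P (FD phi y0 w) = w"
  using inj_linear_orthogonal_left_inverse[OF local_param_linear[OF lp y0(1)]] by metis
 note at = at_within_open[OF S(2,1)]
 have k': "(k has_derivative k') (at x0 within S)" using k(1) at by simp
 note c = chart_pullback[OF lp y0 k' k(2) P tau tau0, unfolded at]
 have "((%x. phi (tau x)) has_derivative (%h. FD phi y0 (P (k' h)))) (at x0)"
  using has_derivative_compose[OF c(1)] local_param_has_derivative[OF lp y0(1)] tau0 by blast
 moreover have "\<forall>\<^sub>F x in at x0. phi (tau x) = k x" using c(2) by eventually_elim auto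
 ultimately have "(k has_derivative (%h. FD phi y0 (P (k' h)))) (at x0)"
  by (rule has_derivative_transform_eventually) (use y0(2) tau0 in auto)
 hence "k' = (%h. FD phi y0 (P (k' h)))"
  using has_derivative_unique[OF k(1)] by blast
 thus thesis using that[OF c(1)] by (simp add: o_def)
qed

text \<open>The definition takes the union over all charts through the point. By
  \<open>chart_lift\<close> the derivative of any other chart factors through that of
  \<open>phi\<close>, so one chart already gives everything.\<close>

lemma tangent_space_chart:
 fixes M :: "(real^4) set" and U :: "(real^3) set"
 assumes lp: "local_param M U phi" and x: "x : U"
 shows "tangent_space M (phi x) = range (FD phi x)"
proof
 show "range (FD phi x) <= tangent_space M (phi x)"
  unfolding tangent_space_def using lp x by blast
 show "tangent_space M (phi x) <= range (FD phi x)"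
 proof
  fix v assume "v : tangent_space M (phi x)"
  then obtain U' :: "(real^3) set" and phi' x' where l': "local_param M U' phi'" "x' : U'" "phi' x' = phi x"
   "v : range (FD phi' x')" unfolding tangent_space_def by blast
  obtain psi' where psi': "open U'" "phi' ` U' <= M" using local_paramE[OF l'(1)] by metis
  obtain psi where psi: "!!p. p : phi ` U ==> psi p : U & phi (psi p) = p" using local_paramE[OF lp] by metis
  obtain tau' where "FD phi' x' = FD phi x \<circ> tau'"
   using chart_lift[OF lp psi'(1) l'(2) x l'(3)[symmetric] local_param_has_derivative[OF l'(1,2)] psi'(2), of "%x. psi (phi' x)"]
    psi by blast
  thus "v : range (FD phi x)" using l'(4) by auto
 qed
qed

lemma tangent_space_curve:
 fixes k :: "'a::euclidean_space => real^4"
 assumes p: "k x0 : mfd_int M" and S: "open S" "x0 : S"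
  and k: "(k has_derivative k') (at x0)" "k ` S <= M"
 shows "k' h : tangent_space M (k x0)"
proof -
 obtain U :: "(real^3) set" and phi x where l: "local_param M U phi" "x : U" "phi x = k x0"
  using p unfolding mfd_interior_def by force
 obtain psi where psi: "!!p. p : phi ` U ==> psi p : U & phi (psi p) = p" using local_paramE[OF l(1)] by metis
 obtain tau' where "k' = FD phi x \<circ> tau'"
  using chart_lift[OF l(1) S l(2,3) k, of "%x. psi (k x)"] psi by blast
 thus ?thesis using tangent_space_chart[OF l(1,2)] l(3) by auto
qed

lemma tangent_space_subspace:
 assumes p: "p : mfd_int M"
 shows "subspace (tangent_space M p)" "dim (tangent_space M p) = 3"
proof -
 obtain U :: "(real^3) set" and phi x where l: "local_param M U phi" "x : U" "phi x = p"
  using p unfolding mfd_interior_def by force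
 note lin = local_param_linear[OF l(1,2)]
 have eq: "tangent_space M p = range (FD phi x)"
  using tangent_space_chart[OF l(1,2)] l(3) by simp
 show "subspace (tangent_space M p)" unfolding eq
  by (rule linear_subspace_image[OF lin(1) subspace_UNIV])
 have "dim (range (FD phi x)) = dim (UNIV :: (real^3) set)"
  by (rule dim_image_eq[OF lin(1)]) (use lin(2) in auto)
 thus "dim (tangent_space M p) = 3" unfolding eq by (simp add: dim_UNIV)
qed

text \<open>\<open>M\<close> is thin in the ambient space, so a derivative within \<open>M\<close>
  is not unique as a linear map; composition with a chart shows that its values on tangent vectors
  are.\<close>

lemma tangential_deriv_unique:
 assumes p: "p : mfd_int M"
  and L: "(f has_derivative L) (at p within M)"
  and L': "(f has_derivative L') (at p within M)"
  and v: "v : tangent_space M p"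
 shows "L v = L' v"
proof -
 obtain U :: "(real^3) set" and phi x where l: "local_param M U phi" "x : U" "phi x = p"
  using p unfolding mfd_interior_def by force
 obtain psi where psi: "open U" "phi ` U <= M" using local_paramE[OF l(1)] by metis
 have "((%y. f (phi y)) has_derivative (%h. L (FD phi x h))) (at x)"
  if "(f has_derivative L) (at p within M)" for L
 proof -
  have "(phi has_derivative FD phi x) (at x within U)"
   using local_param_has_derivative[OF l(1,2)] has_derivative_at_withinI by blast
  moreover have "(f has_derivative L) (at (phi x) within phi ` U)"
   using has_derivative_subset[OF that psi(2)] l(3) by simp
  ultimately have "((%y. f (phi y)) has_derivative (%h. L (FD phi x h))) (at x within U)"
   by (rule has_derivative_in_compose)
  thus ?thesis using at_within_open[OF l(2) psi(1)] by simp
 qed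
 hence "(%h. L (FD phi x h)) = (%h. L' (FD phi x h))"
  using has_derivative_unique L L' by blast
 moreover obtain h where "v = FD phi x h"
  using v tangent_space_chart[OF l(1,2)] l(3) by auto
 ultimately show ?thesis by (metis (no_types))
qed

lemma tangential_deriv_eqI:
 assumes p: "p : mfd_int M"
  and L: "(f has_derivative L) (at p within M)"
   "!!w. (!!v. v : tangent_space M p ==> w \<bullet> v = 0) ==> L w = 0"
 shows "tangential_deriv M f p = L"
 unfolding tangential_deriv_def
proof (rule the_equality)
 fix L' assume L': "(f has_derivative L') (at p within M) &
   (ALL w. (ALL v:tangent_space M p. w \<bullet> v = 0) --> L' w = 0)"
 obtain U :: "(real^3) set" and phi x where l: "local_param M U phi" "x : U" "phi x = p"
  using p unfolding mfd_interior_def by force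
 obtain P where P: "!!w x'. (w - FD phi x (P w)) \<bullet> FD phi x x' = 0"
  using inj_linear_orthogonal_left_inverse[OF local_param_linear[OF l(1,2)]] by metis
 have eq: "tangent_space M p = range (FD phi x)"
  using tangent_space_chart[OF l(1,2)] l(3) by simp
 show "L' = L"
 proof
  fix w
  let ?v = "FD phi x (P w)"
  have "L' ?v = L ?v" by (rule tangential_deriv_unique[OF p]) (use L L' eq in auto)
  moreover have "L (w - ?v) = 0" by (rule L(2)) (use eq P in auto)
  moreover have "L' (w - ?v) = 0" using L' eq P by auto
  moreover have "L w = L ?v + L (w - ?v)" "L' w = L' ?v + L' (w - ?v)"
   using L L' by (metis add_diff_cancel_left' diff_add_cancel has_derivative_linear linear_add)+
  ultimately show "L' w = L w" by simp
 qed
qed (use L in auto)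

text \<open>The derivative is that of \<open>f \<circ> phi\<close> after \<open>P\<close>, the
  derivative of the inverse chart within \<open>M\<close>. Since this \<open>P\<close> vanishes on
  normal vectors, the description in \<open>tangential_deriv\<close> is met.\<close>

lemma tangential_deriv_exists:
 fixes f :: "real^4 => 'b::real_normed_vector"
 assumes l: "local_param M (U :: (real^3) set) phi" "x : U"
  and f: "(%y. f (phi y)) differentiable (at x)"
 obtains L where "(f has_derivative L) (at (phi x) within M)"
  "!!w. (!!v. v : tangent_space M (phi x) ==> w \<bullet> v = 0) ==> L w = 0"
  "tangential_deriv M f (phi x) = L"
proof -
 obtain P where P: "linear P" "!!w. P (FD phi x w) = w"
  "!!w. (!!x'. w \<bullet> FD phi x x' = 0) ==> P w = 0"
  using inj_linear_orthogonal_left_inverse[OF local_param_linear[OF l(1,2)]] by metis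
 obtain psi where psi: "openin (top_of_set M) (phi ` U)" "!!x. x : U ==> psi (phi x) = x"
   "!!p. p : phi ` U ==> psi p : U & phi (psi p) = p" using local_paramE[OF l(1)] by metis
 have pM: "phi x : mfd_int M" using l unfolding mfd_interior_def by blast
 have p: "(psi has_derivative (%h. P h)) (at (phi x) within M)"
  and ev: "\<forall>\<^sub>F q in at (phi x) within M. psi q : U & phi (psi q) = q"
  using chart_pullback[OF l, of "%x. x" "phi x" "%h. h" M P psi] P psi l(2) by auto
 obtain f' where f': "((%y. f (phi y)) has_derivative f') (at x)" using f differentiable_def by blast
 have "((%q. f (phi (psi q))) has_derivative (%h. f' (P h))) (at (phi x) within M)"
  using has_derivative_in_compose[OF p, of "%y. f (phi y)" f'] f' psi(2)[OF l(2)] has_derivative_at_withinI by metis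
 moreover have "\<forall>\<^sub>F q in at (phi x) within M. f (phi (psi q)) = f q"
  using ev by eventually_elim auto
 ultimately have d: "(f has_derivative (%h. f' (P h))) (at (phi x) within M)"
  by (rule has_derivative_transform_eventually)
    (use psi(2)[OF l(2)] l(2) openin_imp_subset[OF psi(1)] in auto)
 have n: "f' (P w) = 0" if "!!v. v : tangent_space M (phi x) ==> w \<bullet> v = 0" for w
 proof -
  have "P w = 0" by (rule P(3), rule that) (use tangent_space_chart[OF l] in auto)
  thus ?thesis using f' has_derivative_linear linear_0 by metis
 qed
 show thesis using that[OF d n tangential_deriv_eqI[OF pM d n]] by blast
qed

section \<open>Existence of the area measure and the area formula\<close>

lemma nn_integral_change_of_variables:
 fixes tau :: "real^'m::{finite,wellorder} => real^'m::{finite,wellorder}"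
 assumes E: "E : sets borel" "tau ` E : sets borel"
  and der: "!!x. x : E ==> (tau has_derivative tau' x) (at x within E)" and inj: "inj_on tau E"
  and f: "f : borel_measurable borel" "!!y. (0::real) <= f y"
  and g: "g : borel_measurable borel" "!!x. x : E ==> g x = abs (det (matrix (tau' x))) * f (tau x)"
   "!!x. 0 <= g x"
 shows "(\<integral>\<^sup>+y\<in>tau ` E. ennreal (f y) \<partial>lborel) = (\<integral>\<^sup>+x\<in>E. ennreal (g x) \<partial>lborel)"
proof -
 have Eleb: "E : sets lebesgue" using E by simp
 have iff: "(%x. abs (det (matrix (tau' x))) *\<^sub>R vec (f (tau x)) :: real^1) absolutely_integrable_on E &
      integral E (%x. abs (det (matrix (tau' x))) *\<^sub>R vec (f (tau x)) :: real^1) = b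
   \<longleftrightarrow> (%y. vec (f y) :: real^1) absolutely_integrable_on (tau ` E) & integral (tau ` E) (%y. vec (f y) :: real^1) = b" for b
  by (rule has_absolute_integral_change_of_variables[OF Eleb der inj])
 have geq: "h absolutely_integrable_on E \<longleftrightarrow> g absolutely_integrable_on E" "integral E h = integral E g"
  if "h = (%x. abs (det (matrix (tau' x))) * f (tau x))" for h
 proof -
  show "h absolutely_integrable_on E \<longleftrightarrow> g absolutely_integrable_on E"
   using that g(2) by (intro set_integrable_cong) auto
  show "integral E h = integral E g" using that g(2) by (intro integral_cong) auto
 qed
 have iff2: "g absolutely_integrable_on E & integral E g = b \<longleftrightarrow>
   f absolutely_integrable_on (tau ` E) & integral (tau ` E) f = b" for b
  using iff[of "vec b"] geq
  by (auto simp: absolutely_integrable_on_1_iff integral_on_1_eq vec_eq_iff)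
 \<comment> \<open>The underlying change of variables theorem concerns absolutely integrable
   functions. For nonnegative functions the remaining case has the value infinity, and it occurs on
   both sides at once.\<close>
 have nonint: "(\<integral>\<^sup>+x\<in>S. ennreal (h x) \<partial>lborel) = \<infinity>"
  if "S : sets borel" "h : borel_measurable borel" "!!x. 0 <= h x" "\<not> h absolutely_integrable_on S" for S and h :: "real^'m::_ => real"
 proof (rule ccontr)
  assume "(\<integral>\<^sup>+x\<in>S. ennreal (h x) \<partial>lborel) ~= \<infinity>"
  moreover have "(\<integral>\<^sup>+x. ennreal (indicator S x * h x) \<partial>lborel) = (\<integral>\<^sup>+x\<in>S. ennreal (h x) \<partial>lborel)"
   by (intro nn_integral_cong) (auto split: split_indicator)
  ultimately have "(%x. indicator S x * h x) integrable_on UNIV"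
   using that by (intro nn_integral_integrable_on) (auto simp: less_top)
  moreover have "(%x. indicator S x * h x) = (%x. if x : S then h x else 0)" by (auto simp: fun_eq_iff)
  ultimately have "h integrable_on S" using integrable_restrict_UNIV by metis
  thus False using that(3,4) absolutely_integrable_on_iff_nonneg by blast
 qed
 have int: "(\<integral>\<^sup>+x\<in>S. ennreal (h x) \<partial>lborel) = ennreal (integral S h)"
  if "!!x. 0 <= h x" "h absolutely_integrable_on S" for S and h :: "real^'m::_ => real"
  using that by (intro nn_integral_has_integral_lebesgue')
   (auto simp: absolutely_integrable_on_def intro: integrable_integral)
 show ?thesis
 proof (cases "f absolutely_integrable_on (tau ` E)")
  case True
  thus ?thesis using iff2[of "integral (tau ` E) f"] int f(2) g(3) by metis
 next
  case False
  hence "\<not> g absolutely_integrable_on E" using iff2 by blast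
  thus ?thesis using nonint[OF E(2) f] nonint[OF E(1) g(1) g(3)] False by simp
 qed
qed

text \<open>The Gram matrix changes by congruence with \<open>matrix tau'\<close>, so its
  determinant gains the square of \<open>det (matrix tau')\<close>.\<close>

lemma jacobian_compose:
 fixes phi :: "real^'k => real^'n" and Phi :: "real^'k => real^'n"
 assumes "FD Phi x = FD phi y \<circ> tau'"
  and lin: "linear (FD phi y)" "linear tau'"
 shows "jacobian Phi x = abs (det (matrix tau')) * jacobian phi y"
proof -
 let ?d = "FD phi y" and ?T = "matrix tau'"
 let ?B = "\<chi> i j. ?d (axis i 1) \<bullet> ?d (axis j 1)"
 have d: "?d (tau' (axis j 1)) = (\<Sum>i\<in>UNIV. ?T $ i $ j *\<^sub>R ?d (axis i 1))" for j
 proof -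
  have "tau' (axis j 1) = (\<Sum>i\<in>UNIV. ?T $ i $ j *\<^sub>R axis i 1)"
   unfolding vec_eq_iff by (simp add: matrix_def axis_def if_distrib[of "%z. _ * z"] cong: if_cong)
  thus ?thesis by (simp add: linear_sum[OF lin(1)] linear_scale[OF lin(1)])
 qed
 have "(\<chi> i j. FD Phi x (axis i 1) \<bullet> FD Phi x (axis j 1))
   = transpose ?T ** ?B ** ?T"
  unfolding vec_eq_iff assms(1)
  by (simp add: d inner_sum_left inner_sum_right matrix_matrix_mult_def transpose_def sum_distrib_left sum_distrib_right ac_simps)
 hence "jacobian Phi x = sqrt ((det ?T)^2 * det ?B)" unfolding jacobian_def
  by (simp add: det_mul power2_eq_square ac_simps)
 thus ?thesis unfolding jacobian_def by (simp add: real_sqrt_mult)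
qed

lemma continuous_on_jacobian:
 assumes "!!v. continuous_on U (%x. FD phi x v)"
 shows "continuous_on U (jacobian phi)"
 unfolding jacobian_def det_def
 by (intro continuous_intros) (simp_all add: assms)

lemma homeomorphism_image_borel:
 fixes f :: "'a::topological_space => 'b::topological_space"
 assumes h: "homeomorphism U V f g" and E: "E : sets borel" "E <= U"
  and V: "openin (top_of_set W) V"
 shows "f ` E : sets (restrict_space borel W)"
proof -
 have g: "g : borel_measurable (restrict_space borel V)"
  using h by (intro borel_measurable_continuous_on_restrict) (auto simp: homeomorphism_def)
 have "g -` E Int space (restrict_space borel V) : sets (restrict_space borel V)"
  by (rule measurable_sets[OF g E(1)])
 moreover have "g -` E Int space (restrict_space borel V) = f ` E"
  using h E(2) by (auto simp: homeomorphism_def space_restrict_space image_iff)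
 ultimately obtain S where S: "S : sets borel" "f ` E = V Int S"
  by (auto simp: sets_restrict_space)
 obtain T where T: "open T" "V = W Int T" using V openin_open by metis
 have "f ` E = W Int (T Int S)" using S T by blast
 thus ?thesis using S(1) T(1) by (auto simp: sets_restrict_space)
qed

lemma suminf_commute_ennreal: "(\<Sum>i. \<Sum>n. f i n) = (\<Sum>n. \<Sum>i. f i n :: ennreal)"
proof -
 have "(\<Sum>i. \<Sum>n. f i n) = (\<integral>\<^sup>+i. (\<Sum>n. f i n) \<partial>count_space UNIV)"
  by (simp add: nn_integral_count_space_nat)
 also have "... = (\<Sum>n. \<integral>\<^sup>+i. f i n \<partial>count_space UNIV)"
  by (rule nn_integral_suminf) simp
 finally show ?thesis by (simp add: nn_integral_count_space_nat)
qed

lemma ennreal_max_zero: "ennreal (max 0 x) = ennreal x"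
 by (auto simp: max_def ennreal_neg)

text \<open>\<open>area_measure\<close> is a definite description, so a measure has to be built:
  countably many charts cover by Lindelof, their images are made disjoint, and on each piece the
  Jacobian density is pushed forward. The formula is proved for injective differentiable maps with
  continuous Jacobian and not just for charts, because the later parametrisation by \<open>t\<close>
  is not known to be smooth.\<close>

lemma area_formula:
 fixes K :: "'k::{finite,wellorder} itself" and M :: "(real^'n) set"
 shows sets_area_measure: "sets (area_measure K M) = sets (restrict_space borel (mfd_interior K M))"
  and area_measure_image: "!!(V :: (real^'k::{finite,wellorder}) set) Phi E. [|open V; !!x. x : V ==> Phi differentiable (at x); inj_on Phi V;
   continuous_on V (jacobian Phi); Phi ` V <= mfd_interior K M; E : sets borel; E <= V|] ==>
   Phi ` E : sets (area_measure K M) &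
   emeasure (area_measure K M) (Phi ` E) = (\<integral>\<^sup>+x\<in>E. ennreal (jacobian Phi x) \<partial>lborel)"
proof -
 define W where "W = mfd_interior K M"
 define RW where "RW = restrict_space borel W"
 have WM: "W <= M"
  unfolding W_def mfd_interior_def local_param_def using openin_imp_subset by blast
 define FF where "FF = {phi ` U | (U :: (real^'k::_) set) phi. local_param M U phi}"
 obtain FF' where FF': "FF' <= FF" "countable FF'" "\<Union>FF' = \<Union>FF"
  by (rule Lindelof_openin[of FF M]) (auto simp: FF_def local_param_def)
 have UF: "\<Union>FF = W" unfolding FF_def W_def mfd_interior_def by blast
 \<comment> \<open>Enumeration by \<open>from_nat_into\<close> needs a nonempty set; the empty chart
   guarantees one.\<close>
 have emp: "{} : FF"
 proof -
  have "C_k_on k {} f" for k and f :: "real^'k::_ => real^'n" by (induction k arbitrary: f) auto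
  hence "local_param M {} (%x::real^'k::_. 0 :: real^'n)"
   unfolding local_param_def smooth_on_def homeomorphism_def by auto
  thus ?thesis unfolding FF_def by blast
 qed
 define B where "B = from_nat_into (insert {} FF')"
 have rB: "range B = insert {} FF'" unfolding B_def using FF'(2) by (intro range_from_nat_into) auto
 have UB: "(\<Union>i. B i) = W" using rB FF'(3) UF by (metis Union_insert sup_bot_left)
 have "B i : FF" for i using rB emp FF'(1) by (metis insert_iff rangeI subsetD)
 hence "ALL i. EX U phi. local_param M (U :: (real^'k::_) set) phi & B i = phi ` U" unfolding FF_def by blast
 then obtain U :: "nat => (real^'k::_) set" and phi where lp: "!!i. local_param M (U i) (phi i)" "!!i. B i = phi i ` U i"
  by metis
 have "ALL i. EX psi. homeomorphism (U i) (phi i ` U i) (phi i) psi" using lp(1) unfolding local_param_def by blast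
 then obtain psi where hom: "!!i. homeomorphism (U i) (B i) (phi i) (psi i)" using lp(2) by metis
 have openU: "open (U i)" for i using lp(1) unfolding local_param_def by blast
 have openB: "openin (top_of_set W) (B i)" for i
  using lp unfolding local_param_def
  by (metis UB UNIV_I UN_upper WM openin_subset_trans)
 have psiphi: "x : U i ==> psi i (phi i x) = x" "p : B i ==> psi i p : U i & phi i (psi i p) = p" for i x p
  using hom[of i] unfolding homeomorphism_def by auto
 define D where "D = disjointed B"
 have D: "disjoint_family D" "(\<Union>i. D i) = W" "D i <= B i" for i
  unfolding D_def using disjoint_family_disjointed[of B] UN_disjointed_eq[of B] UB disjointed_subset[of B i] by auto
 have BRW: "B i : sets RW" for i
 proof -
  obtain T where "open T" "B i = W Int T" using openB openin_open by metis
  thus ?thesis unfolding RW_def by (auto simp: sets_restrict_space)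
 qed
 have DRW: "D i : sets RW" for i unfolding D_def disjointed_def using BRW by auto
 define J where "J i x = ennreal (jacobian (phi i) x) * indicator (U i) x" for i x
 have Jreal: "(%x. max 0 (indicator V x * jacobian Phi x)) : borel_measurable borel"
  if "open V" "continuous_on V (jacobian Phi)" for V and Phi :: "real^'k::_ => real^'n"
  using borel_measurable_continuous_on_indicator[of V "jacobian Phi"] that by simp
 have Jenn: "(%x. ennreal (jacobian Phi x) * indicator V x) : borel_measurable borel"
  if "open V" "continuous_on V (jacobian Phi)" for V and Phi :: "real^'k::_ => real^'n"
 proof -
  have "(%x. ennreal (jacobian Phi x) * indicator V x) = (%x. ennreal (max 0 (indicator V x * jacobian Phi x)))"
   by (auto simp: fun_eq_iff ennreal_max_zero split: split_indicator)
  thus ?thesis using Jreal[OF that] by simp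
 qed
 have jc: "continuous_on (U i) (jacobian (phi i))" for i
  by (rule continuous_on_jacobian) (rule local_param_deriv_continuous[OF lp(1)])
 have Jm: "J i : borel_measurable borel" for i
  unfolding J_def[abs_def] using Jenn openU jc by blast
 define pre where "pre i S = {x : U i. phi i x : S}" for i S
 have preb: "pre i S : sets borel" if S: "S : sets RW" for i S
 proof -
  obtain S' where S': "S' : sets borel" "S = W Int S'" using S by (auto simp: RW_def sets_restrict_space)
  have m: "phi i : borel_measurable (restrict_space borel (U i))"
   using hom[of i] by (intro borel_measurable_continuous_on_restrict) (auto simp: homeomorphism_def)
  have "phi i -` S' Int space (restrict_space borel (U i)) : sets (restrict_space borel (U i))"
   by (rule measurable_sets[OF m S'(1)])
  moreover have "phi i -` S' Int space (restrict_space borel (U i)) = pre i S"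
   using UB lp(2) by (auto simp: pre_def S'(2) space_restrict_space)
  ultimately show ?thesis using openU by (simp add: sets_restrict_space_iff)
 qed
 define mf where "mf S = (\<Sum>i. emeasure (density lborel (J i)) (pre i (S Int D i)))" for S
 define mu where "mu = measure_of W (sets RW) mf"
 have spRW: "space RW = W" unfolding RW_def by (simp add: space_restrict_space)
 have setsmu: "sets mu = sets RW" unfolding mu_def using spRW by (metis sets.sets_measure_of_eq)
 have ca: "countably_additive (sets RW) mf"
 proof (rule countably_additiveI)
  fix A :: "nat => (real^'n) set" assume A: "range A <= sets RW" "disjoint_family A" "(\<Union>n. A n) : sets RW"
  have "emeasure (density lborel (J i)) (pre i ((\<Union>n. A n) Int D i)) = (\<Sum>n. emeasure (density lborel (J i)) (pre i (A n Int D i)))" for i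
  proof -
   have "pre i ((\<Union>n. A n) Int D i) = (\<Union>n. pre i (A n Int D i))" unfolding pre_def by auto
   moreover have "disjoint_family (%n. pre i (A n Int D i))" using A(2) unfolding disjoint_family_on_def pre_def by blast
   moreover have "range (%n. pre i (A n Int D i)) <= sets (density lborel (J i))"
    using A(1) DRW preb by (auto intro!: preb sets.Int)
   ultimately show ?thesis using suminf_emeasure[of "%n. pre i (A n Int D i)" "density lborel (J i)"] by simp
  qed
  thus "(\<Sum>n. mf (A n)) = mf (\<Union>n. A n)"
   unfolding mf_def by (subst suminf_commute_ennreal) simp
 qed
 have emmu: "emeasure mu S = mf S" if "S : sets RW" for S
  unfolding mu_def
 proof (rule emeasure_measure_of_sigma)
  show "sigma_algebra W (sets RW)" using sets.sigma_algebra_axioms[of RW] spRW by simp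
  show "positive (sets RW) mf" unfolding positive_def mf_def pre_def by simp
 qed (use ca that in auto)
 \<comment> \<open>On the piece \<open>D i\<close> the map \<open>Phi\<close> is compared with chart
   \<open>i\<close> through \<open>tau i\<close>, an injective continuous map between open sets of
   equal dimension. Invariance of domain makes the images Borel, and the change of variables with
   \<open>jacobian_compose\<close> matches the densities.\<close>
 have imW: "Phi ` E : sets RW & emeasure mu (Phi ` E) = (\<integral>\<^sup>+x\<in>E. ennreal (jacobian Phi x) \<partial>lborel)"
  if V: "open V" "!!x. x : V ==> Phi differentiable (at x)" "inj_on Phi V"
   "continuous_on V (jacobian Phi)" "Phi ` V <= W" "E : sets borel" "E <= V"
  for V :: "(real^'k::_) set" and Phi E
 proof -
  have contV: "continuous_on V Phi"
   by (metis V(1,2) at_within_open continuous_on_eq_continuous_within differentiable_imp_continuous_within)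
  let ?N = "density lborel (%x. ennreal (jacobian Phi x) * indicator V x)"
  define Vi where "Vi i = {x : V. Phi x : B i}" for i
  have openVi: "open (Vi i)" for i
  proof -
   obtain T where T: "open T" "B i = W Int T" using openB openin_open by metis
   have "Vi i = V Int Phi -` T" using T V(5) by (auto simp: Vi_def)
   thus ?thesis using continuous_on_open_vimage[OF V(1)] contV T(1)
    by (metis inf_commute)
  qed
  define tau where "tau i x = psi i (Phi x)" for i x
  have tau: "tau i x : U i" "phi i (tau i x) = Phi x" if "x : Vi i" for i x
   using psiphi(2)[of "Phi x" i] that by (auto simp: Vi_def tau_def)
  have injtau: "inj_on (tau i) (Vi i)" for i
   by (rule inj_onI) (metis (no_types, lifting) V(3) Vi_def tau(2) inj_onD mem_Collect_eq)
  have lift: "EX tau'. (tau i has_derivative tau') (at x) & FD Phi x = FD (phi i) (tau i x) \<circ> tau'"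
   if x: "x : Vi i" for i x
  proof -
   have d: "(Phi has_derivative FD Phi x) (at x)"
    using V(2) x frechet_derivative_works unfolding Vi_def by blast
   have "Phi ` Vi i <= M" using V(5) WM unfolding Vi_def by auto
   moreover have "ALL x:Vi i. Phi x : phi i ` U i --> tau i x : U i & phi i (tau i x) = Phi x" using tau by blast
   ultimately show ?thesis
    using chart_lift[OF lp(1) openVi x tau[OF x] d] by metis
  qed
  have "EX tau'. ALL i x. x : Vi i --> (tau i has_derivative tau' i x) (at x) &
    FD Phi x = FD (phi i) (tau i x) \<circ> tau' i x"
   by (intro choice allI) (use lift in blast)
  then obtain tau' where tau': "!!i x. x : Vi i ==> (tau i has_derivative tau' i x) (at x)"
   "!!i x. x : Vi i ==> FD Phi x = FD (phi i) (tau i x) \<circ> tau' i x"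
   by blast
  have conttau: "continuous_on (Vi i) (tau i)" for i
   by (metis tau'(1) continuous_at_imp_continuous_on has_derivative_continuous)
  have im: "Phi ` (E Int Vi i) : sets RW" for i
  proof -
   obtain g where g: "homeomorphism (Vi i) (tau i ` Vi i) (tau i) g"
    using invariance_of_domain_homeomorphism[OF openVi conttau _ injtau] by blast
   have "openin (top_of_set UNIV) (tau i ` Vi i)"
    using invariance_of_domain[OF conttau openVi injtau] by simp
   hence "tau i ` (E Int Vi i) : sets (restrict_space borel UNIV)"
    using V(6) openVi by (intro homeomorphism_image_borel[OF g]) auto
   hence "tau i ` (E Int Vi i) : sets borel" by (simp add: sets_restrict_space)
   hence "phi i ` (tau i ` (E Int Vi i)) : sets RW"
    unfolding RW_def using tau(1) by (intro homeomorphism_image_borel[OF hom _ _ openB]) auto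
   moreover have "phi i ` (tau i ` (E Int Vi i)) = Phi ` (E Int Vi i)" using tau(2) by (force simp: image_iff)
   ultimately show ?thesis by simp
  qed
  have "Phi ` E = (\<Union>i. Phi ` (E Int Vi i))"
  proof -
   have "x : (\<Union>i. Vi i)" if "x : E" for x
    using that V(5,7) UB unfolding Vi_def by blast
   thus ?thesis by blast
  qed
  hence imE: "Phi ` E : sets RW" using im by auto
  define Ei where "Ei i = {x : E. Phi x : D i}" for i
  have EiVi: "Ei i <= Vi i" for i using D(3) V(7) unfolding Ei_def Vi_def by blast
  have Eib: "Ei i : sets borel" for i
  proof -
   obtain D' where D': "D' : sets borel" "D i = W Int D'" using DRW[of i] by (auto simp: RW_def sets_restrict_space)
   have m: "Phi : borel_measurable (restrict_space borel V)"
    using contV by (rule borel_measurable_continuous_on_restrict)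
   have "Phi -` D' Int space (restrict_space borel V) : sets (restrict_space borel V)"
    by (rule measurable_sets[OF m D'(1)])
   moreover have "Ei i = E Int (Phi -` D' Int space (restrict_space borel V))"
    using V(5,7) by (auto simp: Ei_def D'(2) space_restrict_space)
   ultimately show ?thesis using V(1,6) by (simp add: sets_restrict_space_iff)
  qed
  have pre: "pre i (Phi ` E Int D i) = tau i ` Ei i" for i
  proof (intro subset_antisym subsetI)
   fix x assume "x : pre i (Phi ` E Int D i)"
   then obtain e where e: "x : U i" "phi i x = Phi e" "e : E" "Phi e : D i" unfolding pre_def by auto
   hence "x = tau i e" using psiphi(1) unfolding tau_def by metis
   thus "x : tau i ` Ei i" using e unfolding Ei_def by blast
  next
   fix x assume "x : tau i ` Ei i"
   then obtain e where e: "x = tau i e" "e : Ei i" by blast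
   hence ev: "e : Vi i" using EiVi by blast
   show "x : pre i (Phi ` E Int D i)" using tau[OF ev] e unfolding pre_def Ei_def by auto
  qed
  have piece: "emeasure (density lborel (J i)) (pre i (Phi ` E Int D i)) =
    emeasure ?N (Ei i)" for i
  proof -
   have pb: "tau i ` Ei i : sets borel" using preb[of "Phi ` E Int D i" i] imE DRW pre by auto
   have "emeasure (density lborel (J i)) (tau i ` Ei i) = (\<integral>\<^sup>+y\<in>tau i ` Ei i. J i y \<partial>lborel)"
    using Jm pb by (intro emeasure_density) auto
   also have "... = (\<integral>\<^sup>+y\<in>tau i ` Ei i. ennreal (max 0 (indicator (U i) y * jacobian (phi i) y)) \<partial>lborel)"
    by (intro nn_integral_cong) (auto simp: J_def ennreal_max_zero split: split_indicator)
   also have "... = (\<integral>\<^sup>+x\<in>Ei i. ennreal (max 0 (indicator V x * jacobian Phi x)) \<partial>lborel)"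
   proof (rule nn_integral_change_of_variables[OF Eib pb])
    show "(tau i has_derivative tau' i x) (at x within Ei i)" if "x : Ei i" for x
     using tau'(1) that EiVi has_derivative_at_withinI by blast
    show "inj_on (tau i) (Ei i)" using injtau EiVi inj_on_subset by blast
    show "max 0 (indicator V x * jacobian Phi x) = abs (det (matrix (tau' i x))) * max 0 (indicator (U i) (tau i x) * jacobian (phi i) (tau i x))"
     if x: "x : Ei i" for x
    proof -
     have xv: "x : Vi i" using x EiVi by blast
     have "jacobian Phi x = abs (det (matrix (tau' i x))) * jacobian (phi i) (tau i x)"
      by (rule jacobian_compose[OF tau'(2)[OF xv]])
       (use tau'(1)[OF xv] has_derivative_linear local_param_linear(1)[OF lp(1) tau(1)[OF xv]] in auto)
     thus ?thesis using tau(1)[OF xv] xv by (simp add: Vi_def max_mult_distrib_left)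
    qed
   qed (use Jreal openU jc V(1,4) in auto)
   also have "... = (\<integral>\<^sup>+x\<in>Ei i. (ennreal (jacobian Phi x) * indicator V x) \<partial>lborel)"
    by (intro nn_integral_cong) (auto simp: ennreal_max_zero split: split_indicator)
   also have "... = emeasure ?N (Ei i)"
    using Jenn[OF V(1,4)] Eib by (intro emeasure_density[symmetric]) auto
   finally show ?thesis using pre by simp
  qed
  have "emeasure mu (Phi ` E) = (\<Sum>i. emeasure ?N (Ei i))"
   using emmu[OF imE] piece unfolding mf_def by simp
  also have "... = emeasure ?N (\<Union>i. Ei i)"
  proof (rule suminf_emeasure)
   show "range Ei <= sets ?N" using Eib by auto
   show "disjoint_family Ei" using D(1) unfolding disjoint_family_on_def Ei_def by blast
  qed
  also have "(\<Union>i. Ei i) = E"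
   using D(2) V(5,7) unfolding Ei_def by blast
  also have "emeasure ?N E
    = (\<integral>\<^sup>+x\<in>E. (ennreal (jacobian Phi x) * indicator V x) \<partial>lborel)"
   using Jenn[OF V(1,4)] V(6) by (intro emeasure_density) auto
  also have "... = (\<integral>\<^sup>+x\<in>E. ennreal (jacobian Phi x) \<partial>lborel)"
   using V(7) by (intro nn_integral_cong) (auto split: split_indicator)
  finally show ?thesis using imE by blast
 qed
 have chart: "emeasure mu (phi' ` E) = (\<integral>\<^sup>+x\<in>E. ennreal (jacobian phi' x) \<partial>lborel)"
  if l: "local_param M U' phi'" "E : sets borel" "E <= U'" for U' :: "(real^'k::_) set" and phi' E
 proof -
  obtain psi' where "open U'" "inj_on phi' U'" using local_paramE[OF l(1)] by metis
  moreover have "phi' ` U' <= W" unfolding W_def mfd_interior_def using l(1) by blast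
  moreover have "continuous_on U' (jacobian phi')"
   by (rule continuous_on_jacobian) (rule local_param_deriv_continuous[OF l(1)])
  moreover have "!!x. x : U' ==> phi' differentiable at x"
   using local_param_has_derivative[OF l(1)] differentiable_def by blast
  ultimately show ?thesis using imW l(2,3) by blast
 qed
 have "area_measure K M = mu"
  unfolding area_measure_def
 proof (rule the_equality)
  show "sets mu = sets (restrict_space borel (mfd_interior K M)) &
    (ALL (U :: (real^'k::_) set) phi E. local_param M U phi & E : sets borel & E <= U -->
      emeasure mu (phi ` E) = (\<integral>\<^sup>+x\<in>E. ennreal (jacobian phi x) \<partial>lborel))"
   using setsmu chart unfolding RW_def W_def by blast
 next
  \<comment> \<open>A competitor is determined on each \<open>S Int D i\<close>, the chart image of
    a Borel set; summation over \<open>i\<close> determines it on \<open>S\<close>.\<close>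
  fix mu' assume mu': "sets mu' = sets (restrict_space borel (mfd_interior K M)) &
    (ALL (U :: (real^'k::_) set) phi E. local_param M U phi & E : sets borel & E <= U -->
      emeasure mu' (phi ` E) = (\<integral>\<^sup>+x\<in>E. ennreal (jacobian phi x) \<partial>lborel))"
  have s': "sets mu' = sets RW" using mu' unfolding RW_def W_def by blast
  show "mu' = mu"
  proof (rule measure_eqI)
   show "sets mu' = sets mu" using s' setsmu by simp
   fix S assume S: "S : sets mu'"
   have SW: "S <= W" using sets.sets_into_space[of S RW] S s' spRW by blast
   have pc: "emeasure mu' (S Int D i) = emeasure (density lborel (J i)) (pre i (S Int D i))" for i
   proof -
    have pb: "pre i (S Int D i) : sets borel" using preb[of "S Int D i" i] S s' DRW[of i] by auto
    have "S Int D i = phi i ` pre i (S Int D i)"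
     using D(3)[of i] lp(2)[of i] unfolding pre_def by (auto simp: image_iff)
    hence "emeasure mu' (S Int D i) = emeasure mu' (phi i ` pre i (S Int D i))" by simp
    also have "... = (\<integral>\<^sup>+x\<in>pre i (S Int D i). ennreal (jacobian (phi i) x) \<partial>lborel)"
     using mu' lp(1) pb unfolding pre_def by blast
    also have "... = (\<integral>\<^sup>+x\<in>pre i (S Int D i). J i x \<partial>lborel)"
     by (intro nn_integral_cong) (auto simp: J_def pre_def split: split_indicator)
    also have "... = emeasure (density lborel (J i)) (pre i (S Int D i))"
     using Jm pb by (intro emeasure_density[symmetric]) auto
    finally show ?thesis .
   qed
   have "emeasure mu' S = (\<Sum>i. emeasure mu' (S Int D i))"
   proof -
    have "S = (\<Union>i. S Int D i)" using SW D(2) by blast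
    moreover have "(\<Sum>i. emeasure mu' (S Int D i)) = emeasure mu' (\<Union>i. S Int D i)"
    proof (rule suminf_emeasure)
     show "range (%i. S Int D i) <= sets mu'" using S s' DRW by auto
     show "disjoint_family (%i. S Int D i)" using D(1) unfolding disjoint_family_on_def by blast
    qed
    ultimately show ?thesis by simp
   qed
   thus "emeasure mu' S = emeasure mu S" using emmu[of S] S s' pc unfolding mf_def by simp
  qed
 qed
 thus "sets (area_measure K M) = sets (restrict_space borel (mfd_interior K M))"
  and "!!(V :: (real^'k::_) set) Phi E. [|open V; !!x. x : V ==> Phi differentiable (at x); inj_on Phi V;
   continuous_on V (jacobian Phi); Phi ` V <= mfd_interior K M; E : sets borel; E <= V|] ==>
   Phi ` E : sets (area_measure K M) &
   emeasure (area_measure K M) (Phi ` E) = (\<integral>\<^sup>+x\<in>E. ennreal (jacobian Phi x) \<partial>lborel)"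
  using setsmu imW unfolding RW_def W_def by auto
qed

section \<open>The unit normal, and curvature in a principal frame\<close>

lemma hyperplane_eqI:
 fixes n :: "real^4"
 assumes "subspace T" "dim T = 3" "!!v. v : T ==> n \<bullet> v = 0" "norm n = 1"
 shows "T = {v. n \<bullet> v = 0}"
proof (rule subspace_dim_equal[OF assms(1) subspace_hyperplane])
 show "T <= {v. n \<bullet> v = 0}" using assms(3) by blast
 have "dim {v. n \<bullet> v = 0} = 3"
  using assms(4) by (subst dim_hyperplane) auto
 thus "dim {v. n \<bullet> v = 0} <= dim T" using assms(2) by simp
qed

lemma tangent_space_hyperplane:
 assumes "p : mfd_int M" "!!v. v : tangent_space M p ==> n \<bullet> v = 0" "norm n = 1"
 shows "tangent_space M p = {v. n \<bullet> v = 0}"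
 using hyperplane_eqI tangent_space_subspace[OF assms(1)] assms(2,3) by blast

text \<open>A continuous unit normal solves the equations \<open>w \<bullet> \<partial>\<^sub>i \<phi> = 0\<close>, \<open>w \<bullet> w = 1\<close>, whose
  derivative in \<open>w\<close> is invertible.\<close>

lemma unit_normal_chart_differentiable:
 fixes M :: "(real^4) set" and U :: "(real^3) set"
 assumes l: "local_param M U phi" "x : U"
  and nu: "continuous_on (phi ` U) nu"
   "!!p. p : phi ` U ==> norm (nu p) = 1"
   "!!p v. p : phi ` U ==> v : tangent_space M p ==> nu p \<bullet> v = 0"
 shows "(%y. nu (phi y)) differentiable (at x)"
proof -
 let ?d = "%y. FD phi y" and ?n = "nu (phi x)"
 have U: "open U" "continuous_on U phi" using local_paramE[OF l(1)] by metis+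
 have "ALL i. EX D. ((%y. ?d y (axis i 1)) has_derivative D) (at x)"
  using local_param_deriv_differentiable[OF l] unfolding differentiable_def by blast
 then obtain Dd where Dd: "!!i. ((%y. ?d y (axis i 1)) has_derivative Dd i) (at x)" by metis
 let ?Psi = "%z::(real^3)\<times>(real^4). ((\<chi> i. snd z \<bullet> ?d (fst z) (axis i 1)) :: real^3, snd z \<bullet> snd z)"
 let ?D = "%z::(real^3)\<times>(real^4). ((\<chi> i. ?n \<bullet> Dd i (fst z) + snd z \<bullet> ?d x (axis i 1)) :: real^3, ?n \<bullet> snd z + snd z \<bullet> ?n)"
 have D: "(?Psi has_derivative ?D) (at (x, ?n) within UNIV \<times> UNIV)"
 proof -
  have s: "(snd has_derivative snd) (at z)" "(fst has_derivative fst) (at z)" for z :: "(real^3)\<times>(real^4)"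
   using has_derivative_snd[OF has_derivative_ident] has_derivative_fst[OF has_derivative_ident] by auto
  have d: "((%z. ?d (fst z) (axis i 1)) has_derivative (%z. Dd i (fst z))) (at (x, ?n))" for i
   using has_derivative_compose[OF s(2)[of "(x, ?n)"], of "%y. ?d y (axis i 1)" "Dd i"] Dd by simp
  have 1: "((%z. \<chi> i. snd z \<bullet> ?d (fst z) (axis i 1)) has_derivative
    (%z. \<chi> i. ?n \<bullet> Dd i (fst z) + snd z \<bullet> ?d x (axis i 1))) (at (x, ?n))"
   unfolding has_derivative_componentwise_within[of "%z. \<chi> i. snd z \<bullet> ?d (fst z) (axis i 1)"]
  proof
   fix b :: "real^3" assume "b : Basis"
   then obtain i where b: "b = axis i 1" by (auto simp: Basis_vec_def)
   show "((%z. (\<chi> i. snd z \<bullet> ?d (fst z) (axis i 1)) \<bullet> b) has_derivative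
     (%z. (\<chi> i. ?n \<bullet> Dd i (fst z) + snd z \<bullet> ?d x (axis i 1)) \<bullet> b)) (at (x, ?n))"
    using has_derivative_inner[OF s(1)[of "(x, ?n)"] d[of i]] unfolding b by (simp add: inner_axis)
  qed
  have 2: "((%z. snd z \<bullet> snd z) has_derivative (%z. ?n \<bullet> snd z + snd z \<bullet> ?n)) (at (x, ?n))"
   using has_derivative_inner[OF s(1)[of "(x, ?n)"] s(1)[of "(x, ?n)"]] by simp
  show ?thesis using has_derivative_Pair[OF 1 2] by simp
 qed
 have im: "phi x : phi ` U" using l(2) by blast
 have ts: "tangent_space M (phi y) = range (?d y)" if "y : U" for y
  using tangent_space_chart[OF l(1) that] .
 have Teq: "range (?d x) = {v. ?n \<bullet> v = 0}"
  using tangent_space_hyperplane[of "phi x" M ?n] nu(2,3)[OF im] ts[OF l(2)] l unfolding mfd_interior_def by blast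
 let ?E = "%w. ?D (0, w)"
 have Dd0: "Dd i 0 = 0" for i using has_derivative_linear[OF Dd] linear_0 by blast
 have E: "?E w = (\<chi> i. w \<bullet> ?d x (axis i 1), 2 * (?n \<bullet> w))" for w by (simp add: Dd0 inner_commute)
 have linE: "linear ?E" unfolding E
  by (intro linearI) (auto simp: vec_eq_iff inner_add_left inner_add_right algebra_simps)
 have "inj ?E"
 proof (rule linear_injective_0[OF linE, THEN iffD2, rule_format])
  fix w assume "?E w = 0"
  hence w: "!!i. w \<bullet> ?d x (axis i 1) = 0" "?n \<bullet> w = 0"
   unfolding E by (auto simp: zero_prod_def vec_eq_iff)
  have "w : range (?d x)" using Teq w(2) by blast
  then obtain h where h: "w = ?d x h" by blast
  have lin: "linear (?d x)" using local_param_linear[OF l] by blast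
  have "h = (\<Sum>i\<in>UNIV. h $ i *\<^sub>R axis i 1)" by (simp add: vec_eq_iff axis_def if_distrib[of "%z. _ * z"] cong: if_cong)
  hence "w = (\<Sum>i\<in>UNIV. h $ i *\<^sub>R ?d x (axis i 1))"
   using h linear_sum[OF lin] linear_scale[OF lin] by (metis (no_types, lifting) sum.cong)
  hence "w \<bullet> w = (\<Sum>i\<in>UNIV. h $ i * (w \<bullet> ?d x (axis i 1)))" by (metis (no_types, lifting) inner_scaleR_right inner_sum_right sum.cong)
  thus "w = 0" using w(1) by simp
 qed
 then obtain P where P: "linear P" "P \<circ> ?E = id" using linear_injective_left_inverse[OF linE] by blast
 have "continuous_on U (%y. nu (phi y))" using continuous_on_compose[OF U(2) nu(1)] by (simp add: o_def)
 hence "isCont (%y. nu (phi y)) x" using U(1) l(2) continuous_on_eq_continuous_at by blast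
 hence cont: "((%y. nu (phi y)) \<longlongrightarrow> nu (phi x)) (at x within UNIV)" by (simp add: isCont_def)
 have "((%y. nu (phi y)) has_derivative (%h. - P (?D (h, 0)))) (at x within UNIV)"
 proof (rule implicit_has_derivative[OF D cont])
  have v: "?Psi (y, nu (phi y)) = (0, 1)" if "y : U" for y
  proof -
   have i: "phi y : phi ` U" using that by blast
   have "nu (phi y) \<bullet> ?d y (axis i 1) = 0" for i using nu(3)[OF i] ts[OF that] by blast
   moreover have "nu (phi y) \<bullet> nu (phi y) = 1" using nu(2)[OF i] by (simp add: norm_eq_1)
   ultimately show ?thesis by (simp add: zero_vec_def)
  qed
  have "\<forall>\<^sub>F y in at x. y : U" using U(1) l(2) eventually_at_topological by blast
  thus "\<forall>\<^sub>F y in at x within UNIV. ?Psi (y, nu (phi y)) = ?Psi (x, nu (phi x))"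
   using v l(2) by (auto elim!: eventually_mono)
  show "bounded_linear P" using P(1) linear_conv_bounded_linear by blast
  show "P (?E w) = w" for w using fun_cong[OF P(2), of w] unfolding o_def id_def .
 qed
 thus ?thesis unfolding differentiable_def by auto
qed

lemma normal_tangential_deriv:
 fixes M :: "(real^4) set"
 assumes p: "p : mfd_int M" and nu: "unit_normal M nu"
 defines "L \<equiv> tangential_deriv M nu p"
 shows "(nu has_derivative L) (at p within M)" "L (nu p) = 0" "linear L"
  "tangent_space M p = {v. nu p \<bullet> v = 0}" "norm (nu p) = 1"
proof -
 obtain U :: "(real^3) set" and phi x where l: "local_param M U phi" "x : U" "p = phi x"
  using p unfolding mfd_interior_def by force
 have sub: "phi ` U <= M" using local_paramE[OF l(1)] by metis
 have "(%y. nu (phi y)) differentiable (at x)"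
  using nu sub unfolding unit_normal_def
  by (intro unit_normal_chart_differentiable[OF l(1,2)]) (auto intro: continuous_on_subset)
 then obtain L' where L': "(nu has_derivative L') (at p within M)"
  "!!w. (!!v. v : tangent_space M p ==> w \<bullet> v = 0) ==> L' w = 0" "L = L'"
  using tangential_deriv_exists[OF l(1,2)] unfolding l(3) L_def by metis
 have pM: "p : M" using sub l by blast
 show "(nu has_derivative L) (at p within M)" "linear L" using L' has_derivative_linear by auto
 show "L (nu p) = 0" using L'(2,3) nu pM unfolding unit_normal_def by blast
 show "tangent_space M p = {v. nu p \<bullet> v = 0}" "norm (nu p) = 1"
  using tangent_space_hyperplane[OF p] nu pM unfolding unit_normal_def by blast+
qed

lemma has_derivative_along_curve:
 assumes L: "(f has_derivative L) (at (c t0) within M)"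
  and S: "open S" "t0 : S" "c ` S <= M" and c: "(c has_vector_derivative v) (at t0)"
 shows "((%t. f (c t)) has_vector_derivative L v) (at t0)"
proof -
 have "(c has_derivative (%h. h *\<^sub>R v)) (at t0 within S)"
  using c has_derivative_at_withinI unfolding has_vector_derivative_def by blast
 moreover have "(f has_derivative L) (at (c t0) within c ` S)" using has_derivative_subset[OF L S(3)] .
 ultimately have "((%t. f (c t)) has_derivative (%h. L (h *\<^sub>R v))) (at t0 within S)"
  by (rule has_derivative_in_compose)
 moreover have "L (h *\<^sub>R v) = h *\<^sub>R L v" for h using has_derivative_linear[OF L] linear_scale by blast
 ultimately show ?thesis
  using at_within_open[OF S(2,1)] unfolding has_vector_derivative_def by simp
qed

lemma curve_tangent:
 assumes p: "c t0 : mfd_int M"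
  and S: "open S" "t0 : S" "c ` S <= M" and c: "(c has_vector_derivative v) (at t0)"
 shows "v : tangent_space M (c t0)"
 using tangent_space_curve[of c t0 M S "%h. h *\<^sub>R v" 1] assms unfolding has_vector_derivative_def by simp

lemma orthonormal_expansion4:
 fixes x :: "real^4"
 assumes o: "v1 \<bullet> v1 = 1" "v2 \<bullet> v2 = 1" "v3 \<bullet> v3 = 1" "v4 \<bullet> v4 = 1"
  "v1 \<bullet> v2 = 0" "v1 \<bullet> v3 = 0" "v1 \<bullet> v4 = 0" "v2 \<bullet> v3 = 0" "v2 \<bullet> v4 = 0" "v3 \<bullet> v4 = 0"
 shows "x = (x \<bullet> v1) *\<^sub>R v1 + (x \<bullet> v2) *\<^sub>R v2 + (x \<bullet> v3) *\<^sub>R v3 + (x \<bullet> v4) *\<^sub>R v4"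
proof -
 let ?B = "{v1, v2, v3, v4}"
 have ne: "v1 ~= v2" "v1 ~= v3" "v1 ~= v4" "v2 ~= v3" "v2 ~= v4" "v3 ~= v4" using o by auto
 have "pairwise orthogonal ?B" using o by (auto simp: pairwise_def orthogonal_def inner_commute)
 moreover have "0 ~: ?B" using o by auto
 ultimately have "independent ?B" by (rule pairwise_orthogonal_independent)
 hence "span ?B = (UNIV :: (real^4) set)"
  using card_ge_dim_independent[of ?B UNIV] ne by (auto simp: dim_UNIV)
 let ?d = "x - ((x \<bullet> v1) *\<^sub>R v1 + (x \<bullet> v2) *\<^sub>R v2 + (x \<bullet> v3) *\<^sub>R v3 + (x \<bullet> v4) *\<^sub>R v4)"
 have o': "v2 \<bullet> v1 = 0" "v3 \<bullet> v1 = 0" "v4 \<bullet> v1 = 0" "v3 \<bullet> v2 = 0" "v4 \<bullet> v2 = 0" "v4 \<bullet> v3 = 0"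
  using o by (simp_all add: inner_commute)
 have "orthogonal ?d y" if "y : ?B" for y
  using that by (auto simp: orthogonal_def inner_diff_left inner_add_left o o')
 hence "orthogonal ?d ?d" using orthogonal_to_span[of ?d ?B ?d] `span ?B = UNIV` by (metis UNIV_I orthogonal_commute)
 thus ?thesis by (simp add: orthogonal_self)
qed

text \<open>Together with the normal the principal directions form an orthonormal basis of the
  ambient space, and the derivative of the normal vanishes on the normal line; so the sums over
  \<open>Basis\<close> in the definitions reduce to three terms. The sign in
  \<open>second_ff\<close> gives the minus in the trace.\<close>

lemma curvatures_from_principal_frame:
 fixes M :: "(real^4) set"
 assumes p: "p : mfd_int M" and nu: "unit_normal M nu"
  and o: "v1 \<bullet> v1 = 1" "v2 \<bullet> v2 = 1" "v3 \<bullet> v3 = 1"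
   "v1 \<bullet> v2 = 0" "v1 \<bullet> v3 = 0" "v2 \<bullet> v3 = 0" "v1 \<bullet> nu p = 0"  "v2 \<bullet> nu p = 0"  "v3 \<bullet> nu p = 0"
  and L: "tangential_deriv M nu p v1 = k1 *\<^sub>R v1" "tangential_deriv M nu p v2 = k2 *\<^sub>R v2"
   "tangential_deriv M nu p v3 = k3 *\<^sub>R v3"
 shows "mean_curvature M nu p = - (k1 + k2 + k3)"
  and "second_ff_norm2 M nu p = k1^2 + k2^2 + k3^2"
proof -
 let ?L = "tangential_deriv M nu p"
 note n = normal_tangential_deriv[OF p nu]
 have nn: "nu p \<bullet> nu p = 1" using n(5) by (simp add: norm_eq_1)
 have Lx: "?L x = (k1 * (x \<bullet> v1)) *\<^sub>R v1 + (k2 * (x \<bullet> v2)) *\<^sub>R v2 + (k3 * (x \<bullet> v3)) *\<^sub>R v3" for x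
 proof -
  have "x = (x \<bullet> v1) *\<^sub>R v1 + (x \<bullet> v2) *\<^sub>R v2 + (x \<bullet> v3) *\<^sub>R v3 + (x \<bullet> nu p) *\<^sub>R nu p"
   using o nn by (intro orthonormal_expansion4) auto
  hence "?L x = ?L ((x \<bullet> v1) *\<^sub>R v1 + (x \<bullet> v2) *\<^sub>R v2 + (x \<bullet> v3) *\<^sub>R v3 + (x \<bullet> nu p) *\<^sub>R nu p)"
   by metis
  also have "... = (x \<bullet> v1) *\<^sub>R ?L v1 + (x \<bullet> v2) *\<^sub>R ?L v2 + (x \<bullet> v3) *\<^sub>R ?L v3 + (x \<bullet> nu p) *\<^sub>R ?L (nu p)"
   by (simp only: linear_add[OF n(3)] linear_scale[OF n(3)])
  finally show ?thesis using L n(2) by (simp add: mult.commute)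
 qed
 have sq: "(\<Sum>b\<in>Basis. (b \<bullet> u) * (b \<bullet> w)) = u \<bullet> w" for u w :: "real^4"
  using euclidean_inner[of u w] by (simp add: inner_commute)
 have "(\<Sum>b\<in>Basis. ?L b \<bullet> b) = (\<Sum>b\<in>Basis. k1 * ((b \<bullet> v1) * (b \<bullet> v1)) + k2 * ((b \<bullet> v2) * (b \<bullet> v2)) + k3 * ((b \<bullet> v3) * (b \<bullet> v3)))"
  by (intro sum.cong refl) (simp add: Lx inner_add_left inner_commute algebra_simps)
 also have "... = k1 + k2 + k3"
  by (simp add: sum.distrib flip: sum_distrib_left) (simp add: sq o)
 finally show "mean_curvature M nu p = - (k1 + k2 + k3)"
  unfolding mean_curvature_def second_ff_def by (simp add: sum_negf)
 have o': "v2 \<bullet> v1 = 0" "v3 \<bullet> v1 = 0" "v3 \<bullet> v2 = 0" using o by (simp_all add: inner_commute)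
 have "second_ff_norm2 M nu p = (\<Sum>b\<in>Basis. ?L b \<bullet> ?L b)"
  unfolding second_ff_norm2_def second_ff_def
  by (intro sum.cong refl) (subst euclidean_inner, simp add: power2_eq_square)
 also have "... = (\<Sum>b\<in>Basis. k1^2 * ((b \<bullet> v1) * (b \<bullet> v1)) + k2^2 * ((b \<bullet> v2) * (b \<bullet> v2)) + k3^2 * ((b \<bullet> v3) * (b \<bullet> v3)))"
  by (intro sum.cong refl) (simp add: Lx inner_add_left inner_add_right o o' power2_eq_square algebra_simps)
 also have "... = k1^2 + k2^2 + k3^2"
  by (simp add: sum.distrib flip: sum_distrib_left) (simp add: sq o)
 finally show "second_ff_norm2 M nu p = k1^2 + k2^2 + k3^2" .
qed

section \<open>Coordinates adapted to the group\<close>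

text \<open>The two choices exchange the planes, so that the circular orbit may be put in the second one.\<close>

locale plane_frame =
 fixes f1 f2 f3 f4 :: "real^4"
 assumes frame: "(f1, f2, f3, f4) = (axis 1 1, axis 2 1, axis 3 1, axis 4 1) \<or>
  (f1, f2, f3, f4) = (axis 3 1, axis 4 1, axis 1 1, axis 2 1)"
begin

abbreviation cd1 :: "real^4 => real" where "cd1 x \<equiv> x \<bullet> f1"
abbreviation cd2 :: "real^4 => real" where "cd2 x \<equiv> x \<bullet> f2"
abbreviation cd3 :: "real^4 => real" where "cd3 x \<equiv> x \<bullet> f3"
abbreviation cd4 :: "real^4 => real" where "cd4 x \<equiv> x \<bullet> f4"

definition cmb :: "real => real => real => real => real^4" where
 "cmb a b c d = a *\<^sub>R f1 + b *\<^sub>R f2 + c *\<^sub>R f3 + d *\<^sub>R f4"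

lemma frame_inner [simp]:
 "cd1 f1 = 1" "cd2 f1 = 0" "cd3 f1 = 0" "cd4 f1 = 0"
 "cd1 f2 = 0" "cd2 f2 = 1" "cd3 f2 = 0" "cd4 f2 = 0"
 "cd1 f3 = 0" "cd2 f3 = 0" "cd3 f3 = 1" "cd4 f3 = 0"
 "cd1 f4 = 0" "cd2 f4 = 0" "cd3 f4 = 0" "cd4 f4 = 1"
 using frame by (auto simp: inner_axis_axis)

lemma cmb_inner [simp]: "cmb a b c d \<bullet> cmb a' b' c' d' = a * a' + b * b' + c * c' + d * d'"
 unfolding cmb_def by (simp add: inner_add_left inner_add_right)

lemma cmb_coords [simp]: "cd1 (cmb a b c d) = a" "cd2 (cmb a b c d) = b" "cd3 (cmb a b c d) = c" "cd4 (cmb a b c d) = d"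
 unfolding cmb_def by (simp_all add: inner_add_left)

lemma cmb_expand: "cmb (cd1 x) (cd2 x) (cd3 x) (cd4 x) = x"
 using orthonormal_expansion4[of f1 f2 f3 f4 x] unfolding cmb_def by simp

lemma cmb_cases: obtains a b c d where "x = cmb a b c d"
 using cmb_expand by metis

lemma cmb_eq [simp]: "cmb a b c d = cmb a' b' c' d' \<longleftrightarrow> a = a' & b = b' & c = c' & d = d'"
 by (metis cmb_coords)

lemma cmb_arith [simp]:
 "cmb a b c d + cmb a' b' c' d' = cmb (a + a') (b + b') (c + c') (d + d')"
 "cmb a b c d - cmb a' b' c' d' = cmb (a - a') (b - b') (c - c') (d - d')"
 "- cmb a b c d = cmb (- a) (- b) (- c) (- d)"
 "k *\<^sub>R cmb a b c d = cmb (k * a) (k * b) (k * c) (k * d)"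
 unfolding cmb_def by (simp_all add: algebra_simps)

lemma cmb_zero: "cmb 0 0 0 0 = 0" unfolding cmb_def by simp

lemma norm_cmb: "(norm (cmb a b c d))^2 = a^2 + b^2 + c^2 + d^2"
 by (simp add: power2_norm_eq_inner) (simp add: power2_eq_square)

lemma has_vector_derivative_cmb [derivative_intros]:
 assumes "(a has_real_derivative a') (at t within S)" "(b has_real_derivative b') (at t within S)"
  "(c has_real_derivative c') (at t within S)" "(d has_real_derivative d') (at t within S)"
 shows "((%t. cmb (a t) (b t) (c t) (d t)) has_vector_derivative cmb a' b' c' d') (at t within S)"
 unfolding cmb_def using assms
 by (auto intro!: derivative_eq_intros simp: has_real_derivative_iff_has_vector_derivative)

lemma continuous_on_cmb [continuous_intros]:
 assumes "continuous_on S a" "continuous_on S b" "continuous_on S c" "continuous_on S d"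
 shows "continuous_on S (%t. cmb (a t) (b t) (c t) (d t))"
 unfolding cmb_def by (intro continuous_intros assms)

lemma tendsto_cmb [tendsto_intros]:
 assumes "(a \<longlongrightarrow> a') F" "(b \<longlongrightarrow> b') F" "(c \<longlongrightarrow> c') F" "(d \<longlongrightarrow> d') F"
 shows "((%t. cmb (a t) (b t) (c t) (d t)) \<longlongrightarrow> cmb a' b' c' d') F"
 unfolding cmb_def by (intro tendsto_intros assms)

lemma G_frame: "g : G \<longleftrightarrow> (ALL x y. dist (g x) (g y) = dist x y) &
  g ` {x. cd3 x = 0 & cd4 x = 0} = {x. cd3 x = 0 & cd4 x = 0} &
  g ` {x. cd1 x = 0 & cd2 x = 0} = {x. cd1 x = 0 & cd2 x = 0}"
 using frame unfolding G_def plane12_def plane34_def by (auto simp: inner_axis)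

text \<open>The identity component of \<open>G\<close>. Rotations already carry every point into the
  quarter plane of \<open>f1\<close> and \<open>f3\<close>, and their connected parameter space is
  what fixes signs in \<open>n_rot\<close>.\<close>

definition rot :: "real => real => real^4 => real^4" where
 "rot al be x = cmb (cos al * (cd1 x) - sin al * (cd2 x)) (sin al * (cd1 x) + cos al * (cd2 x))
   (cos be * (cd3 x) - sin be * (cd4 x)) (sin be * (cd3 x) + cos be * (cd4 x))"

lemma rot_cmb [simp]: "rot al be (cmb a b c d) = cmb (cos al * a - sin al * b) (sin al * a + cos al * b)
  (cos be * c - sin be * d) (sin be * c + cos be * d)"
 unfolding rot_def by simp

lemma sincos_rotate: "x * (cos a * cos a) + x * (sin a * sin a) = (x::real)"
 using sin_cos_squared_add[of a] by algebra

lemma rot_inverse: "rot (- al) (- be) (rot al be x) = x"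
proof -
 obtain a b c d where x: "x = cmb a b c d" by (rule cmb_cases)
 show ?thesis unfolding x by (simp add: algebra_simps sincos_rotate)
qed

lemma rot_inverse': "rot al be (rot (- al) (- be) x) = x"
 using rot_inverse[of "- al" "- be"] by simp

lemma rot_inner: "rot al be x \<bullet> rot al be y = x \<bullet> y"
proof -
 obtain a b c d where x: "x = cmb a b c d" by (rule cmb_cases)
 obtain a' b' c' d' where y: "y = cmb a' b' c' d'" by (rule cmb_cases)
 have *: "(cos t * a - sin t * b) * (cos t * a' - sin t * b') + (sin t * a + cos t * b) * (sin t * a' + cos t * b')
  = a * a' + b * b'" for a b a' b' t :: real
  using sin_cos_squared_add[of t] by algebra
 show ?thesis unfolding x y using *[of al a b a' b'] *[of be c d c' d'] by (simp add: add.assoc)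
qed

lemma linear_rot: "linear (rot al be)"
 unfolding rot_def[abs_def] by (intro linearI) (simp_all add: inner_add_left algebra_simps)

lemma rot_in_G: "rot al be : G"
proof -
 have d: "dist (rot al be x) (rot al be y) = dist x y" for x y
  unfolding dist_norm norm_eq_sqrt_inner by (simp add: rot_inner flip: linear_diff[OF linear_rot])
 have 1: "rot al be x : {x. cd3 x = 0 & cd4 x = 0}" if "x : {x. cd3 x = 0 & cd4 x = 0}" for x al be
  using that unfolding rot_def by simp
 have 2: "rot al be x : {x. cd1 x = 0 & cd2 x = 0}" if "x : {x. cd1 x = 0 & cd2 x = 0}" for x al be
  using that unfolding rot_def by simp
 have eq: "rot al be ` X = X" if "!!x al be. x : X ==> rot al be x : X" for X
  using that rot_inverse' by (metis (no_types, opaque_lifting) image_eqI image_subset_iff subsetI subset_antisym)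
 show ?thesis unfolding G_frame using d eq[OF 1] eq[OF 2] by auto
qed

text \<open>Polar coordinates in the two planes. It serves for points and also for vectors such as
  normals, so the radii may have any sign.\<close>

definition cyl :: "real => real => real => real => real^4" where
 "cyl xi eta al be = cmb (xi * cos al) (xi * sin al) (eta * cos be) (eta * sin be)"

lemma rot_cyl: "rot al be (cyl xi eta al' be') = cyl xi eta (al + al') (be + be')"
 unfolding cyl_def by (simp add: cos_add sin_add algebra_simps)

lemma cyl_zero: "cyl xi eta 0 0 = cmb xi 0 eta 0" unfolding cyl_def by simp

lemma cyl_cases: obtains xi eta al be where "x = cyl xi eta al be" "xi >= 0" "eta >= 0" "- pi < al" "al <= pi" "- pi < be" "be <= pi"
proof -
 obtain a b c d where x: "x = cmb a b c d" by (rule cmb_cases)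
 have "EX xi al. xi >= 0 & a = xi * cos al & b = xi * sin al & - pi < al & al <= pi" for a b
 proof -
  let ?z = "Complex a b"
  have "?z = rcis (cmod ?z) (Arg ?z)" by (simp add: rcis_cmod_Arg)
  hence "a = cmod ?z * cos (Arg ?z)" "b = cmod ?z * sin (Arg ?z)"
   by (metis Re_rcis complex.sel(1), metis Im_rcis complex.sel(2))
  thus ?thesis using Arg_bounded[of ?z] by (intro exI[of _ "cmod ?z"] exI[of _ "Arg ?z"]) auto
 qed
 from this[of a b] this[of c d] show thesis using that unfolding x cyl_def by metis
qed

lemma cyl_norm: "(norm (cyl xi eta al be))^2 = xi^2 + eta^2"
 unfolding cyl_def norm_cmb using sin_cos_squared_add[of al] sin_cos_squared_add[of be] by algebra

text \<open>The origin is the only common point of the two planes, so an isometry preserving both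
  fixes it and is therefore linear.\<close>

lemma G_orthogonal:
 assumes g: "g : G"
 shows "orthogonal_transformation g" "norm (g x) = norm x" "bij g"
  "g (cmb a b 0 0) = cmb (cd1 (g (cmb a b 0 0))) (cd2 (g (cmb a b 0 0))) 0 0"
  "g (cmb 0 0 c d) = cmb 0 0 (cd3 (g (cmb 0 0 c d))) (cd4 (g (cmb 0 0 c d)))"
proof -
 have iso: "!!x y. dist (g x) (g y) = dist x y" using g G_frame by blast
 have p: "g x : {x. cd3 x = 0 & cd4 x = 0}" if "x : {x. cd3 x = 0 & cd4 x = 0}" for x
  using g that unfolding G_frame by blast
 have q: "g x : {x. cd1 x = 0 & cd2 x = 0}" if "x : {x. cd1 x = 0 & cd2 x = 0}" for x
  using g that unfolding G_frame by blast
 have "g 0 = 0" using p[of 0] q[of 0] cmb_expand[of "g 0"] cmb_zero by simp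
 thus o: "orthogonal_transformation g" using iso by (simp add: orthogonal_transformation_isometry)
 thus "norm (g x) = norm x" by (simp add: orthogonal_transformation_norm)
 show "bij g" using o orthogonal_transformation_bij by blast
 show "g (cmb a b 0 0) = cmb (cd1 (g (cmb a b 0 0))) (cd2 (g (cmb a b 0 0))) 0 0"
  using p[of "cmb a b 0 0"] cmb_expand[of "g (cmb a b 0 0)"] by simp
 show "g (cmb 0 0 c d) = cmb 0 0 (cd3 (g (cmb 0 0 c d))) (cd4 (g (cmb 0 0 c d)))"
  using q[of "cmb 0 0 c d"] cmb_expand[of "g (cmb 0 0 c d)"] by simp
qed

lemma cyl_inner: "cyl a b al be \<bullet> cyl a' b' al be = a * a' + b * b'"
 unfolding cyl_def cmb_inner using sin_cos_squared_add[of al] sin_cos_squared_add[of be] by algebra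

definition tan1 :: "real => real^4" where "tan1 al = cmb (- sin al) (cos al) 0 0"
definition tan2 :: "real => real^4" where "tan2 be = cmb 0 0 (- sin be) (cos be)"

lemma tan_inner [simp]:
 "tan1 al \<bullet> tan1 al = 1" "tan2 be \<bullet> tan2 be = 1" "tan1 al \<bullet> tan2 be = 0"  "tan2 be \<bullet> tan1 al = 0"
 "cyl a b al be \<bullet> tan1 al = 0" "cyl a b al be \<bullet> tan2 be = 0"
 "tan1 al \<bullet> cyl a b al be = 0" "tan2 be \<bullet> cyl a b al be = 0"
 unfolding tan1_def tan2_def cyl_def cmb_inner
 using sin_cos_squared_add[of al] sin_cos_squared_add[of be] by algebra+

lemma cyl_expand:
 "x = cyl (x \<bullet> cyl 1 0 al be) (x \<bullet> cyl 0 1 al be) al be + (x \<bullet> tan1 al) *\<^sub>R tan1 al + (x \<bullet> tan2 be) *\<^sub>R tan2 be"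
proof -
 have e: "cyl a b al be = a *\<^sub>R cyl 1 0 al be + b *\<^sub>R cyl 0 1 al be" for a b
  unfolding cyl_def by simp
 show ?thesis
  by (subst e, rule trans[OF orthonormal_expansion4[of "cyl 1 0 al be" "cyl 0 1 al be" "tan1 al" "tan2 be" x]])
   (simp_all add: cyl_inner)
qed

lemma cyl_scale: "k *\<^sub>R cyl a b al be = cyl (k * a) (k * b) al be"
 unfolding cyl_def by simp

lemma has_vector_derivative_cyl:
 assumes "(xi has_real_derivative xi') (at t within S)" "(eta has_real_derivative eta') (at t within S)"
 shows "((%t. cyl (xi t) (eta t) al be) has_vector_derivative cyl xi' eta' al be) (at t within S)"
 unfolding cyl_def by (intro has_vector_derivative_cmb DERIV_cmult_right assms)

lemma has_vector_derivative_cyl_angle1: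
 "((%al. cyl xi eta al be) has_vector_derivative xi *\<^sub>R tan1 al) (at al within S)"
proof -
 have "((%al. cyl xi eta al be) has_vector_derivative cmb (xi * - sin al) (xi * cos al) 0 0) (at al within S)"
  unfolding cyl_def by (rule has_vector_derivative_cmb) (auto intro!: derivative_eq_intros)
 thus ?thesis by (simp add: tan1_def)
qed

lemma has_vector_derivative_cyl_angle2:
 "((%be. cyl xi eta al be) has_vector_derivative eta *\<^sub>R tan2 be) (at be within S)"
proof -
 have "((%be. cyl xi eta al be) has_vector_derivative cmb 0 0 (eta * - sin be) (eta * cos be)) (at be within S)"
  unfolding cyl_def by (rule has_vector_derivative_cmb) (auto intro!: derivative_eq_intros)
 thus ?thesis by (simp add: tan2_def)
qed

lemma has_real_derivative_inner_left:
 assumes "(c has_vector_derivative v) (at t within S)"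
 shows "((%t. c t \<bullet> u) has_real_derivative v \<bullet> u) (at t within S)"
proof -
 have "(%h. (h *\<^sub>R v) \<bullet> u) = (*) (v \<bullet> u)" by (auto simp: fun_eq_iff)
 thus ?thesis
  using has_derivative_inner_left[OF assms[unfolded has_vector_derivative_def], of u]
  by (simp only: has_field_derivative_def)
qed

text \<open>Differentiation of the equivariant normal along the orbit circle, whose velocity is
  \<open>xi *\<^sub>R tan1 al\<close>. Leaving \<open>xi\<close> undivided keeps the statement valid
  where the circle degenerates.\<close>

lemma rotation_curvature1:
 assumes p: "cyl xi eta al be : mfd_int M" and nu: "unit_normal M nu"
  and M: "!!al. cyl xi eta al be : M" and N: "!!al. nu (cyl xi eta al be) = cyl N1 N2 al be"
 shows "xi *\<^sub>R tangential_deriv M nu (cyl xi eta al be) (tan1 al) = N1 *\<^sub>R tan1 al"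
proof -
 note n = normal_tangential_deriv[OF p nu]
 have "((%al. nu (cyl xi eta al be)) has_vector_derivative tangential_deriv M nu (cyl xi eta al be) (xi *\<^sub>R tan1 al)) (at al)"
  by (rule has_derivative_along_curve[OF n(1) open_UNIV _ _ has_vector_derivative_cyl_angle1]) (use M in auto)
 hence "tangential_deriv M nu (cyl xi eta al be) (xi *\<^sub>R tan1 al) = N1 *\<^sub>R tan1 al"
  unfolding N using has_vector_derivative_cyl_angle1 vector_derivative_unique_at by blast
 thus ?thesis by (simp add: linear_scale[OF n(3)])
qed

lemma rotation_curvature2:
 assumes p: "cyl xi eta al be : mfd_int M" and nu: "unit_normal M nu"
  and M: "!!be. cyl xi eta al be : M" and N: "!!be. nu (cyl xi eta al be) = cyl N1 N2 al be"
 shows "eta *\<^sub>R tangential_deriv M nu (cyl xi eta al be) (tan2 be) = N2 *\<^sub>R tan2 be"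
proof -
 note n = normal_tangential_deriv[OF p nu]
 have "((%be. nu (cyl xi eta al be)) has_vector_derivative tangential_deriv M nu (cyl xi eta al be) (eta *\<^sub>R tan2 be)) (at be)"
  by (rule has_derivative_along_curve[OF n(1) open_UNIV _ _ has_vector_derivative_cyl_angle2]) (use M in auto)
 hence "tangential_deriv M nu (cyl xi eta al be) (eta *\<^sub>R tan2 be) = N2 *\<^sub>R tan2 be"
  unfolding N using has_vector_derivative_cyl_angle2 vector_derivative_unique_at by blast
 thus ?thesis by (simp add: linear_scale[OF n(3)])
qed

text \<open>The principal directions are the meridian and the two orbit circles. Along the meridian
  the derivative of the normal has no component along the circles and is perpendicular to the
  normal, as is the velocity; within the meridian plane this makes the two proportional, and the
  factor is \<open>kap\<close>.\<close>

lemma rotational_curvatures: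
 fixes M :: "(real^4) set"
 assumes p: "cyl (xi t0) (eta t0) al be : mfd_int M" and nu: "unit_normal M nu"
  and S: "open S" "t0 : S" and M: "!!t al be. t : S ==> cyl (xi t) (eta t) al be : M"
  and N: "!!t al be. t : S ==> nu (cyl (xi t) (eta t) al be) = cyl (N1 t) (N2 t) al be"
  and pos: "xi t0 > 0" "eta t0 > 0"
  and d: "(xi has_real_derivative xi') (at t0)" "(eta has_real_derivative eta') (at t0)"
  and ne: "xi' ~= 0 \<or> eta' ~= 0"
 obtains kap where "(N1 has_real_derivative kap * xi') (at t0)" "(N2 has_real_derivative kap * eta') (at t0)"
  "N1 t0 * xi' + N2 t0 * eta' = 0"
  "mean_curvature M nu (cyl (xi t0) (eta t0) al be) = - (kap + N1 t0 / xi t0 + N2 t0 / eta t0)"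
  "second_ff_norm2 M nu (cyl (xi t0) (eta t0) al be) = kap^2 + (N1 t0 / xi t0)^2 + (N2 t0 / eta t0)^2"
proof -
 let ?p = "cyl (xi t0) (eta t0) al be" and ?v = "cyl xi' eta' al be"
 let ?L = "tangential_deriv M nu ?p"
 note n = normal_tangential_deriv[OF p nu]
 note lin = linear_scale[OF n(3)]
 have c: "((%t. cyl (xi t) (eta t) al be) has_vector_derivative ?v) (at t0)"
  by (rule has_vector_derivative_cyl) (use d in auto)
 have vT: "?v : tangent_space M ?p"
  by (rule curve_tangent[OF p S _ c]) (use M in auto)
 hence vn: "N1 t0 * xi' + N2 t0 * eta' = 0" using n(4) N[OF S(2)] by (simp add: cyl_inner)
 have Ns: "(N1 t0)^2 + (N2 t0)^2 = 1"
  using n(5) cyl_norm[of "N1 t0" "N2 t0" al be] N[OF S(2)] by simp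
 have nc: "((%t. nu (cyl (xi t) (eta t) al be)) has_vector_derivative ?L ?v) (at t0)"
  by (rule has_derivative_along_curve[OF n(1) S _ c]) (use M in auto)
 have nc2: "((%t. cyl (N1 t) (N2 t) al be) has_vector_derivative ?L ?v) (at t0)"
  by (rule has_vector_derivative_transform_within_open[OF nc S]) (use N in auto)
 note ip = has_real_derivative_inner_left[OF nc2]
 define l1 l2 where "l1 = ?L ?v \<bullet> cyl 1 0 al be" and "l2 = ?L ?v \<bullet> cyl 0 1 al be"
 have dN: "(N1 has_real_derivative l1) (at t0)" "(N2 has_real_derivative l2) (at t0)"
  using ip[of "cyl 1 0 al be"] ip[of "cyl 0 1 al be"] unfolding l1_def l2_def by (simp_all add: cyl_inner)
 have "?L ?v \<bullet> tan1 al = 0" "?L ?v \<bullet> tan2 be = 0"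
  using ip[of "tan1 al"] ip[of "tan2 be"] DERIV_const[of 0 "at t0"] by (auto intro: DERIV_unique)
 hence Lv: "?L ?v = cyl l1 l2 al be"
  using cyl_expand[of "?L ?v" al be] unfolding l1_def l2_def by simp
 have Nl: "N1 t0 * l1 + N2 t0 * l2 = 0"
 proof -
  have "((%t. N1 t * N1 t + N2 t * N2 t) has_real_derivative (2 * (N1 t0 * l1 + N2 t0 * l2))) (at t0)"
   by (rule derivative_eq_intros dN refl)+ simp
  moreover have "((%t. N1 t * N1 t + N2 t * N2 t) has_real_derivative 0) (at t0)"
  proof (rule has_field_derivative_transform_within_open[OF DERIV_const[of 1] S])
   fix t assume t: "t : S"
   have "norm (nu (cyl (xi t) (eta t) al be)) = 1" using nu M[OF t] unfolding unit_normal_def by blast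
   thus "1 = N1 t * N1 t + N2 t * N2 t"
    using N[OF t] cyl_norm[of "N1 t" "N2 t" al be] by (simp add: power2_eq_square)
  qed
  ultimately show ?thesis using DERIV_unique by fastforce
 qed
 define kap where "kap = (l1 * xi' + l2 * eta') / (xi'^2 + eta'^2)"
 have q: "xi'^2 + eta'^2 > 0" using ne by (simp add: sum_power2_gt_zero_iff)
 have cr: "l1 * eta' = l2 * xi'" using vn Nl Ns by algebra
 have l: "l1 = kap * xi'" "l2 = kap * eta'"
 proof -
  have "kap * xi' * (xi'^2 + eta'^2) = (l1 * xi' + l2 * eta') * xi'" unfolding kap_def using q by simp
  also have "... = l1 * (xi'^2 + eta'^2)" using cr by algebra
  finally show "l1 = kap * xi'" using ne by auto
  have "kap * eta' * (xi'^2 + eta'^2) = (l1 * xi' + l2 * eta') * eta'" unfolding kap_def using q by simp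
  also have "... = l2 * (xi'^2 + eta'^2)" using cr by algebra
  finally show "l2 = kap * eta'" using ne by auto
 qed
 let ?r = "sqrt (xi'^2 + eta'^2)"
 let ?v1 = "(1 / ?r) *\<^sub>R ?v"
 have r: "?r > 0" "?r * ?r = xi'^2 + eta'^2" using q by auto
 have L1: "?L ?v1 = kap *\<^sub>R ?v1"
  unfolding lin Lv l by (simp add: cyl_scale mult.left_commute)
 have L2: "?L (tan1 al) = (N1 t0 / xi t0) *\<^sub>R tan1 al"
 proof -
  have "(1 / xi t0) *\<^sub>R (xi t0 *\<^sub>R ?L (tan1 al)) = (1 / xi t0) *\<^sub>R (N1 t0 *\<^sub>R tan1 al)"
   using rotation_curvature1[OF p nu M[OF S(2)] N[OF S(2)]] by simp
  thus ?thesis using pos by simp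
 qed
 have L3: "?L (tan2 be) = (N2 t0 / eta t0) *\<^sub>R tan2 be"
 proof -
  have "(1 / eta t0) *\<^sub>R (eta t0 *\<^sub>R ?L (tan2 be)) = (1 / eta t0) *\<^sub>R (N2 t0 *\<^sub>R tan2 be)"
   using rotation_curvature2[OF p nu M[OF S(2)] N[OF S(2)]] by simp
  thus ?thesis using pos by simp
 qed
 have o1: "?v1 \<bullet> ?v1 = 1" using r q ne by (auto simp: cyl_inner field_simps power2_eq_square)
 have o7: "?v1 \<bullet> nu ?p = 0" using vn by (simp add: N[OF S(2)] cyl_inner mult.commute)
 have cv: "mean_curvature M nu ?p = - (kap + N1 t0 / xi t0 + N2 t0 / eta t0)"
  "second_ff_norm2 M nu ?p = kap^2 + (N1 t0 / xi t0)^2 + (N2 t0 / eta t0)^2"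
  by (rule curvatures_from_principal_frame[OF p nu o1 _ _ _ _ _ o7 _ _ L1 L2 L3];
    simp add: N[OF S(2)])+
 show thesis by (rule that[OF dN[unfolded l] vn cv])
qed

text \<open>On the circle \<open>xi = 0\<close> the curves for all angles \<open>al\<close> pass
  through the same point, so every direction \<open>cyl 1 0 al be\<close> is principal with one and
  the same factor \<open>k\<close>; this is why \<open>k\<close> counts twice.\<close>

lemma axial_curvatures:
 fixes M :: "(real^4) set"
 assumes p: "cyl 0 b 0 be : mfd_int M" and nu: "unit_normal M nu" and b: "b > 0" "eps > 0"
  and M: "!!s al be. abs s < eps ==> cyl s (h s) al be : M"
  and N: "!!s al be. abs s < eps ==> nu (cyl s (h s) al be) = cyl (N1 s) (N2 s) al be"
  and h: "h 0 = b" "(h has_real_derivative 0) (at 0)"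
  and dN: "(N1 has_real_derivative k) (at 0)" "(N2 has_real_derivative 0) (at 0)" "N1 0 = 0"
 shows "mean_curvature M nu (cyl 0 b 0 be) = - (2 * k + N2 0 / b)"
  "second_ff_norm2 M nu (cyl 0 b 0 be) = 2 * k^2 + (N2 0 / b)^2"
proof -
 let ?p = "cyl 0 b 0 be"
 let ?L = "tangential_deriv M nu ?p"
 have pa: "cyl 0 b al be = ?p" for al unfolding cyl_def by simp
 have Np: "nu ?p = cyl 0 (N2 0) 0 be" using N[of 0 0 be] b h dN(3) by simp
 note n = normal_tangential_deriv[OF p nu]
 have L: "?L (cyl 1 0 al be) = k *\<^sub>R cyl 1 0 al be" for al
 proof -
  have c: "((%s. cyl s (h s) al be) has_vector_derivative cyl 1 0 al be) (at 0)"
   by (rule has_vector_derivative_cyl) (use h in auto)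
  have S: "open {-eps<..<eps}" "0 : {-eps<..<eps}" using b by auto
  have n1: "(nu has_derivative ?L) (at (cyl 0 (h 0) al be) within M)" unfolding h(1) pa[of al] by (rule n(1))
  have nc: "((%s. nu (cyl s (h s) al be)) has_vector_derivative ?L (cyl 1 0 al be)) (at 0)"
   by (rule has_derivative_along_curve[OF n1 S _ c]) (use M in auto)
  have nc2: "((%s. cyl (N1 s) (N2 s) al be) has_vector_derivative ?L (cyl 1 0 al be)) (at 0)"
   by (rule has_vector_derivative_transform_within_open[OF nc S]) (use N in auto)
  have "?L (cyl 1 0 al be) = cyl k 0 al be"
   by (rule vector_derivative_unique_at[OF nc2 has_vector_derivative_cyl]) (use dN in auto)
  thus ?thesis by (simp add: cyl_scale)
 qed
 have L3: "?L (tan2 be) = (N2 0 / b) *\<^sub>R tan2 be"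
 proof -
  have "b *\<^sub>R ?L (tan2 be) = N2 0 *\<^sub>R tan2 be"
   using rotation_curvature2[OF p nu, of "N1 0" "N2 0"] M[of 0 0] N[of 0 0] b h by simp
  hence "(1 / b) *\<^sub>R (b *\<^sub>R ?L (tan2 be)) = (1 / b) *\<^sub>R (N2 0 *\<^sub>R tan2 be)" by simp
  thus ?thesis using b by simp
 qed
 let ?u = "cyl 1 0 0 be" and ?w = "cyl 1 0 (pi / 2) be"
 have i: "?u \<bullet> ?u = 1" "?w \<bullet> ?w = 1" "?u \<bullet> ?w = 0" "?u \<bullet> tan2 be = 0" "?w \<bullet> tan2 be = 0" "tan2 be \<bullet> tan2 be = 1"
  "?u \<bullet> nu ?p = 0" "?w \<bullet> nu ?p = 0" "tan2 be \<bullet> nu ?p = 0"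
  unfolding Np unfolding cyl_def by (simp_all add: tan2_def)
    (use sin_cos_squared_add[of be] in algebra)+
 note cv = curvatures_from_principal_frame[OF p nu i(1,2,6,3,4,5,7,8,9) L L L3]
 show "mean_curvature M nu ?p = - (2 * k + N2 0 / b)" using cv(1) by simp
 show "second_ff_norm2 M nu ?p = 2 * k^2 + (N2 0 / b)^2" using cv(2) by simp
qed

end

section \<open>Equivariance of the normal and the meridian slice\<close>

lemma local_inverse:
 fixes f :: "'a::euclidean_space => 'a"
 assumes U: "open U" "x0 : U" and f: "!!x. x : U ==> (f has_derivative f' x) (at x)"
  and cont: "!!v. continuous_on U (%x. f' x v)" and inj: "inj (f' x0)"
 obtains V g where "open V" "x0 : V" "V <= U" "inj_on f V" "open (f ` V)" "continuous_on (f ` V) g"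
  "!!x. x : V ==> g (f x) = x" "!!x. x : V ==> inj (f' x) ==> g differentiable (at (f x))"
proof -
 have lin: "linear (f' x)" if "x : U" for x using f[OF that] has_derivative_linear by blast
 obtain G where G: "linear G" "G \<circ> f' x0 = id" using linear_injective_left_inverse[OF lin[OF U(2)] inj] by blast
 obtain r where r: "r > 0" "ball x0 r <= U" "inj_on f (ball x0 r)"
 proof (rule has_derivative_locally_injective[OF U(2,1) _ G(2) f])
  show "bounded_linear G" using G(1) linear_conv_bounded_linear by blast
  fix e :: real assume e: "e > 0"
  \<comment> \<open>Continuity of \<open>f'\<close> is assumed vector by vector; in finite dimension
    the sum over \<open>Basis\<close> turns this into continuity in the operator norm.\<close>
  have "((%x. \<Sum>b\<in>Basis. norm (f' x b - f' x0 b)) \<longlongrightarrow> (\<Sum>b\<in>Basis. norm (f' x0 b - f' x0 b))) (at x0)"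
   using cont U by (intro tendsto_intros) (auto simp: continuous_on_eq_continuous_at isCont_def)
  hence "\<forall>\<^sub>F x in at x0. (\<Sum>b\<in>Basis. norm (f' x b - f' x0 b)) < e"
   using e by (auto dest: order_tendstoD)
  then obtain d where d: "d > 0" "!!x. x ~= x0 ==> dist x x0 < d ==> (\<Sum>b\<in>Basis. norm (f' x b - f' x0 b)) < e"
   unfolding eventually_at by auto
  obtain d' where d': "d' > 0" "ball x0 d' <= U" using U open_contains_ball by blast
  show "EX d>0. ALL x. dist x0 x < d --> onorm (%v. f' x v - f' x0 v) < e"
  proof (intro exI[of _ "min d d'"] conjI allI impI)
   fix x assume x: "dist x0 x < min d d'"
   hence xU: "x : U" using d' by auto
   have "bounded_linear (%v. f' x v - f' x0 v)"
    using lin[OF xU] lin[OF U(2)] linear_compose_sub linear_conv_bounded_linear by blast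
   hence "onorm (%v. f' x v - f' x0 v) <= (\<Sum>b\<in>Basis. norm (f' x b - f' x0 b))"
    by (rule onorm_componentwise)
   also have "... < e" using d(2)[of x] x e by (cases "x = x0") (auto simp: dist_commute)
   finally show "onorm (%v. f' x v - f' x0 v) < e" .
  qed (use d d' in auto)
 qed auto
 let ?V = "ball x0 r"
 have cf: "continuous_on ?V f"
  by (meson continuous_at_imp_continuous_on f has_derivative_continuous r(2) subsetD)
 obtain g where g: "homeomorphism ?V (f ` ?V) f g"
  using invariance_of_domain_homeomorphism[OF open_ball cf _ r(3)] by blast
 have gf: "g (f x) = x" if "x : ?V" for x using g that unfolding homeomorphism_def by blast
 show thesis
 proof (rule that[of ?V g])
  show "open (f ` ?V)" by (rule invariance_of_domain[OF cf open_ball r(3)])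
  show "continuous_on (f ` ?V) g" using g unfolding homeomorphism_def by blast
  fix x assume x: "x : ?V" and i: "inj (f' x)"
  obtain G' where G': "linear G'" "G' \<circ> f' x = id"
   using linear_injective_left_inverse[OF lin i] r(2) x by blast
  hence "f' x \<circ> G' = id" using linear_inverse_left lin r(2) x by blast
  hence "(g has_derivative G') (at (f x))"
   using has_derivative_inverse_strong[OF open_ball x cf gf f] r(2) x by blast
  thus "g differentiable (at (f x))" unfolding differentiable_def by blast
 qed (use r gf in auto)
qed

lemma axis3_eq:
 "a *\<^sub>R axis 1 1 + b *\<^sub>R axis 2 1 + c *\<^sub>R axis 3 1 = a' *\<^sub>R axis 1 1 + b' *\<^sub>R axis 2 1 + c' *\<^sub>R (axis 3 1 :: real^3)
  \<longleftrightarrow> a = a' & b = b' & c = c'"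
proof -
 have "(a *\<^sub>R axis 1 1 + b *\<^sub>R axis 2 1 + c *\<^sub>R axis 3 1 :: real^3) \<bullet> axis 1 1 = a"
  "(a *\<^sub>R axis 1 1 + b *\<^sub>R axis 2 1 + c *\<^sub>R axis 3 1 :: real^3) \<bullet> axis 2 1 = b"
  "(a *\<^sub>R axis 1 1 + b *\<^sub>R axis 2 1 + c *\<^sub>R axis 3 1 :: real^3) \<bullet> axis 3 1 = c" for a b c
  by (simp_all add: inner_add_left inner_axis_axis)
 thus ?thesis by metis
qed

text \<open>The frame is chosen so that the circular orbit lies in the plane of \<open>f3\<close>
  and \<open>f4\<close>, with radius \<open>b\<close>; \<open>axis_norm\<close> and
  \<open>off_plane\<close> record that \<open>A\<close> meets the coordinate planes nowhere
  else.\<close>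

locale invariant_minimal = plane_frame +
 fixes A :: "(real^4) set" and n :: "real^4 => real^4" and b :: real
 assumes emb: "embedded_submanifold TYPE(3) A"
  and Ginv: "!!g. g : G ==> g ` A = A"
  and un: "unit_normal A n"
  and minimal: "!!p. p : A ==> mean_curvature A n p = 0"
  and conn: "connected A"
  and unbounded: "!!r. EX x:A. norm x >= r"
  and b: "b > 0" and base: "cmb 0 0 b 0 : A"
  and axis_norm: "!!x. x : A ==> cd1 x = 0 ==> cd2 x = 0 ==> norm x = b"
  and off_plane: "!!x. x : A ==> \<not> (cd3 x = 0 & cd4 x = 0)"
begin

lemma mfdA: "x : A ==> x : mfd_int A"
 using emb unfolding embedded_submanifold_def by blast

lemma rot_A: "x : A ==> rot al be x : A"
 using Ginv[OF rot_in_G] by blast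

lemma rot_A_iff: "rot al be x : A \<longleftrightarrow> x : A"
 using rot_A rot_inverse by metis

lemma cyl_A: "cyl xi eta al be : A \<longleftrightarrow> cmb xi 0 eta 0 : A"
proof -
 have "cyl xi eta al be = rot al be (cmb xi 0 eta 0)" by (simp add: cyl_def mult.commute)
 thus ?thesis by (simp only: rot_A_iff)
qed

lemma tangent_rot:
 assumes p: "p : A" and v: "v : tangent_space A p"
 shows "rot al be v : tangent_space A (rot al be p)"
proof -
 obtain U :: "(real^3) set" and phi x where l: "local_param A U phi" "x : U" "phi x = p"
  using mfdA[OF p] unfolding mfd_interior_def by force
 have U: "open U" "phi ` U <= A" using local_paramE[OF l(1)] by metis+
 obtain h where h: "v = FD phi x h" using v tangent_space_chart[OF l(1,2)] l(3) by auto
 have "bounded_linear (rot al be)" using linear_rot linear_conv_bounded_linear by blast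
 hence "((%y. rot al be (phi y)) has_derivative (%h. rot al be (FD phi x h))) (at x)"
  using local_param_has_derivative[OF l(1,2)] bounded_linear.has_derivative by blast
 hence "(%h. rot al be (FD phi x h)) h : tangent_space A (rot al be (phi x))"
  using U l(2) rot_A by (intro tangent_space_curve[where S = U]) (auto intro!: mfdA)
 thus ?thesis using h l(3) by simp
qed

lemma normal_facts:
 assumes "p : A"
 shows "tangent_space A p = {v. n p \<bullet> v = 0}" "norm (n p) = 1" "n p \<bullet> n p = 1"
 using normal_tangential_deriv[OF mfdA[OF assms] un] by (auto simp: norm_eq_1)

lemma n_continuous: "continuous_on A n"
 using un unfolding unit_normal_def by blast

text \<open>Both sides are unit normals at the rotated point, so their inner product is 1 or -1. It
  depends continuously on the two angles, which range over a connected plane, and it is 1 for the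
  identity.\<close>

lemma n_rot:
 assumes p: "p : A"
 shows "n (rot al be p) = rot al be (n p)"
proof -
 let ?f = "%z. n (rot (fst z) (snd z) p) \<bullet> rot (fst z) (snd z) (n p)"
 have pm: "?f z = 1 \<or> ?f z = -1" for z
 proof -
  let ?r = "rot (fst z) (snd z)"
  let ?N = "n (?r p)" and ?w = "?r (n p)"
  note nf = normal_facts[OF rot_A[OF p], of "fst z" "snd z"]
  have "?w \<bullet> v = 0" if v: "?N \<bullet> v = 0" for v
  proof -
   have "v : tangent_space A (?r p)" using nf(1) v by blast
   hence "rot (- fst z) (- snd z) v : tangent_space A p"
    using tangent_rot[OF rot_A[OF p]] rot_inverse by metis
   hence "n p \<bullet> rot (- fst z) (- snd z) v = 0" using normal_facts(1)[OF p] by blast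
   thus ?thesis using rot_inner[of "fst z" "snd z" "n p" "rot (- fst z) (- snd z) v"] by (simp add: rot_inverse')
  qed
  from this[of "?w - (?w \<bullet> ?N) *\<^sub>R ?N"]
  have "?w \<bullet> (?w - (?w \<bullet> ?N) *\<^sub>R ?N) = 0" using nf(3) by (simp add: inner_diff_right inner_commute)
  moreover have "?w \<bullet> ?w = 1" using rot_inner normal_facts(3)[OF p] by simp
  ultimately have "(?N \<bullet> ?w) * (?N \<bullet> ?w) = 1" by (simp add: inner_diff_right inner_commute)
  thus ?thesis by (simp add: square_eq_1_iff)
 qed
 have cr: "continuous_on UNIV (%z. rot (fst z) (snd z) x)" for x
  unfolding rot_def by (intro continuous_intros)
 have "continuous_on UNIV (%z. n (rot (fst z) (snd z) p))"
  using continuous_on_compose2[OF n_continuous cr] rot_A[OF p] by blast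
 hence cf: "continuous_on UNIV ?f" by (intro continuous_on_inner cr)
 have "?f constant_on UNIV"
 proof (rule continuous_finite_range_constant[OF _ cf])
  show "connected (UNIV :: (real \<times> real) set)" by (rule connected_UNIV)
  show "finite (range ?f)" by (rule finite_subset[of _ "{1, -1}"]) (use pm in auto)
 qed
 hence "?f (al, be) = ?f (0, 0)" unfolding constant_on_def by auto
 also have "?f (0, 0) = 1" using normal_facts(3)[OF p] cmb_expand by (simp add: rot_def)
 finally have 1: "n (rot al be p) \<bullet> rot al be (n p) = 1" by simp
 have 2: "rot al be (n p) \<bullet> rot al be (n p) = 1" using rot_inner normal_facts(3)[OF p] by simp
 have 3: "n (rot al be p) \<bullet> n (rot al be p) = 1" using normal_facts(3)[OF rot_A[OF p]] .
 have "(n (rot al be p) - rot al be (n p)) \<bullet> (n (rot al be p) - rot al be (n p)) = 0"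
  using 1 2 3 by (simp add: inner_diff_left inner_diff_right inner_commute)
 thus ?thesis by simp
qed

text \<open>The normal is perpendicular to both orbit circles through the point. Where
  \<open>xi = 0\<close> the first circle degenerates; there the rotation by \<pi> in the first plane
  fixes the point and forces the same component to vanish.\<close>

lemma n_profile:
 assumes p: "cmb xi 0 eta 0 : A"
 shows "n (cmb xi 0 eta 0) = cmb (cd1 (n (cmb xi 0 eta 0))) 0 (cd3 (n (cmb xi 0 eta 0))) 0"
proof -
 let ?p = "cmb xi 0 eta 0"
 have e0: "eta ~= 0" using off_plane[OF p] by auto
 have mA: "cyl xi eta al be : A" for al be using p cyl_A by blast
 have "xi *\<^sub>R tan1 0 : tangent_space A (cyl xi eta 0 0)"
  by (rule curve_tangent[OF mfdA open_UNIV _ _ has_vector_derivative_cyl_angle1]) (use mA in auto)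
 hence 1: "xi * (cd2 (n ?p)) = 0"
  using normal_facts(1)[OF p] by (simp add: cyl_zero tan1_def cmb_def inner_add_right)
 have "eta *\<^sub>R tan2 0 : tangent_space A (cyl xi eta 0 0)"
  by (rule curve_tangent[OF mfdA open_UNIV _ _ has_vector_derivative_cyl_angle2]) (use mA in auto)
 hence 2: "cd4 (n ?p) = 0"
  using normal_facts(1)[OF p] e0 by (simp add: cyl_zero tan2_def cmb_def inner_add_right)
 have 3: "cd2 (n ?p) = 0" if "xi = 0"
 proof -
  have "rot pi 0 ?p = ?p" using that by simp
  hence "n ?p = rot pi 0 (n ?p)" using n_rot[OF p, of pi 0] by simp
  hence "cd2 (n ?p) = cd2 (rot pi 0 (n ?p))" by simp
  thus ?thesis unfolding rot_def by simp
 qed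
 have "cd2 (n ?p) = 0" using 1 3 by auto
 thus ?thesis using cmb_expand[of "n ?p"] 2 by simp
qed

lemma n_cyl:
 assumes p: "cmb xi 0 eta 0 : A"
 shows "n (cyl xi eta al be) = cyl (cd1 (n (cmb xi 0 eta 0))) (cd3 (n (cmb xi 0 eta 0))) al be"
proof -
 have "cyl xi eta al be = rot al be (cmb xi 0 eta 0)" by (simp add: cyl_def mult.commute)
 hence "n (cyl xi eta al be) = rot al be (n (cmb xi 0 eta 0))" using n_rot[OF p] by simp
 also have "... = cyl (cd1 (n (cmb xi 0 eta 0))) (cd3 (n (cmb xi 0 eta 0))) al be"
  by (subst n_profile[OF p]) (simp add: cyl_def mult.commute)
 finally show ?thesis .
qed

lemma n_base: "n (cmb 0 0 b 0) = cmb 0 0 1 0 \<or> n (cmb 0 0 b 0) = cmb 0 0 (-1) 0"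
proof -
 have "rot pi 0 (cmb 0 0 b 0) = cmb 0 0 b 0" by simp
 hence "n (cmb 0 0 b 0) = rot pi 0 (n (cmb 0 0 b 0))" using n_rot[OF base, of pi 0] by simp
 hence "cd1 (n (cmb 0 0 b 0)) = cd1 (rot pi 0 (n (cmb 0 0 b 0)))" by simp
 hence "cd1 (n (cmb 0 0 b 0)) = 0" unfolding rot_def by simp
 hence e: "n (cmb 0 0 b 0) = cmb 0 0 (cd3 (n (cmb 0 0 b 0))) 0" using n_profile[OF base] by simp
 hence "(cd3 (n (cmb 0 0 b 0))) * (cd3 (n (cmb 0 0 b 0))) = 1"
  using normal_facts(3)[OF base] cmb_inner by (metis add_0 add_0_right mult_zero_left)
 hence "cd3 (n (cmb 0 0 b 0)) = 1 \<or> cd3 (n (cmb 0 0 b 0)) = -1" by (simp add: square_eq_1_iff)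
 thus ?thesis using e by metis
qed

text \<open>The map \<open>(q, cd2, cd4)\<close> on \<open>A\<close> is inverted locally, and the
  curve is the preimage of a line. The function \<open>q\<close> is left open because the squared
  norm is a good parameter away from the circular orbit but critical on it, where \<open>cd1\<close>
  is used.\<close>

lemma slice_curve:
 fixes q :: "real^4 => real"
 assumes p: "p : A" "cd2 p = 0" "cd4 p = 0"
  and q: "!!x. (q has_derivative (%v. w x \<bullet> v)) (at x)" "continuous_on UNIV w"
  and trans: "!!v. n p \<bullet> v = 0 ==> cd2 v = 0 ==> cd4 v = 0 ==> w p \<bullet> v = 0 ==> v = 0"
 obtains eps dl c where "eps > 0" "dl > 0" "continuous_on {q p - eps<..<q p + eps} c" "c (q p) = p"
  "!!t. abs (t - q p) < eps ==> c t : A & q (c t) = t & cd2 (c t) = 0 & cd4 (c t) = 0"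
  "!!x. x : A ==> dist p x < dl ==> cd2 x = 0 ==> cd4 x = 0 ==> abs (q x - q p) < eps & x = c (q x)"
  "!!t. abs (t - q p) < eps ==> (!!v. n (c t) \<bullet> v = 0 ==> cd2 v = 0 ==> cd4 v = 0 ==> w (c t) \<bullet> v = 0 ==> v = 0)
   ==> c differentiable (at t)"
proof -
 obtain U :: "(real^3) set" and phi x0 where l: "local_param A U phi" "x0 : U" "phi x0 = p"
  using mfdA[OF p(1)] unfolding mfd_interior_def by force
 obtain psi where psi: "open U" "continuous_on U phi" "continuous_on (phi ` U) psi"
  "!!x. x : U ==> psi (phi x) = x" "!!p. p : phi ` U ==> psi p : U & phi (psi p) = p"
  "openin (top_of_set A) (phi ` U)" "phi ` U <= A" using local_paramE[OF l(1)] by metis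
 let ?d = "%y. FD phi y"
 let ?v3 = "%a b c. a *\<^sub>R axis 1 1 + b *\<^sub>R axis 2 1 + c *\<^sub>R (axis 3 1 :: real^3)"
 define f where "f y = ?v3 (q (phi y)) (cd2 (phi y)) (cd4 (phi y))" for y
 define f' where "f' y h = ?v3 (w (phi y) \<bullet> ?d y h) (cd2 (?d y h)) (cd4 (?d y h))" for y h
 have df: "(f has_derivative f' y) (at y)" if "y : U" for y
 proof -
  note d = local_param_has_derivative[OF l(1) that]
  have "((%y. q (phi y)) has_derivative (%h. w (phi y) \<bullet> ?d y h)) (at y)"
   using has_derivative_compose[OF d q(1)] .
  thus ?thesis unfolding f_def[abs_def] f'_def[abs_def]
   by (intro has_derivative_add has_derivative_scaleR_left has_derivative_inner_left d)
 qed
 have cf': "continuous_on U (%y. f' y v)" for v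
  unfolding f'_def
  by (intro continuous_intros continuous_on_compose2[OF q(2) psi(2)] local_param_deriv_continuous[OF l(1)]) auto
 have injf: "inj (f' y)" if y: "y : U"
  and tr: "!!v. n (phi y) \<bullet> v = 0 ==> cd2 v = 0 ==> cd4 v = 0 ==> w (phi y) \<bullet> v = 0 ==> v = 0" for y
 proof (rule linear_injective_0[THEN iffD2, rule_format])
  show "linear (f' y)" using df[OF y] has_derivative_linear by blast
  fix h assume "f' y h = 0"
  hence "?v3 (w (phi y) \<bullet> ?d y h) (cd2 (?d y h)) (cd4 (?d y h)) = ?v3 0 0 0" unfolding f'_def by simp
  hence "w (phi y) \<bullet> ?d y h = 0" "cd2 (?d y h) = 0" "cd4 (?d y h) = 0" unfolding axis3_eq by auto
  moreover have "n (phi y) \<bullet> ?d y h = 0"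
   using tangent_space_chart[OF l(1) y] normal_facts(1)[of "phi y"] psi(7) y by blast
  ultimately have "?d y h = 0" using tr by blast
  thus "h = 0" using local_param_linear[OF l(1) y] linear_injective_0 by blast
 qed
 obtain V g where V: "open V" "x0 : V" "V <= U" "inj_on f V" "open (f ` V)" "continuous_on (f ` V) g"
  "!!x. x : V ==> g (f x) = x" "!!x. x : V ==> inj (f' x) ==> g differentiable (at (f x))"
  using local_inverse[OF psi(1) l(2) df cf' injf[OF l(2)]] trans l(3) by blast
 have fx0: "f x0 = q p *\<^sub>R axis 1 1" unfolding f_def using l(3) p by simp
 obtain eps where eps: "eps > 0" "ball (f x0) eps <= f ` V" using V(2,5) open_contains_ball by blast
 have inV: "t *\<^sub>R axis 1 1 : f ` V" if "abs (t - q p) < eps" for t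
 proof -
  have "dist (f x0) (t *\<^sub>R axis 1 1) = abs (q p - t)" unfolding fx0 dist_norm scaleR_left_diff_distrib[symmetric] by simp
  thus ?thesis using eps(2) that by auto
 qed
 define c where "c t = phi (g (t *\<^sub>R axis 1 1))" for t
 have gt: "g (t *\<^sub>R axis 1 1) : V" "f (g (t *\<^sub>R axis 1 1)) = t *\<^sub>R axis 1 1" if "abs (t - q p) < eps" for t
  using inV[OF that] V(7) by auto
 have ct: "c t : A & q (c t) = t & cd2 (c t) = 0 & cd4 (c t) = 0" if t: "abs (t - q p) < eps" for t
 proof -
  have "?v3 (q (c t)) (cd2 (c t)) (cd4 (c t)) = ?v3 t 0 0"
   using gt(2)[OF t] unfolding f_def c_def by simp
  thus ?thesis unfolding axis3_eq using gt(1)[OF t] V(3) psi(7) unfolding c_def by blast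
 qed
 have cc: "continuous_on {q p - eps<..<q p + eps} c"
  unfolding c_def
 proof (rule continuous_on_compose2[OF psi(2)])
  show "continuous_on {q p - eps<..<q p + eps} (%t. g (t *\<^sub>R axis 1 1))"
  proof (rule continuous_on_compose2[OF V(6)])
   show "(%t. t *\<^sub>R axis 1 1) ` {q p - eps<..<q p + eps} <= f ` V"
    using inV by (auto simp: abs_less_iff)
  qed (intro continuous_intros)
  show "(%t. g (t *\<^sub>R axis 1 1)) ` {q p - eps<..<q p + eps} <= U"
   using gt V(3) by (auto simp: abs_less_iff subset_iff)
 qed
 \<comment> \<open>Relative openness of the smaller chart image is what excludes other sheets of
   \<open>A\<close> near \<open>p\<close>.\<close>
 have "openin (top_of_set A) (phi ` V)"
 proof -
  have "openin (top_of_set (phi ` U)) (phi ` U Int psi -` V)" using continuous_openin_preimage[OF psi(3), of UNIV V] V(1) by (simp add: openin_open)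
  moreover have "phi ` U Int psi -` V = phi ` V" using psi(4,5) V(3) by (auto simp: image_iff)
  ultimately show ?thesis using openin_trans psi(6) by metis
 qed
 then obtain T where T: "open T" "phi ` V = A Int T" using openin_open by metis
 have "p : T" using T(2) V(2) l(3) by blast
 then obtain dl1 where dl1: "dl1 > 0" "ball p dl1 <= T" using T(1) open_contains_ball by blast
 have "isCont q p" using q(1) has_derivative_continuous by blast
 then obtain dl2 where dl2: "dl2 > 0" "!!x. dist x p < dl2 ==> dist (q x) (q p) < eps"
  using eps(1) unfolding continuous_at_eps_delta by blast
 show thesis
 proof (rule that[of eps "min dl1 dl2" c])
  show "c (q p) = p" unfolding c_def fx0[symmetric] using V(2,7) l(3) by simp
  fix x assume x: "x : A" "dist p x < min dl1 dl2" "cd2 x = 0" "cd4 x = 0"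
  have qe: "abs (q x - q p) < eps" using dl2(2)[of x] x(2) by (simp add: dist_real_def dist_commute)
  have "x : phi ` V" using T(2) dl1(2) x(1,2) by auto
  then obtain y where y: "y : V" "x = phi y" by blast
  have "f y = q x *\<^sub>R axis 1 1" unfolding f_def using y x by simp
  hence "y = g (q x *\<^sub>R axis 1 1)" using V(7)[OF y(1)] by simp
  thus "abs (q x - q p) < eps & x = c (q x)" using qe y unfolding c_def by simp
 next
  fix t assume t: "abs (t - q p) < eps"
   and tr: "!!v. n (c t) \<bullet> v = 0 ==> cd2 v = 0 ==> cd4 v = 0 ==> w (c t) \<bullet> v = 0 ==> v = 0"
  let ?y = "g (t *\<^sub>R axis 1 1)"
  have yU: "?y : U" using gt(1)[OF t] V(3) by blast
  have "inj (f' ?y)" using injf[OF yU] tr unfolding c_def by blast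
  hence dg: "g differentiable (at (t *\<^sub>R axis 1 1))" using V(8)[OF gt(1)[OF t]] gt(2)[OF t] by simp
  have d1: "(%t. t *\<^sub>R (axis 1 1 :: real^3)) differentiable (at t)" by simp
  have d2: "phi differentiable (at (g (t *\<^sub>R axis 1 1)))" using local_param_has_derivative[OF l(1) yU] differentiable_def by blast
  have "(g \<circ> (%t. t *\<^sub>R axis 1 1)) differentiable (at t)" by (rule differentiable_chain_at[OF d1 dg])
  hence "(phi \<circ> (g \<circ> (%t. t *\<^sub>R axis 1 1))) differentiable (at t)" by (rule differentiable_chain_at) (use d2 in simp)
  thus "c differentiable (at t)" unfolding c_def[abs_def] o_def .
 qed (use eps dl1 dl2 ct cc in auto)
qed

text \<open>In the meridian plane this is the inner product of the position with the unit tangent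
  obtained by turning the normal through a right angle; along the meridian the squared norm is
  critical exactly where it vanishes.\<close>

definition Dq :: "real^4 => real" where "Dq x = (cd3 x) * (cd1 (n x)) - (cd1 x) * (cd3 (n x))"

lemma profile_local:
 assumes p: "cmb xi 0 eta 0 : A" and D: "Dq (cmb xi 0 eta 0) ~= 0"
 defines "t0 \<equiv> xi^2 + eta^2"
 obtains eps dl c where "eps > 0" "dl > 0" "continuous_on {t0 - eps<..<t0 + eps} c" "c t0 = cmb xi 0 eta 0"
  "!!t. abs (t - t0) < eps ==> c t : A & (norm (c t))^2 = t & cd2 (c t) = 0 & cd4 (c t) = 0"
  "!!x. x : A ==> dist (cmb xi 0 eta 0) x < dl ==> cd2 x = 0 ==> cd4 x = 0 ==>
   abs ((norm x)^2 - t0) < eps & x = c ((norm x)^2)"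
  "c differentiable (at t0)"
proof -
 let ?p = "cmb xi 0 eta 0"
 have q: "((%x::real^4. (norm x)^2) has_derivative (%v. (2 *\<^sub>R x) \<bullet> v)) (at x)" for x
 proof -
  have "((%x::real^4. x \<bullet> x) has_derivative (%v. x \<bullet> v + v \<bullet> x)) (at x)"
   by (rule has_derivative_inner[OF has_derivative_ident has_derivative_ident])
  moreover have "(%v. x \<bullet> v + v \<bullet> x) = (%v. (2 *\<^sub>R x) \<bullet> v)" by (simp add: fun_eq_iff inner_commute)
  ultimately show ?thesis by (simp add: power2_norm_eq_inner)
 qed
 have tr: "v = 0" if v: "n ?p \<bullet> v = 0" "cd2 v = 0" "cd4 v = 0" "(2 *\<^sub>R ?p) \<bullet> v = 0" for v
 proof -
  obtain v1 v3 where vv: "v = cmb v1 0 v3 0" using cmb_expand[of v] v(2,3) by metis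
  define n1 n3 where "n1 = cd1 (n ?p)" and "n3 = cd3 (n ?p)"
  have "n1 * v1 + n3 * v3 = 0"
   using v(1) n_profile[OF p] unfolding vv n1_def n3_def by (metis add_0_right cmb_inner mult_zero_right)
  moreover have "xi * v1 + eta * v3 = 0" using v(4) unfolding vv by simp
  moreover have "eta * n1 - xi * n3 ~= 0" using D unfolding Dq_def n1_def n3_def by simp
  ultimately have "v1 = 0" "v3 = 0" by algebra+
  thus "v = 0" using vv cmb_zero by simp
 qed
 have t0: "(norm ?p)^2 = t0" unfolding t0_def norm_cmb by simp
 obtain eps dl c where c: "eps > 0" "dl > 0" "continuous_on {t0 - eps<..<t0 + eps} c" "c t0 = ?p"
  "!!t. abs (t - t0) < eps ==> c t : A & (norm (c t))^2 = t & cd2 (c t) = 0 & cd4 (c t) = 0"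
  "!!x. x : A ==> dist ?p x < dl ==> cd2 x = 0 ==> cd4 x = 0 ==> abs ((norm x)^2 - t0) < eps & x = c ((norm x)^2)"
  "!!t. abs (t - t0) < eps ==> (!!v. n (c t) \<bullet> v = 0 ==> cd2 v = 0 ==> cd4 v = 0 ==> (2 *\<^sub>R c t) \<bullet> v = 0 ==> v = 0)
   ==> c differentiable (at t)"
  apply (rule slice_curve[OF p _ _ q, unfolded t0])
  apply simp
  apply simp
  apply (intro continuous_intros)
  apply (rule tr; assumption)
  subgoal premises prems for eps dl c by (rule prems(1)[of eps dl c]) (fact prems)+
  done
 show thesis by (rule that[OF c(1-6)]) (use c(7)[of t0] c(1,4) tr in auto)
qed

end

text \<open>With the normal pointing to the origin on the circular orbit, \<open>Dq\<close> is
  positive just off this orbit. The opposite choice is reduced to this one by changing the sign of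
  the normal.\<close>

locale normalised_minimal = invariant_minimal +
 assumes n_base': "n (cmb 0 0 b 0) = cmb 0 0 (-1) 0"
begin

text \<open>Close to the circular orbit the meridian is a graph over \<open>cd1\<close> with
  horizontal tangent. Minimality on the orbit reads \<open>2 * k = 1 / b\<close> for the derivative
  \<open>k\<close> of \<open>M1\<close>, and then \<open>Dq\<close> has derivative
  \<open>b * k + 1 = 3 / 2\<close> along the graph; so the squared norm increases away from the
  orbit.\<close>

lemma axis_profile:
 obtains eps dl h M1 M2 where "eps > 0" "dl > 0"
  "!!s al be. abs s < eps ==> cyl s (h s) al be : A"
  "!!s al be. abs s < eps ==> n (cyl s (h s) al be) = cyl (M1 s) (M2 s) al be"
  "h 0 = b" "(h has_real_derivative 0) (at 0)" "M1 0 = 0" "M2 0 = -1"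
  "(M1 has_real_derivative 1 / (2 * b)) (at 0)" "(M2 has_real_derivative 0) (at 0)"
  "!!x. x : A ==> dist (cmb 0 0 b 0) x < dl ==> cd2 x = 0 ==> cd4 x = 0 ==>
   abs (cd1 x) < eps & x = cmb (cd1 x) 0 (h (cd1 x)) 0"
  "!!s. 0 < s ==> s < eps ==> 0 < h s & 0 < h s * M1 s - s * M2 s"
  "continuous_on {-eps<..<eps} h"
  "!!s s'. 0 <= s ==> s < s' ==> s' < eps ==> s^2 + (h s)^2 < s'^2 + (h s')^2"
proof -
 let ?p = "cmb 0 0 b 0"
 have q: "((%x::real^4. cd1 x) has_derivative (%v. f1 \<bullet> v)) (at x)" for x
  using has_derivative_inner_left[OF has_derivative_ident[of "at x"], of f1] by (simp add: inner_commute)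
 have f3: "cd3 x = 0 ==> cd1 x = 0 ==> cd2 x = 0 ==> cd4 x = 0 ==> x = 0" for x
  using cmb_expand[of x] cmb_zero by simp
 have tr: "v = 0" if "n ?p \<bullet> v = 0" "cd2 v = 0" "cd4 v = 0" "f1 \<bullet> v = 0" for v
  using that unfolding n_base' by (intro f3) (auto simp: cmb_def inner_commute)
 obtain eps0 dl0 c where c: "eps0 > 0" "dl0 > 0" "continuous_on {- eps0<..<eps0} c" "c 0 = ?p"
  "!!t. abs t < eps0 ==> c t : A & cd1 (c t) = t & cd2 (c t) = 0 & cd4 (c t) = 0"
  "!!x. x : A ==> dist ?p x < dl0 ==> cd2 x = 0 ==> cd4 x = 0 ==> abs (cd1 x) < eps0 & x = c (cd1 x)"
  "!!t. abs t < eps0 ==> (!!v. n (c t) \<bullet> v = 0 ==> cd2 v = 0 ==> cd4 v = 0 ==> f1 \<bullet> v = 0 ==> v = 0)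
   ==> c differentiable (at t)"
  apply (rule slice_curve[OF base _ _ q, unfolded cmb_coords diff_zero add_0 diff_0])
  apply simp
  apply simp
  apply (intro continuous_intros)
  apply (rule tr; assumption)
  subgoal premises prems for eps dl c by (rule prems(1)[of eps dl c]) (fact prems)+
  done
 define h where "h s = cd3 (c s)" for s
 define M1 M2 where "M1 s = cd1 (n (c s))" and "M2 s = cd3 (n (c s))" for s
 have cs: "c s = cmb s 0 (h s) 0" if "abs s < eps0" for s
  using cmb_expand[of "c s"] c(5)[OF that] unfolding h_def by simp
 have cA: "cyl s (h s) al be : A" and nA: "n (cyl s (h s) al be) = cyl (M1 s) (M2 s) al be" if "abs s < eps0" for s al be
  using c(5)[OF that] cs[OF that] cyl_A n_cyl[of s "h s" al be] unfolding M1_def M2_def by auto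
 have h0: "h 0 = b" "M1 0 = 0" "M2 0 = -1" unfolding h_def M1_def M2_def c(4) n_base' by auto
 have sq: "M1 s * M1 s + M2 s * M2 s = 1" if "abs s < eps0" for s
  using normal_facts(3)[OF cA[OF that, of 0 0]] nA[OF that, of 0 0] cyl_inner[of "M1 s" "M2 s" 0 0] by simp
 have ch: "continuous_on {- eps0<..<eps0} h" unfolding h_def by (intro continuous_intros c(3))
 have cn: "continuous_on {- eps0<..<eps0} (%s. n (c s))"
  by (rule continuous_on_compose2[OF n_continuous c(3)]) (use c(5) in "auto simp: abs_less_iff")
 have cM2: "continuous_on {- eps0<..<eps0} M2" unfolding M2_def by (intro continuous_intros cn)
 have slope: "EX h'. (h has_real_derivative h') (at s) & M1 s + M2 s * h' = 0"
  if s: "abs s < eps0" "M2 s ~= 0" for s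
 proof -
  have "c differentiable (at s)"
  proof (rule c(7)[OF s(1)])
   fix v assume v: "n (c s) \<bullet> v = 0" "cd2 v = 0" "cd4 v = 0" "f1 \<bullet> v = 0"
   have "n (c s) = cmb (M1 s) 0 (M2 s) 0" using nA[OF s(1), of 0 0] cs[OF s(1)] by (simp add: cyl_zero)
   hence "M2 s * (f3 \<bullet> v) = 0" using v unfolding cmb_def by (simp add: inner_add_left inner_add_right inner_commute)
   thus "v = 0" using s(2) v by (intro f3) (auto simp: inner_commute)
  qed
  hence d: "(c has_vector_derivative vector_derivative c (at s)) (at s)" by (simp add: vector_derivative_works)
  let ?v = "vector_derivative c (at s)"
  have S: "open {- eps0<..<eps0}" "s : {- eps0<..<eps0}" using s by auto
  have "?v : tangent_space A (c s)"
   by (rule curve_tangent[OF _ S _ d]) (use c(5) s in "auto intro!: mfdA simp: abs_less_iff")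
  hence t: "n (c s) \<bullet> ?v = 0" using normal_facts(1) c(5)[OF s(1)] by blast
  have dh: "(h has_real_derivative cd3 ?v) (at s)"
   unfolding h_def by (rule has_real_derivative_inner_left[OF d])
  have "((%s. c s \<bullet> f1) has_real_derivative cd1 ?v) (at s)" by (rule has_real_derivative_inner_left[OF d])
  moreover have "((%s. cd1 (c s)) has_real_derivative 1) (at s)"
   by (rule has_field_derivative_transform_within_open[OF DERIV_ident S]) (use c(5) in "auto simp: abs_less_iff")
  ultimately have v1: "cd1 ?v = 1" by (rule DERIV_unique)
  have "n (c s) = cmb (M1 s) 0 (M2 s) 0" using nA[OF s(1), of 0 0] cs[OF s(1)] by (simp add: cyl_zero)
  hence "M1 s + M2 s * (cd3 ?v) = 0" using t v1 unfolding cmb_def by (simp add: inner_add_left inner_add_right inner_commute)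
  thus ?thesis using dh by blast
 qed
 have dh0: "(h has_real_derivative 0) (at 0)" using slope[of 0] h0 c(1) by auto
 let ?L = "tangential_deriv A n ?p"
 note nt = normal_tangential_deriv[OF mfdA[OF base] un]
 have cd: "(c has_vector_derivative f1) (at 0)"
 proof -
  have "((%s. cmb s 0 (h s) 0) has_vector_derivative cmb 1 0 0 0) (at 0)"
   by (intro has_vector_derivative_cmb dh0) auto
  hence "(c has_vector_derivative cmb 1 0 0 0) (at 0)"
   by (rule has_vector_derivative_transform_within_open[where S="{- eps0<..<eps0}"]) (use c(1) cs in "auto simp: abs_less_iff")
  thus ?thesis by (simp add: cmb_def)
 qed
 have nd: "((%s. n (c s)) has_vector_derivative ?L f1) (at 0)"
  by (rule has_derivative_along_curve[where S="{- eps0<..<eps0}", OF _ _ _ _ cd]) (use c nt(1) in "auto simp: abs_less_iff")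
 define k k' where "k = cd1 (?L f1)" and "k' = cd3 (?L f1)"
 have dM1: "(M1 has_real_derivative k) (at 0)" and dM2: "(M2 has_real_derivative k') (at 0)"
  unfolding M1_def M2_def k_def k'_def by (rule has_real_derivative_inner_left[OF nd])+
 have "k' = 0"
 proof -
  have "((%s. M1 s * M1 s + M2 s * M2 s) has_real_derivative - 2 * k') (at 0)"
   by (rule derivative_eq_intros dM1 dM2 refl)+ (simp add: h0)
  moreover have "((%s. M1 s * M1 s + M2 s * M2 s) has_real_derivative 0) (at 0)"
   by (rule has_field_derivative_transform_within_open[OF DERIV_const[of 1], where S="{- eps0<..<eps0}"]) (use c(1) sq in "auto simp: abs_less_iff")
  ultimately show ?thesis using DERIV_unique by fastforce
 qed
 hence dM2: "(M2 has_real_derivative 0) (at 0)" using dM2 by simp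
 have pc: "cyl 0 b 0 0 = ?p" by (simp add: cyl_def)
 have "mean_curvature A n (cyl 0 b 0 0) = - (2 * k + M2 0 / b)"
  by (rule axial_curvatures(1)[where be=0, OF mfdA[OF base, folded pc] un b c(1) cA nA h0(1) dh0 dM1 dM2 h0(2)])
 hence "2 * k - 1 / b = 0" using minimal[OF base] pc h0 by simp
 hence k: "k = 1 / (2 * b)" using b by (simp add: field_simps)
 have dD: "((%s. h s * M1 s - s * M2 s) has_real_derivative 3 / 2) (at 0)"
  by (rule derivative_eq_intros dM1 dM2 dh0 refl)+ (use k b h0 in "simp add: field_simps")
 obtain d1 where d1: "d1 > 0" "!!s. 0 < s ==> s < d1 ==> 0 < h s * M1 s - s * M2 s"
  using DERIV_pos_inc_right[OF dD] h0 by auto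
 have S0: "0 : {- eps0<..<eps0}" "open {- eps0<..<eps0}" using c(1) by auto
 have "isCont h 0" "isCont M2 0" using ch cM2 S0 continuous_on_eq_continuous_at by blast+
 then obtain d2 d3 where d2: "d2 > 0" "!!s. dist s 0 < d2 ==> dist (h s) (h 0) < b"
  and d3: "d3 > 0" "!!s. dist s 0 < d3 ==> dist (M2 s) (M2 0) < 1"
  using b unfolding continuous_at_eps_delta by (metis zero_less_one)
 define eps where "eps = min eps0 (min d1 (min d2 d3))"
 have eps: "eps > 0" "eps <= eps0" using c(1) d1 d2 d3 unfolding eps_def by auto
 have hpos: "0 < h s & 0 < h s * M1 s - s * M2 s" if "0 < s" "s < eps" for s
  using d1(2)[of s] d2(2)[of s] that h0 unfolding eps_def by (auto simp: dist_real_def)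
 have M2neg: "M2 s < 0" if "0 < s" "s < eps" for s
  using d3(2)[of s] that h0 unfolding eps_def by (auto simp: dist_real_def)
 have mono: "s^2 + (h s)^2 < s'^2 + (h s')^2" if ss: "0 <= s" "s < s'" "s' < eps" for s s'
 proof (rule DERIV_pos_imp_increasing_open[OF ss(2)])
  fix x assume x: "s < x" "x < s'"
  hence x': "0 < x" "x < eps" "abs x < eps0" using ss eps by auto
  obtain h' where h': "(h has_real_derivative h') (at x)" "M1 x + M2 x * h' = 0"
   using slope[OF x'(3)] M2neg[OF x'(1,2)] by auto
  have dd: "((%s. s^2 + (h s)^2) has_real_derivative 2 * x + 2 * h x * h') (at x)"
   by (rule derivative_eq_intros h' refl)+ simp
  have "M2 x * (2 * x + 2 * h x * h') = - 2 * (h x * M1 x - x * M2 x)" using h'(2) by algebra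
  also have "... < 0" using hpos[OF x'(1,2)] by simp
  finally have "0 < 2 * x + 2 * h x * h'" using M2neg[OF x'(1,2)] by (simp add: mult_less_0_iff)
  thus "EX y. ((%s. s^2 + (h s)^2) has_real_derivative y) (at x) & 0 < y" using dd by blast
 next
  show "continuous_on {s..s'} (%s. s^2 + (h s)^2)"
   by (intro continuous_intros continuous_on_subset[OF ch]) (use ss eps in auto)
 qed
 show thesis
 proof (rule that[of eps "min dl0 eps" h M1 M2])
  fix x assume x: "x : A" "dist ?p x < min dl0 eps" "cd2 x = 0" "cd4 x = 0"
  have xc: "abs (cd1 x) < eps0 & x = c (cd1 x)" using c(6) x by simp
  have "abs (cd1 (x - ?p)) <= norm (x - ?p) * norm f1" by (rule Cauchy_Schwarz_ineq2)
  hence "abs (cd1 x) < eps" using x(2) by (simp add: inner_diff_left norm_eq_sqrt_inner[of f1] dist_norm norm_minus_commute)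
  thus "abs (cd1 x) < eps & x = cmb (cd1 x) 0 (h (cd1 x)) 0" using xc cs by metis
 qed (use eps c(2) cA nA h0 dh0 dM1 dM2 k hpos mono in "auto intro: continuous_on_subset[OF ch]")
qed

section \<open>Continuation of the meridian\<close>

abbreviation "p0 \<equiv> cmb 0 0 b 0"

text \<open>An arc of the meridian in the closed quarter plane. \<open>Dq > 0\<close> makes the
  parameter regular; \<open>p0\<close> has to be allowed separately because \<open>Dq\<close>
  vanishes there.\<close>

definition prof :: "real set => (real => real^4) => bool" where
 "prof I gam \<longleftrightarrow> continuous_on I gam & (ALL t:I. gam t : A & cd2 (gam t) = 0 & cd4 (gam t) = 0 &
   (norm (gam t))^2 = t & 0 <= gam t \<bullet> f1 & 0 <= cd3 (gam t) & (gam t = p0 \<or> Dq (gam t) > 0))"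

definition good :: "real => (real => real^4) => bool" where
 "good T gam \<longleftrightarrow> b^2 < T & prof {b^2..T} gam & gam (b^2) = p0"

lemma norm_p0: "(norm p0)^2 = b^2" by (simp add: norm_cmb)

lemma profD:
 assumes "prof I gam" "t : I"
 shows "gam t : A" "gam t = cmb (cd1 (gam t)) 0 (cd3 (gam t)) 0" "(norm (gam t))^2 = t"
  "0 <= cd1 (gam t)" "0 < cd3 (gam t)" "t ~= b^2 ==> Dq (gam t) > 0" "t ~= b^2 ==> 0 < cd1 (gam t)"
  "(cd1 (gam t))^2 + (cd3 (gam t))^2 = t" "cd2 (gam t) = 0" "cd4 (gam t) = 0"
proof -
 show a: "gam t : A" "(norm (gam t))^2 = t" "0 <= cd1 (gam t)" "cd2 (gam t) = 0" "cd4 (gam t) = 0"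
  using assms unfolding prof_def by auto
 have "0 <= cd3 (gam t)" using assms unfolding prof_def by auto
 thus "0 < cd3 (gam t)" using off_plane[OF a(1)] a(5) by (simp add: less_le)
 show e: "gam t = cmb (cd1 (gam t)) 0 (cd3 (gam t)) 0" using cmb_expand[of "gam t"] a by simp
 show "(cd1 (gam t))^2 + (cd3 (gam t))^2 = t"
  using a(2) norm_cmb[of "cd1 (gam t)" 0 "cd3 (gam t)" 0] e by simp
 show "Dq (gam t) > 0" if "t ~= b^2" using assms that norm_p0 a(2) unfolding prof_def by metis
 show "0 < cd1 (gam t)" if "t ~= b^2"
 proof -
  have "cd1 (gam t) ~= 0" using axis_norm[OF a(1)] a(2,4) that by auto
  thus ?thesis using a(3) by simp
 qed
qed

lemma prof_subset: "prof I gam ==> J <= I ==> prof J gam"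
 unfolding prof_def using continuous_on_subset by blast

text \<open>On the graph near the circular orbit the squared norm is strictly increasing in
  \<open>cd1\<close>, so inverting it reparametrises the graph by \<open>t\<close>.\<close>

lemma good_exists: "EX T gam. good T gam"
proof -
 obtain eps dl h M1 M2 where a: "eps > 0"
  "!!s al be. abs s < eps ==> cyl s (h s) al be : A"
  "!!s al be. abs s < eps ==> n (cyl s (h s) al be) = cyl (M1 s) (M2 s) al be"
  "h 0 = b" "!!s. 0 < s ==> s < eps ==> 0 < h s & 0 < h s * M1 s - s * M2 s"
  "continuous_on {-eps<..<eps} h"
  "!!s s'. 0 <= s ==> s < s' ==> s' < eps ==> s^2 + (h s)^2 < s'^2 + (h s')^2"
  apply (rule axis_profile)
  subgoal premises prems for eps dl h M1 M2 by (rule prems(1)[of eps h M1 M2]) (fact prems)+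
  done
 define R where "R s = s^2 + (h s)^2" for s
 let ?I = "{0..eps/2}"
 have R0: "R 0 = b^2" unfolding R_def a(4) by simp
 have mono: "R s < R s'" if "0 <= s" "s < s'" "s' <= eps/2" for s s'
  unfolding R_def using a(7) that a(1) by simp
 have cR: "continuous_on ?I R"
  unfolding R_def by (intro continuous_intros continuous_on_subset[OF a(6)]) (use a(1) in auto)
 have inj: "inj_on R ?I" by (rule linorder_inj_onI') (use mono in force)
 define si where "si = the_inv_into ?I R"
 have csi: "continuous_on (R ` ?I) si" unfolding si_def by (rule continuous_on_inv_into[OF cR _ inj]) simp
 have im: "{b^2..R (eps/2)} <= R ` ?I"
 proof
  fix t assume "t : {b^2..R (eps/2)}"
  thus "t : R ` ?I" using IVT'[of R 0 t "eps/2"] R0 cR a(1) by force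
 qed
 have si: "si t : ?I" "R (si t) = t" if "t : {b^2..R (eps/2)}" for t
  using im that the_inv_into_into[OF inj, of t] f_the_inv_into_f[OF inj, of t] unfolding si_def by blast+
 have si0: "si (b^2) = 0" unfolding si_def R0[symmetric] using the_inv_into_f_f[OF inj] a(1) by simp
 define gam where "gam t = cmb (si t) 0 (h (si t)) 0" for t
 have "good (R (eps/2)) gam"
  unfolding good_def prof_def
 proof (intro conjI ballI)
  show "b^2 < R (eps/2)" using mono[of 0 "eps/2"] R0 a(1) by simp
  show "gam (b^2) = p0" unfolding gam_def si0 a(4) by simp
  have cs: "continuous_on {b^2..R (eps/2)} si" using csi im continuous_on_subset by blast
  have "continuous_on {b^2..R (eps/2)} (%t. h (si t))"
   by (rule continuous_on_compose2[OF a(6) cs]) (use si(1) a(1) in force)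
  thus "continuous_on {b^2..R (eps/2)} gam" unfolding gam_def by (intro continuous_intros cs)
  fix t assume t: "t : {b^2..R (eps/2)}"
  have s: "abs (si t) < eps" "0 <= si t" "si t < eps" using si(1)[OF t] a(1) by auto
  show "gam t : A" using a(2)[OF s(1)] cyl_A unfolding gam_def by blast
  show "cd2 (gam t) = 0" "cd4 (gam t) = 0" "0 <= cd1 (gam t)" unfolding gam_def using s by auto
  show "(norm (gam t))^2 = t" using si(2)[OF t] unfolding gam_def norm_cmb R_def by simp
  show "0 <= cd3 (gam t)" unfolding gam_def using a(5)[of "si t"] s a(4) b by (cases "si t = 0") auto
  show "gam t = p0 \<or> 0 < Dq (gam t)"
  proof (cases "si t = 0")
   case False
   hence "0 < h (si t) * M1 (si t) - si t * M2 (si t)" using a(5)[of "si t"] s by simp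
   moreover have "n (cmb (si t) 0 (h (si t)) 0) = cmb (M1 (si t)) 0 (M2 (si t)) 0"
    using a(3)[OF s(1), of 0 0] by (simp add: cyl_zero)
   ultimately show ?thesis unfolding Dq_def gam_def by simp
  qed (simp add: gam_def a(4))
 qed
 thus ?thesis by blast
qed

text \<open>Near \<open>p0\<close> the points of \<open>A\<close> in the half plane are determined
  by \<open>cd1\<close>, and the squared norm is strictly increasing in it. The second property is
  for points at the very start of the meridian, where the parameter interval is one-sided.\<close>

lemma axis_unique:
 obtains dl where "dl > 0" "!!x y. x : A ==> y : A ==> dist p0 x < dl ==> dist p0 y < dl ==>
  cd2 x = 0 ==> cd4 x = 0 ==> cd2 y = 0 ==> cd4 y = 0 ==> 0 <= x \<bullet> f1 ==> 0 <= cd1 y ==> norm x = norm y ==> x = y"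
  "!!x. x : A ==> dist p0 x < dl ==> cd2 x = 0 ==> cd4 x = 0 ==> 0 <= cd1 x ==> b^2 <= (norm x)^2"
proof -
 obtain eps dl h where a: "eps > 0" "dl > 0" "h 0 = b"
  "!!x. x : A ==> dist (cmb 0 0 b 0) x < dl ==> cd2 x = 0 ==> cd4 x = 0 ==>
   abs (cd1 x) < eps & x = cmb (cd1 x) 0 (h (cd1 x)) 0"
  "!!s s'. 0 <= s ==> s < s' ==> s' < eps ==> s^2 + (h s)^2 < s'^2 + (h s')^2"
  apply (rule axis_profile)
  subgoal premises prems for eps dl h M1 M2 by (rule prems(1)[of eps dl h]) (fact prems)+
  done
 have nm: "(norm x)^2 = (cd1 x)^2 + (h (cd1 x))^2" "abs (cd1 x) < eps" "x = cmb (cd1 x) 0 (h (cd1 x)) 0"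
  if "x : A" "dist p0 x < dl" "cd2 x = 0" "cd4 x = 0" for x
  using a(4)[OF that] norm_cmb[of "cd1 x" 0 "h (cd1 x)" 0] by auto
 show thesis
 proof (rule that[OF a(2)])
  fix x y assume x: "x : A" "dist p0 x < dl" "cd2 x = 0" "cd4 x = 0" "0 <= cd1 x"
   and y: "y : A" "dist p0 y < dl" "cd2 y = 0" "cd4 y = 0" "0 <= cd1 y" and "norm x = norm y"
  hence "(cd1 x)^2 + (h (cd1 x))^2 = (cd1 y)^2 + (h (cd1 y))^2" using nm(1) by metis
  hence "cd1 x = cd1 y"
   using a(5)[of "cd1 x" "cd1 y"] a(5)[of "cd1 y" "cd1 x"] nm(2)[OF x(1-4)] nm(2)[OF y(1-4)] x(5) y(5) by fastforce
  thus "x = y" using nm(3)[OF x(1-4)] nm(3)[OF y(1-4)] by metis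
 next
  fix x assume x: "x : A" "dist p0 x < dl" "cd2 x = 0" "cd4 x = 0" "0 <= cd1 x"
  show "b^2 <= (norm x)^2"
   using nm[OF x(1-4)] a(5)[of 0 "cd1 x"] a(3) x(5) by (cases "cd1 x = 0") auto
 qed
qed

lemma local_unique:
 assumes x: "x : A" "x = cmb (cd1 x) 0 (cd3 x) 0" "x = p0 \<or> Dq x > 0" "0 <= cd1 x"
 obtains dl where "dl > 0" "!!y z. y : A ==> z : A ==> dist x y < dl ==> dist x z < dl ==>
  cd2 y = 0 ==> cd4 y = 0 ==> cd2 z = 0 ==> cd4 z = 0 ==> 0 <= y \<bullet> f1 ==> 0 <= cd1 z ==> norm y = norm z ==> y = z"
proof (cases "x = p0")
 case True
 thus thesis using axis_unique that by metis
next
 case False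
 hence D: "Dq (cmb (cd1 x) 0 (cd3 x) 0) ~= 0" using x by auto
 obtain dl c where d: "dl > 0"
  "!!y. y : A ==> dist (cmb (cd1 x) 0 (cd3 x) 0) y < dl ==> cd2 y = 0 ==> cd4 y = 0 ==> y = c ((norm y)^2)"
  by (rule profile_local[OF _ D]) (use x(1,2) in auto)
 show thesis by (rule that[OF d(1)]) (use d(2) x(2) in metis)
qed

text \<open>The set of agreement is closed by continuity, and open because near each of its points
  the norm determines the point of \<open>A\<close>; \<open>local_unique\<close> covers the start as
  well.\<close>

lemma prof_unique:
 assumes I: "connected I" "t0 : I" and g: "prof I gam" "prof I gam'" "gam t0 = gam' t0" and t: "t : I"
 shows "gam t = gam' t"
proof -
 let ?E = "{t : I. gam t = gam' t}"
 have c: "continuous_on I gam" "continuous_on I gam'" using g unfolding prof_def by auto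
 have "closedin (top_of_set I) {t : I. gam t - gam' t = 0}"
  by (intro continuous_closedin_preimage_constant continuous_on_diff c)
 hence cl: "closedin (top_of_set I) ?E" by simp
 have op: "openin (top_of_set I) ?E"
  unfolding openin_euclidean_subtopology_iff
 proof (intro conjI ballI)
  fix t assume "t : ?E"
  hence t: "t : I" "gam t = gam' t" by auto
  note p = profD[OF g(1) t(1)]
  have "gam t = p0 \<or> 0 < Dq (gam t)" using g(1) t(1) unfolding prof_def by blast
  then obtain dl where d: "dl > 0" "!!y z. y : A ==> z : A ==> dist (gam t) y < dl ==> dist (gam t) z < dl ==>
   cd2 y = 0 ==> cd4 y = 0 ==> cd2 z = 0 ==> cd4 z = 0 ==> 0 <= y \<bullet> f1 ==> 0 <= cd1 z ==> norm y = norm z ==> y = z"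
   using local_unique[OF p(1,2) _ p(4)] by metis
  obtain e1 e2 where e: "e1 > 0" "!!t'. t' : I ==> dist t' t < e1 ==> dist (gam t') (gam t) < dl"
   "e2 > 0" "!!t'. t' : I ==> dist t' t < e2 ==> dist (gam' t') (gam' t) < dl"
   using c d(1) t(1) unfolding continuous_on_iff by metis
  have "gam t' = gam' t'" if t': "t' : I" "dist t' t < min e1 e2" for t'
  proof (rule d(2))
   show "norm (gam t') = norm (gam' t')"
    using profD(3)[OF g(1) t'(1)] profD(3)[OF g(2) t'(1)] by (metis norm_ge_zero power2_eq_iff_nonneg)
  qed (use profD[OF g(1) t'(1)] profD[OF g(2) t'(1)] e t' t(2) in "auto simp: dist_commute")
  thus "EX e>0. ALL x':I. dist x' t < e --> x' : ?E" using e(1,3) by (intro exI[of _ "min e1 e2"]) auto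
 qed auto
 have "?E = I" using I g(3) cl op unfolding connected_clopen by blast
 thus ?thesis using t by blast
qed

lemma prof_local_extend:
 assumes x: "cmb xi 0 eta 0 : A" "Dq (cmb xi 0 eta 0) > 0" "xi > 0" "eta > 0"
 obtains eps c where "eps > 0" "prof {xi^2 + eta^2 - eps<..<xi^2 + eta^2 + eps} c" "c (xi^2 + eta^2) = cmb xi 0 eta 0"
  "c differentiable (at (xi^2 + eta^2))"
proof -
 let ?t = "xi^2 + eta^2"
 have D: "Dq (cmb xi 0 eta 0) ~= 0" using x by simp
 obtain eps c where c: "eps > 0" "continuous_on {?t - eps<..<?t + eps} c" "c ?t = cmb xi 0 eta 0"
  "!!t. abs (t - ?t) < eps ==> c t : A & (norm (c t))^2 = t & cd2 (c t) = 0 & cd4 (c t) = 0"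
  "c differentiable (at ?t)"
  apply (rule profile_local[OF x(1) D])
  subgoal premises prems for eps dl c by (rule prems(1)[of eps c]) (fact prems)+
  done
 let ?I = "{?t - eps<..<?t + eps}"
 have cA: "c ` ?I <= A" using c(4) by (auto simp: abs_less_iff)
 have cn: "continuous_on ?I (%t. n (c t))"
  by (rule continuous_on_compose2[OF n_continuous c(2) cA])
 have cD: "continuous_on ?I (%t. Dq (c t))" unfolding Dq_def by (intro continuous_intros cn c(2))
 have cf: "continuous_on ?I (%t. min (Dq (c t)) (min (cd1 (c t)) (cd3 (c t))))"
  by (intro continuous_intros cD c(2))
 have tI: "?t : ?I" "open ?I" using c(1) by auto
 have pos: "0 < min (Dq (c ?t)) (min (cd1 (c ?t)) (cd3 (c ?t)))" unfolding c(3) using x by simp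
 have "isCont (%t. min (Dq (c t)) (min (cd1 (c t)) (cd3 (c t)))) ?t"
  using cf tI continuous_on_eq_continuous_at by blast
 then obtain e where e: "e > 0" "!!t. dist t ?t < e ==>
   dist (min (Dq (c t)) (min (cd1 (c t)) (cd3 (c t)))) (min (Dq (c ?t)) (min (cd1 (c ?t)) (cd3 (c ?t))))
    < min (Dq (c ?t)) (min (cd1 (c ?t)) (cd3 (c ?t)))"
  using pos unfolding continuous_at_eps_delta by metis
 have p: "0 < Dq (c t) & 0 < cd1 (c t) & 0 < cd3 (c t)" if "dist t ?t < e" for t
 proof -
  have "0 < min (Dq (c t)) (min (cd1 (c t)) (cd3 (c t)))"
   using e(2)[OF that] unfolding dist_real_def by linarith
  thus ?thesis by simp
 qed
 show thesis
 proof (rule that[of "min eps e" c])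
  show "prof {?t - min eps e<..<?t + min eps e} c"
   unfolding prof_def
  proof (intro conjI ballI)
   show "continuous_on {?t - min eps e<..<?t + min eps e} c" by (rule continuous_on_subset[OF c(2)]) auto
   fix t assume "t : {?t - min eps e<..<?t + min eps e}"
   hence t: "abs (t - ?t) < eps" "dist t ?t < e" by (auto simp: dist_real_def abs_less_iff)
   show "c t : A" "(norm (c t))^2 = t" "cd2 (c t) = 0" "cd4 (c t) = 0" using c(4)[OF t(1)] by auto
   show "0 <= cd1 (c t)" "0 <= cd3 (c t)" "c t = p0 \<or> 0 < Dq (c t)" using p[OF t(2)] by auto
  qed
 qed (use c e in auto)
qed

lemma good_glue:
 assumes g: "good T gam" and c: "prof {T..T'} c" "c T = gam T" and T: "T < T'"
 shows "EX gam'. good T' gam'"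
proof -
 let ?g = "%t. if t <= T then gam t else c t"
 have bT: "b^2 < T" using g unfolding good_def by blast
 have un: "{b^2..T'} = {b^2..T} Un {T..T'}" using T bT by auto
 have "continuous_on ({b^2..T} Un {T..T'}) ?g"
  by (intro continuous_on_cases) (use g c in "auto simp: good_def prof_def")
 hence cont: "continuous_on {b^2..T'} ?g" unfolding un .
 have "prof {b^2..T'} ?g"
  unfolding prof_def
 proof (rule conjI[OF cont], rule ballI)
  fix t assume t: "t : {b^2..T'}"
  show "?g t : A & cd2 (?g t) = 0 & cd4 (?g t) = 0 & (norm (?g t))^2 = t &
   0 <= ?g t \<bullet> f1 & 0 <= cd3 (?g t) & (?g t = p0 \<or> 0 < Dq (?g t))"
  proof (cases "t <= T")
   case True
   hence "t : {b^2..T}" using t by auto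
   thus ?thesis using g True unfolding good_def prof_def by simp
  next
   case False
   hence "t : {T..T'}" using t by auto
   thus ?thesis using c(1) False unfolding prof_def by simp
  qed
 qed
 thus ?thesis using g bT T unfolding good_def by (intro exI[of _ ?g]) auto
qed

lemma good_subset: "good T gam ==> b^2 < T' ==> T' <= T ==> good T' gam"
 unfolding good_def using prof_subset[of "{b^2..T}" gam "{b^2..T'}"] by auto

lemma good_extend:
 assumes g: "good T gam"
 shows "EX T'>T. EX gam'. good T' gam'"
proof -
 have T: "T : {b^2..T}" "T ~= b^2" and pr: "prof {b^2..T} gam" using g unfolding good_def by auto
 note p = profD[OF pr T(1)]
 have xA: "cmb (cd1 (gam T)) 0 (cd3 (gam T)) 0 : A" "Dq (cmb (cd1 (gam T)) 0 (cd3 (gam T)) 0) > 0"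
  using p(1,2,6) T(2) by metis+
 obtain eps c where c: "eps > 0" "prof {T - eps<..<T + eps} c" "c T = gam T"
  using prof_local_extend[OF xA p(7)[OF T(2)] p(5), unfolded p(8)] p(2) by metis
 have "prof {T..T + eps/2} c" by (rule prof_subset[OF c(2)]) (use c(1) in auto)
 hence "EX gam'. good (T + eps/2) gam'" by (rule good_glue[OF g]) (use c in auto)
 thus ?thesis using c(1) by (intro exI[of _ "T + eps/2"]) auto
qed

text \<open>The relation \<open>xi^2 + eta^2 = t\<close> and tangency to \<open>A\<close> determine
  the velocity, and vanishing mean curvature determines the meridian curvature \<open>kap\<close>.
  As \<open>prof\<close> demands only continuity, differentiability is taken from the local curve of
  \<open>prof_local_extend\<close>, which coincides with \<open>gam\<close> near
  \<open>t0\<close>.\<close>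

lemma profile_derivs:
 assumes g: "prof I gam" and I: "open I" "t0 : I" "t0 ~= b^2"
 defines "xi \<equiv> %t. cd1 (gam t)" and "eta \<equiv> %t. cd3 (gam t)" and "N1 \<equiv> %t. cd1 (n (gam t))" and "N2 \<equiv> %t. cd3 (n (gam t))"
 defines "D \<equiv> eta t0 * N1 t0 - xi t0 * N2 t0"
 defines "kap \<equiv> - (N1 t0 / xi t0 + N2 t0 / eta t0)"
 shows "(xi has_real_derivative - N2 t0 / (2 * D)) (at t0)" "(eta has_real_derivative N1 t0 / (2 * D)) (at t0)"
  "(N1 has_real_derivative kap * (- N2 t0 / (2 * D))) (at t0)" "(N2 has_real_derivative kap * (N1 t0 / (2 * D))) (at t0)"
proof -
 note p = profD[OF g I(2)]
 have pos: "xi t0 > 0" "eta t0 > 0" "D > 0" using p(5,6,7) I(3) unfolding xi_def eta_def D_def Dq_def N1_def N2_def by auto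
 have sq: "(cd1 (gam t0))^2 + (cd3 (gam t0))^2 = t0" by (rule p(8))
 have xA: "cmb (cd1 (gam t0)) 0 (cd3 (gam t0)) 0 : A" "Dq (cmb (cd1 (gam t0)) 0 (cd3 (gam t0)) 0) > 0"
  using p(1,2,6) I(3) by metis+
 obtain eps c where c: "eps > 0" "prof {t0 - eps<..<t0 + eps} c" "c t0 = gam t0" "c differentiable (at t0)"
  using prof_local_extend[OF xA, unfolded sq] pos p(2) unfolding xi_def eta_def by metis
 obtain e where e: "e > 0" "ball t0 e <= I" using I open_contains_ball by blast
 let ?J = "ball t0 (min e eps)"
 have J: "connected ?J" "t0 : ?J" "prof ?J gam" "prof ?J c"
  using c(1) e prof_subset[OF g, of ?J] prof_subset[OF c(2), of ?J] by (auto simp: dist_real_def subset_iff abs_less_iff)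
 have eq: "c t = gam t" if "t : ?J" for t by (rule prof_unique[OF J(1,2,4,3) c(3) that])
 obtain v where cv: "(c has_vector_derivative v) (at t0)" using c(4) vector_derivative_works by blast
 have gv: "(gam has_vector_derivative v) (at t0)"
  by (rule has_vector_derivative_transform_within_open[OF cv open_ball J(2)]) (use eq in auto)
 have d: "(xi has_real_derivative cd1 v) (at t0)" "(eta has_real_derivative cd3 v) (at t0)"
  unfolding xi_def eta_def by (rule has_real_derivative_inner_left[OF gv])+
 have "((%t. xi t * xi t + eta t * eta t) has_real_derivative 2 * (xi t0 * (cd1 v) + eta t0 * (cd3 v))) (at t0)"
  by (rule derivative_eq_intros d refl)+ simp
 moreover have "((%t. xi t * xi t + eta t * eta t) has_real_derivative 1) (at t0)"
  by (rule has_field_derivative_transform_within_open[OF DERIV_ident I(1,2)])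
   (use profD(8)[OF g] in "auto simp: xi_def eta_def power2_eq_square")
 ultimately have s1: "2 * (xi t0 * (cd1 v) + eta t0 * (cd3 v)) = 1" by (rule DERIV_unique)
 have gt: "cmb (xi t) 0 (eta t) 0 = gam t" if "t : I" for t
  using profD(2)[OF g that] unfolding xi_def eta_def by simp
 have cA: "cyl (xi t) (eta t) al be : A" if "t : I" for t al be
  using gt[OF that] profD(1)[OF g that] by (simp add: cyl_A)
 have nA: "n (cyl (xi t) (eta t) al be) = cyl (N1 t) (N2 t) al be" if "t : I" for t al be
  using n_cyl[of "xi t" "eta t" al be] gt[OF that] profD(1)[OF g that] unfolding N1_def N2_def by simp
 have ne: "v \<bullet> f1 ~= 0 \<or> cd3 v ~= 0" using s1 by auto
 obtain k where k: "(N1 has_real_derivative k * (cd1 v)) (at t0)" "(N2 has_real_derivative k * (cd3 v)) (at t0)"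
  "N1 t0 * (cd1 v) + N2 t0 * (cd3 v) = 0"
  "mean_curvature A n (cyl (xi t0) (eta t0) 0 0) = - (k + N1 t0 / xi t0 + N2 t0 / eta t0)"
  using rotational_curvatures[OF mfdA[OF cA[OF I(2)]] un I(1,2) cA nA pos(1,2) d ne] by metis
 have kk: "k = kap" using k(4) minimal[OF cA[OF I(2)], of 0 0] unfolding kap_def by simp
 have "2 * D * (cd1 v) = - N2 t0" "2 * D * (cd3 v) = N1 t0" using s1 k(3) unfolding D_def by algebra+
 hence v: "cd1 v = - N2 t0 / (2 * D)" "cd3 v = N1 t0 / (2 * D)" using pos(3) by (auto simp: field_simps)
 show "(xi has_real_derivative - N2 t0 / (2 * D)) (at t0)" "(eta has_real_derivative N1 t0 / (2 * D)) (at t0)"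
  "(N1 has_real_derivative kap * (- N2 t0 / (2 * D))) (at t0)" "(N2 has_real_derivative kap * (N1 t0 / (2 * D))) (at t0)"
  using d k(1,2) unfolding v kk by auto
qed

end

text \<open>\<open>F = p |\<nabla> |x|\<^sup>2|\<close> is a multiple of the flux of \<open>\<nabla> |x|\<^sup>2\<close>, which satisfies \<open>\<Delta> |x|\<^sup>2 = 6\<close>.\<close>

lemma flux_derivative:
 fixes xi eta N1 N2 :: "real => real"
 assumes pos: "xi t > 0" "eta t > 0" "eta t * N1 t - xi t * N2 t > 0" and N: "(N1 t)^2 + (N2 t)^2 = 1"
  and D: "D = eta t * N1 t - xi t * N2 t" and k: "kap = - (N1 t / xi t + N2 t / eta t)"
  and d: "(xi has_real_derivative - N2 t / (2 * D)) (at t)" "(eta has_real_derivative N1 t / (2 * D)) (at t)"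
  "(N1 has_real_derivative kap * (- N2 t / (2 * D))) (at t)" "(N2 has_real_derivative kap * (N1 t / (2 * D))) (at t)"
 shows "((%t. 2 * xi t * eta t * (eta t * N1 t - xi t * N2 t)) has_real_derivative 3 * xi t * eta t / D) (at t)"
proof -
 define x y u v q where "x = xi t" and "y = eta t" and "u = N1 t" and "v = N2 t" and "q = 1 / (2 * D)"
 have kxy: "kap * x * y = - (u * y + v * x)" using pos unfolding k x_def y_def u_def v_def by (simp add: field_simps)
 have q: "3 * xi t * eta t / D = 6 * x * y * q" unfolding x_def y_def q_def by simp
 have d': "(xi has_real_derivative - v * q) (at t)" "(eta has_real_derivative u * q) (at t)"
  "(N1 has_real_derivative kap * (- v * q)) (at t)" "(N2 has_real_derivative kap * (u * q)) (at t)"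
  using d unfolding u_def v_def q_def by auto
 have "((%t. 2 * xi t * eta t * (eta t * N1 t - xi t * N2 t)) has_real_derivative
   (2 * (- v * q) * y + 2 * x * (u * q)) * (y * u - x * v)
   + 2 * x * y * ((u * q) * u + y * (kap * (- v * q)) - ((- v * q) * v + x * (kap * (u * q))))) (at t)"
  by (rule derivative_eq_intros d' refl)+ (simp add: x_def y_def u_def v_def algebra_simps)
 moreover have "(2 * (- v * q) * y + 2 * x * (u * q)) * (y * u - x * v)
   + 2 * x * y * ((u * q) * u + y * (kap * (- v * q)) - ((- v * q) * v + x * (kap * (u * q)))) = 6 * x * y * q"
 proof -
  have "u * u + v * v = 1" using N unfolding u_def v_def by (simp add: power2_eq_square)
  thus ?thesis using kxy by algebra
 qed
 ultimately show ?thesis unfolding q by simp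
qed

section \<open>The meridian never stops and sweeps out \<open>A\<close>\<close>

context normalised_minimal begin

definition Tset :: "real set" where "Tset = insert (b^2) {T. EX gam. good T gam}"

text \<open>Any two good arcs agree at common parameters, so the choices made for different
  \<open>t\<close> fit together; this is \<open>Gam_eq\<close>.\<close>

definition Gam :: "real => real^4" where
 "Gam t = (if t = b^2 then p0 else (SOME gam. good t gam) t)"

lemma Gam_eq:
 assumes g: "good T gam" and t: "b^2 <= t" "t <= T"
 shows "Gam t = gam t"
proof (cases "t = b^2")
 case True
 thus ?thesis using g unfolding Gam_def good_def by simp
next
 case False
 hence g': "good t gam" using good_subset[OF g] t by simp
 hence s: "good t (SOME gam. good t gam)" by (rule someI[of "good t"])
 have "(SOME gam. good t gam) t = gam t"
  by (rule prof_unique[of "{b^2..t}" "b^2"]) (use s g' t in "auto simp: good_def")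
 thus ?thesis using False unfolding Gam_def by simp
qed

lemma Tset_ge: "t : Tset ==> b^2 <= t"
 unfolding Tset_def good_def by auto

lemma Tset_good:
 assumes "t : Tset"
 obtains T gam where "t < T" "good T gam"
 using assms good_exists good_extend unfolding Tset_def good_def by blast

lemma Tset_down: "T : Tset ==> b^2 <= t ==> t <= T ==> t : Tset"
proof (cases "t = b^2")
 case False
 assume T: "T : Tset" and t: "b^2 <= t" "t <= T"
 then obtain gam where "good T gam" using False unfolding Tset_def by auto
 hence "good t gam" by (rule good_subset) (use t False in auto)
 thus ?thesis unfolding Tset_def by blast
qed (simp add: Tset_def)

lemma good_prof_Gam:
 assumes g: "good T gam"
 shows "prof {b^2..T} Gam"
proof -
 have "continuous_on {b^2..T} Gam \<longleftrightarrow> continuous_on {b^2..T} gam"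
  using Gam_eq[OF g] by (intro continuous_on_cong) auto
 thus ?thesis using g Gam_eq[OF g] unfolding good_def prof_def by simp
qed

definition P1 :: "real^4 => real" where "P1 x = sqrt ((cd1 x)^2 + (cd2 x)^2)"
definition P3 :: "real^4 => real" where "P3 x = sqrt ((cd3 x)^2 + (cd4 x)^2)"
text \<open>The representative of the rotation orbit of \<open>x\<close> in the closed quarter
  plane; its continuity transfers convergence on \<open>A\<close> to convergence along the
  meridian.\<close>

definition pr :: "real^4 => real^4" where "pr x = cmb (P1 x) 0 (P3 x) 0"

lemma pr_cyl: "xi >= 0 ==> eta >= 0 ==> pr (cyl xi eta al be) = cmb xi 0 eta 0"
proof -
 assume a: "xi >= 0" "eta >= 0"
 have "(xi * cos al)^2 + (xi * sin al)^2 = xi^2" "(eta * cos be)^2 + (eta * sin be)^2 = eta^2"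
  using sin_cos_squared_add[of al] sin_cos_squared_add[of be] by algebra+
 thus ?thesis using a unfolding pr_def P1_def P3_def cyl_def by simp
qed

lemma pr_polar: obtains al be where "x = cyl (cd1 (pr x)) (cd3 (pr x)) al be" "- pi < al" "al <= pi" "- pi < be" "be <= pi"
 by (rule cyl_cases[of x]) (use pr_cyl in auto)

lemma pr_A: "pr x : A \<longleftrightarrow> x : A"
proof -
 obtain al be where "x = cyl (cd1 (pr x)) (cd3 (pr x)) al be" by (rule pr_polar)
 hence "x : A \<longleftrightarrow> cmb (cd1 (pr x)) 0 (cd3 (pr x)) 0 : A" using cyl_A by metis
 thus ?thesis unfolding pr_def by simp
qed

lemma pr_facts: "norm (pr x) = norm x" "cd2 (pr x) = 0" "cd4 (pr x) = 0" "0 <= cd1 (pr x)" "0 <= cd3 (pr x)"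
 "pr x = cmb (cd1 (pr x)) 0 (cd3 (pr x)) 0"
proof -
 obtain a b c d where x: "x = cmb a b c d" by (rule cmb_cases)
 have "(norm (pr x))^2 = (norm x)^2"
  unfolding pr_def norm_cmb P1_def P3_def x norm_cmb[of a b c d] by simp
 thus "norm (pr x) = norm x" by simp
qed (auto simp: pr_def P1_def P3_def)

lemma continuous_pr: "continuous_on UNIV pr"
 unfolding pr_def P1_def P3_def by (intro continuous_intros)

text \<open>The part of \<open>A\<close> reached from the circular orbit. Being nonempty, open and
  closed in the connected set \<open>A\<close>, it will be all of \<open>A\<close>.\<close>

definition Z :: "(real^4) set" where "Z = {x : A. (norm x)^2 : Tset & pr x = Gam ((norm x)^2)}"

lemma openin_Z: "openin (top_of_set A) Z"
 unfolding openin_euclidean_subtopology_iff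
proof (intro conjI ballI)
 fix x assume x: "x : Z"
 let ?t = "(norm x)^2"
 have xA: "x : A" and px: "pr x = Gam ?t" and tT: "?t : Tset" using x unfolding Z_def by auto
 obtain T gam where T: "?t < T" "good T gam" using Tset_good[OF tT] .
 have pG: "prof {b^2..T} Gam" by (rule good_prof_Gam[OF T(2)])
 have tI: "?t : {b^2..T}" using Tset_ge[OF tT] T(1) by simp
 note p = profD[OF pG tI]
 have "Gam ?t = p0 \<or> 0 < Dq (Gam ?t)" using pG tI unfolding prof_def by blast
 then obtain dl where d: "dl > 0" "!!y z. y : A ==> z : A ==> dist (Gam ?t) y < dl ==> dist (Gam ?t) z < dl ==>
   cd2 y = 0 ==> cd4 y = 0 ==> cd2 z = 0 ==> cd4 z = 0 ==> 0 <= y \<bullet> f1 ==> 0 <= cd1 z ==> norm y = norm z ==> y = z"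
  using local_unique[OF p(1,2) _ p(4)] by metis
 obtain dl' where d': "dl' > 0" "!!x. x : A ==> dist p0 x < dl' ==> cd2 x = 0 ==> cd4 x = 0 ==> 0 <= cd1 x ==> b^2 <= (norm x)^2"
  by (rule axis_unique) blast
 have cG: "continuous_on {b^2..T} Gam" using pG unfolding prof_def by blast
 obtain e1 where e1: "e1 > 0" "!!s. s : {b^2..T} ==> dist s ?t < e1 ==> dist (Gam s) (Gam ?t) < dl"
  using cG tI d(1) unfolding continuous_on_iff by metis
 have cn: "isCont (%y::real^4. (norm y)^2) x" by (intro continuous_intros)
 have cp: "isCont pr x" using continuous_pr continuous_on_eq_continuous_at[of UNIV] by auto
 \<comment> \<open>Room for the parameter around \<open>?t\<close>: two-sided in general, but only
   upwards at \<open>?t = b^2\<close>, where \<open>d'\<close> supplies the lower bound.\<close>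
 define m where "m = (if ?t = b^2 then T - ?t else min (T - ?t) (?t - b^2))"
 have m: "m > 0" using T(1) tI unfolding m_def by auto
 have "min m e1 > 0" "min dl dl' > 0" using m e1(1) d(1) d'(1) by auto
 then obtain e2 e3 where e2: "e2 > 0" "!!y. dist y x < e2 ==> dist ((norm y)^2) ?t < min m e1"
  and e3: "e3 > 0" "!!y. dist y x < e3 ==> dist (pr y) (pr x) < min dl dl'"
  using cn cp unfolding continuous_at_eps_delta by metis
 show "EX e>0. ALL y:A. dist y x < e --> y : Z"
 proof (intro exI[of _ "min e2 e3"] conjI ballI impI)
  fix y assume y: "y : A" "dist y x < min e2 e3"
  let ?s = "(norm y)^2"
  have s1: "dist ?s ?t < m" "dist ?s ?t < e1" using e2(2)[of y] y(2) by auto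
  have s2: "dist (pr y) (pr x) < dl" "dist (pr y) (pr x) < dl'" using e3(2)[of y] y(2) by auto
  have "b^2 <= ?s"
  proof (cases "?t = b^2")
   case True
   hence "pr x = p0" using px unfolding Gam_def by simp
   hence "b^2 <= (norm (pr y))^2"
    using s2(2) y(1) pr_A pr_facts by (intro d'(2)) (auto simp: dist_commute)
   thus ?thesis using pr_facts by simp
  next
   case False
   thus ?thesis using s1(1) unfolding m_def dist_real_def by auto
  qed
  moreover have "?s <= T" using s1(1) unfolding m_def dist_real_def by (auto split: if_splits)
  ultimately have sI: "?s : {b^2..T}" by simp
  note q = profD[OF pG sI]
  have "pr y = Gam ?s"
  proof (rule d(2))
   show "norm (pr y) = norm (Gam ?s)" using q(3) pr_facts(1) by (metis norm_ge_zero power2_eq_iff_nonneg)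
  qed (use y(1) pr_A pr_facts q s2(1) px e1(2)[OF sI s1(2)] in "auto simp: dist_commute")
  moreover have "?s : Tset" using sI T(2) Tset_down[of T ?s] unfolding Tset_def by auto
  ultimately show "y : Z" using y(1) unfolding Z_def by blast
 qed (use e2 e3 in auto)
qed (auto simp: Z_def)

text \<open>The quantity \<open>F\<close> as a function of points instead of \<open>t\<close>; in
  this form it is continuous on \<open>A\<close> and passes to limit points not yet known to lie on
  the continued meridian.\<close>

definition flux :: "real^4 => real" where "flux x = 2 * (cd1 x) * (cd3 x) * Dq x"

lemma continuous_Dq: "continuous_on A Dq"
 unfolding Dq_def by (intro continuous_intros n_continuous)

lemma flux_mono:
 assumes pG: "prof {b^2..T} Gam" and t: "b^2 < t1" "t1 <= t2" "t2 <= T"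
 shows "flux (Gam t1) <= flux (Gam t2)"
proof (rule DERIV_nonneg_imp_increasing_open[OF t(2)])
 fix t assume tt: "t1 < t" "t < t2"
 have pI: "prof {b^2<..<T} Gam" by (rule prof_subset[OF pG]) auto
 have I: "open {b^2<..<T}" "t : {b^2<..<T}" "t ~= b^2" using t tt by auto
 note p = profD[OF pI I(2)]
 note d = profile_derivs[OF pI I]
 have N: "(cd1 (n (Gam t)))^2 + (cd3 (n (Gam t)))^2 = 1"
 proof -
  have "n (Gam t) = cmb (cd1 (n (Gam t))) 0 (cd3 (n (Gam t))) 0" using n_profile p(1,2) by metis
  hence "(norm (n (Gam t)))^2 = (cd1 (n (Gam t)))^2 + (cd3 (n (Gam t)))^2" using norm_cmb[of "cd1 (n (Gam t))" 0 "cd3 (n (Gam t))" 0] by simp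
  thus ?thesis using normal_facts(2)[OF p(1)] by simp
 qed
 have D: "(cd3 (Gam t)) * (cd1 (n (Gam t))) - (cd1 (Gam t)) * (cd3 (n (Gam t))) > 0"
  using p(6)[OF I(3)] unfolding Dq_def .
 note fd = flux_derivative[OF p(7)[OF I(3)] p(5) D N refl refl d]
 have "((%t. flux (Gam t)) has_real_derivative 3 * (cd1 (Gam t)) * (cd3 (Gam t)) / Dq (Gam t)) (at t)"
  using fd unfolding flux_def Dq_def .
 moreover have "0 <= 3 * (cd1 (Gam t)) * (cd3 (Gam t)) / Dq (Gam t)"
  using p(4,5) p(6)[OF I(3)] by (intro divide_nonneg_pos mult_nonneg_nonneg) auto
 ultimately show "EX y. ((%t. flux (Gam t)) has_real_derivative y) (at t) & 0 <= y" by blast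
next
 have c: "continuous_on {t1..t2} Gam" using pG t unfolding prof_def by (auto intro: continuous_on_subset)
 have "Gam ` {t1..t2} <= A" using profD(1)[OF pG] t by auto
 hence "continuous_on {t1..t2} (%t. Dq (Gam t))" using continuous_on_compose2[OF continuous_Dq c] by blast
 thus "continuous_on {t1..t2} (%t. flux (Gam t))" unfolding flux_def by (intro continuous_intros c)
qed

text \<open>The only danger is a limit point at a finite end of \<open>Tset\<close>. Along the
  approach the flux is nondecreasing and positive, so it is positive at the limit; hence
  \<open>xi\<close>, \<open>eta\<close> and \<open>Dq\<close> are positive there and the meridian
  can be continued past it, a contradiction.\<close>

lemma closedin_Z: "closedin (top_of_set A) Z"
 unfolding closedin_limpt
proof (intro conjI allI impI)
 show "Z <= A" unfolding Z_def by blast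
 fix x assume x: "x islimpt Z & x : A"
 then obtain f where f: "!!n. f n : Z" "f \<longlonglongrightarrow> x" unfolding islimpt_sequential by blast
 let ?t = "(norm x)^2" and ?s = "%n. (norm (f n))^2"
 have fZ: "f n : A" "?s n : Tset" "pr (f n) = Gam (?s n)" for n using f(1) unfolding Z_def by auto
 have st: "?s \<longlonglongrightarrow> ?t" by (intro tendsto_intros f(2))
 have pl: "(%n. pr (f n)) \<longlonglongrightarrow> pr x"
  using continuous_pr f(2) by (intro continuous_on_tendsto_compose[where f=pr and s=UNIV]) auto
 have tb: "b^2 <= ?t" using LIMSEQ_le_const[OF st] Tset_ge[OF fZ(2)] by blast
 have xA: "pr x : A" using x pr_A by blast
 have tT: "?t : Tset"
 proof (rule ccontr)
  assume nT: "?t ~: Tset"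
  have lt: "?s n < ?t" for n
   using nT Tset_down[OF fZ(2) tb, of n] by (meson not_le)
  have bt: "b^2 < ?t" using tb nT unfolding Tset_def by (cases "b^2 = ?t") auto
  have "\<forall>\<^sub>F n in sequentially. b^2 < ?s n" using order_tendstoD(1)[OF st bt] .
  then obtain N where N: "b^2 < ?s N" using eventually_happens' sequentially_bot by blast
  have ev: "\<forall>\<^sub>F n in sequentially. ?s N < ?s n" using order_tendstoD(1)[OF st lt] .
  have fl: "flux (Gam (?s N)) <= flux (Gam (?s n))" if "?s N < ?s n" for n
  proof -
   obtain T gam where T: "?s n < T" "good T gam" using Tset_good[OF fZ(2)] .
   show ?thesis by (rule flux_mono[OF good_prof_Gam[OF T(2)] N less_imp_le[OF that] less_imp_le[OF T(1)]])
  qed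
  have pos: "0 < flux (Gam (?s N))"
  proof -
   obtain T gam where T: "?s N < T" "good T gam" using Tset_good[OF fZ(2)] .
   have "?s N : {b^2..T}" "?s N ~= b^2" using N T(1) by auto
   thus ?thesis using profD(5,6,7)[OF good_prof_Gam[OF T(2)], of "?s N"] unfolding flux_def by simp
  qed
  have cfl: "continuous_on A flux" unfolding flux_def by (intro continuous_intros continuous_Dq)
  have "(%n. flux (pr (f n))) \<longlonglongrightarrow> flux (pr x)"
   by (rule continuous_on_tendsto_compose[OF cfl pl xA]) (use fZ(1) pr_A in auto)
  hence "(%n. flux (Gam (?s n))) \<longlonglongrightarrow> flux (pr x)" unfolding fZ(3) .
  hence "flux (Gam (?s N)) <= flux (pr x)"
   by (rule tendsto_lowerbound) (use ev fl in "auto elim!: eventually_mono")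
  hence fx: "0 < flux (pr x)" using pos by simp
  have nz: "cd1 (pr x) ~= 0" "cd3 (pr x) ~= 0" using fx unfolding flux_def by auto
  hence xp: "0 < cd1 (pr x)" "0 < cd3 (pr x)" using pr_facts(4,5)[of x] by linarith+
  hence "0 < 2 * (cd1 (pr x)) * (cd3 (pr x))" by simp
  hence Dx: "0 < Dq (pr x)" using zero_less_mult_pos[OF fx[unfolded flux_def]] by blast
  have e: "cmb (cd1 (pr x)) 0 (cd3 (pr x)) 0 = pr x" using pr_facts(6)[of x] by simp
  have tx: "(cd1 (pr x))^2 + (cd3 (pr x))^2 = ?t"
   using norm_cmb[of "cd1 (pr x)" 0 "cd3 (pr x)" 0] e pr_facts(1)[of x] by simp
  obtain eps c where c: "eps > 0" "prof {?t - eps<..<?t + eps} c" "c ?t = pr x"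
   using prof_local_extend[of "cd1 (pr x)" "cd3 (pr x)", unfolded e tx] xA Dx xp by metis
  obtain dl where d: "dl > 0" "!!y z. y : A ==> z : A ==> dist (pr x) y < dl ==> dist (pr x) z < dl ==>
   cd2 y = 0 ==> cd4 y = 0 ==> cd2 z = 0 ==> cd4 z = 0 ==> 0 <= y \<bullet> f1 ==> 0 <= cd1 z ==> norm y = norm z ==> y = z"
   using local_unique[OF xA pr_facts(6) _ pr_facts(4)] Dx by metis
  have "continuous_on {?t - eps<..<?t + eps} c" using c(2) unfolding prof_def by blast
  hence "isCont c ?t" using c(1) continuous_on_eq_continuous_at[of "{?t - eps<..<?t + eps}" c] by auto
  then obtain e' where e': "e' > 0" "!!s. dist s ?t < e' ==> dist (c s) (pr x) < dl"
   using d(1) c(3) unfolding continuous_at_eps_delta by metis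
  have "\<forall>\<^sub>F n in sequentially. dist (?s n) ?t < min e' eps" by (rule tendstoD[OF st]) (use e'(1) c(1) in simp)
  moreover have "\<forall>\<^sub>F n in sequentially. dist (pr (f n)) (pr x) < dl" using tendstoD[OF pl d(1)] .
  ultimately have "\<forall>\<^sub>F n in sequentially. dist (?s n) ?t < min e' eps & dist (pr (f n)) (pr x) < dl & ?s N < ?s n"
   using ev by eventually_elim auto
  then obtain M where M: "dist (?s M) ?t < min e' eps" "dist (pr (f M)) (pr x) < dl" "?s N < ?s M"
   using eventually_happens' sequentially_bot by blast
  have sI: "?s M : {?t - eps<..<?t + eps}" using M(1) by (auto simp: dist_real_def abs_less_iff)
  note q = profD[OF c(2) sI]
  have cM: "c (?s M) = pr (f M)"
  proof (rule d(2))
   show "norm (c (?s M)) = norm (pr (f M))" using q(3) pr_facts(1) by (metis norm_ge_zero power2_eq_iff_nonneg)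
  qed (use q fZ(1) pr_A pr_facts M e'(2)[of "?s M"] in "auto simp: dist_commute")
  \<comment> \<open>The local arc \<open>c\<close> through the limit point agrees with the meridian
    at the parameter of \<open>f M\<close>, so gluing the two there reaches
    \<open>?t\<close>.\<close>
  obtain gam where g: "good (?s M) gam" using fZ(2)[of M] N M(3) unfolding Tset_def by auto
  have "c (?s M) = gam (?s M)" using cM fZ(3)[of M] Gam_eq[OF g, of "?s M"] Tset_ge[OF fZ(2)] by simp
  moreover have "prof {?s M..?t} c" by (rule prof_subset[OF c(2)]) (use sI c(1) in auto)
  ultimately have "EX gam'. good ?t gam'" using good_glue[OF g] lt by blast
  thus False using nT unfolding Tset_def by blast
 qed
 obtain T gam where T: "?t < T" "good T gam" using Tset_good[OF tT] .
 have cG: "continuous_on {b^2..T} Gam" using good_prof_Gam[OF T(2)] unfolding prof_def by blast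
 have "(%n. Gam (?s n)) \<longlonglongrightarrow> Gam ?t"
 proof (rule continuous_on_tendsto_compose[OF cG st])
  show "?t : {b^2..T}" using tb T(1) by simp
  have "\<forall>\<^sub>F n in sequentially. ?s n < T" using order_tendstoD(2)[OF st T(1)] .
  thus "\<forall>\<^sub>F n in sequentially. ?s n : {b^2..T}" using Tset_ge[OF fZ(2)] by (auto elim!: eventually_mono)
 qed
 hence "pr x = Gam ?t" using pl LIMSEQ_unique unfolding fZ(3) by blast
 thus "x : Z" using x tT unfolding Z_def by blast
qed

lemma A_eq_Z: "Z = A"
proof -
 have "p0 : Z"
  using base norm_p0 pr_cyl[of 0 b 0 0] b unfolding Z_def Tset_def Gam_def by (simp add: cyl_zero)
 thus ?thesis using conn openin_Z closedin_Z unfolding connected_clopen by blast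
qed

text \<open>Every point of \<open>A\<close> lies in \<open>Z\<close>, so its squared norm is in
  \<open>Tset\<close>, and \<open>A\<close> is unbounded.\<close>

lemma Tset_all: "Tset = {b^2..}"
proof
 show "{b^2..} <= Tset"
 proof
  fix t assume t: "t : {b^2..}"
  hence t0: "0 <= t" by (meson atLeast_iff order_trans zero_le_power2)
  obtain x where x: "x : A" "sqrt t <= norm x" using unbounded by blast
  hence "t <= (norm x)^2" using t0 by (metis real_le_rsqrt real_sqrt_le_iff real_sqrt_unique norm_ge_zero)
  moreover have "(norm x)^2 : Tset" using x(1) A_eq_Z unfolding Z_def by blast
  ultimately show "t : Tset" using Tset_down t by auto
 qed
qed (use Tset_ge in auto)

lemma prof_Gam: "prof {b^2..} Gam"
proof -
 have p: "EX T>t. prof {b^2..T} Gam" if "t >= b^2" for t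
  using Tset_good[of t] good_prof_Gam that unfolding Tset_all by (metis atLeast_iff)
 have "continuous_on {b^2..} Gam"
  unfolding continuous_on_eq_continuous_within
 proof
  fix t assume t: "t : {b^2..}"
  then obtain T where T: "t < T" "prof {b^2..T} Gam" using p by auto
  have "at t within {b^2..} = at t within {b^2..T}"
   by (rule at_within_nhd[of _ "{..<T}"]) (use T in auto)
  thus "continuous (at t within {b^2..}) Gam"
   using T t unfolding prof_def continuous_on_eq_continuous_within by auto
 qed
 thus ?thesis using p unfolding prof_def by (metis atLeastAtMost_iff atLeast_iff less_imp_le)
qed

end

text \<open>The interface between geometry and analysis. At \<open>t = b^2\<close> the differential
  equations divide by zero; \<open>start_lim\<close> and \<open>axis_curve\<close> stand in for them
  there.\<close>

locale rotational_profile = plane_frame +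
 fixes A :: "(real^4) set" and n :: "real^4 => real^4" and b :: real and xi eta N1 N2 :: "real => real"
 assumes embA: "embedded_submanifold TYPE(3) A" and unitA: "unit_normal A n" and b_pos: "b > 0"
  and A_eq: "A = {cyl (xi t) (eta t) al be | t al be. b^2 <= t}"
  and n_eq: "!!t al be. b^2 <= t ==> n (cyl (xi t) (eta t) al be) = cyl (N1 t) (N2 t) al be"
  and start: "xi (b^2) = 0" "eta (b^2) = b" "N1 (b^2) = 0" "N2 (b^2) = -1"
  and xi_pos: "!!t. b^2 < t ==> 0 < xi t" and eta_pos: "!!t. b^2 <= t ==> 0 < eta t"
  and radius: "!!t. b^2 <= t ==> (xi t)^2 + (eta t)^2 = t"
  and N_unit: "!!t. b^2 <= t ==> (N1 t)^2 + (N2 t)^2 = 1"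
  and D_pos: "!!t. b^2 < t ==> 0 < eta t * N1 t - xi t * N2 t"
  and profile_cont: "continuous_on {b^2..} xi" "continuous_on {b^2..} eta" "continuous_on {b^2..} N1" "continuous_on {b^2..} N2"
  and profile_deriv: "!!t. b^2 < t ==> (xi has_real_derivative - N2 t / (2 * (eta t * N1 t - xi t * N2 t))) (at t)"
   "!!t. b^2 < t ==> (eta has_real_derivative N1 t / (2 * (eta t * N1 t - xi t * N2 t))) (at t)"
   "!!t. b^2 < t ==> (N1 has_real_derivative
     - (N1 t / xi t + N2 t / eta t) * (- N2 t / (2 * (eta t * N1 t - xi t * N2 t)))) (at t)"
   "!!t. b^2 < t ==> (N2 has_real_derivative
     - (N1 t / xi t + N2 t / eta t) * (N1 t / (2 * (eta t * N1 t - xi t * N2 t)))) (at t)"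
  and start_lim: "((%t. N1 t / xi t) \<longlongrightarrow> 1 / (2 * b)) (at_right (b^2))"
  and axis_curve: "EX eps h M1 M2. eps > 0 & (ALL s al be. abs s < eps --> cyl s (h s) al be : A & n (cyl s (h s) al be) = cyl (M1 s) (M2 s) al be) &
   h 0 = b & (h has_real_derivative 0) (at 0) & M1 0 = 0 & M2 0 = -1 &
   (M1 has_real_derivative 1 / (2 * b)) (at 0) & (M2 has_real_derivative 0) (at 0)"

context normalised_minimal begin

lemma rotational_profile_Gam:
 "rotational_profile f1 f2 f3 f4 A n b (%t. cd1 (Gam t)) (%t. cd3 (Gam t)) (%t. cd1 (n (Gam t))) (%t. cd3 (n (Gam t)))"
proof -
 have G0: "Gam (b^2) = p0" unfolding Gam_def by simp
 note p = profD[OF prof_Gam, simplified]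
 have GA: "cyl (cd1 (Gam t)) (cd3 (Gam t)) al be : A" if "b^2 <= t" for t al be
  using p(1,2)[OF that] cyl_A by metis
 have Gn: "n (cyl (cd1 (Gam t)) (cd3 (Gam t)) al be) = cyl (cd1 (n (Gam t))) (cd3 (n (Gam t))) al be" if "b^2 <= t" for t al be
  using n_cyl p(1,2)[OF that] by metis
 have cG: "continuous_on {b^2..} Gam" using prof_Gam unfolding prof_def by blast
 have cn: "continuous_on {b^2..} (%t. n (Gam t))"
  by (rule continuous_on_compose2[OF n_continuous cG]) (use p(1) in auto)
 obtain eps dl h M1 M2 where a: "eps > 0" "dl > 0"
  "!!s al be. abs s < eps ==> cyl s (h s) al be : A"
  "!!s al be. abs s < eps ==> n (cyl s (h s) al be) = cyl (M1 s) (M2 s) al be"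
  "h 0 = b" "(h has_real_derivative 0) (at 0)" "M1 0 = 0" "M2 0 = -1"
  "(M1 has_real_derivative 1 / (2 * b)) (at 0)" "(M2 has_real_derivative 0) (at 0)"
  "!!x. x : A ==> dist p0 x < dl ==> cd2 x = 0 ==> cd4 x = 0 ==>
   abs (cd1 x) < eps & x = cmb (cd1 x) 0 (h (cd1 x)) 0"
  apply (rule axis_profile)
  subgoal premises prems for eps dl h M1 M2 by (rule prems(1)[of eps dl h M1 M2]) (fact prems)+
  done
 have Glim: "(Gam \<longlongrightarrow> p0) (at_right (b^2))"
  using cG G0 unfolding continuous_on_def by (metis atLeast_iff at_within_Ici_at_right order_refl)
 \<comment> \<open>The quotient is the difference quotient of \<open>M1\<close> at 0, evaluated at
   \<open>cd1 (Gam t)\<close>, which tends to 0 without vanishing.\<close>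
 have lim: "((%t. (cd1 (n (Gam t))) / (cd1 (Gam t))) \<longlongrightarrow> 1 / (2 * b)) (at_right (b^2))"
 proof -
  have "((%s. (M1 s - M1 0) / (s - 0)) \<longlongrightarrow> 1 / (2 * b)) (at 0)"
   using a(9) unfolding has_field_derivative_iff .
  hence l: "((%s. M1 s / s) \<longlongrightarrow> 1 / (2 * b)) (at 0)" using a(7) by simp
  have "((%t. Gam t \<bullet> f1) \<longlongrightarrow> cd1 p0) (at_right (b^2))" by (intro tendsto_intros Glim)
  moreover have "\<forall>\<^sub>F t in at_right (b^2). cd1 (Gam t) ~= 0"
   using p(7) by (auto simp: eventually_at_right_field intro!: exI[of _ "b^2 + 1"] less_imp_le) (metis less_irrefl less_imp_le)
  ultimately have f: "filterlim (%t. cd1 (Gam t)) (at 0) (at_right (b^2))"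
   by (simp add: filterlim_at)
  have "((%t. M1 (cd1 (Gam t)) / (cd1 (Gam t))) \<longlongrightarrow> 1 / (2 * b)) (at_right (b^2))"
   using filterlim_compose[OF l f] .
  moreover have "\<forall>\<^sub>F t in at_right (b^2). M1 (cd1 (Gam t)) / (cd1 (Gam t)) = (cd1 (n (Gam t))) / (cd1 (Gam t))"
  proof -
   have "\<forall>\<^sub>F t in at_right (b^2). dist (Gam t) p0 < dl" using tendstoD[OF Glim a(2)] .
   moreover have "\<forall>\<^sub>F t in at_right (b^2). b^2 < t" by (simp add: eventually_at_right_less)
   ultimately show ?thesis
   proof eventually_elim
    case (elim t)
    hence x: "abs (cd1 (Gam t)) < eps" "Gam t = cmb (cd1 (Gam t)) 0 (h (cd1 (Gam t))) 0"
     using a(11)[of "Gam t"] p(1,9,10)[of t] by (auto simp: dist_commute)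
    have "n (Gam t) = cmb (M1 (cd1 (Gam t))) 0 (M2 (cd1 (Gam t))) 0"
     using a(4)[OF x(1), of 0 0] x(2) by (simp add: cyl_zero)
    thus ?case by simp
   qed
  qed
  ultimately show ?thesis by (rule Lim_transform_eventually)
 qed
 have sub: "A <= {cyl (cd1 (Gam t)) (cd3 (Gam t)) al be | t al be. b^2 <= t}"
 proof
  fix x assume x: "x : A"
  hence "(norm x)^2 : Tset" "pr x = Gam ((norm x)^2)" using A_eq_Z unfolding Z_def by auto
  moreover obtain al be where "x = cyl (cd1 (pr x)) (cd3 (pr x)) al be" by (rule pr_polar)
  ultimately show "x : {cyl (cd1 (Gam t)) (cd3 (Gam t)) al be | t al be. b^2 <= t}" using Tset_all by auto
 qed
 have nn: "(cd1 (n (Gam t)))^2 + (cd3 (n (Gam t)))^2 = 1" if "b^2 <= t" for t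
  using normal_facts(2)[OF GA[OF that, of 0 0]] Gn[OF that, of 0 0] cyl_norm[of "cd1 (n (Gam t))" "cd3 (n (Gam t))" 0 0] by simp
 have D: "0 < (cd3 (Gam t)) * (cd1 (n (Gam t))) - (cd1 (Gam t)) * (cd3 (n (Gam t)))" if "b^2 < t" for t
  using p(6)[of t] that unfolding Dq_def by simp
 have pI: "prof {b^2<..} Gam" by (rule prof_subset[OF prof_Gam]) auto
 show ?thesis
 proof (unfold_locales, goal_cases)
  case 1 thus ?case by (rule emb)
 next
  case 2 thus ?case by (rule un)
 next
  case 3 thus ?case by (rule b)
 next
  case 4 thus ?case using sub GA by blast
 next
  case (5 t al be) thus ?case by (rule Gn)
 next
  case 23
  thus ?case by (rule lim)
 next
  case 24
  show ?case
   by (rule exI[of _ eps], rule exI[of _ h], rule exI[of _ M1], rule exI[of _ M2]) (use a in auto)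
 qed (use G0 n_base' p(5,7,8) nn D cG cn profile_derivs[OF pI] in "auto intro!: continuous_intros")
qed

end

section \<open>A singular Sturm--Liouville problem\<close>

text \<open>The equation in view is \<open>(F u')' + m * (W + lam) * u = 0\<close>. Since
  \<open>F\<close> vanishes at \<open>R0\<close> and has derivative \<open>6 * m\<close>, the
  equation is singular there like a radial Laplacian, and regularity at \<open>R0\<close> takes the
  place of an initial slope.\<close>

locale sturm_data =
 fixes R0 L :: real and F m W :: "real => real"
 assumes RL: "R0 < L" and mc: "continuous_on {R0..L} m" and mpos: "!!t. t : {R0..L} ==> 0 < m t"
  and Fc: "continuous_on {R0..L} F" and F0: "F R0 = 0"
  and Fd: "!!t. R0 < t ==> t < L ==> (F has_real_derivative 6 * m t) (at t)"
  and Wc: "continuous_on {R0..L} W"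
begin

lemma F_integral:
 assumes "t : {R0..L}"
 shows "((%s. 6 * m s) has_integral F t) {R0..t}"
proof -
 have "((%s. 6 * m s) has_integral F t - F R0) {R0..t}"
 proof (rule fundamental_theorem_of_calculus_interior)
  show "continuous_on {R0..t} F" by (rule continuous_on_subset[OF Fc]) (use assms in auto)
  fix x assume "x : {R0<..<t}"
  thus "(F has_vector_derivative 6 * m x) (at x)"
   using Fd[of x] assms by (simp add: has_real_derivative_iff_has_vector_derivative)
 qed (use assms in auto)
 thus ?thesis using F0 by simp
qed

lemma F_increasing: "R0 <= s ==> s < t ==> t <= L ==> F s < F t"
proof -
 assume a: "R0 <= s" "s < t" "t <= L"
 show ?thesis
 proof (rule DERIV_pos_imp_increasing_open[OF a(2)])
 show "continuous_on {s..t} F" by (rule continuous_on_subset[OF Fc]) (use a in auto)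
 fix x assume x: "s < x" "x < t"
 have "(F has_real_derivative 6 * m x) (at x)" "0 < 6 * m x" using Fd[of x] mpos[of x] a x by auto
 thus "EX y. (F has_real_derivative y) (at x) & 0 < y" by blast
 qed
qed

lemma F_pos: "R0 < t ==> t <= L ==> 0 < F t"
 using F_increasing[of R0 t] F0 by simp

text \<open>The average \<open>F^-1 \<integral> m f\<close>, extended to \<open>R0\<close> by its
  limit: near \<open>R0\<close> the integral behaves like \<open>m f (t - R0)\<close> and
  \<open>F\<close> like \<open>6 m (t - R0)\<close>.\<close>

definition Av :: "(real => real) => real => real" where
 "Av f t = (if t <= R0 then f R0 / 6 else integral {R0..t} (%s. m s * f s) / F t)"

lemma m_integrable:
 assumes "continuous_on {R0..L} f" "t : {R0..L}"
 shows "(%s. m s * f s) integrable_on {R0..t}"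
 by (intro integrable_continuous_interval continuous_intros; rule continuous_on_subset[OF mc] continuous_on_subset[OF assms(1)])
   (use assms in auto)

lemma F_Av:
 assumes "t : {R0..L}"
 shows "F t * Av f t = integral {R0..t} (%s. m s * f s)"
 using assms F_pos[of t] F0 unfolding Av_def by (cases "t = R0") auto

lemma m_integral_bound:
 assumes f: "continuous_on {R0..L} f" and t: "t : {R0..L}" and B: "!!s. s : {R0..t} ==> abs (f s) <= B"
 shows "abs (integral {R0..t} (%s. m s * f s)) <= B * F t / 6"
proof -
 have i: "((%s. 6 * m s * (B / 6)) has_integral F t * (B / 6)) {R0..t}"
  by (rule has_integral_mult_left[OF F_integral[OF t]])
 have "norm (integral {R0..t} (%s. m s * f s)) <= integral {R0..t} (%s. 6 * m s * (B / 6))"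
 proof (rule integral_norm_bound_integral[OF m_integrable[OF f t]])
  fix s assume s: "s : {R0..t}"
  hence "0 < m s" using mpos[of s] t by auto
  thus "norm (m s * f s) <= 6 * m s * (B / 6)" using B[OF s] by (simp add: abs_mult)
 qed (use i in blast)
 also have "... = F t * (B / 6)" using i by (rule integral_unique)
 finally show ?thesis by (simp add: mult.commute)
qed

lemma Av_bound:
 assumes f: "continuous_on {R0..L} f" and t: "t : {R0..L}" and B: "!!s. s : {R0..t} ==> abs (f s) <= B"
 shows "abs (Av f t) <= B / 6"
proof (cases "t = R0")
 case True
 thus ?thesis using B[of R0] unfolding Av_def by simp
next
 case False
 hence Ft: "0 < F t" using F_pos t by auto
 have "abs (F t * Av f t) <= B * F t / 6" unfolding F_Av[OF t] by (rule m_integral_bound[OF assms])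
 hence "F t * abs (Av f t) <= F t * (B / 6)" using Ft by (simp add: abs_mult mult.commute)
 thus ?thesis using Ft by simp
qed

lemma Av_diff:
 assumes "continuous_on {R0..L} f" "continuous_on {R0..L} g" "t : {R0..L}"
 shows "Av (%s. f s - g s) t = Av f t - Av g t"
proof (cases "t <= R0")
 case False
 have "integral {R0..t} (%s. m s * (f s - g s)) = integral {R0..t} (%s. m s * f s) - integral {R0..t} (%s. m s * g s)"
  unfolding right_diff_distrib by (rule integral_diff) (use m_integrable assms in auto)
 thus ?thesis using False unfolding Av_def by (simp add: diff_divide_distrib)
qed (simp add: Av_def diff_divide_distrib)

lemma Av_const: "t : {R0..L} ==> Av (%_. c) t = c / 6"
proof -
 assume t: "t : {R0..L}"
 have "((%s. 6 * m s * (c / 6)) has_integral F t * (c / 6)) {R0..t}"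
  by (rule has_integral_mult_left[OF F_integral[OF t]])
 hence "integral {R0..t} (%s. 6 * m s * (c / 6)) = F t * (c / 6)" by (rule integral_unique)
 moreover have "(%s. 6 * m s * (c / 6)) = (%s. m s * c)" by auto
 ultimately have "F t * Av (%_. c) t = F t * (c / 6)" using F_Av[OF t] by (simp only:)
 thus ?thesis using F_pos[of t] t by (cases "t = R0") (auto simp: Av_def)
qed

text \<open>Away from \<open>R0\<close> this is a quotient of continuous functions. At
  \<open>R0\<close> constants go to constants by \<open>Av_const\<close>, so only
  \<open>f - f R0\<close> has to be estimated, which \<open>Av_bound\<close> does.\<close>

lemma Av_continuous:
 assumes f: "continuous_on {R0..L} f"
 shows "continuous_on {R0..L} (Av f)"
 unfolding continuous_on_eq_continuous_within
proof
 fix t0 assume t0: "t0 : {R0..L}"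
 show "continuous (at t0 within {R0..L}) (Av f)"
 proof (cases "t0 = R0")
  case True
  show ?thesis
   unfolding continuous_within_eps_delta
  proof (intro allI impI)
   fix e :: real assume e: "e > 0"
   obtain d where d: "d > 0" "!!s. s : {R0..L} ==> dist s R0 < d ==> dist (f s) (f R0) < e"
    using f RL e unfolding continuous_on_iff by (metis atLeastAtMost_iff less_imp_le order_refl)
   show "EX d>0. ALL x':{R0..L}. dist x' t0 < d --> dist (Av f x') (Av f t0) < e"
   proof (intro exI[of _ d] conjI ballI impI d(1))
    fix t assume t: "t : {R0..L}" "dist t t0 < d"
    have cd: "continuous_on {R0..L} (%s. f s - f R0)" by (intro continuous_intros f)
    have "abs (Av (%s. f s - f R0) t) <= e / 6"
    proof (rule Av_bound[OF cd t(1)])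
     fix s assume "s : {R0..t}"
     thus "abs (f s - f R0) <= e" using d(2)[of s] t True by (auto simp: dist_real_def)
    qed
    hence "abs (Av f t - f R0 / 6) <= e / 6"
     using Av_diff[OF f continuous_on_const t(1), of "f R0"] Av_const[OF t(1)] by simp
    moreover have "Av f t0 = f R0 / 6" using True unfolding Av_def by simp
    ultimately have "abs (Av f t - Av f t0) <= e / 6" by (simp only:)
    thus "dist (Av f t) (Av f t0) < e" using e unfolding dist_real_def by linarith
   qed
  qed
 next
  case False
  hence t0': "R0 < t0" using t0 by simp
  have c: "continuous_on {R0<..L} (%t. integral {R0..t} (%s. m s * f s) / F t)"
  proof (intro continuous_on_divide)
   have "continuous_on {R0..L} (%t. integral {R0..t} (%s. m s * f s))"
    by (rule indefinite_integral_continuous_1[OF m_integrable[OF f]]) (use RL in auto)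
   thus "continuous_on {R0<..L} (%t. integral {R0..t} (%s. m s * f s))"
    by (rule continuous_on_subset) auto
   show "continuous_on {R0<..L} F" by (rule continuous_on_subset[OF Fc]) auto
   show "ALL t:{R0<..L}. F t ~= 0" using F_pos by force
  qed
  have "continuous_on {R0<..L} (Av f)"
   by (rule continuous_on_eq[OF c]) (auto simp: Av_def)
  hence "continuous (at t0 within {R0<..L}) (Av f)" using t0' t0 unfolding continuous_on_eq_continuous_within by auto
  moreover have "at t0 within {R0..L} = at t0 within {R0<..L}"
   by (rule at_within_nhd[of _ "{R0<..}"]) (use t0' in auto)
  ultimately show ?thesis by simp
 qed
qed

text \<open>Integrating the equation twice from \<open>R0\<close>, with \<open>u = 1\<close> and
  \<open>F u' = 0\<close> there, gives \<open>u = 1 - J q u\<close>; the singularity is hidden in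
  \<open>Av\<close>.\<close>

definition J :: "(real => real) => (real => real) => real => real" where
 "J q f t = integral {R0..t} (Av (%s. q s * f s))"

lemma J_continuous:
 assumes "continuous_on {R0..L} q" "continuous_on {R0..L} f"
 shows "continuous_on {R0..L} (J q f)"
 unfolding J_def[abs_def]
 by (intro indefinite_integral_continuous_1 integrable_continuous_interval Av_continuous continuous_intros assms)

lemma J_deriv:
 assumes "continuous_on {R0..L} q" "continuous_on {R0..L} f" "t : {R0..L}"
 shows "(J q f has_real_derivative Av (%s. q s * f s) t) (at t within {R0..L})"
 unfolding J_def[abs_def]
 by (rule integral_has_real_derivative) (intro Av_continuous continuous_intros assms, fact)

lemma Av_integrable:
 assumes "continuous_on {R0..L} f" "t : {R0..L}"
 shows "Av f integrable_on {R0..t}"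
 by (intro integrable_continuous_interval continuous_on_subset[OF Av_continuous[OF assms(1)]]) (use assms in auto)

lemma J_diff:
 assumes q: "continuous_on {R0..L} q" and f: "continuous_on {R0..L} f" "continuous_on {R0..L} g" and t: "t : {R0..L}"
 shows "J q (%s. f s - g s) t = J q f t - J q g t"
proof -
 have c: "continuous_on {R0..L} (%s. q s * f s)" "continuous_on {R0..L} (%s. q s * g s)"
  by (intro continuous_intros q f)+
 have "J q (%s. f s - g s) t = integral {R0..t} (%s. Av (%s. q s * f s) s - Av (%s. q s * g s) s)"
  unfolding J_def using t by (intro integral_cong) (simp add: right_diff_distrib Av_diff[OF c])
 also have "... = J q f t - J q g t" unfolding J_def by (intro integral_diff Av_integrable c t)
 finally show ?thesis .
qed

lemma J_diff_left:
 assumes q: "continuous_on {R0..L} q" "continuous_on {R0..L} q'" and f: "continuous_on {R0..L} f" and t: "t : {R0..L}"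
 shows "J (%s. q s - q' s) f t = J q f t - J q' f t"
 using J_diff[OF f q t] by (simp add: J_def mult.commute)

text \<open>In the sup norm weighted by \<open>exp (2 * M * (t - R0))\<close> the operator halves:
  \<open>Av\<close> contributes a factor \<open>M\<close>, and integration of the weight a factor
  \<open>1 / (2 * M)\<close>. So no smallness of the interval is involved.\<close>

lemma J_bound:
 assumes q: "continuous_on {R0..L} q" and f: "continuous_on {R0..L} f" and t: "t : {R0..L}"
  and M: "M > 0" "!!s. s : {R0..L} ==> abs (q s) <= 6 * M"
  and E: "!!s. s : {R0..L} ==> abs (f s) <= E * exp (2 * M * (s - R0))" "0 <= E"
 shows "abs (J q f t) <= E / 2 * exp (2 * M * (t - R0))"
proof -
 have c: "continuous_on {R0..L} (%s. q s * f s)" by (intro continuous_intros q f)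
 have A: "abs (Av (%s. q s * f s) s) <= M * E * exp (2 * M * (s - R0))" if s: "s : {R0..L}" for s
 proof -
  have "abs (Av (%s. q s * f s) s) <= (6 * M * (E * exp (2 * M * (s - R0)))) / 6"
  proof (rule Av_bound[OF c s])
   fix x assume x: "x : {R0..s}"
   hence xL: "x : {R0..L}" using s by auto
   have "abs (f x) <= E * exp (2 * M * (x - R0))" by (rule E(1)[OF xL])
   also have "... <= E * exp (2 * M * (s - R0))" using x M(1) E(2) by (intro mult_left_mono) auto
   finally show "abs (q x * f x) <= 6 * M * (E * exp (2 * M * (s - R0)))"
    unfolding abs_mult using M(1) M(2)[OF xL] by (intro mult_mono) auto
  qed
  thus ?thesis by simp
 qed
 have i: "((%s. M * E * exp (2 * M * (s - R0))) has_integral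
   E / 2 * exp (2 * M * (t - R0)) - E / 2 * exp (2 * M * (R0 - R0))) {R0..t}"
 proof (rule fundamental_theorem_of_calculus)
  fix x assume "x : {R0..t}"
  show "((%x. E / 2 * exp (2 * M * (x - R0))) has_vector_derivative M * E * exp (2 * M * (x - R0))) (at x within {R0..t})"
   unfolding has_real_derivative_iff_has_vector_derivative[symmetric]
   by (auto intro!: derivative_eq_intros)
 qed (use t in auto)
 have "norm (J q f t) <= integral {R0..t} (%s. M * E * exp (2 * M * (s - R0)))"
  unfolding J_def
  by (rule integral_norm_bound_integral[OF Av_integrable[OF c t]]) (use i A t in auto)
 also have "... = E / 2 * exp (2 * M * (t - R0)) - E / 2 * exp (2 * M * (R0 - R0))" by (rule integral_unique[OF i])
 finally show ?thesis using E(2) by simp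
qed

text \<open>If \<open>E\<close> is the weighted supremum of \<open>f\<close>, the contraction gives
  \<open>E <= E / 2 + A\<close>, the weight being at least 1.\<close>

lemma gronwall_J:
 assumes q: "continuous_on {R0..L} q" and f: "continuous_on {R0..L} f" and A: "0 <= A"
  and M: "M > 0" "!!s. s : {R0..L} ==> abs (q s) <= 6 * M"
  and le: "!!t. t : {R0..L} ==> abs (f t) <= abs (J q f t) + A" and t: "t : {R0..L}"
 shows "abs (f t) <= 2 * A * exp (2 * M * (t - R0))"
proof -
 let ?e = "%t. exp (2 * M * (t - R0))"
 have "continuous_on {R0..L} (%t. abs (f t) / ?e t)" by (intro continuous_intros f) auto
 moreover have "compact {R0..L}" "{R0..L} ~= {}" using RL by auto
 ultimately obtain t1 where t1: "t1 : {R0..L}" "!!s. s : {R0..L} ==> abs (f s) / ?e s <= abs (f t1) / ?e t1"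
  using continuous_attains_sup by (metis (no_types, lifting))
 define E where "E = abs (f t1) / ?e t1"
 have E0: "0 <= E" unfolding E_def by simp
 have fE: "abs (f s) <= E * ?e s" if "s : {R0..L}" for s
  using t1(2)[OF that] unfolding E_def[symmetric] by (simp add: pos_divide_le_eq)
 have "abs (f t1) <= E / 2 * ?e t1 + A"
  using le[OF t1(1)] J_bound[OF q f t1(1) M fE E0] by linarith
 moreover have "abs (f t1) = E * ?e t1" unfolding E_def by simp
 ultimately have "E * ?e t1 <= 2 * A" by simp
 moreover have "1 <= ?e t1" using M(1) t1(1) by simp
 ultimately have "E <= 2 * A" using E0 mult_left_mono[of 1 "?e t1" E] by simp
 hence "E * ?e t <= 2 * A * ?e t" by (intro mult_right_mono) auto
 thus ?thesis by (rule order_trans[OF fE[OF t]])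
qed

text \<open>Picard iteration from the constant 1, with successive differences halving in the
  weighted norm. The clause for \<open>q <= 0\<close> holds for every iterate and hence for the
  limit; it controls the solution for very negative parameters.\<close>

lemma solution_exists:
 assumes q: "continuous_on {R0..L} q" and M: "M > 0" "!!s. s : {R0..L} ==> abs (q s) <= 6 * M"
 shows "EX u. continuous_on {R0..L} u & (ALL t:{R0..L}. u t = 1 - J q u t) &
   ((ALL t:{R0..L}. q t <= 0) --> (ALL t:{R0..L}. 1 <= u t))"
proof -
 define S where "S n = ((%f t. 1 - J q f t) ^^ n) (%_. 1)" for n
 have S0: "S 0 = (%_. 1)" and SS: "S (Suc n) = (%t. 1 - J q (S n) t)" for n unfolding S_def by auto
 have Sc: "continuous_on {R0..L} (S n)" for n
  by (induction n) (auto simp: S0 SS intro!: continuous_intros J_continuous q)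
 let ?e = "%t. exp (2 * M * (t - R0))"
 have step: "abs (S (Suc n) t - S n t) <= (1/2) ^ Suc n * ?e t" if "t : {R0..L}" for n t
  using that
 proof (induction n arbitrary: t)
  case 0
  have "abs (J q (%_. 1) t) <= 1 / 2 * ?e t"
   by (rule J_bound[OF q _ 0 M]) (use M in auto)
  thus ?case unfolding SS S0 by simp
 next
  case (Suc n)
  have "S (Suc (Suc n)) t - S (Suc n) t = - J q (%s. S (Suc n) s - S n s) t"
   using J_diff[OF q Sc[of "Suc n"] Sc[of n] Suc.prems] SS[of "Suc n"] SS[of n] by simp
  moreover have "abs (J q (%s. S (Suc n) s - S n s) t) <= (1/2) ^ Suc n / 2 * ?e t"
   by (rule J_bound[OF q _ Suc.prems M Suc.IH]) (use Sc in "auto intro!: continuous_intros")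
  ultimately show ?case by simp
 qed
 let ?B = "?e L"
 have step': "norm (S (Suc n) t - S n t) <= (1/2) ^ Suc n * ?B" if t: "t : {R0..L}" for n t
 proof -
  have "?e t <= ?B" using t M(1) by simp
  hence "(1/2) ^ Suc n * ?e t <= (1/2) ^ Suc n * ?B" by (intro mult_left_mono) auto
  thus ?thesis unfolding real_norm_def by (rule order_trans[OF step[OF t, of n]])
 qed
 have "summable (%n. (1/2) ^ Suc n * ?B)" by (intro summable_mult2) (simp add: summable_mult)
 hence ul: "uniform_limit {R0..L} (%N t. \<Sum>n<N. S (Suc n) t - S n t) (%t. \<Sum>n. S (Suc n) t - S n t) sequentially"
  by (intro Weierstrass_m_test[where M="%n. (1/2) ^ Suc n * ?B"] step')
 define u where "u t = 1 + (\<Sum>n. S (Suc n) t - S n t)" for t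
 have tel: "(\<Sum>n<N. S (Suc n) t - S n t) = S N t - 1" for N t
  using sum_lessThan_telescope[of "%n. S n t" N] S0 by simp
 have us: "uniform_limit {R0..L} S u sequentially"
 proof -
  have "uniform_limit {R0..L} (%N t. 1 + (\<Sum>n<N. S (Suc n) t - S n t)) u sequentially"
   unfolding u_def[abs_def] by (intro uniform_limit_intros ul)
  thus ?thesis unfolding tel by simp
 qed
 have uc: "continuous_on {R0..L} u"
  by (rule uniform_limit_theorem[OF _ us]) (use Sc in auto)
 have ptw: "(%n. S n t) \<longlonglongrightarrow> u t" if "t : {R0..L}" for t
  using tendsto_uniform_limitI[OF us that] .
 have "u t = 1 - J q u t" if t: "t : {R0..L}" for t
 proof -
  have "(%n. J q (S n) t) \<longlonglongrightarrow> J q u t"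
  proof (rule LIMSEQ_I)
   fix r :: real assume r: "r > 0"
   have "0 < r / ?B" using r by simp
   hence "\<forall>\<^sub>F n in sequentially. ALL s:{R0..L}. dist (S n s) (u s) < r / ?B"
    using us unfolding uniform_limit_iff by blast
   then obtain N where N: "!!n s. n >= N ==> s : {R0..L} ==> dist (S n s) (u s) < r / ?B"
    unfolding eventually_sequentially by blast
   show "EX no. ALL n>=no. norm (J q (S n) t - J q u t) < r"
   proof (intro exI[of _ N] allI impI)
    fix n assume n: "N <= n"
    have cd: "continuous_on {R0..L} (%s. S n s - u s)" by (intro continuous_intros Sc uc)
    have "abs (J q (%s. S n s - u s) t) <= (r / ?B) / 2 * ?e t"
    proof (rule J_bound[OF q cd t M])
     fix s assume s: "s : {R0..L}"
     have "1 <= ?e s" using s M(1) by simp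
     hence "r / ?B * 1 <= r / ?B * ?e s" using r by (intro mult_left_mono) auto
     thus "abs (S n s - u s) <= r / ?B * ?e s" using N[OF n s] by (simp add: dist_real_def)
    qed (use r in auto)
    also have "... <= (r / ?B) / 2 * ?B" using r t M(1) by (intro mult_left_mono) auto
    also have "... < r" using r by simp
    finally show "norm (J q (S n) t - J q u t) < r" using J_diff[OF q Sc uc t] by simp
   qed
  qed
  hence "(%n. S (Suc n) t) \<longlonglongrightarrow> 1 - J q u t" unfolding SS by (intro tendsto_intros)
  moreover have "(%n. S (Suc n) t) \<longlonglongrightarrow> u t" using LIMSEQ_Suc[OF ptw[OF t]] .
  ultimately show ?thesis by (rule LIMSEQ_unique[symmetric])
 qed
 moreover have "1 <= u t" if qn: "ALL t:{R0..L}. q t <= 0" and t: "t : {R0..L}" for t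
 proof -
  have S1: "1 <= S n s" if "s : {R0..L}" for n s
   using that
  proof (induction n arbitrary: s)
   case (Suc n)
   have A: "Av (%s. q s * S n s) x <= 0" if x: "x : {R0..s}" for x
   proof (cases "x <= R0")
    case True
    have "q R0 * S n R0 <= 0" using qn Suc.IH[of R0] RL by (intro mult_nonpos_nonneg) (auto intro: order_trans[of 0 1])
    thus ?thesis using True unfolding Av_def by simp
   next
    case False
    have "integral {R0..x} (%s. m s * (q s * S n s)) <= integral {R0..x} (%_. 0)"
    proof (rule integral_le)
     show "(%s. m s * (q s * S n s)) integrable_on {R0..x}"
      using x Suc.prems by (intro m_integrable continuous_intros q Sc) auto
     fix y assume y: "y : {R0..x}"
     hence yL: "y : {R0..L}" using x Suc.prems by auto
     hence "q y * S n y <= 0" using qn Suc.IH[OF yL] by (intro mult_nonpos_nonneg) (auto intro: order_trans[of 0 1])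
     thus "m y * (q y * S n y) <= 0" using mpos[OF yL] by (simp add: mult_nonneg_nonpos)
    qed auto
    thus ?thesis using False F_pos[of x] x Suc.prems unfolding Av_def by (simp add: divide_nonpos_pos)
   qed
   have "J q (S n) s <= integral {R0..s} (%_. 0)"
    unfolding J_def by (rule integral_le) (use A Suc.prems in "auto intro!: Av_integrable continuous_intros q Sc")
   thus ?case unfolding SS by simp
  qed (simp add: S0)
  show ?thesis by (rule LIMSEQ_le_const[OF ptw[OF t]]) (use S1[OF t] in blast)
 qed
 ultimately show ?thesis using uc by blast
qed

end

text \<open>Where \<open>u\<close> vanishes, \<open>u' = v / F\<close> has the sign of
  \<open>v\<close>, so the point \<open>(u, v)\<close> crosses the vertical axis clockwise.
  Multiplication by \<open>sin (phi t0)\<close> treats both half axes at once, since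
  \<open>sin (phi t0) * u t = - r t * sin (phi t - phi t0)\<close>.\<close>

lemma angle_crosses_down:
 fixes u v phi r :: "real => real"
 assumes polar: "!!t. t : {a..c} ==> u t = r t * cos (phi t) & v t = r t * sin (phi t) & 0 < r t"
  and cont: "continuous_on {a..c} phi" and t0: "a < t0" "t0 <= c" and k: "cos (phi t0) = 0"
  and d: "(u has_real_derivative v t0 / F) (at t0 within {a..c})" "0 < F"
 shows "EX dl>0. ALL t:{a..c}. abs (t - t0) < dl --> (t < t0 --> phi t0 < phi t) & (t0 < t --> phi t < phi t0)"
proof -
 let ?s = "sin (phi t0)"
 have I: "t0 : {a..c}" using t0 by auto
 have s2: "?s * ?s = 1" using k sin_cos_squared_add[of "phi t0"] by (simp add: power2_eq_square)
 have u0: "u t0 = 0" using polar[OF I] k by simp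
 have dd: "((%t. ?s * u t) has_real_derivative ?s * (v t0 / F)) (at t0 within {a..c})"
  by (rule DERIV_cmult[OF d(1)])
 have pos: "0 < ?s * (v t0 / F)"
 proof -
  have "?s * (v t0 / F) = r t0 * (?s * ?s) / F" using polar[OF I] by simp
  also have "... = r t0 / F" unfolding s2 by simp
  finally have e: "?s * (v t0 / F) = r t0 / F" .
  show ?thesis unfolding e using polar[OF I] d(2) by simp
 qed
 have "((%t. (?s * u t - ?s * u t0) / (t - t0)) \<longlongrightarrow> ?s * (v t0 / F)) (at t0 within {a..c})"
  using dd unfolding has_field_derivative_iff .
 hence "\<forall>\<^sub>F t in at t0 within {a..c}. 0 < (?s * u t - ?s * u t0) / (t - t0)"
  using pos by (rule order_tendstoD)
 then obtain d1 where d1: "d1 > 0" "!!t. t : {a..c} ==> t ~= t0 ==> dist t t0 < d1 ==> 0 < (?s * u t) / (t - t0)"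
  using u0 unfolding eventually_at by auto
 obtain d2 where d2: "d2 > 0" "!!t. t : {a..c} ==> dist t t0 < d2 ==> dist (phi t) (phi t0) < pi"
  using cont I pi_gt_zero unfolding continuous_on_iff by metis
 have key: "?s * u t = - r t * sin (phi t - phi t0)" if "t : {a..c}" for t
 proof -
  have "cos (phi t) = - ?s * sin (phi t - phi t0)"
   using cos_add[of "phi t0" "phi t - phi t0"] k by simp
  hence "?s * u t = - r t * (?s * ?s) * sin (phi t - phi t0)" using polar[OF that] by simp
  thus ?thesis using s2 by simp
 qed
 show ?thesis
 proof (intro exI[of _ "min d1 d2"] conjI ballI impI)
  fix t assume t: "t : {a..c}" "abs (t - t0) < min d1 d2" "t < t0"
  have "0 < (?s * u t) / (t - t0)" using d1(2)[OF t(1)] t by (simp add: dist_real_def)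
  hence "?s * u t < 0" using t(3) by (simp add: zero_less_divide_iff)
  hence sg: "0 < sin (phi t - phi t0)" using key[OF t(1)] polar[OF t(1)] by (simp add: zero_less_mult_iff)
  have ab: "abs (phi t - phi t0) < pi" using d2(2)[OF t(1)] t(2) by (simp add: dist_real_def)
  show "phi t0 < phi t"
  proof (rule ccontr)
   assume "\<not> phi t0 < phi t"
   hence "0 <= sin (phi t0 - phi t)" using ab by (intro sin_ge_zero) auto
   thus False using sg sin_minus[of "phi t - phi t0"] by simp
  qed
 next
  fix t assume t: "t : {a..c}" "abs (t - t0) < min d1 d2" "t0 < t"
  have "0 < (?s * u t) / (t - t0)" using d1(2)[OF t(1)] t by (simp add: dist_real_def)
  hence "0 < ?s * u t" using t(3) by (simp add: zero_less_divide_iff)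
  hence "0 < r t * - sin (phi t - phi t0)" using key[OF t(1)] by simp
  hence sg: "sin (phi t - phi t0) < 0" using polar[OF t(1)] by (simp add: mult_less_0_iff)
  have ab: "abs (phi t - phi t0) < pi" using d2(2)[OF t(1)] t(2) by (simp add: dist_real_def)
  show "phi t < phi t0"
  proof (rule ccontr)
   assume "\<not> phi t < phi t0"
   hence "0 <= sin (phi t - phi t0)" using ab by (intro sin_ge_zero) auto
   thus False using sg by simp
  qed
 qed (use d1 d2 in auto)
qed

text \<open>A barrier argument: at the first return to the level \<open>y\<close> the angle would
  have to come from above, yet it was below just before.\<close>

lemma angle_stays_below:
 fixes phi :: "real => real"
 assumes cont: "continuous_on {a..c} phi" and y: "a <= s" "s < t" "t <= c" "phi s <= y"
  and down: "!!t0. a <= t0 ==> t0 <= c ==> phi t0 = y ==> EX dl>0. ALL t:{a..c}. abs (t - t0) < dl -->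
   (t < t0 --> y < phi t) & (t0 < t --> phi t < y)"
 shows "phi t < y"
proof (rule ccontr)
 assume nt: "\<not> phi t < y"
 have "EX s'. s <= s' & s' < t & phi s' < y"
 proof (cases "phi s = y")
  case True
  have "s <= c" using y by simp
  from down[OF y(1) this True] obtain dl where d: "dl > 0" "!!t. t : {a..c} ==> abs (t - s) < dl ==> s < t ==> phi t < y" by blast
  have "phi (s + min (dl/2) ((t - s)/2)) < y" by (rule d(2)) (use d(1) y in "auto simp: min_def field_simps")
  thus ?thesis using d(1) y by (intro exI[of _ "s + min (dl/2) ((t - s)/2)"]) (auto simp: min_def field_simps)
 next
  case False
  thus ?thesis using y by (intro exI[of _ s]) auto
 qed
 then obtain s' where s': "s <= s'" "s' < t" "phi s' < y" by blast
 let ?X = "{x : {s'..t}. y <= phi x}"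
 have cc: "continuous_on {s'..t} phi" by (rule continuous_on_subset[OF cont]) (use s' y in auto)
 have "closed ?X"
  using continuous_closed_preimage[OF cc closed_atLeastAtMost closed_atLeast[of y]] by (simp add: vimage_def Int_def)
 hence cX: "compact ?X"
  unfolding compact_eq_bounded_closed by (blast intro: bounded_subset[OF bounded_closed_interval[of s' t]])
 have "t : ?X" using nt s' by auto
 then obtain t1 where t1: "t1 : ?X" "!!x. x : ?X ==> t1 <= x"
  using compact_attains_inf[OF cX] by blast
 have "s' < t1" using t1(1) s'(3) by (cases "s' = t1") auto
 have below: "phi x < y" if "s' <= x" "x < t1" for x
  using t1(2)[of x] t1(1) that by force
 have "phi t1 = y"
 proof (rule antisym)
  show "y <= phi t1" using t1(1) by simp
  have "(phi \<longlongrightarrow> phi t1) (at t1 within {s'..t1})"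
   using continuous_on_subset[OF cc, of "{s'..t1}"] t1(1) `s' < t1` unfolding continuous_on_def by auto
  thus "phi t1 <= y"
  proof (rule tendsto_upperbound)
   show "\<forall>\<^sub>F x in at t1 within {s'..t1}. phi x <= y"
    unfolding eventually_at_filter using below by (intro always_eventually) (auto simp: less_le)
   show "at t1 within {s'..t1} ~= bot" using `s' < t1` by (simp add: trivial_limit_within islimpt_Icc)
  qed
 qed
 moreover have "a <= t1" "t1 <= c" using t1(1) s' y by auto
 ultimately obtain dl where d: "dl > 0" "!!x. x : {a..c} ==> abs (x - t1) < dl ==> x < t1 ==> y < phi x"
  using down by blast
 let ?x = "t1 - min (dl/2) ((t1 - s')/2)"
 have "y < phi ?x" by (rule d(2)) (use d(1) `s' < t1` `t1 <= c` s' y in "auto simp: min_def field_simps")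
 moreover have "phi ?x < y" by (rule below) (use d(1) `s' < t1` in "auto simp: min_def field_simps")
 ultimately show False by simp
qed

text \<open>The Lipschitz bound moves the parameter from \<open>l\<close> to \<open>k\<close>
  uniformly in \<open>t\<close>; after that only continuity of \<open>f k\<close> is used.\<close>

lemma continuous_on_Times_lipschitz:
 fixes f :: "real => real => real"
 assumes c: "!!l. l : I ==> continuous_on S (f l)"
  and l: "!!l k t. l : I ==> k : I ==> t : S ==> abs (f l t - f k t) <= C * abs (l - k)"
 shows "continuous_on (S \<times> I) (%z. f (snd z) (fst z))"
 unfolding continuous_on_iff
proof (intro ballI allI impI)
 fix z and e :: real assume z: "z : S \<times> I" and e: "e > 0"
 obtain t k where tk: "z = (t, k)" "t : S" "k : I" using z by auto
 obtain d where d: "d > 0" "!!s. s : S ==> dist s t < d ==> dist (f k s) (f k t) < e / 2"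
  using c[OF tk(3)] tk(2) e unfolding continuous_on_iff by (metis half_gt_zero)
 define d' where "d' = e / (2 * (abs C + 1))"
 have d': "d' > 0" using e unfolding d'_def by (simp add: add_pos_nonneg)
 show "EX d>0. ALL x':S \<times> I. dist x' z < d --> dist (f (snd x') (fst x')) (f (snd z) (fst z)) < e"
 proof (intro exI[of _ "min d d'"] conjI ballI impI)
  fix x' assume x': "x' : S \<times> I" "dist x' z < min d d'"
  obtain s l' where sl: "x' = (s, l')" "s : S" "l' : I" using x'(1) by auto
  have ds: "dist s t < d" "dist l' k < d'"
   using x'(2) dist_fst_le[of x' z] dist_snd_le[of x' z] unfolding sl tk by auto
  have "abs (f l' s - f k s) <= C * abs (l' - k)" by (rule l[OF sl(3) tk(3) sl(2)])
  also have "... <= (abs C + 1) * abs (l' - k)" by (intro mult_right_mono) auto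
  also have "... <= (abs C + 1) * d'" using ds(2) by (intro mult_left_mono) (auto simp: dist_real_def)
  also have "... = e / 2" unfolding d'_def by (simp add: field_simps add_eq_0_iff_both_eq_0)
  finally have "abs (f l' s - f k s) <= e / 2" .
  moreover have "abs (f k s - f k t) < e / 2" using d(2)[OF sl(2) ds(1)] by (simp add: dist_real_def)
  ultimately show "dist (f (snd x') (fst x')) (f (snd z) (fst z)) < e"
   unfolding sl tk dist_real_def fst_conv snd_conv by linarith
 qed (use d d' in auto)
qed

section \<open>Shooting: the angle at the boundary as a function of the parameter\<close>

context sturm_data begin

lemma J_const_bound:
 assumes f: "continuous_on {R0..L} f" and B: "!!s. s : {R0..L} ==> abs (f s) <= B" and t: "t : {R0..L}"
 shows "abs (J (%_. c) f t) <= abs c * (B * (L - R0) / 6)"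
proof -
 have c: "continuous_on {R0..L} (%s. c * f s)" by (intro continuous_intros f)
 have B0: "0 <= B" using B[of R0] RL by auto
 have A: "abs (Av (%s. c * f s) s) <= (abs c * B) / 6" if s: "s : {R0..L}" for s
  by (rule Av_bound[OF c s]) (use B s in "auto simp: abs_mult intro!: mult_left_mono")
 have "norm (J (%_. c) f t) <= integral {R0..t} (%s. (abs c * B) / 6)"
  unfolding J_def by (rule integral_norm_bound_integral[OF Av_integrable[OF c t]]) (use A t in auto)
 also have "... = (t - R0) * (abs c * B / 6)" using t by simp
 also have "... <= (L - R0) * (abs c * B / 6)" using t B0 by (intro mult_right_mono) auto
 finally show ?thesis by (simp add: field_simps)
qed

lemma solution_derivs:
 assumes q: "continuous_on {R0..L} q" and u: "continuous_on {R0..L} u" "!!t. t : {R0..L} ==> u t = 1 - J q u t"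
  and t: "t : {R0..L}"
 shows "(u has_real_derivative - Av (%s. q s * u s) t) (at t within {R0..L})"
  "((%t. F t * - Av (%s. q s * u s) t) has_real_derivative - (m t * (q t * u t))) (at t within {R0..L})"
proof -
 have "((%t. 1 - J q u t) has_real_derivative 0 - Av (%s. q s * u s) t) (at t within {R0..L})"
  by (intro DERIV_diff DERIV_const J_deriv q u t)
 thus "(u has_real_derivative - Av (%s. q s * u s) t) (at t within {R0..L})"
  using has_field_derivative_transform_within[of "%t. 1 - J q u t" _ t "{R0..L}" 1 u] u(2) t by simp
 have c: "continuous_on {R0..L} (%s. m s * (q s * u s))" by (intro continuous_intros q u mc)
 have "((%t. integral {R0..t} (%s. m s * (q s * u s))) has_real_derivative m t * (q t * u t)) (at t within {R0..L})"
  by (rule integral_has_real_derivative[OF c t])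
 hence d: "((%t. - integral {R0..t} (%s. m s * (q s * u s))) has_real_derivative - (m t * (q t * u t))) (at t within {R0..L})"
  by (rule DERIV_minus)
 have e: "- integral {R0..x} (%s. m s * (q s * u s)) = F x * - Av (%s. q s * u s) x" if "x : {R0..L}" for x
  using F_Av[OF that] by simp
 show "((%t. F t * - Av (%s. q s * u s) t) has_real_derivative - (m t * (q t * u t))) (at t within {R0..L})"
  by (rule has_field_derivative_transform_within[OF d zero_less_one t]) (use e in auto)
qed

text \<open>Backwards from \<open>t1\<close> the system is regular as long as \<open>F\<close> stays
  away from 0: on \<open>{s..t1}\<close> the function \<open>exp (C * t) * (u^2 + v^2)\<close>
  increases and ends at 0, so it vanishes at \<open>s\<close>. The constant \<open>C\<close> depends
  on \<open>s\<close>, but this still gives \<open>u = 0\<close> on the whole open interval and, by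
  continuity, at \<open>R0\<close>.\<close>

lemma no_double_zero:
 assumes q: "continuous_on {R0..L} q" and u: "continuous_on {R0..L} u" "u R0 ~= 0"
  and du: "!!t. R0 < t ==> t < L ==> (u has_real_derivative v t / F t) (at t)"
  and v: "continuous_on {R0..L} v" "!!t. R0 < t ==> t < L ==> (v has_real_derivative - (m t * (q t * u t))) (at t)"
  and t1: "R0 < t1" "t1 <= L" "u t1 = 0" "v t1 = 0"
 shows False
proof -
 have cmq: "continuous_on {R0..L} (%t. abs (m t * q t))" by (intro continuous_intros mc q)
 obtain Q where Q: "!!t. t : {R0..L} ==> abs (m t * q t) <= Q"
  using continuous_attains_sup[OF _ _ cmq] RL by (metis atLeastAtMost_iff compact_Icc empty_iff less_imp_le order_refl)
 have z: "u s = 0" if s: "R0 < s" "s < t1" for s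
 proof -
  define C where "C = 1 / F s + Q"
  have Fs: "0 < F s" using F_pos s t1 by simp
  let ?E = "%t. exp (C * t) * (u t * u t + v t * v t)"
  have "?E s <= ?E t1"
  proof (rule DERIV_nonneg_imp_increasing_open[of s t1 ?E])
   fix x assume x: "s < x" "x < t1"
   have Fx: "F s < F x" using F_increasing[of s x] s x t1 by simp
   have xI: "x : {R0..L}" using x s t1 by auto
   have dE: "(?E has_real_derivative
     C * exp (C * x) * (u x * u x + v x * v x) +
     exp (C * x) * ((v x / F x) * u x + u x * (v x / F x) + (- (m x * (q x * u x)) * v x + v x * (- (m x * (q x * u x)))))) (at x)"
    using x s t1 by (auto intro!: derivative_eq_intros du v(2))
   have ab: "2 * abs (u x * v x) <= u x * u x + v x * v x"
   proof -
    have "0 <= (abs (u x) - abs (v x))^2" by simp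
    thus ?thesis by (simp add: power2_diff abs_mult power2_eq_square algebra_simps)
   qed
   have c: "abs (1 / F x - m x * q x) <= C"
   proof -
    have "1 / F x <= 1 / F s" using Fx Fs by (simp add: frac_le)
    moreover have "0 < 1 / F x" using Fx Fs by simp
    ultimately show ?thesis using Q[OF xI] unfolding C_def by linarith
   qed
   have "abs ((1 / F x - m x * q x) * (2 * (u x * v x))) <= C * (u x * u x + v x * v x)"
    unfolding abs_mult[of "1 / F x - m x * q x"] using c ab Fs Q[OF xI] unfolding abs_mult[of 2]
    by (intro mult_mono) (auto simp: C_def intro: order_trans[OF abs_ge_zero])
   hence "0 <= C * (u x * u x + v x * v x) + (1 / F x - m x * q x) * (2 * (u x * v x))" by linarith
   hence "0 <= exp (C * x) * (C * (u x * u x + v x * v x) + (1 / F x - m x * q x) * (2 * (u x * v x)))" by simp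
   also have "... = C * exp (C * x) * (u x * u x + v x * v x) +
     exp (C * x) * ((v x / F x) * u x + u x * (v x / F x) + (- (m x * (q x * u x)) * v x + v x * (- (m x * (q x * u x)))))"
    by (simp add: algebra_simps)
   finally show "EX y. (?E has_real_derivative y) (at x) & 0 <= y" using dE by blast
  next
   show "continuous_on {s..t1} ?E"
    by (intro continuous_intros continuous_on_subset[OF u(1)] continuous_on_subset[OF v(1)]) (use s t1 in auto)
  qed (use s in simp)
  hence "?E s <= 0" using t1 by simp
  hence "u s * u s + v s * v s <= 0" by (simp add: mult_le_0_iff)
  thus "u s = 0" using sum_squares_le_zero_iff by blast
 qed
 have "(u \<longlongrightarrow> u R0) (at R0 within {R0..L})" using u(1) RL unfolding continuous_on_def by auto
 hence "(u \<longlongrightarrow> u R0) (at_right R0)" using at_within_Icc_at_right[OF RL] by simp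
 moreover have "(u \<longlongrightarrow> 0) (at_right R0)"
 proof (rule Lim_transform_eventually[OF tendsto_const])
  show "\<forall>\<^sub>F x in at_right R0. 0 = u x" unfolding eventually_at_right_field using z t1(1) by auto
 qed
 ultimately have "u R0 = 0" by (rule tendsto_unique[rotated]) simp
 thus False using u(2) by simp
qed

text \<open>Two integrations bring \<open>u0\<close>, known only through differential equations in
  the open interval, to the Volterra form, in which it can be compared with the solution obtained by
  iteration.\<close>

lemma zero_solution_unique:
 assumes u0: "continuous_on {R0..L} u0" and Y: "continuous_on {R0..L} Y" "Y R0 = 0"
  and du: "!!t. R0 < t ==> t < L ==> (u0 has_real_derivative Y t / F t) (at t)"
  and dY: "!!t. R0 < t ==> t < L ==> (Y has_real_derivative - (m t * (W t * u0 t))) (at t)"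
  and t: "t : {R0..L}"
 shows "u0 t = u0 R0 - J W u0 t"
proof -
 have Yi: "Y s = - integral {R0..s} (%x. m x * (W x * u0 x))" if s: "s : {R0..L}" for s
 proof -
  have "((%x. - (m x * (W x * u0 x))) has_integral Y s - Y R0) {R0..s}"
  proof (rule fundamental_theorem_of_calculus_interior)
   fix x assume "x : {R0<..<s}"
   thus "(Y has_vector_derivative - (m x * (W x * u0 x))) (at x)"
    using dY[of x] s by (simp add: has_real_derivative_iff_has_vector_derivative)
  qed (use s Y in "auto intro: continuous_on_subset")
  hence "integral {R0..s} (%x. - (m x * (W x * u0 x))) = Y s - Y R0" by (rule integral_unique)
  thus ?thesis using Y(2) by simp
 qed
 have YA: "Y s / F s = - Av (%x. W x * u0 x) s" if s: "R0 < s" "s <= L" for s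
  using Yi[of s] s unfolding Av_def by simp
 have "((%s. - Av (%x. W x * u0 x) s) has_integral u0 t - u0 R0) {R0..t}"
 proof (rule fundamental_theorem_of_calculus_interior)
  fix x assume "x : {R0<..<t}"
  thus "(u0 has_vector_derivative - Av (%x. W x * u0 x) x) (at x)"
   using du[of x] t YA[of x] by (simp add: has_real_derivative_iff_has_vector_derivative)
 qed (use t u0 in "auto intro: continuous_on_subset")
 hence "integral {R0..t} (%s. - Av (%x. W x * u0 x) s) = u0 t - u0 R0" by (rule integral_unique)
 thus ?thesis unfolding J_def by simp
qed

text \<open>The polar angle of \<open>(u, F u')\<close> at \<open>L\<close> depends continuously on \<open>\<lambda>\<close>; for very negative \<open>\<lambda>\<close> it
  exceeds the angle of the Robin condition, and for \<open>\<lambda> = 0\<close> each zero of \<open>u\<close> has cost it a half turn.\<close>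

lemma negative_robin_eigenvalues:
 fixes s :: "nat => real"
 assumes u0: "continuous_on {R0..L} u0" "u0 R0 ~= 0" and Y: "continuous_on {R0..L} Y" "Y R0 = 0"
  and du: "!!t. R0 < t ==> t < L ==> (u0 has_real_derivative Y t / F t) (at t)"
  and dY: "!!t. R0 < t ==> t < L ==> (Y has_real_derivative - (m t * (W t * u0 t))) (at t)"
  and s: "s 0 = R0" "!!i. i < l ==> s i < s (Suc i)" "s l = L" "!!i. 1 <= i ==> i <= l ==> u0 (s i) = 0"
  and rho: "0 < rho"
 obtains Lam U U' where "inj_on Lam {..<l}" "!!j. j < l ==> Lam j < (0::real)"
  "!!j. j < l ==> U j R0 = (1::real)"
  "!!j. j < l ==> continuous_on {R0..L} (U' j)"
  "!!j t. j < l ==> t : {R0..L} ==> (U j has_real_derivative U' j t) (at t within {R0..L})"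
  "!!j t. j < l ==> t : {R0..L} ==>
   ((%t. F t * U' j t) has_real_derivative - (m t * ((W t + Lam j) * U j t))) (at t within {R0..L})"
  "!!j. j < l ==> F L * U' j L = rho * U j L"
proof -
 have cpt: "compact {R0..L}" "{R0..L} ~= {}" using RL by auto
 have "continuous_on {R0..L} (%t. abs (W t))" by (intro continuous_intros Wc)
 then obtain Wb where Wb: "!!t. t : {R0..L} ==> abs (W t) <= Wb"
  using continuous_attains_sup[OF cpt] by metis
 obtain tm where tm: "tm : {R0..L}" "!!t. t : {R0..L} ==> m tm <= m t"
  using continuous_attains_inf[OF cpt mc] by metis
 obtain tM where tM: "!!t. t : {R0..L} ==> m t <= m tM"
  using continuous_attains_sup[OF cpt mc] by metis
 define mm where "mm = m tm"
 have mm: "mm > 0" using mpos[OF tm(1)] unfolding mm_def .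
 \<comment> \<open>\<open>a0\<close>, \<open>a\<close> and \<open>kap0\<close> serve the bound on
   the angle for the most negative parameter. The interval \<open>{a..L}\<close> is so short that
   \<open>u\<close> grows on it by at most \<open>v L / (3 * rho)\<close>, and \<open>kap0\<close>
   is so large that \<open>v\<close> grows on it by at least \<open>3 * rho * u a\<close>. Together
   these give \<open>rho * u L < v L\<close>.\<close>
 define a0 where "a0 = (R0 + L) / 2"
 have a0: "R0 < a0" "a0 < L" using RL unfolding a0_def by auto
 have Fa0: "0 < F a0" using F_pos a0 by simp
 define a where "a = L - min (L - a0) (F a0 / (3 * rho))"
 have a: "a0 <= a" "a < L" "(L - a) / F a <= 1 / (3 * rho)" "0 < F a"
 proof -
  have p: "0 < F a0 / (3 * rho)" using Fa0 rho by simp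
  show "a0 <= a" "a < L" unfolding a_def using p a0 by (auto simp: min_def)
  hence Fa: "F a0 <= F a" using F_increasing[of a0 a] a0 by (cases "a0 = a") auto
  thus "0 < F a" using Fa0 by simp
  have "L - a <= F a0 / (3 * rho)" unfolding a_def by simp
  also have "... <= F a / (3 * rho)" using Fa rho by (simp add: divide_right_mono)
  finally show "(L - a) / F a <= 1 / (3 * rho)" using `0 < F a` rho by (simp add: field_simps)
 qed
 define kap0 where "kap0 = 3 * rho / (mm * (L - a))"
 have kap0: "0 < kap0" "mm * (L - a) * kap0 = 3 * rho" using rho mm a(2) unfolding kap0_def by auto
 have Wb0: "0 <= Wb" using Wb[of R0] RL by auto
 \<comment> \<open>With this \<open>K\<close> the coefficient \<open>W - K\<close> is at most
   \<open>- kap0\<close> throughout, so for the parameter \<open>- K\<close> the solution stays at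
   least 1.\<close>
 define K where "K = Wb + kap0"
 have K: "0 < K" using Wb0 kap0 unfolding K_def by simp
 define M where "M = (Wb + K) / 6 + 1"
 have M: "M > 0" unfolding M_def by (rule add_nonneg_pos) (use Wb0 K in auto)
 have M6: "6 * M = Wb + K + 6" unfolding M_def by simp
 let ?q = "%lam t. W t + lam"
 have qc: "continuous_on {R0..L} (?q lam)" for lam by (intro continuous_intros Wc)
 have qM: "abs (?q lam t) <= 6 * M" if "lam : {-K..0}" "t : {R0..L}" for lam t
  unfolding M6 using Wb[OF that(2)] that(1) by auto
 define sol where "sol lam = (SOME u. continuous_on {R0..L} u & (ALL t:{R0..L}. u t = 1 - J (?q lam) u t) &
   ((ALL t:{R0..L}. ?q lam t <= 0) --> (ALL t:{R0..L}. 1 <= u t)))" for lam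
 have sol: "continuous_on {R0..L} (sol lam) & (ALL t:{R0..L}. sol lam t = 1 - J (?q lam) (sol lam) t) &
   ((ALL t:{R0..L}. ?q lam t <= 0) --> (ALL t:{R0..L}. 1 <= sol lam t))" if "lam : {-K..0}" for lam
  unfolding sol_def using someI_ex[OF solution_exists[OF qc M qM[OF that]]] .
 have sc: "continuous_on {R0..L} (sol lam)" and se: "!!t. t : {R0..L} ==> sol lam t = 1 - J (?q lam) (sol lam) t"
  if "lam : {-K..0}" for lam using sol[OF that] by auto
 have s0: "sol lam R0 = 1" if "lam : {-K..0}" for lam
  using se[OF that, of R0] RL by (simp add: J_def)
 define Bd where "Bd = 2 * exp (2 * M * (L - R0))"
 have sB: "abs (sol lam t) <= Bd" if l: "lam : {-K..0}" and t: "t : {R0..L}" for lam t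
 proof -
  have "abs (sol lam t) <= 2 * 1 * exp (2 * M * (t - R0))"
  proof (rule gronwall_J[OF qc sc[OF l] _ M qM[OF l] _ t])
   fix x assume "x : {R0..L}"
   thus "abs (sol lam x) <= abs (J (?q lam) (sol lam) x) + 1" using se[OF l, of x] by linarith
  qed auto
  also have "... <= Bd" using t M unfolding Bd_def by simp
  finally show ?thesis .
 qed
 have Bd0: "0 <= Bd" unfolding Bd_def by simp
 define C where "C = 2 * (Bd * (L - R0) / 6) * exp (2 * M * (L - R0))"
 \<comment> \<open>The difference of two solutions satisfies a Volterra equation whose source is
   \<open>J\<close> with the constant coefficient \<open>lam - lam'\<close>;
   \<open>gronwall_J\<close> bounds it by the size of this source.\<close>
 have lip: "abs (sol lam t - sol lam' t) <= C * abs (lam - lam')"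
  if l: "lam : {-K..0}" "lam' : {-K..0}" and t: "t : {R0..L}" for lam lam' t
 proof -
  have cd: "continuous_on {R0..L} (%t. sol lam t - sol lam' t)" by (intro continuous_intros sc l)
  have "abs (sol lam t - sol lam' t) <= 2 * (abs (lam - lam') * (Bd * (L - R0) / 6)) * exp (2 * M * (t - R0))"
  proof (rule gronwall_J[OF qc cd _ M qM[OF l(1)] _ t])
   fix x assume x: "x : {R0..L}"
   have "(%s. ?q lam s - ?q lam' s) = (%_. lam - lam')" by auto
   hence "J (%_. lam - lam') (sol lam') x = J (?q lam) (sol lam') x - J (?q lam') (sol lam') x"
    using J_diff_left[OF qc qc sc[OF l(2)] x, of lam lam'] by simp
   hence "sol lam x - sol lam' x = - J (?q lam) (%s. sol lam s - sol lam' s) x - J (%_. lam - lam') (sol lam') x"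
    using J_diff[OF qc sc[OF l(1)] sc[OF l(2)] x, of lam] se[OF l(1) x] se[OF l(2) x] by linarith
   moreover have "abs (J (%_. lam - lam') (sol lam') x) <= abs (lam - lam') * (Bd * (L - R0) / 6)"
    by (rule J_const_bound[OF sc[OF l(2)] sB[OF l(2)] x])
   ultimately show "abs (sol lam x - sol lam' x) <= abs (J (?q lam) (%s. sol lam s - sol lam' s) x) + abs (lam - lam') * (Bd * (L - R0) / 6)"
    by linarith
  qed (use Bd0 RL in auto)
  also have "... <= 2 * (abs (lam - lam') * (Bd * (L - R0) / 6)) * exp (2 * M * (L - R0))"
   using t M Bd0 RL by (intro mult_left_mono) auto
  also have "... = C * abs (lam - lam')" unfolding C_def by (simp only: times_divide_eq_left times_divide_eq_right mult_ac)
  finally show ?thesis .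
 qed
 let ?u' = "%lam t. - Av (%s. ?q lam s * sol lam s) t"
 define v where "v lam t = F t * ?u' lam t" for lam t
 have v_int: "v lam t = - integral {R0..t} (%x. m x * (?q lam x * sol lam x))" if "t : {R0..L}" for lam t
  unfolding v_def using F_Av[OF that] by simp
 have dsol: "(sol lam has_real_derivative ?u' lam t) (at t within {R0..L})"
  "(v lam has_real_derivative - (m t * (?q lam t * sol lam t))) (at t within {R0..L})"
  if "lam : {-K..0}" "t : {R0..L}" for lam t
  using solution_derivs[OF qc sc[OF that(1)] se[OF that(1)] that(2)] unfolding v_def by auto
 have vc: "continuous_on {R0..L} (v lam)" if "lam : {-K..0}" for lam
  unfolding v_def by (intro continuous_intros Fc Av_continuous qc sc that)
 have inner: "at t within {R0..L} = at t" if "R0 < t" "t < L" for t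
  by (rule at_within_interior) (use that in auto)
 have dv: "(sol lam has_real_derivative v lam t / F t) (at t)"
  "(v lam has_real_derivative - (m t * (?q lam t * sol lam t))) (at t)"
  if "lam : {-K..0}" "R0 < t" "t < L" for lam t
  using dsol[OF that(1), of t] inner[OF that(2,3)] that F_pos[of t] unfolding v_def by auto
 define C2 where "C2 = (6 * M * C + Bd) * F L / 6"
 have C0: "0 <= C" unfolding C_def using Bd0 RL by simp
 have lipv: "abs (v lam t - v lam' t) <= C2 * abs (lam - lam')"
  if l: "lam : {-K..0}" "lam' : {-K..0}" and t: "t : {R0..L}" for lam lam' t
 proof -
  have c: "continuous_on {R0..L} (%x. ?q lam x * sol lam x)" if "lam : {-K..0}" for lam
   by (intro continuous_intros qc sc that)
  have cd: "continuous_on {R0..L} (%x. ?q lam' x * sol lam' x - ?q lam x * sol lam x)"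
   by (intro continuous_intros c l)
  have "v lam t - v lam' t = integral {R0..t} (%x. m x * (?q lam' x * sol lam' x - ?q lam x * sol lam x))"
   unfolding v_int[OF t] right_diff_distrib[of "m _"]
   using integral_diff[OF m_integrable[OF c[OF l(2)] t] m_integrable[OF c[OF l(1)] t]] by simp
  also have "abs ... <= ((6 * M * C + Bd) * abs (lam - lam')) * F t / 6"
  proof (rule m_integral_bound[OF cd t])
   fix x assume x: "x : {R0..t}"
   hence xL: "x : {R0..L}" using t by auto
   have "?q lam' x * sol lam' x - ?q lam x * sol lam x = ?q lam x * (sol lam' x - sol lam x) + (lam' - lam) * sol lam' x"
    by (simp add: algebra_simps)
   also have "abs ... <= abs (?q lam x) * abs (sol lam' x - sol lam x) + abs (lam' - lam) * abs (sol lam' x)"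
    by (rule order_trans[OF abs_triangle_ineq]) (simp add: abs_mult)
   also have "... <= 6 * M * (C * abs (lam' - lam)) + abs (lam' - lam) * Bd"
    using qM[OF l(1) xL] lip[OF l(2,1) xL] sB[OF l(2) xL] M by (intro add_mono mult_mono) auto
   finally show "abs (?q lam' x * sol lam' x - ?q lam x * sol lam x) <= (6 * M * C + Bd) * abs (lam - lam')"
    by (simp add: algebra_simps abs_minus_commute)
  qed
  also have "... <= ((6 * M * C + Bd) * abs (lam - lam')) * F L / 6"
   using F_increasing[of t L] t C0 Bd0 M by (cases "t = L") (auto intro!: divide_right_mono mult_left_mono)
  finally show ?thesis unfolding C2_def by (simp add: algebra_simps)
 qed
 let ?R = "{R0..L} \<times> {-K..0}"
 \<comment> \<open>The pair \<open>(u, F u')\<close> is a nowhere vanishing complex function on a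
   contractible rectangle, so it has a continuous logarithm; the imaginary part is an angle
   continuous in \<open>t\<close> and \<open>lam\<close> together.\<close>
 define z where "z p = Complex (sol (snd p) (fst p)) (v (snd p) (fst p))" for p
 have zc: "continuous_on ?R z"
  unfolding z_def[abs_def] Complex_eq
  by (intro continuous_intros continuous_on_Times_lipschitz[where C=C] continuous_on_Times_lipschitz[where C=C2] sc vc lip lipv) auto
 have znz: "z p ~= 0" if p: "p : ?R" for p
 proof
  assume "z p = 0"
  hence z0: "sol (snd p) (fst p) = 0" "v (snd p) (fst p) = 0" unfolding z_def by (auto simp: complex_eq_iff)
  have pl: "snd p : {-K..0}" "fst p : {R0..L}" using p by auto
  have "fst p ~= R0" using z0(1) s0[OF pl(1)] by auto
  thus False
   using no_double_zero[OF qc sc[OF pl(1)] _ dv(1)[OF pl(1)] vc[OF pl(1)] dv(2)[OF pl(1)] _ _ z0] s0[OF pl(1)] pl(2) by auto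
 qed
 have "contractible ?R" by (intro convex_imp_contractible convex_Times) auto
 then obtain g where g: "continuous_on ?R g" "!!p. p : ?R ==> z p = exp (g p)"
  using continuous_logarithm_on_contractible[OF zc _ znz] by blast
 \<comment> \<open>Subtracting the value at \<open>R0\<close>, where \<open>z = 1\<close>, fixes the
   branch: the angle starts at 0 for every \<open>lam\<close>.\<close>
 define th where "th lam t = Im (g (t, lam) - g (R0, lam))" for lam t
 define rr where "rr lam t = exp (Re (g (t, lam) - g (R0, lam)))" for lam t
 have polar: "sol lam t = rr lam t * cos (th lam t) & v lam t = rr lam t * sin (th lam t) & 0 < rr lam t"
  if l: "lam : {-K..0}" and t: "t : {R0..L}" for lam t
 proof -
  have "z (R0, lam) = 1" using s0[OF l] F0 unfolding z_def v_def by (simp add: complex_eq_iff)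
  hence "exp (g (t, lam) - g (R0, lam)) = z (t, lam)"
   using g(2)[of "(t, lam)"] g(2)[of "(R0, lam)"] l t RL by (simp add: exp_diff)
  hence "Re (exp (g (t, lam) - g (R0, lam))) = sol lam t" "Im (exp (g (t, lam) - g (R0, lam))) = v lam t"
   unfolding z_def by auto
  thus ?thesis unfolding Re_exp Im_exp th_def rr_def by simp
 qed
 have thR: "th lam R0 = 0" for lam unfolding th_def by simp
 have cth: "continuous_on {R0..L} (th lam)" if l: "lam : {-K..0}" for lam
  unfolding th_def by (intro continuous_intros continuous_on_compose2[OF g(1)]) (use l RL in auto)
 have cthL: "continuous_on {-K..0} (%lam. th lam L)"
  unfolding th_def by (intro continuous_intros continuous_on_compose2[OF g(1)]) (use RL in auto)
 have lK: "-K : {-K..0}" "0 : {-K..0}" using K by auto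
 \<comment> \<open>The Robin condition \<open>v = rho * u\<close> says that the angle equals
   \<open>th0\<close> modulo \<pi>.\<close>
 define th0 where "th0 = arctan rho"
 have th0: "0 < th0" "th0 < pi / 2" "rho = tan th0" unfolding th0_def using rho arctan_ubound by (auto simp: tan_arctan)
 have upper: "th0 < th (-K) L"
 proof -
  let ?u = "sol (-K)" and ?v = "v (-K)"
  have qn: "?q (-K) t <= - kap0" if "t : {R0..L}" for t using Wb[OF that] unfolding K_def by auto
  have u1: "1 <= ?u t" if t: "t : {R0..L}" for t
  proof -
   have "ALL t:{R0..L}. ?q (-K) t <= 0" using qn kap0(1) by force
   thus ?thesis using sol[OF lK(1)] t by blast
  qed
  have dvpos: "mm * kap0 * ?u t <= - (m t * (?q (-K) t * ?u t))" if t: "t : {R0..L}" for t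
  proof -
   have "mm * kap0 <= m t * - ?q (-K) t" using tm(2)[OF t] qn[OF t] mm kap0(1) unfolding mm_def by (intro mult_mono) auto
   hence "mm * kap0 * ?u t <= m t * - ?q (-K) t * ?u t" using u1[OF t] by (intro mult_right_mono) auto
   thus ?thesis by (simp add: algebra_simps)
  qed
  have vmono: "?v x <= ?v y" if xy: "R0 <= x" "x <= y" "y <= L" for x y
  proof (rule DERIV_nonneg_imp_increasing_open[of x y ?v])
   fix t assume t: "x < t" "t < y"
   have "0 <= mm * kap0 * ?u t" using mm kap0(1) u1[of t] t xy by (intro mult_nonneg_nonneg) auto
   also have "... <= - (m t * (?q (-K) t * ?u t))" by (rule dvpos) (use t xy in auto)
   finally show "EX d. (?v has_real_derivative d) (at t) & 0 <= d" using dv(2)[OF lK(1), of t] t xy by auto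
  qed (use xy vc[OF lK(1)] in "auto intro: continuous_on_subset")
  have vR: "?v R0 = 0" unfolding v_def using F0 by simp
  have v0: "0 <= ?v x" if "x : {R0..L}" for x using vmono[of R0 x] that vR by auto
  have umono: "?u x <= ?u y" if xy: "R0 <= x" "x <= y" "y <= L" for x y
  proof (rule DERIV_nonneg_imp_increasing_open[of x y ?u])
   fix t assume t: "x < t" "t < y"
   have "0 <= ?v t / F t" using v0[of t] F_pos[of t] t xy by (intro divide_nonneg_pos) auto
   thus "EX d. (?u has_real_derivative d) (at t) & 0 <= d" using dv(1)[OF lK(1), of t] t xy by auto
  qed (use xy sc[OF lK(1)] in "auto intro: continuous_on_subset")
  have aI: "R0 < a" "a : {R0..L}" using a a0 by auto
  obtain x1 where x1: "a < x1" "x1 < L" "?u L - ?u a = (L - a) * (?v x1 / F x1)"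
  proof (rule mvt[OF a(2), of ?u "%t. (*) (?v t / F t)"])
   show "continuous_on {a..L} ?u" by (rule continuous_on_subset[OF sc[OF lK(1)]]) (use aI in auto)
  qed (use dv(1)[OF lK(1)] aI that in "auto simp: has_field_derivative_def mult.commute")
  obtain x2 where x2: "a < x2" "x2 < L" "?v L - ?v a = (L - a) * - (m x2 * (?q (-K) x2 * ?u x2))"
  proof (rule mvt[OF a(2), of ?v "%t. (*) (- (m t * (?q (-K) t * ?u t)))"])
   show "continuous_on {a..L} ?v" by (rule continuous_on_subset[OF vc[OF lK(1)]]) (use aI in auto)
  next
   fix x assume "a < x" "x < L"
   thus "(?v has_derivative (*) (- (m x * (?q (-K) x * ?u x)))) (at x)"
    using dv(2)[OF lK(1), of x] aI unfolding has_field_derivative_def by simp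
  next
   fix x assume x: "a < x" "x < L" "?v L - ?v a = - (m x * (?q (-K) x * ?u x)) * (L - a)"
   show thesis by (rule that[OF x(1,2)]) (use x(3) in "simp only: mult.commute")
  qed
  have "?v x1 / F x1 <= ?v L / F a"
   using vmono[of x1 L] v0[of L] x1 aI a(4) F_increasing[of a x1] RL by (intro frac_le) auto
  hence "?u L - ?u a <= (L - a) * (?v L / F a)" unfolding x1(3) using a(2) by (intro mult_left_mono) auto
  also have "... = ?v L * ((L - a) / F a)" by simp
  also have "... <= ?v L * (1 / (3 * rho))" using a(3) v0[of L] RL by (intro mult_left_mono) auto
  finally have e1: "3 * rho * (?u L - ?u a) <= ?v L" using rho by (simp add: field_simps)
  have "mm * kap0 * ?u a <= mm * kap0 * ?u x2" using umono[of a x2] x2 aI mm kap0(1) by (intro mult_left_mono) auto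
  also have "... <= - (m x2 * (?q (-K) x2 * ?u x2))" by (rule dvpos) (use x2 aI in auto)
  finally have "(L - a) * (mm * kap0 * ?u a) <= ?v L - ?v a" unfolding x2(3) using a(2) by (intro mult_left_mono) auto
  moreover have "(L - a) * (mm * kap0 * ?u a) = 3 * rho * ?u a" using kap0(2) by (simp add: ac_simps)
  ultimately have e2: "3 * rho * ?u a <= ?v L" using v0[OF aI(2)] by simp
  have ua: "1 <= ?u a" "1 <= ?u L" using u1 aI RL by auto
  have "0 < rho * ?u a" using rho ua by simp
  hence big: "rho * ?u L < ?v L" using e1 e2 by (simp add: algebra_simps)
  have cpos: "0 < cos (th (-K) t)" if t: "t : {R0..L}" for t
   using polar[OF lK(1) t] u1[OF t] by (metis less_le_trans zero_less_mult_pos zero_less_one)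
  have LI: "L : {R0..L}" using RL by auto
  \<comment> \<open>Because \<open>u\<close> stays positive, the angle cannot leave the interval
    from -\<pi>/2 to \<pi>/2, and \<open>arctan\<close> recovers it from its tangent.\<close>
  have lt: "th (-K) L < pi / 2"
  proof (rule ccontr)
   assume "\<not> th (-K) L < pi / 2"
   then obtain t where "R0 <= t" "t <= L" "th (-K) t = pi / 2"
    using IVT'[of "th (-K)" R0 "pi / 2" L] thR cth[OF lK(1)] RL pi_gt_zero by (auto simp: not_less)
   thus False using cpos[of t] by (metis atLeastAtMost_iff cos_pi_half less_irrefl)
  qed
  have gt: "- (pi / 2) < th (-K) L"
  proof (rule ccontr)
   assume "\<not> - (pi / 2) < th (-K) L"
   then obtain t where "R0 <= t" "t <= L" "th (-K) t = - (pi / 2)"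
    using IVT2'[of "th (-K)" L "- (pi / 2)" R0] thR cth[OF lK(1)] RL pi_gt_zero by (auto simp: not_less)
   thus False using cpos[of t] by (metis atLeastAtMost_iff cos_minus cos_pi_half less_irrefl)
  qed
  have pL: "?u L = rr (-K) L * cos (th (-K) L)" "?v L = rr (-K) L * sin (th (-K) L)" "0 < rr (-K) L"
   using polar[OF lK(1) LI] by auto
  have "rho * cos (th (-K) L) < sin (th (-K) L)"
  proof -
   have "rr (-K) L * (rho * cos (th (-K) L)) < rr (-K) L * sin (th (-K) L)" using big unfolding pL by (simp add: ac_simps)
   thus ?thesis using pL(3) by simp
  qed
  hence "rho < tan (th (-K) L)" using cpos[OF LI] unfolding tan_def by (simp add: field_simps)
  hence "arctan rho < arctan (tan (th (-K) L))" by (simp add: arctan_less_iff)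
  thus ?thesis unfolding th0_def using arctan_tan[OF gt lt] by simp
 qed
 \<comment> \<open>Both sides satisfy the same Volterra equation with coefficient \<open>W\<close>,
   so \<open>gronwall_J\<close> applies to their difference with \<open>A = 0\<close>.\<close>
 have u0s: "u0 t = u0 R0 * sol 0 t" if t: "t : {R0..L}" for t
 proof -
  have W0: "?q 0 = W" by auto
  let ?w = "%t. u0 t - u0 R0 * sol 0 t"
  have csc: "continuous_on {R0..L} (%t. u0 R0 * sol 0 t)" by (intro continuous_intros sc lK)
  have cw: "continuous_on {R0..L} ?w" by (intro continuous_intros u0 sc lK)
  have "abs (?w t) <= 2 * 0 * exp (2 * M * (t - R0))"
  proof (rule gronwall_J[OF Wc cw _ M _ _ t])
   fix x assume x: "x : {R0..L}"
   thus "abs (W x) <= 6 * M" using qM[OF lK(2) x] by simp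
   have sc': "J W (%t. u0 R0 * sol 0 t) x = u0 R0 * J W (sol 0) x"
   proof -
    have av: "Av (%s. W s * (u0 R0 * sol 0 s)) = (%t. u0 R0 * Av (%s. W s * sol 0 s) t)"
    proof
     fix t
     have "integral {R0..t} (%s. m s * (W s * (u0 R0 * sol 0 s))) = integral {R0..t} (%s. u0 R0 * (m s * (W s * sol 0 s)))"
      by (intro integral_cong) simp
     thus "Av (%s. W s * (u0 R0 * sol 0 s)) t = u0 R0 * Av (%s. W s * sol 0 s) t"
      unfolding Av_def by simp
    qed
    show ?thesis unfolding J_def av by simp
   qed
   have "u0 R0 * sol 0 x = u0 R0 * (1 - J W (sol 0) x)" using se[OF lK(2) x, unfolded W0] by simp
   hence "u0 R0 * sol 0 x = u0 R0 - u0 R0 * J W (sol 0) x" by (simp only: right_diff_distrib mult_1_right)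
   hence "?w x = - J W ?w x"
    using zero_solution_unique[OF u0(1) Y du dY x] J_diff[OF Wc u0(1) csc x] sc' by linarith
   thus "abs (?w x) <= abs (J W ?w x) + 0" by simp
  qed auto
  thus ?thesis by simp
 qed
 have sI: "s i : {R0..L}" if "i <= l" for i
 proof -
  have "R0 <= s i" using that
  proof (induction i)
   case (Suc i) thus ?case using s(2)[of i] by simp
  qed (simp add: s(1))
  moreover have "s i <= L"
  proof -
   have "s i <= s (i + k)" if "i + k <= l" for k
    using that
   proof (induction k)
    case (Suc k) thus ?case using s(2)[of "i + k"] by simp
   qed simp
   from this[of "l - i"] show ?thesis using that s(3) by simp
  qed
  ultimately show ?thesis by simp
 qed
 \<comment> \<open>Beyond \<open>s i\<close> the angle stays below \<open>pi / 2 - i * pi\<close>.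
   At \<open>s (Suc i)\<close> the cosine vanishes, so the angle is an odd multiple of \<pi>/2
   strictly below this level, hence at least half a turn lower. The start \<open>s 0 = R0\<close>
   has angle 0.\<close>
 have lower: "th 0 (s i) <= pi / 2 - real i * pi" if "i <= l" for i
  using that
 proof (induction i)
  case 0 thus ?case using thR s(1) pi_gt_zero by simp
 next
  case (Suc i)
  let ?y = "pi / 2 - real i * pi"
  have i: "i <= l" "i < l" using Suc.prems by auto
  have I1: "s i : {R0..L}" "s (Suc i) : {R0..L}" using sI Suc.prems i by auto
  have "th 0 (s (Suc i)) < ?y"
  proof (rule angle_stays_below[OF cth[OF lK(2)] _ s(2)[OF i(2)] _ Suc.IH[OF i(1)]])
   fix t0 assume t0: "R0 <= t0" "t0 <= L" "th 0 t0 = ?y"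
   have c0: "cos (th 0 t0) = 0" unfolding t0(3) cos_zero_iff_int2 by (intro exI[of _ "- int i"]) simp
   hence "R0 ~= t0" using thR by auto
   hence r: "R0 < t0" using t0 by simp
   have "(sol 0 has_real_derivative v 0 t0 / F t0) (at t0 within {R0..L})"
    using dsol(1)[OF lK(2), of t0] t0 F_pos[OF r t0(2)] unfolding v_def by simp
   from angle_crosses_down[OF polar[OF lK(2)] cth[OF lK(2)] r t0(2) c0 this F_pos[OF r t0(2)]]
   show "EX dl>0. ALL t:{R0..L}. abs (t - t0) < dl --> (t < t0 --> ?y < th 0 t) & (t0 < t --> th 0 t < ?y)"
    unfolding t0(3) .
  qed (use I1 in auto)
  moreover obtain k where k: "th 0 (s (Suc i)) = of_int k * pi + pi / 2"
  proof -
   have "u0 R0 * sol 0 (s (Suc i)) = 0" using u0s[OF I1(2)] s(4)[of "Suc i"] Suc.prems by simp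
   hence "cos (th 0 (s (Suc i))) = 0" using polar[OF lK(2) I1(2)] u0(2) by auto
   thus thesis unfolding cos_zero_iff_int2 using that by auto
  qed
  ultimately have "of_int k * pi < - real i * pi" by simp
  hence "of_int k < - real i" using pi_gt_zero by (simp only: mult_less_cancel_right_pos)
  hence "k < - int i" by linarith
  hence "k <= - int (Suc i)" by simp
  hence "of_int k <= - real (Suc i)" by linarith
  hence "of_int k * pi <= - real (Suc i) * pi" by (rule mult_right_mono) simp
  thus ?case unfolding k by (simp add: algebra_simps)
 qed
 \<comment> \<open>For \<open>j < l\<close> the target lies between the two extreme angles: for
   parameter 0 all \<open>l\<close> zeros, including the one at \<open>L\<close>, have been passed,
   and for \<open>- K\<close> the angle exceeds \<open>th0\<close>. Different \<open>j\<close> give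
   different angles and therefore different parameters.\<close>
 have ex: "EX lam. lam : {-K..0} & th lam L = th0 - real j * pi & lam ~= 0" if j: "j < l" for j
 proof -
  have t0: "th 0 L < th0 - real j * pi"
  proof -
   have "th 0 L <= pi / 2 - real l * pi" using lower[of l] s(3) by simp
   also have "... <= pi / 2 - (real j + 1) * pi"
    using j pi_gt_zero by (intro diff_left_mono mult_right_mono) auto
   also have "... = - (pi / 2) - real j * pi" by (simp add: algebra_simps)
   also have "... < th0 - real j * pi" using th0(1) pi_gt_zero by linarith
   finally show ?thesis .
  qed
  have "th0 - real j * pi <= th (-K) L" using upper mult_nonneg_nonneg[OF of_nat_0_le_iff pi_ge_zero, of j] by linarith
  then obtain x where "-K <= x" "x <= 0" "th x L = th0 - real j * pi"
   using IVT2'[of "%lam. th lam L" 0 "th0 - real j * pi" "-K"] t0 cthL K by auto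
  thus ?thesis using t0 by (intro exI[of _ x]) auto
 qed
 then obtain Lam where Lam: "!!j. j < l ==> Lam j : {-K..0} & th (Lam j) L = th0 - real j * pi & Lam j ~= 0" by metis
 show thesis
 proof (rule that[of Lam "%j. sol (Lam j)" "%j. ?u' (Lam j)"])
  show "inj_on Lam {..<l}"
  proof (rule inj_onI)
   fix i j assume "i : {..<l}" "j : {..<l}" "Lam i = Lam j"
   hence "th0 - real i * pi = th0 - real j * pi" using Lam[of i] Lam[of j] by (metis lessThan_iff)
   thus "i = j" by simp
  qed
  fix j assume j: "j < l"
  hence lj: "Lam j : {-K..0}" "th (Lam j) L = th0 - real j * pi" "Lam j ~= 0" using Lam by auto
  show "Lam j < 0" using lj by auto
  show "sol (Lam j) R0 = 1" by (rule s0[OF lj(1)])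
  show "continuous_on {R0..L} (?u' (Lam j))" by (intro continuous_intros Av_continuous qc sc lj)
  have p: "sol (Lam j) L = rr (Lam j) L * cos (th (Lam j) L)" "v (Lam j) L = rr (Lam j) L * sin (th (Lam j) L)"
   using polar[OF lj(1), of L] RL by auto
  have c0: "cos th0 > 0" using th0 by (intro cos_gt_zero_pi) auto
  have "sin (th0 - real j * pi) = rho * cos (th0 - real j * pi)"
  proof -
   have "sin th0 = rho * cos th0" using th0(3) c0 unfolding tan_def by simp
   thus ?thesis by (simp add: sin_diff cos_diff sin_npi)
  qed
  hence "v (Lam j) L = rho * sol (Lam j) L" unfolding p lj(2) by simp
  thus "F L * ?u' (Lam j) L = rho * sol (Lam j) L" unfolding v_def .
  fix t assume t: "t : {R0..L}"
  show "(sol (Lam j) has_real_derivative ?u' (Lam j) t) (at t within {R0..L})" by (rule dsol(1)[OF lj(1) t])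
  show "((%t. F t * ?u' (Lam j) t) has_real_derivative - (m t * ((W t + Lam j) * sol (Lam j) t))) (at t within {R0..L})"
   using dsol(2)[OF lj(1) t] unfolding v_def[abs_def] .
 qed
qed

end

section \<open>Smoothness under restriction and scaling; charts of the truncation\<close>

lemma frechet_derivative_cong_open:
 assumes "open U" "x : U" "!!y. y : U ==> f y = g y"
 shows "FD f x = FD g x"
  "f differentiable (at x) \<longleftrightarrow> g differentiable (at x)"
proof -
 have evU: "\<forall>\<^sub>F y in at x. y : U" using assms(1,2) unfolding eventually_at_topological by blast
 have ev: "\<forall>\<^sub>F y in at x. f y = g y" "\<forall>\<^sub>F y in at x. g y = f y"
  using assms(3) by (auto intro: eventually_mono[OF evU])
 have "(f has_derivative D) (at x) \<longleftrightarrow> (g has_derivative D) (at x)" for D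
  using has_derivative_transform_eventually[OF _ ev(1)] has_derivative_transform_eventually[OF _ ev(2)] assms(2,3)
  by (metis UNIV_I)
 thus "FD f x = FD g x" "f differentiable (at x) \<longleftrightarrow> g differentiable (at x)"
  unfolding frechet_derivative_def differentiable_def by auto
qed

lemma C_k_on_cong:
 assumes "open U" "!!x. x : U ==> f x = g x" "C_k_on k U f"
 shows "C_k_on k U g"
 using assms(2,3)
proof (induction k arbitrary: f g)
 case 0
 thus ?case by (auto cong: continuous_on_cong)
next
 case (Suc k)
 have "C_k_on k U (%x. FD g x v)" for v
 proof (rule Suc.IH)
  show "C_k_on k U (%x. FD f x v)" using Suc.prems by auto
  show "FD f x v = FD g x v" if "x : U" for x
   using frechet_derivative_cong_open(1)[OF assms(1) that, of f g] Suc.prems(1) by simp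
 qed
 moreover have "g differentiable (at x)" if "x : U" for x
  using frechet_derivative_cong_open(2)[OF assms(1) that, of f g] Suc.prems that by simp
 ultimately show ?case by simp
qed

lemma C_k_on_scale_subset:
 assumes "open U'" "U' <= U" "C_k_on k U f"
 shows "C_k_on k U' (%x. c *\<^sub>R f x)"
 using assms(3)
proof (induction k arbitrary: f)
 case 0
 thus ?case using assms(2) by (auto intro!: continuous_intros intro: continuous_on_subset)
next
 case (Suc k)
 have d: "((%x. c *\<^sub>R f x) has_derivative (%v. c *\<^sub>R FD f x v)) (at x)" if "x : U'" for x
 proof -
  have "(f has_derivative FD f x) (at x)"
   using Suc.prems that assms(2) frechet_derivative_works by auto
  thus ?thesis by (rule has_derivative_scaleR_right)
 qed
 have "C_k_on k U' (%x. FD (%x. c *\<^sub>R f x) x v)" for v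
 proof (rule C_k_on_cong[OF assms(1)])
  show "C_k_on k U' (%x. c *\<^sub>R FD f x v)" using Suc by auto
  show "c *\<^sub>R FD f x v = FD (%x. c *\<^sub>R f x) x v" if "x : U'" for x
   using frechet_derivative_at[OF d[OF that]] by metis
 qed
 moreover have "ALL x:U'. (%x. c *\<^sub>R f x) differentiable (at x)" using d unfolding differentiable_def by blast
 ultimately show ?case by simp
qed

text \<open>Only the open ball is used, so these charts describe interior points; that the points on
  the sphere are not interior is a separate matter, settled in
  \<open>boundary_not_interior\<close>.\<close>

lemma local_param_truncation:
 fixes phi :: "real^'k => real^4"
 assumes l: "local_param A U phi" and rho: "rho > 0"
 shows "local_param (truncation A rho) {y : U. norm (phi y) < rho} (%y. (1 / rho) *\<^sub>R phi y)"
proof -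
 let ?c = "1 / rho" and ?U = "{y : U. norm (phi y) < rho}"
 obtain psi where psi: "open U" "continuous_on U phi" "continuous_on (phi ` U) psi"
  "!!x. x : U ==> psi (phi x) = x" "!!p. p : phi ` U ==> psi p : U & phi (psi p) = p"
  "openin (top_of_set A) (phi ` U)" "phi ` U <= A" using local_paramE[OF l] by metis
 have oU: "open ?U"
 proof -
  have "?U = U Int phi -` ball 0 rho" by auto
  thus ?thesis using continuous_on_open_vimage[OF psi(1)] psi(2) by (metis inf_commute open_ball)
 qed
 have c: "?c ~= 0" using rho by simp
 show ?thesis
  unfolding local_param_def
 proof (intro conjI ballI oU)
  show "smooth_on ?U (%y. ?c *\<^sub>R phi y)"
   using l C_k_on_scale_subset[OF oU, of U] unfolding local_param_def smooth_on_def by auto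
  fix x assume x: "x : ?U"
  hence xU: "x : U" by simp
  have "((%y. ?c *\<^sub>R phi y) has_derivative (%v. ?c *\<^sub>R FD phi x v)) (at x)"
   by (rule has_derivative_scaleR_right[OF local_param_has_derivative[OF l xU]])
  hence "FD (%y. ?c *\<^sub>R phi y) x = (%v. ?c *\<^sub>R FD phi x v)"
   using frechet_derivative_at by metis
  thus "inj (FD (%y. ?c *\<^sub>R phi y) x)"
   using local_param_linear(2)[OF l xU] c by (auto simp: inj_def)
 next
  have "homeomorphism ?U ((%y. ?c *\<^sub>R phi y) ` ?U) (%y. ?c *\<^sub>R phi y) (%p. psi (rho *\<^sub>R p))"
   unfolding homeomorphism_def
  proof (intro conjI)
   show "continuous_on ?U (%y. ?c *\<^sub>R phi y)" by (intro continuous_intros continuous_on_subset[OF psi(2)]) auto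
   show "continuous_on ((%y. ?c *\<^sub>R phi y) ` ?U) (%p. psi (rho *\<^sub>R p))"
    by (intro continuous_on_compose2[OF psi(3)] continuous_intros) (use rho in auto)
   show "(%p. psi (rho *\<^sub>R p)) ` (%y. ?c *\<^sub>R phi y) ` ?U = ?U"
    using rho psi(4) by (auto simp: image_iff)
  qed (use rho psi(4) in auto)
  thus "EX psi. homeomorphism ?U ((%y. ?c *\<^sub>R phi y) ` ?U) (%y. ?c *\<^sub>R phi y) psi" by blast
  obtain T where T: "open T" "phi ` U = A Int T" using psi(6) openin_open by metis
  have "(%y. ?c *\<^sub>R phi y) ` ?U = truncation A rho Int (%x. ?c *\<^sub>R x) ` (T Int ball 0 rho)"
  proof (intro subset_antisym subsetI)
   fix p assume "p : (%y. ?c *\<^sub>R phi y) ` ?U"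
   then obtain y where y: "y : U" "norm (phi y) < rho" "p = ?c *\<^sub>R phi y" by blast
   hence "phi y : A Int T" using T(2) by blast
   thus "p : truncation A rho Int (%x. ?c *\<^sub>R x) ` (T Int ball 0 rho)"
    using y unfolding truncation_def by auto
  next
   fix p assume p: "p : truncation A rho Int (%x. ?c *\<^sub>R x) ` (T Int ball 0 rho)"
   then obtain x x' where x: "x : A" "p = ?c *\<^sub>R x" "x' : T" "norm x' < rho" "p = ?c *\<^sub>R x'"
    unfolding truncation_def by (elim IntE imageE) auto
   hence "x = x'" using c by simp
   hence "x : phi ` U" using x T(2) by blast
   thus "p : (%y. ?c *\<^sub>R phi y) ` ?U" using x `x = x'` by auto
  qed
  moreover have "open ((%x. ?c *\<^sub>R x) ` (T Int ball 0 rho))" using c T(1) by (intro open_scaling) auto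
  ultimately show "openin (top_of_set (truncation A rho)) ((%y. ?c *\<^sub>R phi y) ` ?U)"
   unfolding openin_open by blast
 qed
qed

section \<open>Area measures as push-forwards\<close>

text \<open>The dimension of \<open>area_measure\<close> is carried by the types
  \<open>real^3\<close> and \<open>real^2\<close>, whereas boxes and iterated integrals are handled
  in product types; \<open>vec3\<close> and \<open>vec2\<close> translate and preserve Lebesgue
  measure.\<close>

definition vec3 :: "real3 => real^3" where
 "vec3 z = fst z *\<^sub>R axis 1 1 + fst (snd z) *\<^sub>R axis 2 1 + snd (snd z) *\<^sub>R axis 3 1"

definition vec2 :: "real \<times> real => real^2" where
 "vec2 z = fst z *\<^sub>R axis 1 1 + snd z *\<^sub>R axis 2 1"

lemma vec3_nth [simp]: "vec3 z $ 1 = fst z" "vec3 z $ 2 = fst (snd z)" "vec3 z $ 3 = snd (snd z)"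
 unfolding vec3_def by (simp_all add: axis_def)

lemma vec2_nth [simp]: "vec2 z $ 1 = fst z" "vec2 z $ 2 = snd z"
 unfolding vec2_def by (simp_all add: axis_def)

lemma vec2_eta: "vec2 (y $ 1, y $ 2) = y" by (simp add: vec_eq_iff forall_2)

lemma vec3_measurable [measurable]: "vec3 : borel_measurable borel"
 unfolding vec3_def[abs_def] by (intro borel_measurable_continuous_onI continuous_intros)
lemma vec2_measurable [measurable]: "vec2 : borel_measurable borel"
 unfolding vec2_def[abs_def] by (intro borel_measurable_continuous_onI continuous_intros)

lemma Basis_real3: "(Basis :: (real^3) set) = {axis 1 1, axis 2 1, axis 3 1}"
 unfolding Basis_vec_def by (auto simp: UNIV_3)
lemma Basis_real2: "(Basis :: (real^2) set) = {axis 1 1, axis 2 1}"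
 unfolding Basis_vec_def by (auto simp: UNIV_2)

lemma lborel_vec3: "distr lborel borel vec3 = lborel"
proof (rule lborel_eqI[symmetric])
 fix l u :: "real^3" assume le: "!!b. b : Basis ==> l \<bullet> b <= u \<bullet> b"
 hence le': "l $ 1 <= u $ 1" "l $ 2 <= u $ 2" "l $ 3 <= u $ 3"
  using le[of "axis 1 1"] le[of "axis 2 1"] le[of "axis 3 1"] by (simp_all add: Basis_real3 inner_axis)
 have "emeasure (distr lborel borel vec3) (box l u) = emeasure lborel (vec3 -` box l u)"
  by (subst emeasure_distr) auto
 also have "vec3 -` box l u = box (l $ 1, l $ 2, l $ 3) (u $ 1, u $ 2, u $ 3)"
  by (auto simp: box_def Basis_real3 inner_axis Basis_prod_def)
 also have "emeasure lborel ... = (\<Prod>b\<in>Basis. ((u $ 1, u $ 2, u $ 3) - (l $ 1, l $ 2, l $ 3)) \<bullet> b)"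
  using le' by (subst emeasure_lborel_box) (auto simp: Basis_prod_def)
 also have "(\<Prod>b\<in>Basis. ((u $ 1, u $ 2, u $ 3) - (l $ 1, l $ 2, l $ 3)) \<bullet> b) = (\<Prod>b\<in>Basis. (u - l) \<bullet> b)"
  by (simp add: Basis_prod_def Basis_real3 inner_axis axis_eq_axis image_Un)
 finally show "emeasure (distr lborel borel vec3) (box l u) = (\<Prod>b\<in>Basis. (u - l) \<bullet> b)" .
qed simp

lemma lborel_vec2: "distr lborel borel vec2 = lborel"
proof (rule lborel_eqI[symmetric])
 fix l u :: "real^2" assume le: "!!b. b : Basis ==> l \<bullet> b <= u \<bullet> b"
 hence le': "l $ 1 <= u $ 1" "l $ 2 <= u $ 2"
  using le[of "axis 1 1"] le[of "axis 2 1"] by (simp_all add: Basis_real2 inner_axis)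
 have "emeasure (distr lborel borel vec2) (box l u) = emeasure lborel (vec2 -` box l u)"
  by (subst emeasure_distr) auto
 also have "vec2 -` box l u = box (l $ 1, l $ 2) (u $ 1, u $ 2)"
  by (auto simp: box_def Basis_real2 inner_axis Basis_prod_def)
 also have "emeasure lborel ... = (\<Prod>b\<in>Basis. ((u $ 1, u $ 2) - (l $ 1, l $ 2)) \<bullet> b)"
  using le' by (subst emeasure_lborel_box) (auto simp: Basis_prod_def)
 also have "(\<Prod>b\<in>Basis. ((u $ 1, u $ 2) - (l $ 1, l $ 2)) \<bullet> b) = (\<Prod>b\<in>Basis. (u - l) \<bullet> b)"
  by (simp add: Basis_prod_def Basis_real2 inner_axis axis_eq_axis)
 finally show "emeasure (distr lborel borel vec2) (box l u) = (\<Prod>b\<in>Basis. (u - l) \<bullet> b)" .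
qed simp

text \<open>\<open>J\<close> identifies the parameter domain, a product, with \<open>\<real>\<^sup>k\<close>.\<close>

lemma area_measure_eq_distr:
 fixes Phi :: "real^'k::{finite,wellorder} => real^'n" and J :: "'e::euclidean_space => real^'k::{finite,wellorder}"
  and M :: "(real^'n) set" and K :: "'k itself"
 assumes V: "open V" "!!x. x : V ==> Phi differentiable (at x)" "inj_on Phi V"
   "continuous_on V (jacobian Phi)" "Phi ` V <= mfd_interior K M"
  and null: "EX N. N : null_sets (area_measure K M) & mfd_interior K M - Phi ` V <= N"
  and J: "J : borel_measurable borel" "distr lborel borel J = lborel"
  and B: "open B" "!!z. J z : V \<longleftrightarrow> z : B"
  and w: "w : borel_measurable borel" "!!z. z : B ==> w z = jacobian Phi (J z)"
  and Psi: "!!z. z : B ==> Psi z = Phi (J z)"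
 shows "Psi : measurable (density (restrict_space lborel B) (%z. ennreal (w z))) (area_measure K M)"
  and "area_measure K M = distr (density (restrict_space lborel B) (%z. ennreal (w z))) (area_measure K M) Psi"
proof -
 let ?mu = "area_measure K M" and ?W = "mfd_interior K M"
 let ?N = "density (restrict_space lborel B) (%z. ennreal (w z))"
 have spW: "space ?mu = ?W"
  using sets_eq_imp_space_eq[OF sets_area_measure[of K M]] by (simp add: space_restrict_space)
 have contV: "continuous_on V Phi"
  by (metis V(1,2) at_within_open continuous_on_eq_continuous_within differentiable_imp_continuous_within)
 have pre: "{x : V. Phi x : S} : sets borel" if S: "S : sets ?mu" for S
 proof -
  obtain S' where S': "S' : sets borel" "S = ?W Int S'" using S by (auto simp: sets_area_measure sets_restrict_space)
  have m: "Phi : borel_measurable (restrict_space borel V)" by (rule borel_measurable_continuous_on_restrict[OF contV])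
  have "Phi -` S' Int space (restrict_space borel V) : sets (restrict_space borel V)" by (rule measurable_sets[OF m S'(1)])
  moreover have "Phi -` S' Int space (restrict_space borel V) = {x : V. Phi x : S}"
   using V(5) by (auto simp: S'(2) space_restrict_space)
  ultimately show ?thesis using V(1) by (simp add: sets_restrict_space_iff)
 qed
 have preJ: "{z : B. Psi z : S} : sets borel" and preJ_eq: "{z : B. Psi z : S} = J -` {x : V. Phi x : S}"
  if S: "S : sets ?mu" for S
 proof -
  show e: "{z : B. Psi z : S} = J -` {x : V. Phi x : S}" using B(2) Psi by auto
  show "{z : B. Psi z : S} : sets borel" unfolding e using measurable_sets[OF J(1) pre[OF S]] by simp
 qed
 show m: "Psi : measurable ?N ?mu"
 proof (rule measurableI)
  fix z assume "z : space ?N"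
  hence "z : B" by (simp add: space_restrict_space)
  thus "Psi z : space ?mu" unfolding spW using Psi B(2) V(5) by auto
 next
  fix S assume S: "S : sets ?mu"
  have "Psi -` S Int space ?N = {z : B. Psi z : S}" by (auto simp: space_restrict_space)
  thus "Psi -` S Int space ?N : sets ?N" using preJ[OF S] B(1) by (auto simp: sets_restrict_space_iff)
 qed
 show "?mu = distr ?N ?mu Psi"
 proof (rule measure_eqI)
  fix S assume S: "S : sets ?mu"
  let ?E = "{x : V. Phi x : S}"
  have im: "Phi ` ?E : sets ?mu & emeasure ?mu (Phi ` ?E) = (\<integral>\<^sup>+x\<in>?E. ennreal (jacobian Phi x) \<partial>lborel)"
   by (rule area_measure_image[OF V pre[OF S]]) auto
  obtain N where N: "N : null_sets ?mu" "?W - Phi ` V <= N" using null by blast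
  have SW: "S <= ?W" using sets.sets_into_space[OF S] spW by simp
  have "emeasure ?mu S = emeasure ?mu (Phi ` ?E)"
  proof (rule antisym)
   have "S <= Phi ` ?E Un N" using SW N(2) by auto
   hence "emeasure ?mu S <= emeasure ?mu (Phi ` ?E Un N)" using im N(1) by (intro emeasure_mono) auto
   also have "... = emeasure ?mu (Phi ` ?E)" using im N(1) by (intro emeasure_Un_null_set) auto
   finally show "emeasure ?mu S <= emeasure ?mu (Phi ` ?E)" .
   show "emeasure ?mu (Phi ` ?E) <= emeasure ?mu S" using S by (intro emeasure_mono) auto
  qed
  also have "... = (\<integral>\<^sup>+x. ennreal (jacobian Phi x) * indicator ?E x \<partial>distr lborel borel J)" using im J(2) by simp
  also have "... = (\<integral>\<^sup>+z. ennreal (jacobian Phi (J z)) * indicator ?E (J z) \<partial>lborel)"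
  proof -
   have "(%x. ennreal (jacobian Phi x) * indicator ?E x) = (%x. ennreal (indicator V x * jacobian Phi x) * indicator ?E x)"
    by (auto simp: fun_eq_iff split: split_indicator)
   moreover have "(%x. indicator V x * jacobian Phi x) : borel_measurable borel"
    using borel_measurable_continuous_on_indicator[of V "jacobian Phi"] V(1,4) by simp
   ultimately have "(%x. ennreal (jacobian Phi x) * indicator ?E x) : borel_measurable borel"
    using pre[OF S] by simp
   thus ?thesis using J(1) by (subst nn_integral_distr) simp_all
  qed
  also have "... = (\<integral>\<^sup>+z. ennreal (w z) * indicator {z : B. Psi z : S} z \<partial>lborel)"
   unfolding preJ_eq[OF S] using w(2) B(2) by (intro nn_integral_cong) (auto split: split_indicator)
  also have "... = (\<integral>\<^sup>+z. (ennreal (w z) * indicator {z : B. Psi z : S} z) * indicator B z \<partial>lborel)"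
   by (intro nn_integral_cong) (auto split: split_indicator)
  also have "... = (\<integral>\<^sup>+z. ennreal (w z) * indicator {z : B. Psi z : S} z \<partial>restrict_space lborel B)"
   using B(1) by (intro nn_integral_restrict_space[symmetric]) auto
  also have "... = emeasure ?N {z : B. Psi z : S}"
  proof (rule emeasure_density[symmetric])
   show "(%z. ennreal (w z)) : borel_measurable (restrict_space lborel B)"
    using w(1) by (intro measurable_restrict_space1) simp
   show "{z : B. Psi z : S} : sets (restrict_space lborel B)"
    using preJ[OF S] B(1) by (auto simp: sets_restrict_space_iff)
  qed
  also have "{z : B. Psi z : S} = Psi -` S Int space ?N" by (auto simp: space_restrict_space)
  also have "emeasure ?N ... = emeasure (distr ?N ?mu Psi) S" using m S by (intro emeasure_distr[symmetric]) auto
  finally show "emeasure ?mu S = emeasure (distr ?N ?mu Psi) S" .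
 qed simp
qed

text \<open>\<open>C_k_on\<close> recurses through directional derivatives, so the induction needs a
  whole family closed under them. It is applied to polynomials and to trigonometric
  combinations.\<close>

lemma C_k_on_closed_family:
 assumes "!!f x. f : FF ==> f differentiable (at x)"
  and "!!f v. f : FF ==> (%x. FD f x v) : FF" and "f : FF"
 shows "C_k_on k U f"
 using assms(3)
proof (induction k arbitrary: f)
 case 0
 hence "continuous (at x) f" for x using assms(1) differentiable_imp_continuous_within by blast
 thus ?case by (simp add: continuous_at_imp_continuous_on)
next
 case (Suc k)
 thus ?case using assms(1,2) by simp
qed

lemma real_polynomial_function_derivative:
 fixes p :: "'a::euclidean_space => real"
 assumes "real_polynomial_function p"
 shows "EX p'. (ALL x. (p has_derivative p' x) (at x)) & (ALL v. real_polynomial_function (%x. p' x v))"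
 using assms
proof (induction rule: real_polynomial_function.induct)
 case (linear f)
 thus ?case by (intro exI[of _ "%_. f"]) (auto simp: bounded_linear_imp_has_derivative)
next
 case (const c)
 thus ?case by (intro exI[of _ "%_ _. 0"]) auto
next
 case (add f g)
 then obtain f' g' where "!!x. (f has_derivative f' x) (at x)" "!!v. real_polynomial_function (%x. f' x v)"
  "!!x. (g has_derivative g' x) (at x)" "!!v. real_polynomial_function (%x. g' x v)" by metis
 thus ?case by (intro exI[of _ "%x v. f' x v + g' x v"]) (auto intro!: has_derivative_add)
next
 case (mult f g)
 then obtain f' g' where "!!x. (f has_derivative f' x) (at x)" "!!v. real_polynomial_function (%x. f' x v)"
  "!!x. (g has_derivative g' x) (at x)" "!!v. real_polynomial_function (%x. g' x v)" by metis
 thus ?case using mult.hyps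
  by (intro exI[of _ "%x v. f x * g' x v + f' x v * g x"] conjI allI has_derivative_mult real_polynomial_function.intros(3,4)) auto
qed

lemma smooth_on_real_polynomial_function:
 fixes p :: "'a::euclidean_space => real"
 assumes "real_polynomial_function p"
 shows "smooth_on U p"
 unfolding smooth_on_def
proof
 fix k
 show "C_k_on k U p"
 proof (rule C_k_on_closed_family[of "{p. real_polynomial_function p}"])
  fix f :: "'a => real" and v assume "f : {p. real_polynomial_function p}"
  then obtain f' where f': "!!x. (f has_derivative f' x) (at x)" "!!v. real_polynomial_function (%x. f' x v)"
   using real_polynomial_function_derivative by blast
  thus "f differentiable (at x)" for x unfolding differentiable_def by blast
  have "FD f x = f' x" for x using frechet_derivative_at[OF f'(1)] by metis
  thus "(%x. FD f x v) : {p. real_polynomial_function p}" using f'(2) by simp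
 qed (use assms in simp)
qed

lemma real_polynomial_function_norm_square: "real_polynomial_function (%x::'a::euclidean_space. (norm x)^2)"
proof -
 have "(%x::'a. (norm x)^2) = (%x. \<Sum>b\<in>Basis. (x \<bullet> b) * (x \<bullet> b))"
  by (subst fun_eq_iff) (metis euclidean_inner power2_norm_eq_inner)
 thus ?thesis
  by (simp only:) (intro real_polynomial_function_sum finite_Basis real_polynomial_function.intros(4) real_polynomial_function.intros(1) bounded_linear_inner_left)
qed

text \<open>Weierstrass is applied to \<open>U'\<close> and the polynomial is integrated;
  approximation of \<open>U\<close> itself would give no control over derivatives.\<close>

lemma polynomial_C1_approximation:
 fixes U :: "real => real"
 assumes ab: "a < b" and dU: "!!t. t : {a..b} ==> (U has_real_derivative U' t) (at t within {a..b})"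
  and c: "continuous_on {a..b} U'" and e: "0 < e"
 obtains p p' where "real_polynomial_function p" "!!t. (p has_real_derivative p' t) (at t)"
  "!!t. t : {a..b} ==> abs (U t - p t) <= e" "!!t. t : {a..b} ==> abs (U' t - p' t) <= e"
proof -
 define d where "d = min e (e / (b - a))"
 have d: "0 < d" "d <= e" "d * (b - a) <= e" using ab e by (auto simp: d_def min_def field_simps)
 obtain q where q: "real_polynomial_function q" "!!t. t : {a..b} ==> abs (U' t - q t) < d"
  using Stone_Weierstrass_real_polynomial_function[OF compact_Icc c d(1)] by metis
 obtain k N where k: "q = (%x. \<Sum>i\<le>N. k i * x ^ i)" using q(1) real_polynomial_function_iff_sum by metis
 define p0 where "p0 = (%x. \<Sum>i\<le>N. k i / (Suc i) * x ^ Suc i)"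
 have dp0: "(p0 has_real_derivative q t) (at t)" for t
 proof -
  have "((%x. k i / (Suc i) * x ^ Suc i) has_real_derivative k i * t ^ i) (at t)" for i
   by (rule DERIV_cong[OF DERIV_cmult[OF DERIV_pow]]) simp
  thus ?thesis unfolding p0_def k by (intro DERIV_sum) auto
 qed
 define p where "p = (%t. U a - p0 a + p0 t)"
 have dp: "(p has_real_derivative q t) (at t)" for t unfolding p_def by (auto intro!: derivative_eq_intros dp0)
 have "real_polynomial_function p" unfolding p_def p0_def
  by (intro real_polynomial_function.intros real_polynomial_function_sum real_polynomial_function_power) auto
 moreover have "abs (U t - p t) <= e" if t: "t : {a..b}" for t
 proof -
  have "norm ((U t - p t) - (U a - p a)) <= d * norm (t - a)"
  proof (rule differentiable_bound[where S="{a..b}"])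
   show "((%t. U t - p t) has_derivative (*) (U' s - q s)) (at s within {a..b})" if "s : {a..b}" for s
    using DERIV_diff[OF dU[OF that] has_field_derivative_at_within[OF dp]] unfolding has_field_derivative_def .
   show "onorm ((*) (U' s - q s)) <= d" if "s : {a..b}" for s
    using q(2)[OF that] by (intro onorm_bound) (auto simp: abs_mult d(1) less_imp_le intro!: mult_right_mono)
  qed (use t ab in auto)
  hence "abs (U t - p t) <= d * (t - a)" using t by (simp add: p_def)
  also have "... <= d * (b - a)" using t d(1) by auto
  finally show ?thesis using d(3) by linarith
 qed
 moreover have "abs (U' t - q t) <= e" if "t : {a..b}" for t using q(2)[OF that] d(2) by linarith
 ultimately show ?thesis using that dp by blast
qed

lemma Arg_cos_sin: "a > 0 ==> - pi < y ==> y <= pi ==> Arg (Complex (a * cos y) (a * sin y)) = y"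
 by (rule Arg_unique[of a y]) (auto simp: exp_Euler complex_eq_iff cos_of_real sin_of_real)

lemma cos_sin_Arg: "z ~= 0 ==> Complex (cmod z * cos (Arg z)) (cmod z * sin (Arg z)) = z"
 using rcis_cmod_Arg[of z] by (simp add: rcis_def cis.ctr complex_eq_iff)

lemma continuous_on_Complex [continuous_intros]:
 "continuous_on S f ==> continuous_on S g ==> continuous_on S (%x. Complex (f x) (g x))"
 unfolding Complex_eq by (intro continuous_intros)

section \<open>Charts of the torus orbits\<close>

context plane_frame begin

lemma tan_comb_eq: "x *\<^sub>R tan1 al + y *\<^sub>R tan2 be = x' *\<^sub>R tan1 al + y' *\<^sub>R tan2 be ==> x = x' & y = y'"
 by (metis (no_types, lifting) inner_add_left inner_scaleR_left mult.right_neutral mult_zero_right add.right_neutral add.left_neutral tan_inner(1-4))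

lemma cyl_smooth: "smooth_on U (%y::real^2. cyl a e (al0 + y $ 1) (be0 + y $ 2))"
  and cyl_angles_derivative: "((%y::real^2. cyl a e (al0 + y $ 1) (be0 + y $ 2)) has_derivative
   (%v. (a * v $ 1) *\<^sub>R tan1 (al0 + x $ 1) + (e * v $ 2) *\<^sub>R tan2 (be0 + x $ 2))) (at x)"
proof -
 \<comment> \<open>This family, with arbitrary coefficient vectors, is closed under directional
   derivatives, which \<open>cyl\<close> with fixed radii is not.\<close>
 define T where "T = (%(u1::real^4) u2 u3 u4 (y::real^2). cos (al0 + y $ 1) *\<^sub>R u1 + sin (al0 + y $ 1) *\<^sub>R u2 + cos (be0 + y $ 2) *\<^sub>R u3 + sin (be0 + y $ 2) *\<^sub>R u4)"
 have dT: "(T u1 u2 u3 u4 has_derivative (%v. T (v $ 1 *\<^sub>R u2) (- v $ 1 *\<^sub>R u1) (v $ 2 *\<^sub>R u4) (- v $ 2 *\<^sub>R u3) x)) (at x)" for u1 u2 u3 u4 x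
 proof -
  have l: "((%y::real^2. c + y $ i) has_derivative (%v. v $ i)) (at x)" for c i
   by (rule has_derivative_eq_rhs[OF has_derivative_add[OF has_derivative_const bounded_linear_imp_has_derivative[OF bounded_linear_vec_nth]]]) simp
  have d: "((%y::real^2. cos (c + y $ i) *\<^sub>R u) has_derivative (%v. (v $ i * - sin (c + x $ i)) *\<^sub>R u)) (at x)"
   "((%y::real^2. sin (c + y $ i) *\<^sub>R u) has_derivative (%v. (v $ i * cos (c + x $ i)) *\<^sub>R u)) (at x)" for c i and u :: "real^4"
   by (rule has_derivative_scaleR_left[OF has_derivative_eq_rhs[OF has_derivative_cos[OF l]]]
    has_derivative_scaleR_left[OF has_derivative_eq_rhs[OF has_derivative_sin[OF l]]]; simp)+
  show ?thesis unfolding T_def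
   by (rule has_derivative_eq_rhs[OF has_derivative_add[OF has_derivative_add[OF has_derivative_add[OF d(1,2)] d(1)] d(2)]])
    (simp add: fun_eq_iff mult.commute)
 qed
 have cyl: "(%y. cyl a e (al0 + y $ 1) (be0 + y $ 2)) = T (a *\<^sub>R f1) (a *\<^sub>R f2) (e *\<^sub>R f3) (e *\<^sub>R f4)"
  unfolding T_def cyl_def cmb_def by (auto simp: fun_eq_iff algebra_simps)
 show "smooth_on U (%y. cyl a e (al0 + y $ 1) (be0 + y $ 2))"
  unfolding smooth_on_def
 proof
  fix k
  show "C_k_on k U (%y. cyl a e (al0 + y $ 1) (be0 + y $ 2))"
  proof (rule C_k_on_closed_family[of "{T u1 u2 u3 u4 | u1 u2 u3 u4. True}"])
   fix f :: "real^2 => real^4" and v assume "f : {T u1 u2 u3 u4 | u1 u2 u3 u4. True}"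
   then obtain u1 u2 u3 u4 where f: "f = T u1 u2 u3 u4" by auto
   show "f differentiable (at x)" for x unfolding f differentiable_def using dT by blast
   have "FD f x v = T (v $ 1 *\<^sub>R u2) (- v $ 1 *\<^sub>R u1) (v $ 2 *\<^sub>R u4) (- v $ 2 *\<^sub>R u3) x" for x
    by (simp add: f frechet_derivative_at[OF dT, symmetric])
   thus "(%x. FD f x v) : {T u1 u2 u3 u4 | u1 u2 u3 u4. True}" by auto
  qed (use cyl in auto)
 qed
 show "((%y. cyl a e (al0 + y $ 1) (be0 + y $ 2)) has_derivative
   (%v. (a * v $ 1) *\<^sub>R tan1 (al0 + x $ 1) + (e * v $ 2) *\<^sub>R tan2 (be0 + x $ 2))) (at x)"
  unfolding cyl using dT[of "a *\<^sub>R f1" "a *\<^sub>R f2" "e *\<^sub>R f3" "e *\<^sub>R f4" x]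
  by (rule has_derivative_eq_rhs) (auto simp: T_def tan1_def tan2_def cmb_def fun_eq_iff algebra_simps)
qed

text \<open>Once the base angles are rotated to 0, the inverse is \<open>Arg\<close> in each plane.
  It is continuous off the nonpositive reals, and this slit is exactly what the strict bounds on the
  angles leave out.\<close>

lemma torus_chart:
 assumes "a > 0" "e > 0"
 shows "local_param {cyl a e al be | al be. True} {y::real^2. abs (y $ 1) < pi & abs (y $ 2) < pi} (%y. cyl a e (al0 + y $ 1) (be0 + y $ 2))"
  (is "local_param ?T ?U ?phi")
proof -
 define q where "q = rot (- al0) (- be0)"
 define z1 where "z1 = (%p. Complex (q p \<bullet> f1) (q p \<bullet> f2))"
 define z2 where "z2 = (%p. Complex (q p \<bullet> f3) (q p \<bullet> f4))"
 define psi where "psi = (%p. vec2 (Arg (z1 p), Arg (z2 p)))"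
 have cq: "continuous_on UNIV q" unfolding q_def using linear_rot linear_continuous_on linear_conv_bounded_linear by blast
 have cz: "continuous_on UNIV z1" "continuous_on UNIV z2" unfolding z1_def z2_def by (intro continuous_intros cq)+
 have qc: "q (cyl a e al be) = cyl a e (al - al0) (be - be0)" for al be unfolding q_def rot_cyl by (simp add: algebra_simps)
 have z: "z1 (cyl a e al be) = Complex (a * cos (al - al0)) (a * sin (al - al0))"
  "z2 (cyl a e al be) = Complex (e * cos (be - be0)) (e * sin (be - be0))" for al be
  unfolding z1_def z2_def qc by (auto simp: cyl_def)
 have Arg_z: "Arg (z1 (?phi y)) = y $ 1" "Arg (z2 (?phi y)) = y $ 2" if "y : ?U" for y
  unfolding z using that assms by (auto intro!: Arg_cos_sin simp: abs_less_iff)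
 have psiphi: "psi (?phi y) = y" if "y : ?U" for y
  unfolding psi_def Arg_z[OF that] by (rule vec2_eta)
 define O' where "O' = {p. z1 p ~: \<real>\<^sub>\<le>\<^sub>0 & z2 p ~: \<real>\<^sub>\<le>\<^sub>0}"
 have O': "open O'"
 proof -
  have "open (z1 -` (- \<real>\<^sub>\<le>\<^sub>0))" "open (z2 -` (- \<real>\<^sub>\<le>\<^sub>0))"
   using cz by (simp_all add: continuous_on_open_vimage[OF open_UNIV, simplified] open_Compl)
  moreover have "O' = z1 -` (- \<real>\<^sub>\<le>\<^sub>0) Int z2 -` (- \<real>\<^sub>\<le>\<^sub>0)" unfolding O'_def by auto
  ultimately show ?thesis by auto
 qed
 have notR: "Complex x y ~: \<real>\<^sub>\<le>\<^sub>0 \<longleftrightarrow> Arg (Complex x y) < pi & Complex x y ~= 0" for x y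
  using Arg_le_pi[of "Complex x y"] Arg_eq_pi[of "Complex x y"]
  by (auto simp: complex_nonpos_Reals_iff complex_eq_iff less_le)
 have nz: "Complex (r * cos t) (r * sin t) ~= 0" if "r > 0" for r t
  using that sin_zero_abs_cos_one[of t] by (auto simp: complex_eq_iff)
 have im: "?phi ` ?U = ?T Int O'"
 proof (intro subset_antisym subsetI)
  fix p assume "p : ?phi ` ?U"
  then obtain y where y: "y : ?U" "p = ?phi y" by auto
  have "z1 p ~: \<real>\<^sub>\<le>\<^sub>0" "z2 p ~: \<real>\<^sub>\<le>\<^sub>0"
   using Arg_z[OF y(1)] y nz assms unfolding y(2) z notR by auto
  thus "p : ?T Int O'" using y(2) unfolding O'_def by auto
 next
  fix p assume p: "p : ?T Int O'"
  then obtain al be where ab: "p = cyl a e al be" by auto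
  have cm0: "cmod (Complex (r * cos t) (r * sin t)) = r" if "r > 0" for r t
   using that by (simp add: cmod_def power_mult_distrib flip: distrib_left)
  have cm: "cmod (z1 p) = a" "cmod (z2 p) = e"
   unfolding ab z using assms cm0 by auto
  have zp: "Complex (a * cos (Arg (z1 p))) (a * sin (Arg (z1 p))) = z1 p"
   "Complex (e * cos (Arg (z2 p))) (e * sin (Arg (z2 p))) = z2 p"
   using cos_sin_Arg[of "z1 p"] cos_sin_Arg[of "z2 p"] cm assms by auto
  let ?y = "vec2 (Arg (z1 p), Arg (z2 p))"
  have lt: "Arg (z1 p) < pi" "Arg (z2 p) < pi" using p notR unfolding O'_def z1_def z2_def by auto
  hence y: "?y : ?U" using mpi_less_Arg[of "z1 p"] mpi_less_Arg[of "z2 p"] by (auto simp: abs_less_iff)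
  have "q (?phi ?y) = cyl a e (Arg (z1 p)) (Arg (z2 p))" unfolding qc by simp
  also have "... = q p"
   using zp unfolding z1_def z2_def cyl_def by (metis cmb_expand complex.sel)
  finally have "?phi ?y = p" unfolding q_def using rot_inverse'[of al0 be0] by metis
  from this[symmetric] y show "p : ?phi ` ?U" by (rule image_eqI)
 qed
 have fd: "FD ?phi x = (%v. (a * v $ 1) *\<^sub>R tan1 (al0 + x $ 1) + (e * v $ 2) *\<^sub>R tan2 (be0 + x $ 2))" for x
  using frechet_derivative_at[OF cyl_angles_derivative] by metis
 have cphi: "continuous_on ?U ?phi"
  by (intro continuous_at_imp_continuous_on ballI has_derivative_continuous[OF cyl_angles_derivative])
 show ?thesis unfolding local_param_def
 proof (intro conjI ballI cyl_smooth)
  show "open ?U" by (intro open_Collect_conj open_Collect_less continuous_intros)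
  fix x show "inj (FD ?phi x)"
  proof (rule injI)
   fix v w assume "FD ?phi x v = FD ?phi x w"
   hence "a * v $ 1 = a * w $ 1 & e * v $ 2 = e * w $ 2" unfolding fd by (rule tan_comb_eq)
   thus "v = w" using assms by (auto simp: vec_eq_iff forall_2)
  qed
 next
  have "homeomorphism ?U (?phi ` ?U) ?phi psi"
   unfolding homeomorphism_def
  proof (intro conjI cphi)
   show "continuous_on (?phi ` ?U) psi"
   proof -
    have "continuous_on O' (%p. Arg (z1 p))" "continuous_on O' (%p. Arg (z2 p))"
     unfolding continuous_on_eq_continuous_at[OF O']
     using cz by (auto simp: O'_def continuous_on_eq_continuous_at intro: isCont_o2 continuous_at_Arg)
    hence "continuous_on O' psi" unfolding psi_def vec2_def by (auto intro!: continuous_intros)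
    thus ?thesis using im continuous_on_subset by blast
   qed
  qed (use psiphi in "auto simp: image_iff")
  thus "EX psi. homeomorphism ?U (?phi ` ?U) ?phi psi" by blast
  show "openin (top_of_set ?T) (?phi ` ?U)" unfolding im using O' openin_open_Int by blast
 qed
qed

lemma mfd_interior_torus:
 assumes "a > 0" "e > 0"
 shows "mfd_interior TYPE(2) {cyl a e al be | al be. True} = {cyl a e al be | al be. True}" (is "_ = ?T")
proof
 show "mfd_interior TYPE(2) ?T <= ?T"
  unfolding mfd_interior_def local_param_def using openin_imp_subset by blast
 show "?T <= mfd_interior TYPE(2) ?T"
 proof
  fix p assume "p : ?T"
  then obtain al be where p: "p = cyl a e al be" by auto
  have "p : (%y. cyl a e (al + y $ 1) (be + y $ 2)) ` {y::real^2. abs (y $ 1) < pi & abs (y $ 2) < pi}"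
   by (rule image_eqI[of _ _ 0]) (auto simp: p)
  thus "p : mfd_interior TYPE(2) ?T" unfolding mfd_interior_def using torus_chart[OF assms] by blast
 qed
qed

end

text \<open>The three identities are \<open>F' = 6 * m\<close>, \<open>u0' = Y0 / F\<close> and
  \<open>Y0' = - (m * W * u0)\<close> in terms of the functions defined below. With the curvatures
  \<open>u = p / x\<close> and \<open>v = q / e\<close> as unknowns everything is polynomial,
  subject to the single relation \<open>u^2 * x^2 + v^2 * e^2 = 1\<close>.\<close>

lemma profile_algebra:
 fixes x e p q D :: real
 assumes x: "x > 0" and e: "e > 0" and D: "D = e * p - x * q" "D > 0" and N: "p^2 + q^2 = 1"
 defines "k \<equiv> - (p / x + q / e)"
 defines "dx \<equiv> - q / (2 * D)" and "de \<equiv> p / (2 * D)"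
 shows "2 * ((dx * e + de * x) * D + (de * p + k * dx * e - (dx * q + k * de * x)) * (x * e)) = 6 * (x * e / (2 * D))"
  and "dx * p + k * dx * x + (de * q + k * de * e) = ((x * q) * (x * q) - (e * p) * (e * p)) / (2 * x * e * D)"
  and "(dx * q + k * de * x) * (x * q) + (dx * q + k * de * x) * (x * q) - ((de * p + k * dx * e) * (e * p) + (de * p + k * dx * e) * (e * p)) =
   - (x * e / (2 * D) * (((p / x + q / e)^2 + (p / x)^2 + (q / e)^2) * (x * p + e * q)))"
proof -
 define a u v where "a = 1 / (2 * D)" "u = p / x" "v = q / e"
 have 1: "p = u * x" "q = v * e" "2 * a * D = 1" using x e D(2) unfolding a_u_v_def by auto
 have D': "D = x * e * (u - v)" unfolding D(1) 1(1,2) by (simp add: algebra_simps)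
 have 2: "dx = - v * e * a" "de = u * x * a" "k = - (u + v)"
  unfolding dx_def de_def k_def using x e by (auto simp: a_u_v_def)
 have 3: "x * e / (2 * D) = x * e * a" unfolding a_u_v_def by simp
 have 4: "y / (2 * x * e * D) = y * a / (x * e)" for y unfolding a_u_v_def by simp
 have 5: "p / x = u" "q / e = v" unfolding a_u_v_def by auto
 have N': "u^2 * x^2 + v^2 * e^2 = 1" using N unfolding 1(1,2) by (simp add: power_mult_distrib)
 show "2 * ((dx * e + de * x) * D + (de * p + k * dx * e - (dx * q + k * de * x)) * (x * e)) = 6 * (x * e / (2 * D))"
  unfolding 3 unfolding 2 D' 1(1,2) using N' by algebra
 have "(dx * p + k * dx * x + (de * q + k * de * e)) * (x * e) = ((x * q) * (x * q) - (e * p) * (e * p)) * a"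
  unfolding 2 1(1,2) by algebra
 thus "dx * p + k * dx * x + (de * q + k * de * e) = ((x * q) * (x * q) - (e * p) * (e * p)) / (2 * x * e * D)"
  unfolding 4 using x e by (metis mult_pos_pos nonzero_mult_div_cancel_right less_numeral_extra(3))
 show "(dx * q + k * de * x) * (x * q) + (dx * q + k * de * x) * (x * q) - ((de * p + k * dx * e) * (e * p) + (de * p + k * dx * e) * (e * p)) =
   - (x * e / (2 * D) * (((p / x + q / e)^2 + (p / x)^2 + (q / e)^2) * (x * p + e * q)))"
 proof -
  have s: "dx * q + k * de * x = - a * (1 + u * v * x^2)" "de * p + k * dx * e = a * (1 + u * v * e^2)"
   unfolding 2 1(1,2) N'[symmetric] by algebra+
  have "((u + v)^2 + u^2 + v^2) * (x * (u * x) + e * (v * e)) =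
   2 * ((u + v) * (u^2 * x^2 + v^2 * e^2) + u * v * (v * x^2 + u * e^2))" by algebra
  hence "((u + v)^2 + u^2 + v^2) * (x * (u * x) + e * (v * e)) = 2 * (u + v + u * v * (v * x^2 + u * e^2))"
   unfolding N' by simp
  thus ?thesis unfolding 3 5 s unfolding 1(1,2) by algebra
 qed
qed

section \<open>Coefficients of the radial Jacobi equation\<close>

context rotational_profile begin

definition D :: "real => real" where "D t = eta t * N1 t - xi t * N2 t"
text \<open>The curvature in the direction of the first orbit circle, continued to the circular
  orbit by its limit.\<close>

definition k2 :: "real => real" where "k2 t = (if t <= b^2 then 1 / (2 * b) else N1 t / xi t)"
text \<open>For \<open>t > b^2\<close> this is \<open>xi * eta / (2 * D)\<close>, the area element
  in \<open>t\<close> and the two angles; cancelling \<open>xi\<close> makes it continuous and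
  positive at \<open>b^2\<close>. The same rewriting turns \<open>2 * xi * eta * D\<close> into the
  formula for \<open>F\<close> below.\<close>

definition m :: "real => real" where "m t = eta t / (2 * (eta t * k2 t - N2 t))"
definition W :: "real => real" where "W t = (k2 t + N2 t / eta t)^2 + (k2 t)^2 + (N2 t / eta t)^2"
definition F :: "real => real" where "F t = 2 * (xi t)^2 * eta t * (eta t * k2 t - N2 t)"
definition u0 :: "real => real" where "u0 t = xi t * N1 t + eta t * N2 t"
text \<open>This is \<open>F u0'\<close> for the support function \<open>u0\<close>, in a form
  without denominators that is visibly 0 at \<open>b^2\<close>.\<close>

definition Y0 :: "real => real" where "Y0 t = (xi t * N2 t) * (xi t * N2 t) - (eta t * N1 t) * (eta t * N1 t)"

lemma bpos2: "0 < b^2" using b_pos by simp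

lemma D_pos': "b^2 < t ==> 0 < D t" using D_pos unfolding D_def .

lemma k2_continuous: "continuous_on {b^2..} k2"
 unfolding continuous_on_def
proof
 fix t assume t: "t : {b^2..}"
 show "(k2 \<longlongrightarrow> k2 t) (at t within {b^2..})"
 proof (cases "t = b^2")
  case True
  have "(k2 \<longlongrightarrow> 1 / (2 * b)) (at_right (b^2))"
   using start_lim by (rule Lim_transform_within[where d=1]) (auto simp: k2_def dist_real_def)
  thus ?thesis using True by (simp add: k2_def at_within_Ici_at_right)
 next
  case False
  hence t: "t : {b^2<..}" using t by auto
  have "continuous_on {b^2<..} (%t. N1 t / xi t)"
   using xi_pos by (intro continuous_intros continuous_on_subset[OF profile_cont(1)] continuous_on_subset[OF profile_cont(3)]) force+
  hence "continuous_on {b^2<..} k2" by (rule continuous_on_eq) (auto simp: k2_def)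
  hence "isCont k2 t" using t continuous_on_eq_continuous_at open_greaterThan by blast
  thus ?thesis by (simp add: isCont_def Lim_at_imp_Lim_at_within)
 qed
qed

lemma k2_D: "b^2 < t ==> eta t * k2 t - N2 t = D t / xi t"
 using xi_pos[of t] unfolding k2_def D_def by (simp add: field_simps)

lemma denom_pos: "b^2 <= t ==> 0 < eta t * k2 t - N2 t"
 using k2_D[of t] D_pos'[of t] xi_pos[of t] start b_pos by (cases "t = b^2") (auto simp: k2_def)

lemma m_eq: "b^2 < t ==> m t = xi t * eta t / (2 * D t)"
 and F_eq: "b^2 < t ==> F t = 2 * xi t * eta t * D t"
 using k2_D[of t] D_pos'[of t] xi_pos[of t] unfolding m_def F_def by (auto simp: power2_eq_square)

lemma F_start: "F (b^2) = 0" unfolding F_def by (simp add: start)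

lemma m_pos: "b^2 <= t ==> 0 < m t"
 unfolding m_def using denom_pos eta_pos by simp

lemma profile_continuous: "continuous_on {b^2..} m" "continuous_on {b^2..} F" "continuous_on {b^2..} W"
 "continuous_on {b^2..} u0" "continuous_on {b^2..} Y0"
 unfolding m_def F_def W_def u0_def Y0_def using denom_pos eta_pos
 by (intro continuous_intros profile_cont k2_continuous; force)+

lemma profile_eqs:
 assumes t: "b^2 < t"
 shows "(F has_real_derivative 6 * m t) (at t)" "(u0 has_real_derivative Y0 t / F t) (at t)"
  "(Y0 has_real_derivative - (m t * (W t * u0 t))) (at t)"
proof -
 note d = profile_deriv[OF t, folded D_def]
 note a = profile_algebra[OF xi_pos[OF t] eta_pos[OF less_imp_le[OF t]] D_def D_pos'[OF t] N_unit[OF less_imp_le[OF t]]]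
 have dD: "(D has_real_derivative N1 t / (2 * D t) * N1 t + - (N1 t / xi t + N2 t / eta t) * (- N2 t / (2 * D t)) * eta t -
   (- N2 t / (2 * D t) * N2 t + - (N1 t / xi t + N2 t / eta t) * (N1 t / (2 * D t)) * xi t)) (at t)"
  using DERIV_diff[OF DERIV_mult[OF d(2,3)] DERIV_mult[OF d(1,4)]] unfolding D_def[symmetric] .
 have "((%t. 2 * (xi t * eta t * D t)) has_real_derivative 6 * m t) (at t)"
  unfolding m_eq[OF t] by (rule DERIV_cong[OF DERIV_cmult[OF DERIV_mult[OF DERIV_mult[OF d(1,2)] dD]] a(1)])
 moreover have ev: "\<forall>\<^sub>F s in nhds t. 2 * (xi s * eta s * D s) = F s"
  by (rule eventually_mono[OF eventually_nhds_in_open[OF open_greaterThan[of "b^2"]]]) (use t F_eq in auto)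
 ultimately show "(F has_real_derivative 6 * m t) (at t)" using DERIV_cong_ev[OF refl ev refl] by blast
 show "(u0 has_real_derivative Y0 t / F t) (at t)"
  unfolding u0_def Y0_def F_eq[OF t]
  by (rule DERIV_cong[OF DERIV_add[OF DERIV_mult[OF d(1,3)] DERIV_mult[OF d(2,4)]] a(2)])
 have W: "W t = (N1 t / xi t + N2 t / eta t)^2 + (N1 t / xi t)^2 + (N2 t / eta t)^2"
  using t unfolding W_def k2_def by simp
 show "(Y0 has_real_derivative - (m t * (W t * u0 t))) (at t)"
  unfolding Y0_def W m_eq[OF t] u0_def
  by (rule DERIV_cong[OF DERIV_diff[OF DERIV_mult[OF DERIV_mult[OF d(1,4)] DERIV_mult[OF d(1,4)]]
     DERIV_mult[OF DERIV_mult[OF d(2,3)] DERIV_mult[OF d(2,3)]]] a(3)])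
qed

lemma profile_sturm_data: "b^2 < L ==> sturm_data (b^2) L F m W"
 by unfold_locales (auto intro: continuous_on_subset[OF profile_continuous(1)] continuous_on_subset[OF profile_continuous(2)]
   continuous_on_subset[OF profile_continuous(3)] m_pos profile_eqs F_start)

end

text \<open>The geometry is set up for any radius above \<open>b\<close>; that \<open>rho^2\<close>
  is a zero of \<open>u0\<close> enters only when eigenvalues are counted.\<close>

locale truncated_profile = rotational_profile +
 fixes rho :: real
 assumes b_less: "b < rho"
begin

definition Sig :: "(real^4) set" where "Sig = truncation A rho"
definition Psi :: "real => real => real => real^4" where "Psi t al be = cyl (xi t / rho) (eta t / rho) al be"
definition nuSig :: "real^4 => real^4" where "nuSig x = n (rho *\<^sub>R x)"
definition L :: real where "L = rho^2"

lemma rho_pos: "0 < rho" using b_less b_pos by simp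
lemma L_gt: "b^2 < L" unfolding L_def using b_less b_pos by (simp add: power_strict_mono)

lemma Psi_scale: "Psi t al be = (1 / rho) *\<^sub>R cyl (xi t) (eta t) al be" "rho *\<^sub>R Psi t al be = cyl (xi t) (eta t) al be"
 unfolding Psi_def cyl_scale using rho_pos by simp_all

lemma cyl_norm2: "b^2 <= t ==> (norm (cyl (xi t) (eta t) al be))^2 = t"
 unfolding cyl_norm by (rule radius)

lemma Psi_norm: "b^2 <= t ==> L * (norm (Psi t al be))^2 = t"
 unfolding Psi_scale L_def using rho_pos cyl_norm2[of t] by (simp add: power_divide)

lemma Psi_t_eq: "Psi t al be = Psi t' al' be' ==> b^2 <= t ==> b^2 <= t' ==> t = t'" using Psi_norm by metis

lemma cyl_norm_le: "b^2 <= t ==> norm (cyl (xi t) (eta t) al be) <= rho \<longleftrightarrow> t <= L"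
 using cyl_norm2[of t al be] rho_pos unfolding L_def by (metis abs_le_square_iff abs_norm_cancel abs_of_pos)

lemma Sig_eq: "Sig = {Psi t al be | t al be. b^2 <= t & t <= L}"
proof (intro subset_antisym subsetI)
 fix p assume "p : Sig"
 then obtain x where x: "x : A" "norm x <= rho" "p = (1 / rho) *\<^sub>R x" unfolding Sig_def truncation_def by auto
 then obtain t al be where "x = cyl (xi t) (eta t) al be" "b^2 <= t" unfolding A_eq by auto
 thus "p : {Psi t al be | t al be. b^2 <= t & t <= L}" using x cyl_norm_le Psi_scale by auto
next
 fix p assume "p : {Psi t al be | t al be. b^2 <= t & t <= L}"
 then obtain t al be where p: "p = Psi t al be" "b^2 <= t" "t <= L" by auto
 have "cyl (xi t) (eta t) al be : A Int {x. norm x <= rho}" using p cyl_norm_le A_eq by auto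
 thus "p : Sig" unfolding Sig_def truncation_def p(1) Psi_scale(1) by (rule imageI)
qed

lemma scale_Sig: "p : Sig ==> rho *\<^sub>R p : A"
 unfolding Sig_eq using Psi_scale(2) A_eq by fastforce

lemma nu_Psi: "b^2 <= t ==> nuSig (Psi t al be) = cyl (N1 t) (N2 t) al be"
 unfolding nuSig_def Psi_scale(2) by (rule n_eq)

lemma Psi_interior:
 assumes t: "b^2 <= t" "t < L"
 shows "Psi t al be : mfd_int Sig"
proof -
 let ?x = "cyl (xi t) (eta t) al be"
 have "?x : A" using t A_eq by auto
 then obtain U :: "(real^3) set" and phi y where U: "local_param A U phi" "y : U" "?x = phi y"
  using embA unfolding embedded_submanifold_def mfd_interior_def by blast
 have "(norm ?x)^2 < rho^2" using cyl_norm2[of t] t L_def by simp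
 hence "norm (phi y) < rho" using U(3) rho_pos power2_less_imp_less by fastforce
 hence "y : {y : U. norm (phi y) < rho}" using U by simp
 moreover have "Psi t al be = (1 / rho) *\<^sub>R phi y" unfolding Psi_scale U(3) ..
 ultimately show ?thesis
  unfolding Sig_def mfd_interior_def using local_param_truncation[OF U(1) rho_pos] by blast
qed

lemma unit_normal_Sig: "unit_normal Sig nuSig"
 unfolding unit_normal_def
proof (intro conjI ballI)
 show "continuous_on Sig nuSig" unfolding nuSig_def
  using unitA scale_Sig unfolding unit_normal_def
  by (intro continuous_on_compose2[of A n Sig "%x. rho *\<^sub>R x"] continuous_on_scaleR continuous_on_const continuous_on_id) auto
 fix p assume p: "p : Sig"
 show "norm (nuSig p) = 1" using unitA scale_Sig[OF p] unfolding unit_normal_def nuSig_def by blast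
 fix v assume "v : tangent_space Sig p"
 then obtain U :: "(real^3) set" and phi x w where U: "local_param Sig U phi" "x : U" "phi x = p" "v = FD phi x w"
  unfolding tangent_space_def by auto
 have *: "open U" "phi ` U <= Sig" using U(1) openin_imp_subset unfolding local_param_def by blast+
 have "rho *\<^sub>R FD phi x w : tangent_space A (rho *\<^sub>R phi x)"
 proof (rule tangent_space_curve[of "%y. rho *\<^sub>R phi y" x A U "%w. rho *\<^sub>R FD phi x w" w])
  show "rho *\<^sub>R phi x : mfd_int A"
   using embA scale_Sig p U(3) unfolding embedded_submanifold_def by blast
  show "((%y. rho *\<^sub>R phi y) has_derivative (%w. rho *\<^sub>R FD phi x w)) (at x)"
   by (rule has_derivative_scaleR_right[OF local_param_has_derivative[OF U(1,2)]])
 qed (use * scale_Sig U(2) in auto)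
 hence "n (rho *\<^sub>R p) \<bullet> (rho *\<^sub>R v) = 0"
  using unitA scale_Sig[OF p] U(3,4) unfolding unit_normal_def by blast
 thus "nuSig p \<bullet> v = 0" unfolding nuSig_def using rho_pos by simp
qed

text \<open>If such a point were interior, the squared norm would be maximal there and hence
  critical along the hypersurface, and the position would be normal. But the meridian tangent has
  inner product \<open>D L / rho > 0\<close> with the position: \<open>A\<close> crosses the sphere
  transversally.\<close>

lemma boundary_not_interior: "Psi L al be ~: mfd_int Sig"
proof
 assume p: "Psi L al be : mfd_int Sig"
 let ?p = "Psi L al be" and ?v = "cyl (- N2 L) (N1 L) al be"
 obtain U :: "(real^3) set" and phi x where U: "local_param Sig U phi" "x : U" "phi x = ?p"
  using p unfolding mfd_interior_def by auto
 have *: "open U" "phi ` U <= Sig" using U(1) openin_imp_subset unfolding local_param_def by blast+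
 let ?d = "FD phi x"
 have bd: "phi y \<bullet> phi y <= phi x \<bullet> phi x" if y: "y : U" for y
 proof -
  obtain t al' be' where t: "phi y = Psi t al' be'" "b^2 <= t" "t <= L" using *(2) y unfolding Sig_eq by blast
  have "L * (norm (phi y))^2 <= L * (norm (phi x))^2" unfolding U(3) t(1) Psi_norm[OF t(2)] Psi_norm[OF less_imp_le[OF L_gt]] by (rule t(3))
  thus ?thesis using L_gt bpos2 by (simp add: power2_norm_eq_inner)
 qed
 have "((%y. phi y \<bullet> phi y) has_derivative (%w. phi x \<bullet> ?d w + ?d w \<bullet> phi x)) (at x)"
  by (rule has_derivative_inner[OF local_param_has_derivative[OF U(1,2)] local_param_has_derivative[OF U(1,2)]])
 hence "(%w. phi x \<bullet> ?d w + ?d w \<bullet> phi x) = (%_. 0)"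
  using bd by (intro differential_zero_maxmin[OF U(2) *(1)]) auto
 from fun_cong[OF this] have z: "?p \<bullet> ?d w = 0" for w using U(3) by (simp add: inner_commute)
 have "?v : tangent_space Sig ?p"
  unfolding normal_tangential_deriv(4)[OF p unit_normal_Sig] using nu_Psi[of L] L_gt by (simp add: cyl_inner)
 then obtain w where "?v = ?d w" using tangent_space_chart[OF U(1,2)] U(3) by auto
 hence "?p \<bullet> ?v = 0" using z by simp
 moreover have "?p \<bullet> ?v = D L / rho" unfolding Psi_def cyl_inner D_def by (simp add: diff_divide_distrib algebra_simps)
 ultimately show False using D_pos'[OF L_gt] rho_pos by simp
qed

lemma interior_Sig: "mfd_int Sig = {Psi t al be | t al be. b^2 <= t & t < L}"
proof (intro subset_antisym subsetI)
 fix p assume p: "p : mfd_int Sig"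
 hence "p : Sig" unfolding mfd_interior_def local_param_def using openin_imp_subset by blast
 then obtain t al be where "p = Psi t al be" "b^2 <= t" "t <= L" unfolding Sig_eq by auto
 thus "p : {Psi t al be | t al be. b^2 <= t & t < L}"
  using p boundary_not_interior less_le by blast
qed (use Psi_interior in auto)

lemma boundary_Sig: "mfd_boundary TYPE(3) Sig = {Psi L al be | al be. True}"
 unfolding mfd_boundary_def interior_Sig unfolding Sig_eq using L_gt Psi_t_eq[of L] by (fastforce simp: less_le)

text \<open>Dilation by \<open>1 / rho\<close> multiplies curvatures by \<open>rho\<close>. Off the
  circular orbit the meridian curvature is read off from the profile equations; on it two curvatures
  coincide, and \<open>axial_curvatures\<close> takes over.\<close>

lemma second_ff_Sig:
 assumes t: "b^2 <= t" "t < L"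
 shows "second_ff_norm2 Sig nuSig (Psi t al be) = rho^2 * W t"
proof (cases "t = b^2")
 case False
 hence t': "b^2 < t" using t by simp
 note d = profile_deriv[OF t', folded D_def]
 let ?k = "- (N1 t / xi t + N2 t / eta t)" and ?dx = "- N2 t / (2 * D t)" and ?de = "N1 t / (2 * D t)"
 have ne: "?dx ~= 0 \<or> ?de ~= 0" using N_unit[OF t(1)] D_pos'[OF t'] by auto
 obtain kap where kap: "(N1 has_real_derivative kap * (?dx / rho)) (at t)" "(N2 has_real_derivative kap * (?de / rho)) (at t)"
  "second_ff_norm2 Sig nuSig (cyl (xi t / rho) (eta t / rho) al be) = kap^2 + (N1 t / (xi t / rho))^2 + (N2 t / (eta t / rho))^2"
  apply (rule rotational_curvatures[of "%t. xi t / rho" t "%t. eta t / rho" al be Sig nuSig "{b^2<..<L}" N1 N2 "?dx / rho" "?de / rho"])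
  subgoal using Psi_interior[OF t] unfolding Psi_def .
  subgoal by (rule unit_normal_Sig)
  subgoal by simp
  subgoal using t t' by simp
  subgoal for s al be unfolding Sig_eq Psi_def by fastforce
  subgoal for s al be using nu_Psi[of s al be] unfolding Psi_def by simp
  subgoal using xi_pos[OF t'] rho_pos by simp
  subgoal using eta_pos[OF t(1)] rho_pos by simp
  subgoal by (rule DERIV_cdivide[OF d(1)])
  subgoal by (rule DERIV_cdivide[OF d(2)])
  subgoal using ne rho_pos by auto
  subgoal premises prems for kap by (rule prems(1)[of kap]) (fact prems)+
  done
 have "kap * (?dx / rho) = ?k * ?dx" "kap * (?de / rho) = ?k * ?de"
  using DERIV_unique[OF kap(1) d(3)] DERIV_unique[OF kap(2) d(4)] by auto
 hence "(kap - rho * ?k) * ?dx = 0" "(kap - rho * ?k) * ?de = 0" using rho_pos by (auto simp: field_simps)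
 hence "kap = rho * ?k" using ne by auto
 show ?thesis unfolding Psi_def kap(3) `kap = rho * ?k` W_def k2_def using t'
  by (simp only: power_mult_distrib power2_minus) (simp add: power_mult_distrib power_divide algebra_simps)
next
 case True
 obtain eps h M1 M2 where ax: "eps > 0" "!!s al be. abs s < eps ==> cyl s (h s) al be : A & n (cyl s (h s) al be) = cyl (M1 s) (M2 s) al be"
   "h 0 = b" "(h has_real_derivative 0) (at 0)" "M1 0 = 0" "M2 0 = -1"
   "(M1 has_real_derivative 1 / (2 * b)) (at 0)" "(M2 has_real_derivative 0) (at 0)"
  using axis_curve by metis
 have "isCont h 0" using ax(4) DERIV_isCont by blast
 hence "((%s. s^2 + (h s)^2) \<longlongrightarrow> 0^2 + b^2) (at 0)" using ax(3) unfolding isCont_def by (intro tendsto_intros) auto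
 hence "\<forall>\<^sub>F s in at 0. s^2 + (h s)^2 < L" using L_gt by (intro order_tendstoD(2)) auto
 then obtain d where d: "d > 0" "!!s. abs s < d ==> s^2 + (h s)^2 < L"
  unfolding eventually_at using ax(3) L_gt by (auto simp: dist_real_def) (metis abs_zero power_zero_numeral add_0)
 let ?e = "min eps d / rho"
 have e: "0 < ?e" "!!s. abs s < ?e ==> abs (rho * s) < eps & abs (rho * s) < d"
  using ax(1) d(1) rho_pos by (auto simp: abs_mult field_simps)
 have sc: "cyl s (h (rho * s) / rho) al be = (1 / rho) *\<^sub>R cyl (rho * s) (h (rho * s)) al be" for s al be
  unfolding cyl_scale using rho_pos by simp
 have lin: "((%s. rho * s) has_real_derivative rho) (at 0)" by (auto intro!: derivative_eq_intros)
 have ch: "((%s. f (rho * s)) has_real_derivative f' * rho) (at 0)" if "(f has_real_derivative f') (at 0)" for f f'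
  by (rule DERIV_chain2[OF _ lin]) (use that in simp)
 have "second_ff_norm2 Sig nuSig (cyl 0 (b / rho) 0 be) = 2 * (rho / (2 * b))^2 + (M2 (rho * 0) / (b / rho))^2"
 proof (rule axial_curvatures(2)[of _ _ _ _ ?e "%s. h (rho * s) / rho" "%s. M1 (rho * s)" "%s. M2 (rho * s)"])
  show "cyl 0 (b / rho) 0 be : mfd_int Sig"
   using Psi_interior[OF t, of 0 be] True start unfolding Psi_def by simp
  fix s al be assume s: "abs s < ?e"
  note s' = e(2)[OF s]
  have "(norm (cyl (rho * s) (h (rho * s)) al be))^2 < rho^2" unfolding cyl_norm using d(2)[of "rho * s"] s' L_def by simp
  hence "norm (cyl (rho * s) (h (rho * s)) al be) <= rho" using rho_pos power2_less_imp_less by fastforce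
  thus "cyl s (h (rho * s) / rho) al be : Sig" unfolding sc Sig_def truncation_def using ax(2) s' by auto
  show "nuSig (cyl s (h (rho * s) / rho) al be) = cyl (M1 (rho * s)) (M2 (rho * s)) al be"
   unfolding sc nuSig_def using ax(2) s' rho_pos by simp
 next
  show "((%s. h (rho * s) / rho) has_real_derivative 0) (at 0)" using DERIV_cdivide[OF ch[OF ax(4)], of rho] by simp
  show "((%s. M1 (rho * s)) has_real_derivative rho / (2 * b)) (at 0)" using ch[OF ax(7)] by simp
  show "((%s. M2 (rho * s)) has_real_derivative 0) (at 0)" using ch[OF ax(8)] by simp
 qed (use unit_normal_Sig e b_pos rho_pos ax in auto)
 moreover have "Psi t al be = cyl 0 (b / rho) 0 be" unfolding Psi_def True start by (simp add: start cyl_def)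
 moreover have "2 * (rho / (2 * b))^2 + (M2 (rho * 0) / (b / rho))^2 = rho^2 * W t"
  unfolding W_def k2_def True start using ax(6) b_pos by (simp add: start field_simps power2_eq_square)
 ultimately show ?thesis by simp
qed

end

text \<open>Strict positivity of \<open>w\<close> on \<open>B\<close> makes the weighted measure and
  Lebesgue measure share their null sets, so statements almost everywhere pass in both
  directions.\<close>

lemma pushforward_facts:
 fixes B :: "'e::euclidean_space set" and w :: "'e => real" and mu :: "'b measure"
 assumes B: "open B" and w: "w : borel_measurable borel" "!!z. z : B ==> 0 < w z"
  and Psi: "Psi : measurable (density (restrict_space lborel B) (%z. ennreal (w z))) mu"
  and mu: "mu = distr (density (restrict_space lborel B) (%z. ennreal (w z))) mu Psi"
 shows pushforward_measurable: "Psi : measurable (restrict_space lborel B) mu"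
  and pushforward_nn_integral: "f : borel_measurable mu ==> (\<integral>\<^sup>+p. f p \<partial>mu) = (\<integral>\<^sup>+z. ennreal (w z) * f (Psi z) \<partial>restrict_space lborel B)"
  and pushforward_integral: "!!h :: 'b => real. h : borel_measurable mu ==> (LINT p|mu. h p) = (LINT z|restrict_space lborel B. w z * h (Psi z))"
  and pushforward_AE: "{p : space mu. P p} : sets mu ==> (AE p in mu. P p) \<longleftrightarrow> (AE z in restrict_space lborel B. P (Psi z))"
proof -
 let ?R = "restrict_space lborel B"
 have w': "w : borel_measurable ?R" using w(1) by (intro measurable_restrict_space1) simp
 show m: "Psi : measurable ?R mu" using Psi by (simp add: measurable_def)
 have AEw: "AE z in ?R. 0 <= w z" using w(2) by (intro AE_I2) (auto simp: space_restrict_space less_imp_le)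
 show "(\<integral>\<^sup>+p. f p \<partial>mu) = (\<integral>\<^sup>+z. ennreal (w z) * f (Psi z) \<partial>?R)" if f: "f : borel_measurable mu"
 proof -
  have "(\<integral>\<^sup>+p. f p \<partial>mu) = (\<integral>\<^sup>+p. f p \<partial>distr (density ?R (%z. ennreal (w z))) mu Psi)" using mu by simp
  also have "... = (\<integral>\<^sup>+z. f (Psi z) \<partial>density ?R (%z. ennreal (w z)))" by (rule nn_integral_distr[OF Psi]) (use f in simp)
  also have "... = (\<integral>\<^sup>+z. ennreal (w z) * f (Psi z) \<partial>?R)"
   by (rule nn_integral_density) (use w' measurable_compose[OF m f] in auto)
  finally show ?thesis .
 qed
 show "(LINT p|mu. h p) = (LINT z|?R. w z * h (Psi z))" if h: "h : borel_measurable mu" for h :: "'b => real"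
 proof -
  have "(LINT p|mu. h p) = (LINT p|distr (density ?R (%z. ennreal (w z))) mu Psi. h p)" using mu by simp
  also have "... = (LINT z|density ?R (%z. ennreal (w z)). h (Psi z))" by (rule integral_distr[OF Psi]) (use h in simp)
  also have "... = (LINT z|?R. w z *\<^sub>R h (Psi z))"
   by (rule integral_density) (use w' AEw measurable_compose[OF m h] in auto)
  finally show ?thesis by simp
 qed
 show "(AE p in mu. P p) \<longleftrightarrow> (AE z in ?R. P (Psi z))" if P: "{p : space mu. P p} : sets mu"
 proof -
  have "(AE p in mu. P p) \<longleftrightarrow> (AE p in distr (density ?R (%z. ennreal (w z))) mu Psi. P p)"
   by (rule arg_cong[OF mu, where f="%M. almost_everywhere M P"])
  also have "... \<longleftrightarrow> (AE z in density ?R (%z. ennreal (w z)). P (Psi z))" by (rule AE_distr_iff[OF Psi]) (use P in simp)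
  also have "... \<longleftrightarrow> (AE z in ?R. 0 < ennreal (w z) --> P (Psi z))" by (rule AE_density) (use w' in simp)
  also have "... \<longleftrightarrow> (AE z in ?R. P (Psi z))" using w(2) by (intro AE_cong) (auto simp: space_restrict_space)
  finally show ?thesis .
 qed
qed

lemma angle_eq:
 assumes "cos (a + x) = cos (a + y)" "sin (a + x) = sin (a + y)" "abs x < pi" "abs y < pi"
 shows "x = (y::real)"
proof -
 obtain k :: int where k: "a + x = a + y + 2 * pi * k" using assms(1,2) sin_cos_eq_iff[of "a + x" "a + y"] by auto
 hence "abs (2 * pi * k) < 2 * pi" using assms(3,4) by linarith
 hence "abs (real_of_int k) < 1" by (simp add: abs_mult)
 thus ?thesis using k by simp
qed

lemma null_sets_hyperplane:
 fixes i :: "'k::finite"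
 assumes "E : sets borel" "E <= {y :: real^'k. y $ i = 0 \<or> y $ j = 0}"
 shows "E : null_sets lborel"
proof -
 have "negligible {y :: real^'k. y \<bullet> axis i 1 = 0}" "negligible {y :: real^'k. y \<bullet> axis j 1 = 0}"
  by (intro negligible_standard_hyperplane; force simp: Basis_vec_def)+
 hence "negligible ({y :: real^'k. y \<bullet> axis i 1 = 0} Un {y. y \<bullet> axis j 1 = 0})" by (rule negligible_Un)
 hence "negligible E" by (rule negligible_subset) (use assms(2) in "auto simp: inner_axis")
 thus ?thesis using assms(1) by (simp add: negligible_iff_null_sets null_sets_completion_iff)
qed

text \<open>In the chart the curve becomes the differentiable image of a subset of the line, in a
  space of dimension at least 2.\<close>

lemma chart_preimage_curve_negligible:
 fixes M :: "(real^'n) set" and g :: "real => real^'n" and phi :: "real^'k => real^'n"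
 assumes l: "local_param M U phi" and g: "!!s. g differentiable (at s)" "range g <= M" and k: "1 < CARD('k)"
 shows "negligible {y : U. phi y : range g}"
proof -
 obtain psi where psi: "!!x. x : U ==> psi (phi x) = x" "!!p. p : phi ` U ==> psi p : U & phi (psi p) = p"
  using local_paramE[OF l] by metis
 have "(%s. psi (g s)) differentiable_on {s. g s : phi ` U}"
  unfolding differentiable_on_def
 proof
  fix s assume "s : {s. g s : phi ` U}"
  hence s: "psi (g s) : U" "phi (psi (g s)) = g s" using psi(2) by auto
  obtain g' where g': "(g has_derivative g') (at s)" using g(1) unfolding differentiable_def by blast
  obtain tau' where "((%s. psi (g s)) has_derivative tau') (at s)"
   using chart_lift[OF l open_UNIV UNIV_I s g' g(2), of "%s. psi (g s)"] psi(2) by blast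
  thus "(%s. psi (g s)) differentiable (at s within {s. g s : phi ` U})"
   unfolding differentiable_def using has_derivative_at_withinI by blast
 qed
 hence "negligible ((%s. psi (g s)) ` {s. g s : phi ` U})"
  using k by (intro negligible_differentiable_image_lowdim) auto
 moreover have "{y : U. phi y : range g} <= (%s. psi (g s)) ` {s. g s : phi ` U}"
  using psi(1) by (force simp: image_iff)
 ultimately show ?thesis by (rule negligible_subset)
qed

text \<open>Meant for the circular orbit, where the parametrisation by \<open>t\<close> and the
  angles degenerates. By compactness finitely many charts suffice.\<close>

lemma compact_curve_null:
 fixes M :: "(real^'n) set" and g :: "real => real^'n" and K :: "'k::{finite,wellorder} itself"
 assumes g: "!!s. g differentiable (at s)" "range g <= mfd_interior K M" "compact (range g)" and k: "1 < CARD('k)"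
 shows "range g : null_sets (area_measure K M)"
proof -
 have IM: "mfd_interior K M <= M" unfolding mfd_interior_def local_param_def using openin_imp_subset by blast
 have "EX T. open T & p : T & range g Int T : null_sets (area_measure K M)" if p: "p : range g" for p
 proof -
  obtain U :: "(real^'k::_) set" and phi where U: "local_param M U phi" "p : phi ` U"
   using p g(2) unfolding mfd_interior_def by auto
  obtain psi where psi: "open U" "inj_on phi U" "continuous_on U phi" "openin (top_of_set M) (phi ` U)" using local_paramE[OF U(1)] by metis
  obtain T where T: "open T" "phi ` U = M Int T" using psi(4) unfolding openin_open by blast
  let ?E = "{y : U. phi y : range g}"
  have neg: "negligible ?E" by (rule chart_preimage_curve_negligible[OF U(1) g(1) _ k]) (use g(2) IM in blast)
  have "closedin (top_of_set U) (U Int phi -` range g)"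
   by (rule continuous_closedin_preimage[OF psi(3)]) (use g(3) compact_imp_closed in blast)
  then obtain C where "closed C" "U Int phi -` range g = U Int C" unfolding closedin_closed by blast
  moreover have "?E = U Int phi -` range g" by auto
  ultimately have E: "?E : sets borel" using psi(1) by auto
  have nE: "?E : null_sets lborel" using neg E by (simp add: negligible_iff_null_sets null_sets_completion_iff)
  have "p : T" using U(2) T(2) by blast
  have im: "phi ` ?E : sets (area_measure K M) & emeasure (area_measure K M) (phi ` ?E) = (\<integral>\<^sup>+x\<in>?E. ennreal (jacobian phi x) \<partial>lborel)"
  proof (rule area_measure_image[OF psi(1) _ psi(2) _ _ E])
   show "phi differentiable (at x)" if "x : U" for x using local_param_has_derivative[OF U(1) that] unfolding differentiable_def by blast
   show "continuous_on U (jacobian phi)" by (intro continuous_on_jacobian local_param_deriv_continuous[OF U(1)])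
   show "phi ` U <= mfd_interior K M" using U(1) unfolding mfd_interior_def by blast
  qed auto
  have "phi ` ?E = phi ` U Int range g" by blast
  also have "... = range g Int T" unfolding T(2) using g(2) IM by blast
  finally have imE: "phi ` ?E = range g Int T" .
  note im' = im[unfolded nn_integral_null_set[OF nE] imE]
  have "range g Int T : null_sets (area_measure K M)" by (rule null_setsI[OF conjunct2[OF im'] conjunct1[OF im']])
  thus ?thesis using T(1) `p : T` by blast
 qed
 then obtain T where T: "!!p. p : range g ==> open (T p) & p : T p & range g Int T p : null_sets (area_measure K M)" by metis
 have "EX C<=range g. finite C & range g <= (\<Union>p\<in>C. T p)"
  by (rule compactE_image[OF g(3), of "range g" T]) (use T in blast)+
 then obtain C where C: "C <= range g" "finite C" "range g <= (\<Union>p\<in>C. T p)" by blast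
 have "(\<Union>p\<in>C. range g Int T p) : null_sets (area_measure K M)" using C(1,2) T by (intro null_sets.finite_UN) auto
 moreover have "(\<Union>p\<in>C. range g Int T p) = range g" using C(3) by blast
 ultimately show ?thesis by simp
qed

context plane_frame begin

lemma cyl_angle_inj:
 assumes "cyl a e (al0 + x) (be0 + y) = cyl a e (al0 + x') (be0 + y')" "a > 0" "e > 0"
  "abs x < pi" "abs x' < pi" "abs y < pi" "abs y' < pi"
 shows "x = x' & y = y'"
 using assms by (auto simp: cyl_def intro: angle_eq)

text \<open>The angles \<open>\<pm>\<pi>\<close>, missed by the parametrization, are covered by three rotated copies of it.\<close>

lemma cyl_angle_cover:
 obtains "EX x y. abs x < pi & abs y < pi & cyl a e al be = cyl a e x y"
 | al0 be0 x y where "(al0, be0) : {(pi, 0), (0, pi), (pi, pi)}" "abs x < pi" "abs y < pi" "x = 0 \<or> y = 0" "cyl a e al be = cyl a e (al0 + x) (be0 + y)"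
proof -
 obtain x where x: "- pi < x" "x <= pi" "sin x = sin al" "cos x = cos al" using sincos_principal_value by blast
 obtain y where y: "- pi < y" "y <= pi" "sin y = sin be" "cos y = cos be" using sincos_principal_value by blast
 have c: "cyl a e al be = cyl a e x y" unfolding cyl_def x y by simp
 consider "x < pi" "y < pi" | "x = pi" "y < pi" | "x < pi" "y = pi" | "x = pi" "y = pi" using x y by linarith
 thus ?thesis
 proof cases
  case 1
  have "abs x < pi & abs y < pi & cyl a e al be = cyl a e x y" using 1 x y c by auto
  thus ?thesis using that(1) by blast
 next
  case 2 show ?thesis by (rule that(2)[of pi 0 0 y]) (use 2 x y c in auto)
 next
  case 3 show ?thesis by (rule that(2)[of 0 pi x 0]) (use 3 x y c in auto)
 next
  case 4 show ?thesis by (rule that(2)[of pi pi 0 0]) (use 4 x y c in auto)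
 qed
qed

end

section \<open>Volume and boundary area in the coordinates \<open>t\<close>, \<open>al\<close>,
  \<open>be\<close>\<close>

context truncated_profile begin

text \<open>The base angles \<open>al0\<close> and \<open>be0\<close> shift the cut of the angular
  coordinates; shifts by \<pi> cover what the unshifted map misses.\<close>

definition Phi :: "real => real => real^3 => real^4" where "Phi al0 be0 y = Psi (y $ 1) (al0 + y $ 2) (be0 + y $ 3)"
definition V :: "(real^3) set" where "V = {y. b^2 < y $ 1 & y $ 1 < L & abs (y $ 2) < pi & abs (y $ 3) < pi}"

lemma open_V: "open V"
 unfolding V_def by (intro open_Collect_conj open_Collect_less continuous_intros)

lemma Phi_derivative:
 assumes y: "y : V"
 shows "(Phi al0 be0 has_derivative (%v. (v $ 1 / (2 * D (y $ 1) * rho)) *\<^sub>R cyl (- N2 (y $ 1)) (N1 (y $ 1)) (al0 + y $ 2) (be0 + y $ 3)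
   + (v $ 2 * xi (y $ 1) / rho) *\<^sub>R tan1 (al0 + y $ 2) + (v $ 3 * eta (y $ 1) / rho) *\<^sub>R tan2 (be0 + y $ 3))) (at y)"
proof -
 let ?t = "y $ 1" and ?a = "al0 + y $ 2" and ?b = "be0 + y $ 3"
 have t: "b^2 < ?t" using y unfolding V_def by simp
 note d = profile_deriv[OF t, folded D_def]
 define c1 c2 where "c1 = (%al. cmb (cos al) (sin al) 0 0)" "c2 = (%be. cmb 0 0 (cos be) (sin be))"
 have cyl: "cyl p q al be = p *\<^sub>R c1 al + q *\<^sub>R c2 be" for p q al be unfolding c1_c2_def cyl_def by simp
 have nth: "((%y. y $ i) has_derivative (%v. v $ i)) (at y)" for i :: 3
  by (rule bounded_linear_imp_has_derivative[OF bounded_linear_vec_nth])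
 have ang: "((%y. c + y $ i) has_derivative (%v. v $ i)) (at y)" for c and i :: 3
  using has_derivative_add[OF has_derivative_const nth] by simp
 have vc: "((%y. f (h y)) has_derivative (%v. h' v *\<^sub>R f')) (at y)"
  if "(f has_vector_derivative f') (at (h y))" "(h has_derivative h') (at y)" for f :: "real => real^4" and h h' f'
  using has_derivative_compose[OF that(2) that(1)[unfolded has_vector_derivative_def]] .
 have rc: "((%y. f (y $ 1) / rho) has_derivative (%v. f' * v $ 1 / rho)) (at y)" if "(f has_real_derivative f') (at ?t)" for f f'
  using has_derivative_compose[OF nth has_field_derivative_imp_has_derivative[OF DERIV_cdivide[OF that]]] by (simp add: mult.commute)
 have dc: "(c1 has_vector_derivative tan1 al) (at al)" "(c2 has_vector_derivative tan2 be) (at be)" for al be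
  using has_vector_derivative_cyl_angle1[of 1 0 0 al UNIV] has_vector_derivative_cyl_angle2[of 0 1 0 be UNIV] unfolding cyl by simp_all
 show ?thesis
  unfolding Phi_def[abs_def] Psi_def cyl
  by (rule has_derivative_eq_rhs[OF has_derivative_add[OF has_derivative_scaleR[OF rc[OF d(1)] vc[OF dc(1) ang]]
    has_derivative_scaleR[OF rc[OF d(2)] vc[OF dc(2) ang]]]])
   (simp add: fun_eq_iff scaleR_right_distrib mult.commute add.commute add.left_commute divide_simps scaleR_right_diff_distrib)
qed

lemma Phi_frechet: "y : V ==> FD (Phi al0 be0) y = (%v. (v $ 1 / (2 * D (y $ 1) * rho)) *\<^sub>R cyl (- N2 (y $ 1)) (N1 (y $ 1)) (al0 + y $ 2) (be0 + y $ 3)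
   + (v $ 2 * xi (y $ 1) / rho) *\<^sub>R tan1 (al0 + y $ 2) + (v $ 3 * eta (y $ 1) / rho) *\<^sub>R tan2 (be0 + y $ 3))"
 by (rule frechet_derivative_at[OF Phi_derivative, symmetric])

lemma Phi_differentiable: "y : V ==> Phi al0 be0 differentiable (at y)"
 using Phi_derivative unfolding differentiable_def by blast

text \<open>The three partial derivatives are orthogonal, with lengths
  \<open>1 / (2 * D * rho)\<close>, \<open>xi / rho\<close> and \<open>eta / rho\<close>, so the
  Gram matrix is diagonal.\<close>

lemma Phi_jacobian:
 assumes y: "y : V"
 shows "jacobian (Phi al0 be0) y = m (y $ 1) / rho ^ 3"
proof -
 let ?t = "y $ 1"
 have t: "b^2 < ?t" using y unfolding V_def by simp
 note pos = D_pos'[OF t] xi_pos[OF t] eta_pos[OF less_imp_le[OF t]] rho_pos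
 have N: "N2 ?t * N2 ?t + N1 ?t * N1 ?t = 1" using N_unit[OF less_imp_le[OF t]] by (simp add: power2_eq_square)
 have "det (\<chi> i j. FD (Phi al0 be0) y (axis i 1) \<bullet> FD (Phi al0 be0) y (axis j 1)) =
  (xi ?t * eta ?t / (2 * D ?t * rho ^ 3))^2"
  unfolding Phi_frechet[OF y] det_3
  by (simp add: axis_def cyl_inner N) (simp add: power2_eq_square power3_eq_cube field_simps)
 hence "jacobian (Phi al0 be0) y = abs (xi ?t * eta ?t / (2 * D ?t * rho ^ 3))" unfolding jacobian_def by simp
 also have "... = m ?t / rho ^ 3" using pos by (simp add: m_eq[OF t])
 finally show ?thesis .
qed

lemma Phi_jacobian_continuous: "continuous_on V (jacobian (Phi al0 be0))"
proof (rule continuous_on_eq)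
 show "continuous_on V (%y. m (y $ 1) / rho ^ 3)"
  using rho_pos by (intro continuous_intros continuous_on_compose2[OF profile_continuous(1)]) (auto simp: V_def)
qed (simp add: Phi_jacobian)

lemma Phi_inj: "inj_on (Phi al0 be0) V"
proof (rule inj_onI)
 fix y z assume yz: "y : V" "z : V" "Phi al0 be0 y = Phi al0 be0 z"
 have t: "y $ 1 = z $ 1" using yz Psi_t_eq unfolding V_def Phi_def by force
 have "cyl (xi (y $ 1) / rho) (eta (y $ 1) / rho) (al0 + y $ 2) (be0 + y $ 3) = cyl (xi (y $ 1) / rho) (eta (y $ 1) / rho) (al0 + z $ 2) (be0 + z $ 3)"
  using yz(3) t unfolding Phi_def Psi_def by simp
 hence "y $ 2 = z $ 2 & y $ 3 = z $ 3"
  by (rule cyl_angle_inj) (use yz rho_pos xi_pos eta_pos in "auto simp: V_def")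
 thus "y = z" using t by (simp add: vec_eq_iff forall_3)
qed

lemma Phi_range: "Phi al0 be0 ` V <= mfd_int Sig"
 unfolding interior_Sig V_def Phi_def by force

lemma Phi_image_null:
 "Phi al0 be0 ` {y : V. y $ 2 = 0 \<or> y $ 3 = 0} : null_sets (vol Sig)"
proof -
 let ?E = "{y : V. y $ 2 = 0 \<or> y $ 3 = 0}"
 have "closed {y::real^3. y $ 2 = 0 \<or> y $ 3 = 0}" by (intro closed_Collect_disj closed_Collect_eq continuous_intros)
 hence "V Int {y. y $ 2 = 0 \<or> y $ 3 = 0} : sets borel" using open_V by auto
 moreover have "?E = V Int {y. y $ 2 = 0 \<or> y $ 3 = 0}" by auto
 ultimately have E: "?E : sets borel" by simp
 have "?E : null_sets lborel" by (rule null_sets_hyperplane[OF E, of 2 3]) auto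
 from nn_integral_null_set[OF this] show ?thesis
  using area_measure_image[OF open_V Phi_differentiable Phi_inj Phi_jacobian_continuous Phi_range E, of al0 be0]
  unfolding null_sets_def by auto
qed

definition Box :: "(real3) set" where "Box = box (b^2, - pi, - pi) (L, pi, pi)"
definition Box2 :: "(real \<times> real) set" where "Box2 = box (- pi, - pi) (pi, pi)"
definition Psi3 :: "real3 => real^4" where "Psi3 z = Psi (fst z) (fst (snd z)) (snd (snd z))"
definition Psi2 :: "real \<times> real => real^4" where "Psi2 z = Psi L (fst z) (snd z)"
definition w3 :: "real3 => real" where "w3 z = indicator Box z * (m (fst z) / rho ^ 3)"
definition area2 :: real where "area2 = xi L * eta L / rho^2"
abbreviation "BB \<equiv> restrict_space lborel Box"
abbreviation "BB2 \<equiv> restrict_space lborel Box2"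

lemma Box_iff: "z : Box \<longleftrightarrow> b^2 < fst z & fst z < L & abs (fst (snd z)) < pi & abs (snd (snd z)) < pi"
 "z' : Box2 \<longleftrightarrow> (abs (fst z')) < pi & abs (snd z') < pi"
 unfolding Box_def Box2_def by (cases z; cases z'; cases "snd z"; auto simp: box_def Basis_prod_def)+

lemma w3_Box: "z : Box ==> w3 z = m (fst z) / rho ^ 3" unfolding w3_def by simp

lemma w3_pos: "z : Box ==> 0 < w3 z" unfolding w3_def using m_pos rho_pos by (simp add: Box_iff)

lemma w3_measurable: "w3 : borel_measurable borel"
proof -
 have "continuous_on Box (%z. m (fst z) / rho ^ 3)"
  using rho_pos by (intro continuous_intros continuous_on_compose2[OF profile_continuous(1)]) (auto simp: Box_iff)
 thus ?thesis unfolding w3_def[abs_def]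
  using borel_measurable_continuous_on_indicator[of Box "%z. m (fst z) / rho ^ 3"] by (simp add: Box_def)
qed

text \<open>The map \<open>Phi 0 0\<close> misses the circular orbit and the points with an angle
  \<pi>. The former is a curve; in a shifted copy of the parametrisation the latter have a vanishing
  angle, so they come from two coordinate planes. Both are null.\<close>

lemma vol_pushforward:
 "Psi3 : measurable (density BB (%z. ennreal (w3 z))) (vol Sig)"
 "vol Sig = distr (density BB (%z. ennreal (w3 z))) (vol Sig) Psi3"
proof -
 let ?circle = "range (%be. Psi (b^2) 0 be)"
 have K: "?circle : null_sets (vol Sig)"
 proof (rule compact_curve_null)
  show "(%be. Psi (b^2) 0 be) differentiable (at s)" for s
   unfolding Psi_def using has_vector_derivative_cyl_angle2 differentiableI_vector by blast
  show "?circle <= mfd_int Sig" unfolding interior_Sig using L_gt by auto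
  have "?circle = (%be. Psi (b^2) 0 be) ` {-pi..pi}"
  proof (intro subset_antisym subsetI)
   fix p assume "p : ?circle"
   then obtain be where p: "p = Psi (b^2) 0 be" by auto
   obtain y where y: "- pi < y" "y <= pi" "sin y = sin be" "cos y = cos be" using sincos_principal_value by blast
   have "p = Psi (b^2) 0 y" unfolding p Psi_def cyl_def y ..
   thus "p : (%be. Psi (b^2) 0 be) ` {-pi..pi}" using y by auto
  qed auto
  moreover have "continuous_on {-pi..pi} (%be. Psi (b^2) 0 be)" unfolding Psi_def cyl_def by (intro continuous_intros)
  ultimately show "compact ?circle" using compact_continuous_image compact_Icc by metis
 qed simp
 let ?N = "%al0 be0. Phi al0 be0 ` {y : V. y $ 2 = 0 \<or> y $ 3 = 0}"
 have N: "?circle Un (?N pi 0 Un ?N 0 pi Un ?N pi pi) : null_sets (vol Sig)"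
  by (intro null_sets.Un K Phi_image_null)
 have cover: "mfd_int Sig - Phi 0 0 ` V <= ?circle Un (?N pi 0 Un ?N 0 pi Un ?N pi pi)"
 proof
  fix p assume p: "p : mfd_int Sig - Phi 0 0 ` V"
  then obtain t al be where t: "p = Psi t al be" "b^2 <= t" "t < L" unfolding interior_Sig by auto
  show "p : ?circle Un (?N pi 0 Un ?N 0 pi Un ?N pi pi)"
  proof (cases "t = b^2")
   case True
   hence "p = Psi (b^2) 0 be" unfolding t(1) Psi_def cyl_def by (simp add: start)
   thus ?thesis by blast
  next
   case False
   hence t': "b^2 < t" using t by simp
   show ?thesis
   proof (rule cyl_angle_cover[of "xi t / rho" "eta t / rho" al be])
    assume "EX x y. abs x < pi & abs y < pi & cyl (xi t / rho) (eta t / rho) al be = cyl (xi t / rho) (eta t / rho) x y"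
    then obtain x y where xy: "abs x < pi" "abs y < pi" "p = Psi t x y" unfolding t(1) Psi_def by blast
    have "p = Phi 0 0 (vec3 (t, x, y))" "vec3 (t, x, y) : V" unfolding Phi_def V_def using xy t' t by auto
    thus ?thesis using p by blast
   next
    fix al0 be0 x y
    assume xy: "(al0, be0) : {(pi, 0), (0, pi), (pi, pi)}" "abs x < pi" "abs y < pi" "x = 0 \<or> y = 0"
     "cyl (xi t / rho) (eta t / rho) al be = cyl (xi t / rho) (eta t / rho) (al0 + x) (be0 + y)"
    have "p = Phi al0 be0 (vec3 (t, x, y))" "vec3 (t, x, y) : {y : V. y $ 2 = 0 \<or> y $ 3 = 0}"
     unfolding Phi_def V_def t(1) Psi_def using xy t' t by auto
    hence "p : ?N al0 be0" by (rule image_eqI)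
    thus ?thesis using xy(1) by auto
   qed
  qed
 qed
 have **: "vec3 z : V \<longleftrightarrow> z : Box" "z : Box ==> w3 z = jacobian (Phi 0 0) (vec3 z)" "z : Box ==> Psi3 z = Phi 0 0 (vec3 z)" for z
 proof -
  show V: "vec3 z : V \<longleftrightarrow> z : Box" by (simp add: V_def Box_iff)
  show "w3 z = jacobian (Phi 0 0) (vec3 z)" "Psi3 z = Phi 0 0 (vec3 z)" if "z : Box"
   using that V by (auto simp: Phi_jacobian w3_def Phi_def Psi3_def)
 qed
 have oB: "open Box" unfolding Box_def by (rule open_box)
 note res = area_measure_eq_distr[OF open_V Phi_differentiable Phi_inj Phi_jacobian_continuous Phi_range _ vec3_measurable lborel_vec3 oB **(1) w3_measurable **(2,3)]
 show "Psi3 : measurable (density BB (%z. ennreal (w3 z))) (vol Sig)"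
  by (rule res(1)) (use N cover in blast)+
 show "vol Sig = distr (density BB (%z. ennreal (w3 z))) (vol Sig) Psi3"
  by (rule res(2)) (use N cover in blast)+
qed

lemma area2_pos: "0 < area2"
 unfolding area2_def using xi_pos[OF L_gt] eta_pos[OF less_imp_le[OF L_gt]] rho_pos by simp

text \<open>As for the volume, but without a singular orbit: \<open>L > b^2\<close>, so both radii
  of the boundary torus are positive.\<close>

lemma bdry_pushforward:
 "Psi2 : measurable (density BB2 (%z. ennreal area2)) (bdry_area Sig)"
 "bdry_area Sig = distr (density BB2 (%z. ennreal area2)) (bdry_area Sig) Psi2"
proof -
 define a e where "a = xi L / rho" "e = eta L / rho"
 have ae: "a > 0" "e > 0" unfolding a_e_def using xi_pos[OF L_gt] eta_pos[OF less_imp_le[OF L_gt]] rho_pos by auto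
 define T where "T = {cyl a e al be | al be. True}"
 have bT: "mfd_boundary TYPE(3) Sig = T" unfolding boundary_Sig T_def Psi_def a_e_def ..
 have iT: "mfd_interior TYPE(2) T = T" unfolding T_def by (rule mfd_interior_torus[OF ae])
 define phi where "phi = (%al0 be0 (y::real^2). cyl a e (al0 + y $ 1) (be0 + y $ 2))"
 define V2 where "V2 = {y::real^2. abs (y $ 1) < pi & abs (y $ 2) < pi}"
 have oV: "open V2" unfolding V2_def by (intro open_Collect_conj open_Collect_less continuous_intros)
 have fd: "FD (phi al0 be0) y = (%v. (a * v $ 1) *\<^sub>R tan1 (al0 + y $ 1) + (e * v $ 2) *\<^sub>R tan2 (be0 + y $ 2))" for al0 be0 y
  unfolding phi_def using frechet_derivative_at[OF cyl_angles_derivative] by metis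
 have df: "phi al0 be0 differentiable (at y)" for al0 be0 y
  unfolding phi_def using cyl_angles_derivative unfolding differentiable_def by blast
 have jac: "jacobian (phi al0 be0) = (%y. a * e)" for al0 be0
 proof
  fix y
  have "det (\<chi> i j. FD (phi al0 be0) y (axis i 1) \<bullet> FD (phi al0 be0) y (axis j 1)) = (a * e)^2"
   unfolding fd det_2 by (simp add: axis_def) (simp add: power2_eq_square)
  thus "jacobian (phi al0 be0) y = a * e" unfolding jacobian_def using ae by simp
 qed
 have jc: "continuous_on V2 (jacobian (phi al0 be0))" for al0 be0 unfolding jac by (intro continuous_intros)
 have inj: "inj_on (phi al0 be0) V2" for al0 be0
 proof (rule inj_onI)
  fix y z assume "y : V2" "z : V2" "phi al0 be0 y = phi al0 be0 z"
  hence "y $ 1 = z $ 1 & y $ 2 = z $ 2"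
   unfolding phi_def V2_def by (intro cyl_angle_inj[OF _ ae, of al0 _ be0]) auto
  thus "y = z" by (simp add: vec_eq_iff forall_2)
 qed
 have ran: "phi al0 be0 ` V2 <= mfd_interior TYPE(2) T" for al0 be0 unfolding iT unfolding T_def phi_def by auto
 let ?N = "%al0 be0. phi al0 be0 ` {y : V2. y $ 1 = 0 \<or> y $ 2 = 0}"
 have nul: "?N al0 be0 : null_sets (area_measure TYPE(2) T)" for al0 be0
 proof -
  let ?E = "{y : V2. y $ 1 = 0 \<or> y $ 2 = 0}"
  have "closed {y::real^2. y $ 1 = 0 \<or> y $ 2 = 0}" by (intro closed_Collect_disj closed_Collect_eq continuous_intros)
  hence "V2 Int {y. y $ 1 = 0 \<or> y $ 2 = 0} : sets borel" using oV by auto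
  moreover have "?E = V2 Int {y. y $ 1 = 0 \<or> y $ 2 = 0}" by auto
  ultimately have E: "?E : sets borel" by simp
  have "?E : null_sets lborel" by (rule null_sets_hyperplane[OF E, of 1 2]) auto
  from nn_integral_null_set[OF this] show ?thesis
   using area_measure_image[OF oV df inj jc ran E, of al0 be0] unfolding null_sets_def by auto
 qed
 have N: "?N pi 0 Un ?N 0 pi Un ?N pi pi : null_sets (area_measure TYPE(2) T)" by (intro null_sets.Un nul)
 have cover: "mfd_interior TYPE(2) T - phi 0 0 ` V2 <= ?N pi 0 Un ?N 0 pi Un ?N pi pi"
 proof
  fix p assume p: "p : mfd_interior TYPE(2) T - phi 0 0 ` V2"
  then obtain al be where t: "p = cyl a e al be" unfolding iT unfolding T_def by auto
  show "p : ?N pi 0 Un ?N 0 pi Un ?N pi pi"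
  proof (rule cyl_angle_cover[of a e al be])
   assume "EX x y. abs x < pi & abs y < pi & cyl a e al be = cyl a e x y"
   then obtain x y where xy: "abs x < pi" "abs y < pi" "p = cyl a e x y" unfolding t by blast
   have "p = phi 0 0 (vec2 (x, y))" "vec2 (x, y) : V2" unfolding phi_def V2_def using xy by auto
   thus ?thesis using p by blast
  next
   fix al0 be0 x y
   assume xy: "(al0, be0) : {(pi, 0), (0, pi), (pi, pi)}" "abs x < pi" "abs y < pi" "x = 0 \<or> y = 0"
    "cyl a e al be = cyl a e (al0 + x) (be0 + y)"
   have "p = phi al0 be0 (vec2 (x, y))" "vec2 (x, y) : {y : V2. y $ 1 = 0 \<or> y $ 2 = 0}"
    unfolding phi_def V2_def t using xy by auto
   hence "p : ?N al0 be0" by (rule image_eqI)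
   thus ?thesis using xy(1) by auto
  qed
 qed
 have oB: "open Box2" unfolding Box2_def by (rule open_box)
 have **: "vec2 z : V2 \<longleftrightarrow> z : Box2" "z : Box2 ==> area2 = jacobian (phi 0 0) (vec2 z)" "z : Box2 ==> Psi2 z = phi 0 0 (vec2 z)" for z
  unfolding jac by (auto simp: V2_def Box_iff area2_def a_e_def power2_eq_square Psi2_def Psi_def phi_def)
 note res = area_measure_eq_distr[OF oV df inj jc ran _ vec2_measurable lborel_vec2 oB **(1) borel_measurable_const **(2,3)]
 show "Psi2 : measurable (density BB2 (%z. ennreal area2)) (bdry_area Sig)"
  unfolding bT by (rule res(1)) (use N cover in blast)+
 show "bdry_area Sig = distr (density BB2 (%z. ennreal area2)) (bdry_area Sig) Psi2"
  unfolding bT by (rule res(2)) (use N cover in blast)+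
qed

lemma open_Boxes: "open Box" "open Box2" unfolding Box_def Box2_def by (rule open_box)+

lemma vol_facts:
 shows "Psi3 : measurable BB (vol Sig)"
  and "f : borel_measurable (vol Sig) ==> (\<integral>\<^sup>+p. f p \<partial>vol Sig) = (\<integral>\<^sup>+z. ennreal (w3 z) * f (Psi3 z) \<partial>BB)"
  and "!!h :: _ => real. h : borel_measurable (vol Sig) ==> (LINT p|vol Sig. h p) = (LINT z|BB. w3 z * h (Psi3 z))"
  and "{p : space (vol Sig). P p} : sets (vol Sig) ==> (AE p in vol Sig. P p) \<longleftrightarrow> (AE z in BB. P (Psi3 z))"
 by (rule pushforward_facts[OF open_Boxes(1) w3_measurable _ vol_pushforward]; (erule w3_pos | assumption))+

lemmas bdry_facts = pushforward_facts[OF open_Boxes(2) borel_measurable_const area2_pos bdry_pushforward]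

end

section \<open>Limits in L2, cut-off functions and integration over boxes\<close>

lemma L2_tendsto_L1:
 fixes f :: "nat => 'a => real"
 assumes fin: "finite_measure M" and conv: "L2_tendsto M f u" and f: "!!n. integrable M (f n)"
 shows "(%n. \<integral>\<^sup>+z. ennreal (abs (f n z - u z)) \<partial>M) \<longlonglongrightarrow> 0" and "integrable M u"
proof -
 have fM: "emeasure M (space M) < top" using finite_measure.finite_emeasure_space[OF fin] by (simp add: less_top)
 have u: "u : borel_measurable M" and e: "(%n. \<integral>\<^sup>+z. ennreal ((f n z - u z)^2) \<partial>M) \<longlonglongrightarrow> 0"
  using conv unfolding L2_tendsto_def by (auto simp: power2_abs)
 define h where "h = (%n. \<integral>\<^sup>+z. ennreal (abs (f n z - u z)) \<partial>M)"
 have m: "(%z. ennreal (abs (f n z - u z))) : borel_measurable M" for n using u f by measurable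
 \<comment> \<open>Cauchy-Schwarz against the constant function 1, so the total mass appears as a
   factor.\<close>
 have cs: "(h n)^2 <= emeasure M (space M) * (\<integral>\<^sup>+z. ennreal ((f n z - u z)^2) \<partial>M)" for n
  using Cauchy_Schwarz_nn_integral[OF m[of n] borel_measurable_const[of 1]]
  by (simp add: h_def ennreal_power mult.commute)
 have "(%n. emeasure M (space M) * (\<integral>\<^sup>+z. ennreal ((f n z - u z)^2) \<partial>M)) \<longlonglongrightarrow> 0"
  using ennreal_tendsto_cmult[OF fM e] by simp
 hence h2: "(%n. (h n)^2) \<longlonglongrightarrow> 0"
  by (rule tendsto_sandwich[OF _ _ tendsto_const, rotated 2]) (use cs in auto)
 show h0: "h \<longlonglongrightarrow> 0"
 proof (rule order_tendstoI)
  fix x :: ennreal assume "0 < x"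
  hence "0 < x^2" by (simp add: power2_eq_square ennreal_zero_less_mult_iff)
  hence "\<forall>\<^sub>F n in sequentially. (h n)^2 < x^2" using order_tendstoD(2)[OF h2] by blast
  thus "\<forall>\<^sub>F n in sequentially. h n < x"
   by (rule eventually_mono) (metis not_less power_mono zero_le)
 qed simp
 have "\<forall>\<^sub>F n in sequentially. h n < 1" using order_tendstoD(2)[OF h0, of 1] by simp
 then obtain n where "h n < 1" by (auto simp: eventually_sequentially)
 hence "(\<integral>\<^sup>+z. ennreal (norm (f n z - u z)) \<partial>M) < \<infinity>" unfolding h_def by (simp add: order.strict_trans)
 hence "integrable M (%z. f n z - u z)" using u f[of n] by (intro integrableI_bounded) auto
 from Bochner_Integration.integrable_diff[OF f[of n] this] show "integrable M u" by (simp only: diff_diff_eq2 add_diff_cancel_left')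
qed

lemma integrable_bounded_mult:
 fixes a u :: "'a => real"
 assumes "integrable M u" "a : borel_measurable M" "!!z. z : space M ==> abs (a z) <= C"
 shows "integrable M (%z. a z * u z)"
proof (rule Bochner_Integration.integrable_bound)
 show "integrable M (%z. C * u z)" using assms(1) by simp
 show "(%z. a z * u z) : borel_measurable M" using assms(1,2) by measurable
 show "AE z in M. norm (a z * u z) <= norm (C * u z)"
 proof (rule AE_I2)
  fix z assume "z : space M"
  hence "abs (a z) * abs (u z) <= abs C * abs (u z)" using assms(3)[of z] by (intro mult_right_mono) auto
  thus "norm (a z * u z) <= norm (C * u z)" by (simp add: abs_mult)
 qed
qed

lemma L2_tendsto_integral:
 fixes f :: "nat => 'a => real"
 assumes fin: "finite_measure M" and conv: "L2_tendsto M f u" and f: "!!n. integrable M (f n)"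
  and a: "a : borel_measurable M" "!!z. z : space M ==> abs (a z) <= C"
 shows "(%n. LINT z|M. a z * f n z) \<longlonglongrightarrow> (LINT z|M. a z * u z)"
proof (rule tendsto_L1_int)
 note L = L2_tendsto_L1[OF fin conv f]
 show "integrable M (%z. a z * f n z)" for n by (rule integrable_bounded_mult[OF f a])
 show "integrable M (%z. a z * u z)" by (rule integrable_bounded_mult[OF L(2) a])
 have m: "(%z. ennreal (abs (f n z - u z))) : borel_measurable M" for n using L(2) f by measurable
 have bd: "(\<integral>\<^sup>+z. ennreal (norm (a z * f n z - a z * u z)) \<partial>M) <= ennreal C * (\<integral>\<^sup>+z. ennreal (abs (f n z - u z)) \<partial>M)" for n
 proof -
  have "(\<integral>\<^sup>+z. ennreal (norm (a z * f n z - a z * u z)) \<partial>M) <= (\<integral>\<^sup>+z. ennreal C * ennreal (abs (f n z - u z)) \<partial>M)"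
  proof (rule nn_integral_mono)
   fix z assume z: "z : space M"
   have "norm (a z * f n z - a z * u z) <= C * abs (f n z - u z)"
    unfolding right_diff_distrib[symmetric] using a(2)[OF z] by (simp add: abs_mult mult_right_mono)
   thus "ennreal (norm (a z * f n z - a z * u z)) <= ennreal C * ennreal (abs (f n z - u z))"
    using a(2)[OF z] by (simp add: ennreal_mult[symmetric] ennreal_leI)
  qed
  thus ?thesis using nn_integral_cmult[OF m] by simp
 qed
 have lim: "(%n. ennreal C * (\<integral>\<^sup>+z. ennreal (abs (f n z - u z)) \<partial>M)) \<longlonglongrightarrow> 0"
  using ennreal_tendsto_cmult[OF _ L(1), of "ennreal C"] by simp
 show "(%n. \<integral>\<^sup>+z. ennreal (norm (a z * f n z - a z * u z)) \<partial>M) \<longlonglongrightarrow> 0"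
  by (rule tendsto_sandwich[OF _ _ tendsto_const lim]) (intro always_eventually allI bd zero_le)+
qed

text \<open>Boxes generate the Borel sets and are closed under intersection, so the vanishing
  spreads to all Borel sets by Dynkin induction; a density all of whose integrals vanish is zero
  almost everywhere.\<close>

lemma AE_zero_of_box_integrals:
 fixes y :: "'e::euclidean_space => real"
 assumes y: "integrable (restrict_space lborel (box a b)) y"
  and z: "!!c d. box c d <= box a b ==> (LINT z|restrict_space lborel (box a b). indicator (box c d) z * y z) = 0"
 shows "AE z in restrict_space lborel (box a b). y z = 0"
proof -
 define g where "g = (%z. indicator (box a b) z * y z)"
 have g: "integrable lborel g" using y by (simp add: g_def integrable_restrict_space)
 have s: "set_integrable lborel A g" if "A : sets borel" for A
  unfolding set_integrable_def by (rule integrable_mult_indicator[OF _ g]) (use that in simp)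
 have bx: "(LINT z:box c d|lborel. g z) = 0" for c d
 proof -
  obtain c' d' where c: "box a b Int box c d = box c' d'" by (rule that[OF box_Int_box])
  have "(LINT z:box c d|lborel. g z) = (LINT z|restrict_space lborel (box a b). indicator (box c' d') z * y z)"
   unfolding set_lebesgue_integral_def g_def c[symmetric]
   by (subst integral_restrict_space, simp) (intro Bochner_Integration.integral_cong refl, auto split: split_indicator)
  also have "... = 0" by (rule z) (unfold c[symmetric], rule Int_lower1)
  finally show ?thesis .
 qed
 have tot: "(LINT z:UNIV|lborel. g z) = 0"
 proof -
  have "(LINT z:UNIV|lborel. g z) = (LINT z:box a b|lborel. g z)"
   unfolding set_lebesgue_integral_def g_def by (auto intro!: Bochner_Integration.integral_cong split: split_indicator)
  thus ?thesis using bx by simp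
 qed
 let ?E = "range (%(a, b). box a b :: 'e set)"
 have sb: "sets borel = sigma_sets UNIV ?E" by (simp add: borel_eq_box)
 have "(LINT z:A|lborel. g z) = 0" if A: "A : sigma_sets UNIV ?E" for A
 proof (rule sigma_sets_induct_disjoint[OF _ _ A, where P="%A. (LINT z:A|lborel. g z) = 0"])
  show "Int_stable ?E" by (auto simp: Int_stable_def box_Int_box)
  fix A assume "A : ?E"
  then obtain p where p: "A = (%(c, d). box c d) p" by (rule imageE)
  show "(LINT z:A|lborel. g z) = 0" unfolding p case_prod_beta by (rule bx)
 next
  show "(LINT z:{}|lborel. g z) = 0" by (simp add: set_lebesgue_integral_def)
 next
  fix A :: "'e set" assume A: "A : sigma_sets UNIV ?E" "(LINT z:A|lborel. g z) = 0"
  have A1: "A : sets borel" unfolding sb by (rule A(1))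
  hence A': "A : sets borel" "UNIV - A : sets borel" by (simp_all add: sets.Diff)
  have "(LINT z:A Un (UNIV - A)|lborel. g z) = (LINT z:A|lborel. g z) + (LINT z:UNIV - A|lborel. g z)"
   by (rule set_integral_Un) (use A' s in auto)
  thus "(LINT z:UNIV - A|lborel. g z) = 0" using A(2) tot by simp
 next
  fix A :: "nat => 'e set"
  assume A: "disjoint_family A" "range A <= sigma_sets UNIV ?E" "!!i. (LINT z:A i|lborel. g z) = 0"
  have A': "A i : sets borel" for i unfolding sb using A(2) by (rule subsetD) (rule rangeI)
  have "(LINT z:(\<Union>i. A i)|lborel. g z) = (\<Sum>i. LINT z:A i|lborel. g z)"
   by (rule lebesgue_integral_countable_add) (use A' s A(1) in "auto simp: disjoint_family_on_def")
  thus "(LINT z:(\<Union>i. A i)|lborel. g z) = 0" using A(3) by simp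
 qed simp
 hence "AE z in lborel. g z = 0"
  using density_unique_real[OF g, of "%_. 0"] sb by (simp add: set_lebesgue_integral_def)
 thus ?thesis
  by (subst AE_restrict_space_iff) (auto simp: g_def elim!: eventually_mono split: split_indicator_asm)
qed

text \<open>A polynomial cut-off: \<open>4 / (b - a)^2 * ((s - a) * (b - s))\<close> rises from 0 at
  the ends to 1 in the middle, so for large \<open>k\<close> the indicator of the open interval is
  approximated. Vanishing at the ends removes the boundary terms of an integration by parts.\<close>

definition bump :: "nat => real => real => real => real" where
 "bump k a b s = 1 - (1 - 4 / (b - a)^2 * ((s - a) * (b - s))) ^ k"

lemma bump_derivative: "EX psi'. continuous_on UNIV psi' & (ALL s. (bump k a b has_real_derivative psi' s) (at s))"
proof -
 define c where "c = 4 / (b - a)^2"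
 have "(bump k a b has_real_derivative real k * (1 - c * ((s - a) * (b - s))) ^ (k - Suc 0) * (c * ((b - s) - (s - a)))) (at s)" for s
  unfolding bump_def[abs_def] c_def[symmetric] by (auto intro!: derivative_eq_intros simp: algebra_simps)
 moreover have "continuous_on UNIV (%s. real k * (1 - c * ((s - a) * (b - s))) ^ (k - Suc 0) * (c * ((b - s) - (s - a))))"
  by (intro continuous_intros)
 ultimately show ?thesis by blast
qed

lemma bump_facts:
 assumes "a < s" "s < b"
 shows "0 <= bump k a b s" "bump k a b s <= 1" "(%k. bump k a b s) \<longlonglongrightarrow> 1"
proof -
 define v where "v = 1 - 4 / (b - a)^2 * ((s - a) * (b - s))"
 have p: "0 < 4 / (b - a)^2 * ((s - a) * (b - s))" using assms by simp
 have "0 <= (2 * s - a - b)^2" by simp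
 hence "4 * ((s - a) * (b - s)) <= (b - a)^2" by (simp add: power2_eq_square algebra_simps)
 hence v: "0 <= v" "v < 1" using p assms unfolding v_def by (auto simp: divide_le_eq mult.assoc)
 show "0 <= bump k a b s" "bump k a b s <= 1" unfolding bump_def v_def[symmetric] using v by (auto simp: power_le_one)
 have "(%k. 1 - v ^ k) \<longlonglongrightarrow> 1 - 0" using v by (intro tendsto_intros LIMSEQ_power_zero) auto
 thus "(%k. bump k a b s) \<longlonglongrightarrow> 1" unfolding bump_def v_def[symmetric] by simp
qed

lemma bump_ends: "bump k a b a = 0" "bump k a b b = 0" unfolding bump_def by auto

lemma bump_limit:
 fixes h :: "'e::euclidean_space => real"
 assumes h: "integrable M h" and sM: "sig : borel_measurable M" and R: "R Int space M : sets M" "!!z. z : R ==> a < sig z & sig z < b"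
  and z: "!!k. (LINT z|M. indicator R z * (bump k a b (sig z) * h z)) = 0"
 shows "(LINT z|M. indicator R z * h z) = 0"
proof -
 have bm: "bump k a b : borel_measurable borel" for k
  unfolding bump_def[abs_def] by (intro borel_measurable_continuous_onI continuous_intros)
 have iR: "(indicator R :: _ => real) : borel_measurable M" using R(1) by (simp add: borel_measurable_indicator_iff Int_commute)
 have "(%k. LINT z|M. indicator R z * (bump k a b (sig z) * h z)) \<longlonglongrightarrow> (LINT z|M. indicator R z * h z)"
 proof (rule integral_dominated_convergence[where w="%z. abs (h z)"])
  show "(%z. indicator R z * h z) : borel_measurable M" using h iR by measurable
  show "(%z. indicator R z * (bump k a b (sig z) * h z)) : borel_measurable M" for k
   using h iR measurable_compose[OF sM bm] by measurable
  show "AE z in M. (%k. indicator R z * (bump k a b (sig z) * h z)) \<longlonglongrightarrow> indicator R z * h z"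
  proof (rule AE_I2)
   fix z
   show "(%k. indicator R z * (bump k a b (sig z) * h z)) \<longlonglongrightarrow> indicator R z * h z"
   proof (cases "z : R")
    case True
    hence "(%k. bump k a b (sig z) * h z) \<longlonglongrightarrow> 1 * h z"
     using R(2) by (intro tendsto_mult bump_facts(3) tendsto_const) auto
    thus ?thesis using True by simp
   qed simp
  qed
  show "AE z in M. norm (indicator R z * (bump k a b (sig z) * h z)) <= abs (h z)" for k
  proof (rule AE_I2)
   fix z show "norm (indicator R z * (bump k a b (sig z) * h z)) <= abs (h z)"
    using bump_facts(1,2)[of a "sig z" b k] R(2)[of z] by (auto simp: abs_mult intro!: mult_left_le_one_le split: split_indicator)
  qed
 qed (use h in auto)
 from this[unfolded z] show ?thesis by (simp add: LIMSEQ_const_iff)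
qed

lemma box_integral_restrict:
 fixes f :: "'e::euclidean_space => real"
 assumes f: "continuous_on (cbox c d) f" and B: "box c d <= B" "open B"
 shows "(LINT z|restrict_space lborel B. indicator (box c d) z * f z) = integral (cbox c d) f"
proof -
 have "set_integrable lborel (cbox c d) f" unfolding set_integrable_def by (rule borel_integrable_compact[OF compact_cbox f])
 hence s: "set_integrable lborel (box c d) f" by (rule set_integrable_subset) (auto simp: box_subset_cbox)
 have "(LINT z|restrict_space lborel B. indicator (box c d) z * f z) = (LINT z:box c d|lborel. f z)"
  unfolding set_lebesgue_integral_def using B
  by (subst integral_restrict_space) (auto intro!: Bochner_Integration.integral_cong split: split_indicator)
 also have "... = integral (box c d) f" by (rule set_borel_integral_eq_integral(2)[OF s])
 finally show ?thesis by (simp add: integral_open_interval)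
qed

lemma integrable_restrict_box:
 fixes f :: "'e::euclidean_space => real"
 assumes f: "continuous_on (cbox c d) f"
 shows "integrable (restrict_space lborel (box c d)) f"
proof -
 have "set_integrable lborel (cbox c d) f" unfolding set_integrable_def by (rule borel_integrable_compact[OF compact_cbox f])
 hence "set_integrable lborel (box c d) f" by (rule set_integrable_subset) (auto simp: box_subset_cbox)
 thus ?thesis unfolding set_integrable_def by (subst integrable_restrict_space) auto
qed

lemma continuous_on_Pair_slice:
 assumes "continuous_on (cbox (a, c) (b, d)) P"
 shows "x : cbox a b ==> continuous_on (cbox c d) (%y. P (x, y))" "y : cbox c d ==> continuous_on (cbox a b) (%x. P (x, y))"
 by (rule continuous_on_compose2[OF assms]; auto intro!: continuous_intros)+

text \<open>The derivative is asked for in the open interval only, because the profile is known to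
  be differentiable in \<open>t\<close> only beyond \<open>b^2\<close>, while the boxes reach down
  to \<open>b^2\<close>.\<close>

lemma integral_first_direction:
 fixes P Q :: "real \<times> 'e::euclidean_space => real"
 assumes t: "t1 <= t2" and P: "continuous_on (cbox (t1, c) (t2, d)) P"
  and Q: "!!y. y : cbox c d ==> continuous_on {t1..t2} (%t. Q (t, y))"
   "!!t y. y : cbox c d ==> t1 < t ==> t < t2 ==> ((%t. Q (t, y)) has_real_derivative P (t, y)) (at t)"
 shows "integral (cbox (t1, c) (t2, d)) P = integral (cbox c d) (%y. Q (t2, y) - Q (t1, y))"
proof -
 have "integral (cbox (t1, c) (t2, d)) P = integral (cbox t1 t2) (%t. integral (cbox c d) (%y. P (t, y)))"
  by (rule integral_prod_continuous[OF P])
 also have "... = integral (cbox c d) (%y. integral (cbox t1 t2) (%t. P (t, y)))"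
  by (rule integral_swap_continuous) (use P in "simp add: case_prod_beta")
 also have "... = integral (cbox c d) (%y. Q (t2, y) - Q (t1, y))"
 proof (rule integral_cong)
  fix y assume y: "y : cbox c d"
  have "((%t. P (t, y)) has_integral Q (t2, y) - Q (t1, y)) {t1..t2}"
   by (rule fundamental_theorem_of_calculus_interior[OF t Q(1)[OF y]])
    (use Q(2)[OF y] in "simp add: has_real_derivative_iff_has_vector_derivative")
  thus "integral (cbox t1 t2) (%t. P (t, y)) = Q (t2, y) - Q (t1, y)" by (simp add: integral_unique)
 qed
 finally show ?thesis .
qed

lemma integral_second_direction:
 fixes P Q :: "real \<times> real \<times> 'e::euclidean_space => real"
 assumes s: "s1 <= s2" and P: "continuous_on (cbox (t1, s1, c) (t2, s2, d)) P"
  and Q: "!!t y. t : {t1..t2} ==> y : cbox c d ==> continuous_on {s1..s2} (%s. Q (t, s, y))"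
   "!!t s y. t : {t1..t2} ==> y : cbox c d ==> s1 < s ==> s < s2 ==> ((%s. Q (t, s, y)) has_real_derivative P (t, s, y)) (at s)"
   "!!t y. Q (t, s1, y) = 0" "!!t y. Q (t, s2, y) = 0"
 shows "integral (cbox (t1, s1, c) (t2, s2, d)) P = 0"
proof -
 have "integral (cbox (t1, s1, c) (t2, s2, d)) P = integral (cbox t1 t2) (%t. integral (cbox (s1, c) (s2, d)) (%y. P (t, y)))"
  by (rule integral_prod_continuous[OF P])
 also have "... = integral (cbox t1 t2) (%t. 0)"
 proof (rule integral_cong)
  fix t assume t: "t : cbox t1 t2"
  have "integral (cbox (s1, c) (s2, d)) (%y. P (t, y)) = integral (cbox c d) (%y. Q (t, s2, y) - Q (t, s1, y))"
   by (rule integral_first_direction[OF s continuous_on_Pair_slice(1)[OF P t], where Q="%y. Q (t, y)"]) (use t Q(1,2) in auto)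
  thus "integral (cbox (s1, c) (s2, d)) (%y. P (t, y)) = 0" using Q(3,4) by simp
 qed
 finally show ?thesis by simp
qed

lemma integral_third_direction:
 fixes P Q :: "real \<times> 'e::euclidean_space \<times> real => real"
 assumes s: "s1 <= s2" and P: "continuous_on (cbox (t1, c, s1) (t2, d, s2)) P"
  and Q: "!!t y. t : {t1..t2} ==> y : cbox c d ==> continuous_on {s1..s2} (%s. Q (t, y, s))"
   "!!t s y. t : {t1..t2} ==> y : cbox c d ==> s1 < s ==> s < s2 ==> ((%s. Q (t, y, s)) has_real_derivative P (t, y, s)) (at s)"
   "!!t y. Q (t, y, s1) = 0" "!!t y. Q (t, y, s2) = 0"
 shows "integral (cbox (t1, c, s1) (t2, d, s2)) P = 0"
proof -
 have "integral (cbox (t1, c, s1) (t2, d, s2)) P = integral (cbox t1 t2) (%t. integral (cbox (c, s1) (d, s2)) (%y. P (t, y)))"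
  by (rule integral_prod_continuous[OF P])
 also have "... = integral (cbox t1 t2) (%t. 0)"
 proof (rule integral_cong)
  fix t assume t: "t : cbox t1 t2"
  have "integral (cbox (c, s1) (d, s2)) (%y. P (t, y)) = integral (cbox c d) (%x. integral (cbox s1 s2) (%s. P (t, x, s)))"
   by (rule integral_prod_continuous[OF continuous_on_Pair_slice(1)[OF P t]])
  also have "... = integral (cbox c d) (%x. 0)"
  proof (rule integral_cong)
   fix y assume y: "y : cbox c d"
   have "((%s. P (t, y, s)) has_integral Q (t, y, s2) - Q (t, y, s1)) {s1..s2}"
    by (rule fundamental_theorem_of_calculus_interior[OF s Q(1)])
     (use t y Q(2) in "auto simp: has_real_derivative_iff_has_vector_derivative")
   thus "integral (cbox s1 s2) (%s. P (t, y, s)) = 0" using Q(3,4) by (simp add: integral_unique)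
  qed
  finally show "integral (cbox (c, s1) (d, s2)) (%y. P (t, y)) = 0" by simp
 qed
 finally show ?thesis by simp
qed

lemma smooth_on_derivative:
 fixes f :: "'a::euclidean_space => real"
 assumes "smooth_on UNIV f"
 shows "(f has_derivative FD f x) (at x)" "continuous_on UNIV (%x. FD f x v)"
proof -
 have "C_k_on (Suc 0) UNIV f" using assms unfolding smooth_on_def by blast
 thus "(f has_derivative FD f x) (at x)" "continuous_on UNIV (%x. FD f x v)"
  using frechet_derivative_works by auto
qed

lemma smooth_on_continuous:
 fixes f :: "'a::euclidean_space => real"
 assumes "smooth_on UNIV f" shows "continuous_on UNIV f"
 by (intro continuous_at_imp_continuous_on ballI has_derivative_continuous[OF smooth_on_derivative(1)[OF assms]])

lemma linear_euclidean_sum: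
 fixes L :: "'a::euclidean_space => real"
 assumes "linear L" shows "L v = (\<Sum>b\<in>Basis. (v \<bullet> b) * L b)"
proof -
 have "L v = L (\<Sum>b\<in>Basis. (v \<bullet> b) *\<^sub>R b)" by (simp add: euclidean_representation)
 thus ?thesis using assms by (simp add: linear_sum linear_scale)
qed

lemma smooth_on_directional_continuous:
 fixes f :: "'a::euclidean_space => real"
 assumes f: "smooth_on UNIV f" and c: "continuous_on S P" "continuous_on S E"
 shows "continuous_on S (%z. FD f (P z) (E z))"
proof -
 have "FD f (P z) (E z) = (\<Sum>b\<in>Basis. (E z \<bullet> b) * FD f (P z) b)" for z
  by (rule linear_euclidean_sum[OF has_derivative_linear[OF smooth_on_derivative(1)[OF f]]])
 thus ?thesis
  using continuous_on_compose2[OF smooth_on_derivative(2)[OF f] c(1)] by (auto intro!: continuous_intros c(2))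
qed

lemma box_coefficient:
 fixes h :: "'e::euclidean_space => real"
 assumes "continuous_on (cbox p q) h"
 shows "(%z. indicator (box p q) z * h z) : borel_measurable (restrict_space lborel B)"
  and "EX C. ALL z. abs (indicator (box p q) z * h z) <= C"
proof -
 have "(%z. indicator (box p q) z *\<^sub>R h z) : borel_measurable borel"
  by (intro borel_measurable_continuous_on_indicator continuous_on_subset[OF assms box_subset_cbox]) simp
 thus "(%z. indicator (box p q) z * h z) : borel_measurable (restrict_space lborel B)"
  by (intro measurable_restrict_space1) simp
 have "bounded (h ` cbox p q)" using assms compact_continuous_image compact_cbox compact_imp_bounded by blast
 then obtain C where C: "!!z. z : cbox p q ==> abs (h z) <= C" unfolding bounded_iff by auto
 have "abs (indicator (box p q) z * h z) <= abs C" for z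
  using C[of z] box_subset_cbox[of p q] by (cases "z : box p q") auto
 thus "EX C. ALL z. abs (indicator (box p q) z * h z) <= C" by blast
qed

section \<open>Weak gradient and boundary trace in an adapted frame\<close>

context truncated_profile begin

text \<open>\<open>tangential_deriv\<close> agrees with the ambient derivative on tangent vectors
  and vanishes on the normal, so \<open>v\<close> may be replaced by its tangential part.\<close>

lemma tangential_grad_inner:
 assumes f: "(f has_derivative f') (at p)" and p: "p : mfd_int Sig"
 shows "tangential_grad Sig f p \<bullet> v = f' (v - (v \<bullet> nuSig p) *\<^sub>R nuSig p)"
proof -
 note nu = normal_tangential_deriv(4,5)[OF p unit_normal_Sig]
 obtain U :: "(real^3) set" and phi x where U: "local_param Sig U phi" "x : U" "p = phi x" using p unfolding mfd_interior_def by auto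
 have "(%y. f (phi y)) differentiable (at x)"
  using has_derivative_compose[OF local_param_has_derivative[OF U(1,2)]] f[unfolded U(3)] unfolding differentiable_def by blast
 then obtain L where L: "(f has_derivative L) (at p within Sig)"
  "!!w. (!!v. v : tangent_space Sig p ==> w \<bullet> v = 0) ==> L w = 0" "tangential_deriv Sig f p = L"
  using tangential_deriv_exists[OF U(1,2)] unfolding U(3) by metis
 have lin: "linear L" using L(1) has_derivative_linear by blast
 let ?w = "v - (v \<bullet> nuSig p) *\<^sub>R nuSig p"
 have n1: "nuSig p \<bullet> nuSig p = 1" using nu(2) by (simp add: norm_eq_1)
 have "?w : tangent_space Sig p" unfolding nu(1) by (simp add: inner_diff_right inner_commute n1)
 hence 1: "L ?w = f' ?w" by (rule tangential_deriv_unique[OF p L(1) has_derivative_at_withinI[OF f]])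
 have 2: "L (nuSig p) = 0" by (rule L(2)) (simp add: nu(1))
 have "tangential_grad Sig f p \<bullet> v = (\<Sum>b\<in>Basis. (v \<bullet> b) * L b)"
  unfolding tangential_grad_def L(3) inner_sum_left by (simp add: inner_commute mult.commute)
 also have "... = L v" by (rule linear_euclidean_sum[OF lin, symmetric])
 also have "... = L ?w" using lin 2 by (simp add: linear_diff linear_scale)
 finally show ?thesis using 1 by simp
qed

text \<open>The meridian direction, obtained by turning \<open>(N1, N2)\<close> through a right
  angle; with \<open>e2\<close> and \<open>e3\<close> along the circles it completes an orthonormal
  tangent frame. The frame stays defined at \<open>t = b^2\<close>, where the coordinate fields
  degenerate.\<close>

definition e1 :: "real3 => real^4" where "e1 z = cyl (- N2 (fst z)) (N1 (fst z)) (fst (snd z)) (snd (snd z))"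
definition e2 :: "real3 => real^4" where "e2 z = tan1 (fst (snd z))"
definition e3 :: "real3 => real^4" where "e3 z = tan2 (snd (snd z))"
definition frame_field :: "(real3 => real^4) => bool" where
 "frame_field e \<longleftrightarrow> continuous_on {z. b^2 <= fst z} e & (ALL z. b^2 <= fst z --> norm (e z) = 1 & e z \<bullet> nuSig (Psi3 z) = 0)"

lemma frame_fieldD: "frame_field e ==> b^2 <= fst z ==> norm (e z) = 1" "frame_field e ==> b^2 <= fst z ==> e z \<bullet> nuSig (Psi3 z) = 0"
 unfolding frame_field_def by blast+

lemma nu_Psi3: "b^2 <= fst z ==> nuSig (Psi3 z) = cyl (N1 (fst z)) (N2 (fst z)) (fst (snd z)) (snd (snd z))"
 unfolding Psi3_def by (rule nu_Psi)

lemma cont_fst: "continuous_on {b^2..} f ==> continuous_on {z::real \<times> 'z::topological_space. b^2 <= fst z} (%z. f (fst z))"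
 by (rule continuous_on_compose2[of "{b^2..}"]) (auto intro!: continuous_intros)

lemma frame_fields: "frame_field e1" "frame_field e2" "frame_field e3"
proof -
 note c = cont_fst[OF profile_cont(3)] cont_fst[OF profile_cont(4)]
 have 1: "continuous_on {z. b^2 <= fst z} e1" "continuous_on {z. b^2 <= fst z} e2" "continuous_on {z. b^2 <= fst z} e3"
  unfolding cyl_def tan1_def tan2_def e1_def[abs_def] e2_def[abs_def] e3_def[abs_def] by (intro continuous_intros c)+
 have 2: "norm (e1 z) = 1" "norm (e2 z) = 1" "norm (e3 z) = 1" "e1 z \<bullet> nuSig (Psi3 z) = 0" "e2 z \<bullet> nuSig (Psi3 z) = 0" "e3 z \<bullet> nuSig (Psi3 z) = 0"
  if z: "b^2 <= fst z" for z
  unfolding nu_Psi3[OF z] e1_def e2_def e3_def using N_unit[OF z] by (simp_all add: cyl_inner norm_eq_1 power2_eq_square)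
 show "frame_field e1" "frame_field e2" "frame_field e3" unfolding frame_field_def using 1 2 by blast+
qed

lemma cont_Psi3: "continuous_on {z. b^2 <= fst z} Psi3"
 unfolding Psi3_def Psi_def cyl_def using rho_pos
 by (intro continuous_intros cont_fst[OF profile_cont(1)] cont_fst[OF profile_cont(2)]) auto

lemma cont_Psi2: "continuous_on UNIV Psi2"
 unfolding Psi2_def Psi_def cyl_def by (intro continuous_intros)

lemma Psi3_interior: "z : Box ==> Psi3 z : mfd_int Sig"
 unfolding Psi3_def using Psi_interior by (simp add: Box_iff)

lemma space_BB [simp]: "space BB = Box" "space BB2 = Box2" by (simp_all add: space_restrict_space)

lemma finite_BB: "finite_measure BB" "finite_measure BB2"
proof -
 have "emeasure BB Box = emeasure lborel Box" "emeasure BB2 Box2 = emeasure lborel Box2"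
  by (subst emeasure_restrict_space; simp add: open_Boxes borel_open)+
 thus "finite_measure BB" "finite_measure BB2"
  using emeasure_lborel_box_finite[of "(b^2, - pi, - pi)" "(L, pi, pi)"] emeasure_lborel_box_finite[of "(- pi, - pi)" "(pi, pi)"]
  by (auto intro!: finite_measureI simp: Box_def Box2_def)
qed

lemma BB_measurable:
 fixes h :: "real3 => 'z::euclidean_space"
 assumes "continuous_on {z. b^2 <= fst z} h"
 shows "h : borel_measurable BB"
proof -
 have "h : borel_measurable (restrict_space borel Box)"
  by (intro borel_measurable_continuous_on_restrict continuous_on_subset[OF assms]) (auto simp: Box_iff)
 thus ?thesis by (simp cong: measurable_cong_sets add: sets_restrict_space)
qed

lemma cbox_le: "box p q <= Box ==> box p q ~= {} ==> cbox p q <= cbox (b^2, - pi, - pi) (L, pi, pi)"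
 using closure_mono[of "box p q" Box] closure_box[of p q] closure_box[of "(b^2, - pi, - pi)" "(L, pi, pi)"]
 unfolding Box_def by (metis subset_empty)

lemma cbox_Box: "cbox (b^2, - pi, - pi) (L, pi, pi) <= {z. b^2 <= fst z}"
 by (auto simp: cbox_def Basis_prod_def)

lemma BB_integrable:
 assumes "continuous_on {z. b^2 <= fst z} h"
 shows "integrable BB (h :: _ => real)"
 unfolding Box_def by (rule integrable_restrict_box[OF continuous_on_subset[OF assms cbox_Box]])

lemma w_bounds: obtains w0 w1 where "0 < w0" "!!z. z : Box ==> w0 <= w3 z" "!!z. z : Box ==> w3 z <= w1"
proof -
 have c: "continuous_on {b^2..L} (%t. m t / rho ^ 3)" using rho_pos
  by (intro continuous_intros continuous_on_subset[OF profile_continuous(1)]) auto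
 have ne: "{b^2..L} ~= {}" using L_gt by auto
 obtain s where s: "s : {b^2..L}" "!!t. t : {b^2..L} ==> m s / rho ^ 3 <= m t / rho ^ 3"
  using continuous_attains_inf[OF compact_Icc ne c] by auto
 obtain s' where s': "!!t. t : {b^2..L} ==> m t / rho ^ 3 <= m s' / rho ^ 3"
  using continuous_attains_sup[OF compact_Icc ne c] by blast
 show thesis by (rule that[of "m s / rho ^ 3" "m s' / rho ^ 3"]) (use s s' m_pos rho_pos in "auto simp: w3_Box Box_iff")
qed

lemma vol_measurable:
 fixes h :: "real^4 => 'z::euclidean_space"
 shows "continuous_on (mfd_int Sig) h ==> h : borel_measurable (vol Sig)"
  "continuous_on UNIV h ==> h : borel_measurable (bdry_area Sig)"
proof -
 show "h : borel_measurable (vol Sig)" if "continuous_on (mfd_int Sig) h"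
  using borel_measurable_continuous_on_restrict[OF that] by (simp cong: measurable_cong_sets add: sets_area_measure)
 show "h : borel_measurable (bdry_area Sig)" if "continuous_on UNIV h"
  using borel_measurable_continuous_on_restrict[OF continuous_on_subset[OF that subset_UNIV]]
  by (simp cong: measurable_cong_sets add: sets_area_measure)
qed

lemma smooth_measurable:
 assumes f: "smooth_on UNIV f"
 shows "f : borel_measurable (vol Sig)" "f : borel_measurable (bdry_area Sig)" "tangential_grad Sig f : borel_measurable (vol Sig)"
proof -
 show "f : borel_measurable (vol Sig)" "f : borel_measurable (bdry_area Sig)"
  using vol_measurable continuous_on_subset smooth_on_continuous[OF f] by blast+
 have IS: "mfd_int Sig <= Sig" unfolding mfd_interior_def local_param_def using openin_imp_subset by blast
 have cn: "continuous_on (mfd_int Sig) nuSig"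
  using unit_normal_Sig continuous_on_subset[OF _ IS] unfolding unit_normal_def by blast
 have "(%p. tangential_grad Sig f p \<bullet> v) : borel_measurable (vol Sig)" for v
 proof (rule vol_measurable(1), rule continuous_on_eq)
  show "continuous_on (mfd_int Sig) (%p. FD f p (v - (v \<bullet> nuSig p) *\<^sub>R nuSig p))"
   by (intro smooth_on_directional_continuous[OF f] continuous_intros cn)
 qed (simp add: tangential_grad_inner[OF smooth_on_derivative(1)[OF f]])
 thus "tangential_grad Sig f : borel_measurable (vol Sig)" using borel_measurable_euclidean_space by blast
qed

text \<open>The density \<open>w3\<close> is bounded below by a positive constant, so convergence in
  L2 for the volume implies convergence in L2 for Lebesgue measure on \<open>Box\<close>. Domination
  instead of equality lets \<open>sn\<close> be a single component of a vector field.\<close>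

lemma L2_pullback:
 fixes X :: "real^4 => 'z::euclidean_space"
 assumes X: "L2_tendsto (vol Sig) Xn X" "!!n. Xn n : borel_measurable (vol Sig)"
  and s: "s : borel_measurable BB" "!!n z. z : Box ==> abs (sn n z - s z) <= norm (Xn n (Psi3 z) - X (Psi3 z))"
 shows "L2_tendsto BB sn s"
 unfolding L2_tendsto_def
proof (intro conjI s(1))
 obtain w0 w1 where w0: "0 < w0" "!!z. z : Box ==> w0 <= w3 z" "!!z. z : Box ==> w3 z <= w1" using w_bounds by blast
 have mX: "X : borel_measurable (vol Sig)" and lim: "(%n. \<integral>\<^sup>+p. ennreal ((norm (Xn n p - X p))^2) \<partial>vol Sig) \<longlonglongrightarrow> 0"
  using X(1) unfolding L2_tendsto_def by auto
 have mm: "(%p. ennreal ((norm (Xn n p - X p))^2)) : borel_measurable (vol Sig)" for n using X(2) mX by measurable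
 have le: "(\<integral>\<^sup>+z. ennreal ((norm (sn n z - s z))^2) \<partial>BB) <= ennreal (1 / w0) * (\<integral>\<^sup>+p. ennreal ((norm (Xn n p - X p))^2) \<partial>vol Sig)" for n
 proof -
  have "(\<integral>\<^sup>+z. ennreal ((norm (sn n z - s z))^2) \<partial>BB) <= (\<integral>\<^sup>+z. ennreal (1 / w0) * (ennreal (w3 z) * ennreal ((norm (Xn n (Psi3 z) - X (Psi3 z)))^2)) \<partial>BB)"
  proof (rule nn_integral_mono)
   fix z assume "z : space BB"
   hence z: "z : Box" by simp
   have "(norm (sn n z - s z))^2 <= 1 * (norm (Xn n (Psi3 z) - X (Psi3 z)))^2"
    unfolding mult_1 by (rule power_mono) (use s(2)[OF z] in simp_all)
   also have "... <= 1 / w0 * w3 z * (norm (Xn n (Psi3 z) - X (Psi3 z)))^2"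
    using w0(1) w0(2)[OF z] by (intro mult_right_mono) auto
   finally show "ennreal ((norm (sn n z - s z))^2) <= ennreal (1 / w0) * (ennreal (w3 z) * ennreal ((norm (Xn n (Psi3 z) - X (Psi3 z)))^2))"
    using w0(1) w3_pos[OF z] by (simp add: ennreal_mult[symmetric] ennreal_leI mult.assoc)
  qed
  also have "... = ennreal (1 / w0) * (\<integral>\<^sup>+z. ennreal (w3 z) * ennreal ((norm (Xn n (Psi3 z) - X (Psi3 z)))^2) \<partial>BB)"
  proof (rule nn_integral_cmult)
   have "w3 : borel_measurable BB" using w3_measurable by (intro measurable_restrict_space1) simp
   thus "(%z. ennreal (w3 z) * ennreal ((norm (Xn n (Psi3 z) - X (Psi3 z)))^2)) : borel_measurable BB"
    using measurable_compose[OF vol_facts(1) mm[of n]] by measurable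
  qed
  finally show ?thesis using vol_facts(2)[OF mm] by simp
 qed
 have lim2: "(%n. ennreal (1 / w0) * (\<integral>\<^sup>+p. ennreal ((norm (Xn n p - X p))^2) \<partial>vol Sig)) \<longlonglongrightarrow> 0"
  using ennreal_tendsto_cmult[OF _ lim, of "ennreal (1 / w0)"] by simp
 show "(%n. \<integral>\<^sup>+z. ennreal ((norm (sn n z - s z))^2) \<partial>BB) \<longlonglongrightarrow> 0"
  by (rule tendsto_sandwich[OF _ _ tendsto_const lim2]) (intro always_eventually allI le zero_le)+
qed

lemma L2_pullback_bdry:
 assumes X: "L2_tendsto (bdry_area Sig) f tau" "!!n. f n : borel_measurable (bdry_area Sig)"
 shows "L2_tendsto BB2 (%n y. f n (Psi2 y)) (%y. tau (Psi2 y) :: real)"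
 unfolding L2_tendsto_def
proof
 have mX: "tau : borel_measurable (bdry_area Sig)" and lim: "(%n. \<integral>\<^sup>+p. ennreal ((norm (f n p - tau p))^2) \<partial>bdry_area Sig) \<longlonglongrightarrow> 0"
  using X(1) unfolding L2_tendsto_def by auto
 show "(%y. tau (Psi2 y)) : borel_measurable BB2" by (rule measurable_compose[OF bdry_facts(1) mX])
 have mm: "(%p. ennreal ((norm (f n p - tau p))^2)) : borel_measurable (bdry_area Sig)" for n using X(2) mX by measurable
 have "(\<integral>\<^sup>+y. ennreal ((norm (f n (Psi2 y) - tau (Psi2 y)))^2) \<partial>BB2) = ennreal (1 / area2) * (\<integral>\<^sup>+p. ennreal ((norm (f n p - tau p))^2) \<partial>bdry_area Sig)" for n
  unfolding bdry_facts(2)[OF mm] using area2_pos measurable_compose[OF bdry_facts(1) mm]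
  by (subst nn_integral_cmult) (auto simp: ennreal_mult[symmetric] mult.assoc[symmetric])
 thus "(%n. \<integral>\<^sup>+y. ennreal ((norm (f n (Psi2 y) - tau (Psi2 y)))^2) \<partial>BB2) \<longlonglongrightarrow> 0"
  using ennreal_tendsto_cmult[OF _ lim, of "ennreal (1 / area2)"] by simp
qed

abbreviation Dir :: "(real3 => real^4) => (real^4 => real) => real3 => real" where
 "Dir e f z \<equiv> FD f (Psi3 z) (e z)"

lemma Dir_continuous: "smooth_on UNIV f ==> frame_field e ==> continuous_on {z. b^2 <= fst z} (Dir e f)"
 unfolding frame_field_def by (intro smooth_on_directional_continuous cont_Psi3) auto

lemma smooth_Psi3_continuous: "smooth_on UNIV (f :: _ => real) ==> continuous_on {z. b^2 <= fst z} (%z. f (Psi3 z))"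
 using continuous_on_compose2[OF smooth_on_continuous[of f] cont_Psi3] by auto

lemma Dir_grad: "smooth_on UNIV f ==> frame_field e ==> z : Box ==> tangential_grad Sig f (Psi3 z) \<bullet> e z = Dir e f z"
 using tangential_grad_inner[OF smooth_on_derivative(1) Psi3_interior, of f z "e z"]
 using frame_fieldD[of e z] by (simp add: Box_iff)

text \<open>One approximating sequence serves function, gradient and trace at once, so an identity
  linear in all three survives the limit. The limit gradient is tangential almost everywhere because
  the gradients of the approximants are.\<close>

lemma H1_data_limits:
 assumes "H1_data Sig u X tau"
 obtains f where "!!n. smooth_on UNIV (f n)"
  "!!e p q h1 h2. frame_field e ==> continuous_on (cbox p q) h1 ==> continuous_on (cbox p q) h2 ==>
   (%n. LINT z|BB. indicator (box p q) z * (h1 z * f n (Psi3 z) + h2 z * Dir e (f n) z)) \<longlonglongrightarrow>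
    (LINT z|BB. indicator (box p q) z * (h1 z * u (Psi3 z) + h2 z * (X (Psi3 z) \<bullet> e z)))"
  "!!c d. (%n. LINT y|BB2. indicator (box c d) y * f n (Psi2 y)) \<longlonglongrightarrow> (LINT y|BB2. indicator (box c d) y * tau (Psi2 y))"
  "integrable BB (%z. u (Psi3 z))" "!!e. frame_field e ==> integrable BB (%z. X (Psi3 z) \<bullet> e z)"
  "integrable BB2 (%y. tau (Psi2 y))" "AE z in BB. X (Psi3 z) \<bullet> nuSig (Psi3 z) = 0"
proof -
 obtain f where f: "!!n. smooth_on UNIV (f n)" "L2_tendsto (vol Sig) f u" "L2_tendsto (vol Sig) (%n. tangential_grad Sig (f n)) X"
  "L2_tendsto (bdry_area Sig) f tau" using assms unfolding H1_data_def by auto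
 have mu: "u : borel_measurable (vol Sig)" and mX: "X : borel_measurable (vol Sig)" using f(2,3) unfolding L2_tendsto_def by auto
 have mXPsi: "(%z. X (Psi3 z)) : borel_measurable BB" by (rule measurable_compose[OF vol_facts(1) mX])
 have Lu: "L2_tendsto BB (%n z. f n (Psi3 z)) (%z. u (Psi3 z))"
  by (rule L2_pullback[OF f(2) smooth_measurable(1)[OF f(1)] measurable_compose[OF vol_facts(1) mu]]) (simp only: real_norm_def order.refl)
 have LX: "L2_tendsto BB (%n z. Dir e (f n) z) (%z. X (Psi3 z) \<bullet> e z)" if e: "frame_field e" for e
 proof (rule L2_pullback[OF f(3) smooth_measurable(3)[OF f(1)]])
  show "(%z. X (Psi3 z) \<bullet> e z) : borel_measurable BB"
   using mXPsi BB_measurable[of e] e unfolding frame_field_def by (intro borel_measurable_inner) auto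
  fix n z assume z: "z : Box"
  have "abs ((tangential_grad Sig (f n) (Psi3 z) - X (Psi3 z)) \<bullet> e z) <= norm (tangential_grad Sig (f n) (Psi3 z) - X (Psi3 z)) * norm (e z)"
   by (rule Cauchy_Schwarz_ineq2)
  thus "abs (Dir e (f n) z - X (Psi3 z) \<bullet> e z) <= norm (tangential_grad Sig (f n) (Psi3 z) - X (Psi3 z))"
   using Dir_grad[OF f(1) e z] frame_fieldD(1)[OF e, of z] z by (simp add: inner_diff_left Box_iff)
 qed
 have Lt: "L2_tendsto BB2 (%n y. f n (Psi2 y)) (%y. tau (Psi2 y))"
  by (rule L2_pullback_bdry[OF f(4) smooth_measurable(2)[OF f(1)]])
 have if1: "integrable BB (%z. f n (Psi3 z))" for n by (rule BB_integrable[OF smooth_Psi3_continuous[OF f(1)]])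
 have if2: "integrable BB (Dir e (f n))" if "frame_field e" for e n by (rule BB_integrable[OF Dir_continuous[OF f(1) that]])
 have cf2: "continuous_on UNIV (%y. f n (Psi2 y))" for n
  by (rule continuous_on_compose2[OF smooth_on_continuous[OF f(1)] cont_Psi2]) auto
 have if3: "integrable BB2 (%y. f n (Psi2 y))" for n
  unfolding Box2_def by (rule integrable_restrict_box[OF continuous_on_subset[OF cf2 subset_UNIV]])
 note iu = L2_tendsto_L1(2)[OF finite_BB(1) Lu if1]
 have iX: "integrable BB (%z. X (Psi3 z) \<bullet> e z)" if "frame_field e" for e
  by (rule L2_tendsto_L1(2)[OF finite_BB(1) LX[OF that] if2[OF that]])
 show thesis
 proof (rule that[of f])
  fix e p q and h1 h2 :: "real3 => real"
  assume e: "frame_field e" and h: "continuous_on (cbox p q) h1" "continuous_on (cbox p q) h2"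
  obtain C1 C2 where C: "!!z. abs (indicator (box p q) z * h1 z) <= C1" "!!z. abs (indicator (box p q) z * h2 z) <= C2"
   using box_coefficient(2)[OF h(1)] box_coefficient(2)[OF h(2)] by metis
  have "(%n. (LINT z|BB. (indicator (box p q) z * h1 z) * f n (Psi3 z)) + (LINT z|BB. (indicator (box p q) z * h2 z) * Dir e (f n) z)) \<longlonglongrightarrow>
   (LINT z|BB. (indicator (box p q) z * h1 z) * u (Psi3 z)) + (LINT z|BB. (indicator (box p q) z * h2 z) * (X (Psi3 z) \<bullet> e z))"
   using C by (intro tendsto_add L2_tendsto_integral[OF finite_BB(1)] Lu if1 LX[OF e] if2[OF e] box_coefficient(1)[OF h(1)] box_coefficient(1)[OF h(2)])
  moreover have "(LINT z|BB. (indicator (box p q) z * h1 z) * v z) + (LINT z|BB. (indicator (box p q) z * h2 z) * w z) =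
   (LINT z|BB. indicator (box p q) z * (h1 z * v z + h2 z * w z))" if "integrable BB v" "integrable BB w" for v w
   using integrable_bounded_mult[OF that(1) box_coefficient(1)[OF h(1)] C(1)] integrable_bounded_mult[OF that(2) box_coefficient(1)[OF h(2)] C(2)]
   by (subst Bochner_Integration.integral_add[symmetric]) (auto simp: algebra_simps)
  ultimately show "(%n. LINT z|BB. indicator (box p q) z * (h1 z * f n (Psi3 z) + h2 z * Dir e (f n) z)) \<longlonglongrightarrow>
    (LINT z|BB. indicator (box p q) z * (h1 z * u (Psi3 z) + h2 z * (X (Psi3 z) \<bullet> e z)))"
   using if1 if2[OF e] iu iX[OF e] by simp
 next
  fix c d :: "real \<times> real"
  have "abs (indicator (box c d) z) <= (1::real)" for z by (simp split: split_indicator)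
  thus "(%n. LINT y|BB2. indicator (box c d) y * f n (Psi2 y)) \<longlonglongrightarrow> (LINT y|BB2. indicator (box c d) y * tau (Psi2 y))"
   using box_coefficient(1)[of c d "%_. 1" Box2]
   by (intro L2_tendsto_integral[OF finite_BB(2) Lt if3]) auto
 next
  have "L2_tendsto BB (%n z. 0) (%z. X (Psi3 z) \<bullet> nuSig (Psi3 z))"
  proof (rule L2_pullback[OF f(3) smooth_measurable(3)[OF f(1)]])
   have "continuous_on {z. b^2 <= fst z} (%z. nuSig (Psi3 z))"
   proof (rule continuous_on_eq)
    show "continuous_on {z. b^2 <= fst z} (%z. cyl (N1 (fst z)) (N2 (fst z)) (fst (snd z)) (snd (snd z)))"
     unfolding cyl_def by (intro continuous_intros cont_fst[OF profile_cont(3)] cont_fst[OF profile_cont(4)])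
   qed (simp add: nu_Psi3)
   thus "(%z. X (Psi3 z) \<bullet> nuSig (Psi3 z)) : borel_measurable BB" using mXPsi BB_measurable by (intro borel_measurable_inner) auto
   fix n z assume z: "z : Box"
   have n1: "norm (nuSig (Psi3 z)) = 1" using normal_tangential_deriv(5)[OF Psi3_interior[OF z] unit_normal_Sig] .
   hence "nuSig (Psi3 z) \<bullet> nuSig (Psi3 z) = 1" by (simp add: norm_eq_1)
   hence "tangential_grad Sig (f n) (Psi3 z) \<bullet> nuSig (Psi3 z) = FD (f n) (Psi3 z) 0"
    using tangential_grad_inner[OF smooth_on_derivative(1)[OF f(1)] Psi3_interior[OF z]] by simp
   hence g: "tangential_grad Sig (f n) (Psi3 z) \<bullet> nuSig (Psi3 z) = 0"
    using has_derivative_linear[OF smooth_on_derivative(1)[OF f(1)]] by (simp add: linear_0)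
   have "abs ((tangential_grad Sig (f n) (Psi3 z) - X (Psi3 z)) \<bullet> nuSig (Psi3 z)) <= norm (tangential_grad Sig (f n) (Psi3 z) - X (Psi3 z)) * norm (nuSig (Psi3 z))"
    by (rule Cauchy_Schwarz_ineq2)
   thus "abs (0 - X (Psi3 z) \<bullet> nuSig (Psi3 z)) <= norm (tangential_grad Sig (f n) (Psi3 z) - X (Psi3 z))"
    using g n1 by (simp add: inner_diff_left)
  qed
  hence "(\<integral>\<^sup>+z. ennreal ((X (Psi3 z) \<bullet> nuSig (Psi3 z))^2) \<partial>BB) = 0" "(%z. X (Psi3 z) \<bullet> nuSig (Psi3 z)) : borel_measurable BB"
   unfolding L2_tendsto_def by (auto simp: LIMSEQ_const_iff)
  thus "AE z in BB. X (Psi3 z) \<bullet> nuSig (Psi3 z) = 0"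
   by (subst (asm) nn_integral_0_iff_AE) auto
 qed (use f(1) iu iX L2_tendsto_L1(2)[OF finite_BB(2) Lt if3] in auto)
qed

end

lemma smooth_on_chain:
 fixes f :: "'a::euclidean_space => real"
 assumes "smooth_on UNIV f" "(gam has_vector_derivative v) (at s)"
 shows "((%s. f (gam s)) has_real_derivative FD f (gam s) v) (at s)"
proof -
 have lin: "linear (FD f (gam s))" by (rule has_derivative_linear[OF smooth_on_derivative(1)[OF assms(1)]])
 have "((%s. f (gam s)) has_derivative (%h. FD f (gam s) (h *\<^sub>R v))) (at s)"
  by (rule has_derivative_compose[OF assms(2)[unfolded has_vector_derivative_def] smooth_on_derivative(1)[OF assms(1)]])
 moreover have "(%h. FD f (gam s) (h *\<^sub>R v)) = (*) (FD f (gam s) v)"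
  using linear_scale[OF lin] by (auto simp: mult.commute)
 ultimately show ?thesis unfolding has_field_derivative_def by simp
qed

context truncated_profile begin

lemma Dir_scale: "smooth_on UNIV f ==> FD f (Psi3 z) (c *\<^sub>R v) = c * FD f (Psi3 z) v"
 using linear_scale[OF has_derivative_linear[OF smooth_on_derivative(1)]] by (metis real_scaleR_def)

lemma smooth_Psi3_derivatives:
 assumes f: "smooth_on UNIV f"
 shows "b^2 < t ==> ((%t. f (Psi3 (t, y))) has_real_derivative Dir e1 f (t, y) / (2 * D t * rho)) (at t)"
  and "((%s. f (Psi3 (t, s, s'))) has_real_derivative xi t / rho * Dir e2 f (t, s, s')) (at s)"
  and "((%s. f (Psi3 (t, s', s))) has_real_derivative eta t / rho * Dir e3 f (t, s', s)) (at s)"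
proof -
 assume t: "b^2 < t"
 note d = profile_deriv[OF t, folded D_def]
 have e: "cyl (- N2 t / (2 * D t) / rho) (N1 t / (2 * D t) / rho) (fst y) (snd y) = (1 / (2 * D t * rho)) *\<^sub>R e1 (t, y)"
  unfolding e1_def cyl_scale by simp
 have "((%t. Psi3 (t, y)) has_vector_derivative (1 / (2 * D t * rho)) *\<^sub>R e1 (t, y)) (at t)"
  unfolding e[symmetric] Psi3_def Psi_def fst_conv snd_conv by (intro has_vector_derivative_cyl DERIV_cdivide d)
 from smooth_on_chain[OF f this] show "((%t. f (Psi3 (t, y))) has_real_derivative Dir e1 f (t, y) / (2 * D t * rho)) (at t)"
  unfolding Dir_scale[OF f] by simp
next
 have "((%s. Psi3 (t, s, s')) has_vector_derivative (xi t / rho) *\<^sub>R e2 (t, s, s')) (at s)"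
  unfolding Psi3_def Psi_def e2_def fst_conv snd_conv by (rule has_vector_derivative_cyl_angle1)
 from smooth_on_chain[OF f this] show "((%s. f (Psi3 (t, s, s'))) has_real_derivative xi t / rho * Dir e2 f (t, s, s')) (at s)"
  unfolding Dir_scale[OF f] .
next
 have "((%s. Psi3 (t, s', s)) has_vector_derivative (eta t / rho) *\<^sub>R e3 (t, s', s)) (at s)"
  unfolding Psi3_def Psi_def e3_def fst_conv snd_conv by (rule has_vector_derivative_cyl_angle2)
 from smooth_on_chain[OF f this] show "((%s. f (Psi3 (t, s', s))) has_real_derivative eta t / rho * Dir e3 f (t, s', s)) (at s)"
  unfolding Dir_scale[OF f] .
qed

text \<open>Beyond \<open>b^2\<close> this is \<open>F / (2 * D * rho)\<close>, the factor that
  appears when \<open>F\<close> multiplies the \<open>t\<close>-derivative of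
  \<open>f (Psi3 z)\<close>; its value at \<open>L\<close> will be the Robin constant.\<close>

definition c1 :: "real => real" where "c1 t = xi t * eta t / rho"

lemma cont_c1: "continuous_on {b^2..} c1"
 unfolding c1_def using rho_pos by (intro continuous_intros profile_cont) auto

lemma slab_subset: "b^2 <= t1 ==> cbox (t1, c) (t2, d) <= {z. b^2 <= fst z}"
 by (auto simp: cbox_prod)

lemma cont_profile_slab:
 "continuous_on {t1..t2::real} (k :: real => real) ==> continuous_on (cbox (t1, c) (t2, d)) (%z. k (fst z))"
 by (rule continuous_on_compose2[of "{t1..t2}"]) (auto simp: cbox_prod cbox_interval intro!: continuous_intros)

text \<open>The fundamental theorem of calculus for \<open>F * k * f\<close> along meridians. The
  derivative is assumed for the product \<open>F * k\<close> because \<open>k\<close> will be the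
  derivative of an eigenfunction, and the equation controls only \<open>F\<close> times it.\<close>

lemma radial_identity:
 assumes f: "smooth_on UNIV f" and t: "b^2 <= t1" "t1 < t2" "t2 <= L"
  and k: "continuous_on {t1..t2} k" "continuous_on {t1..t2} K'"
   "!!t. t1 < t ==> t < t2 ==> ((%t. F t * k t) has_real_derivative K' t) (at t)"
 shows "integral (cbox (t1, c) (t2, d)) (%z. K' (fst z) * f (Psi3 z) + k (fst z) * c1 (fst z) * Dir e1 f z) =
  integral (cbox c d) (%y. F t2 * k t2 * f (Psi3 (t2, y)) - F t1 * k t1 * f (Psi3 (t1, y)))"
proof -
 note sub = slab_subset[OF t(1), of c t2 d]
 have cf: "continuous_on {z. b^2 <= fst z} (%z. f (Psi3 z))" by (rule smooth_Psi3_continuous[OF f])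
 have "integral (cbox (t1, c) (t2, d)) (%z. K' (fst z) * f (Psi3 z) + k (fst z) * c1 (fst z) * Dir e1 f z) =
  integral (cbox c d) (%y. (%z. F (fst z) * k (fst z) * f (Psi3 z)) (t2, y) - (%z. F (fst z) * k (fst z) * f (Psi3 z)) (t1, y))"
 proof (rule integral_first_direction)
  show "continuous_on (cbox (t1, c) (t2, d)) (%z. K' (fst z) * f (Psi3 z) + k (fst z) * c1 (fst z) * Dir e1 f z)"
   by (intro continuous_on_add continuous_on_mult continuous_on_subset[OF cf sub] continuous_on_subset[OF Dir_continuous[OF f frame_fields(1)] sub]
    continuous_on_subset[OF cont_fst[OF cont_c1] sub] cont_profile_slab[OF k(1)] cont_profile_slab[OF k(2)])
  fix y
  have cF: "continuous_on {t1..t2} F" by (rule continuous_on_subset[OF profile_continuous(2)]) (use t in auto)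
  have "continuous_on {t1..t2} (%t. f (Psi3 (t, y)))"
   by (rule continuous_on_compose2[OF cf]) (use t in "auto intro!: continuous_intros")
  thus "continuous_on {t1..t2} (%t. F (fst (t, y)) * k (fst (t, y)) * f (Psi3 (t, y)))"
   using cF k(1) by (simp add: continuous_on_mult)
  fix t' assume t': "t1 < t'" "t' < t2"
  hence t'': "b^2 < t'" using t by simp
  have "k t' * c1 t' * Dir e1 f (t', y) = Dir e1 f (t', y) / (2 * D t' * rho) * (F t' * k t')"
   using D_pos'[OF t''] rho_pos unfolding c1_def F_eq[OF t''] by simp
  thus "((%t. F (fst (t, y)) * k (fst (t, y)) * f (Psi3 (t, y))) has_real_derivative
    K' (fst (t', y)) * f (Psi3 (t', y)) + k (fst (t', y)) * c1 (fst (t', y)) * Dir e1 f (t', y)) (at t')"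
   using DERIV_mult[OF k(3)[OF t'] smooth_Psi3_derivatives(1)[OF f t'']] by simp
 qed (use t in simp)
 thus ?thesis by simp
qed

lemma H1_data_facts:
 assumes "H1_data Sig u X tau"
 shows "integrable BB (%z. u (Psi3 z))" "!!e. frame_field e ==> integrable BB (%z. X (Psi3 z) \<bullet> e z)"
  "integrable BB2 (%y. tau (Psi2 y))" "AE z in BB. X (Psi3 z) \<bullet> nuSig (Psi3 z) = 0"
 by (rule H1_data_limits[OF assms]; (assumption | simp))+

text \<open>Both sides are continuous under the limits in \<open>H1_data_limits\<close>, so an
  integration by parts valid for smooth functions carries over. With \<open>kap = 0\<close> it
  serves for cut-off functions, where no boundary term remains.\<close>

lemma H1_data_identity:
 assumes data: "H1_data Sig u X tau" and e: "frame_field e" and R: "box p q <= Box" "box p q ~= {}"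
  and h: "continuous_on (cbox p q) h1" "continuous_on (cbox p q) h2"
  and id: "!!f. smooth_on UNIV f ==> integral (cbox p q) (%z. h1 z * f (Psi3 z) + h2 z * Dir e f z) =
   kap * (LINT y|BB2. indicator (box c d) y * f (Psi2 y))"
 shows "(LINT z|BB. indicator (box p q) z * (h1 z * u (Psi3 z) + h2 z * (X (Psi3 z) \<bullet> e z))) =
   kap * (LINT y|BB2. indicator (box c d) y * tau (Psi2 y))"
  and "integrable BB (%z. indicator (box p q) z * (h1 z * u (Psi3 z)))"
  and "integrable BB (%z. indicator (box p q) z * (h2 z * (X (Psi3 z) \<bullet> e z)))"
proof -
 note iu = H1_data_facts(1)[OF data] and iX = H1_data_facts(2)[OF data e]
 obtain f where f: "!!n. smooth_on UNIV (f n)"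
  "(%n. LINT z|BB. indicator (box p q) z * (h1 z * f n (Psi3 z) + h2 z * Dir e (f n) z)) \<longlonglongrightarrow>
    (LINT z|BB. indicator (box p q) z * (h1 z * u (Psi3 z) + h2 z * (X (Psi3 z) \<bullet> e z)))"
  "(%n. LINT y|BB2. indicator (box c d) y * f n (Psi2 y)) \<longlonglongrightarrow> (LINT y|BB2. indicator (box c d) y * tau (Psi2 y))"
  apply (rule H1_data_limits[OF data])
  subgoal premises prems for f by (rule prems(1)[of f, OF prems(2) prems(3)[OF e h] prems(4)])
  done
 have sub: "cbox p q <= {z. b^2 <= fst z}" using cbox_le[OF R] cbox_Box by blast
 have "(LINT z|BB. indicator (box p q) z * (h1 z * f n (Psi3 z) + h2 z * Dir e (f n) z)) = kap * (LINT y|BB2. indicator (box c d) y * f n (Psi2 y))" for n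
 proof -
  have "continuous_on (cbox p q) (%z. h1 z * f n (Psi3 z) + h2 z * Dir e (f n) z)"
   by (intro continuous_intros h continuous_on_subset[OF smooth_Psi3_continuous[OF f(1)] sub] continuous_on_subset[OF Dir_continuous[OF f(1) e] sub])
  from box_integral_restrict[OF this R(1) open_Boxes(1)] show ?thesis using id[OF f(1)] by simp
 qed
 thus "(LINT z|BB. indicator (box p q) z * (h1 z * u (Psi3 z) + h2 z * (X (Psi3 z) \<bullet> e z))) =
   kap * (LINT y|BB2. indicator (box c d) y * tau (Psi2 y))"
  using f(2) tendsto_mult_left[OF f(3), of kap] LIMSEQ_unique by simp
 obtain C1 C2 where C: "!!z. abs (indicator (box p q) z * h1 z) <= C1" "!!z. abs (indicator (box p q) z * h2 z) <= C2"
  using box_coefficient(2)[OF h(1)] box_coefficient(2)[OF h(2)] by metis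
 show "integrable BB (%z. indicator (box p q) z * (h1 z * u (Psi3 z)))"
  "integrable BB (%z. indicator (box p q) z * (h2 z * (X (Psi3 z) \<bullet> e z)))"
  using integrable_bounded_mult[OF iu box_coefficient(1)[OF h(1)] C(1)] integrable_bounded_mult[OF iX box_coefficient(1)[OF h(2)] C(2)]
  by (simp_all only: mult.assoc)
qed

text \<open>Subtracting the identities for \<open>X\<close> and \<open>X'\<close> eliminates
  \<open>u\<close> and leaves the integral of a cut-off times \<open>c\<close> times the difference
  of the components. The cut-off tends to the indicator of the box, and every box is
  available.\<close>

lemma direction_unique:
 fixes sig :: "real3 => real"
 assumes data: "H1_data Sig u X tau" "H1_data Sig u X' tau'" and e: "frame_field e"
  and sig: "continuous_on UNIV sig" "!!p q z. z : box p q ==> sig p < sig z & sig z < sig q"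
  and c: "continuous_on {z. b^2 <= fst z} c" "!!z. z : Box ==> 0 < c z"
  and van: "!!p q k. box p q <= Box ==> box p q ~= {} ==> EX h1. continuous_on (cbox p q) h1 &
   (ALL f. smooth_on UNIV f --> integral (cbox p q) (%z. h1 z * f (Psi3 z) + bump k (sig p) (sig q) (sig z) * c z * Dir e f z) = 0)"
 shows "AE z in BB. X (Psi3 z) \<bullet> e z = X' (Psi3 z) \<bullet> e z"
proof -
 have cB: "continuous_on (cbox (b^2, - pi, - pi) (L, pi, pi)) c" by (rule continuous_on_subset[OF c(1) cbox_Box])
 define y where "y = (%z. (indicator Box z * c z) * (X (Psi3 z) \<bullet> e z - X' (Psi3 z) \<bullet> e z))"
 obtain C where C: "!!z. abs (indicator Box z * c z) <= C" using box_coefficient(2)[OF cB] unfolding Box_def by blast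
 have iX: "integrable BB (%z. X (Psi3 z) \<bullet> e z)" "integrable BB (%z. X' (Psi3 z) \<bullet> e z)"
  using H1_data_facts(2)[OF data(1) e] H1_data_facts(2)[OF data(2) e] by auto
 have y: "integrable BB y" unfolding y_def
  by (rule integrable_bounded_mult[OF _ box_coefficient(1)[OF cB, folded Box_def] C]) (use iX in simp)
 have "AE z in BB. y z = 0"
  unfolding Box_def
 proof (rule AE_zero_of_box_integrals)
  show "integrable (restrict_space lborel (box (b^2, - pi, - pi) (L, pi, pi))) y" using y unfolding Box_def .
  fix p q :: "real3" assume "box p q <= box (b^2, - pi, - pi) (L, pi, pi)"
  hence R: "box p q <= Box" unfolding Box_def .
  show "(LINT z|restrict_space lborel (box (b^2, - pi, - pi) (L, pi, pi)). indicator (box p q) z * y z) = 0"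
   unfolding Box_def[symmetric]
  proof (cases "box p q = {}")
   case False
   have sub: "cbox p q <= {z. b^2 <= fst z}" using cbox_le[OF R False] cbox_Box by blast
   show "(LINT z|BB. indicator (box p q) z * y z) = 0"
   proof (rule bump_limit[OF y, of sig _ "sig p" "sig q"])
    show "sig : borel_measurable BB" by (rule BB_measurable[OF continuous_on_subset[OF sig(1) subset_UNIV]])
    show "box p q Int space BB : sets BB" using R by (simp add: sets_restrict_space_iff open_Boxes borel_open Int_absorb2)
    fix k
    obtain h1 where h1: "continuous_on (cbox p q) h1"
     "!!f. smooth_on UNIV f ==> integral (cbox p q) (%z. h1 z * f (Psi3 z) + bump k (sig p) (sig q) (sig z) * c z * Dir e f z) = 0"
     using van[OF R False] by blast
    have cb: "continuous_on UNIV (bump k (sig p) (sig q))" unfolding bump_def[abs_def] by (intro continuous_intros)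
    have h2: "continuous_on (cbox p q) (%z. bump k (sig p) (sig q) (sig z) * c z)"
     by (intro continuous_intros continuous_on_compose2[OF cb] continuous_on_subset[OF sig(1)] continuous_on_subset[OF c(1) sub]) auto
    note I = H1_data_identity[OF data(1) e R False h1(1) h2, of 0] and I' = H1_data_identity[OF data(2) e R False h1(1) h2, of 0]
    have "(LINT z|BB. indicator (box p q) z * (bump k (sig p) (sig q) (sig z) * y z)) =
     (LINT z|BB. indicator (box p q) z * (h1 z * u (Psi3 z) + (bump k (sig p) (sig q) (sig z) * c z) * (X (Psi3 z) \<bullet> e z)) -
      indicator (box p q) z * (h1 z * u (Psi3 z) + (bump k (sig p) (sig q) (sig z) * c z) * (X' (Psi3 z) \<bullet> e z)))"
     by (intro Bochner_Integration.integral_cong refl) (auto simp: y_def algebra_simps split: split_indicator)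
    also have "... = (LINT z|BB. indicator (box p q) z * (h1 z * u (Psi3 z) + (bump k (sig p) (sig q) (sig z) * c z) * (X (Psi3 z) \<bullet> e z))) -
      (LINT z|BB. indicator (box p q) z * (h1 z * u (Psi3 z) + (bump k (sig p) (sig q) (sig z) * c z) * (X' (Psi3 z) \<bullet> e z)))"
     unfolding distrib_left using I(2,3) I'(2,3) h1(2) by (intro Bochner_Integration.integral_diff Bochner_Integration.integrable_add) auto
    also have "... = 0" using I(1) I'(1) h1(2) by simp
    finally show "(LINT z|BB. indicator (box p q) z * (bump k (sig p) (sig q) (sig z) * y z)) = 0" .
   qed (use sig(2) in blast)
  qed simp
 qed
 thus ?thesis
  by (rule AE_mp) (intro AE_I2, use c(2) in "force simp: y_def")
qed

text \<open>Here the cut-off depends on \<open>t\<close>, and \<open>h1\<close> is the derivative of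
  \<open>F\<close> times the cut-off, with \<open>F' = 6 * m\<close>.\<close>

lemma direction1_unique:
 assumes data: "H1_data Sig u X tau" "H1_data Sig u X' tau'"
 shows "AE z in BB. X (Psi3 z) \<bullet> e1 z = X' (Psi3 z) \<bullet> e1 z"
proof (rule direction_unique[OF data frame_fields(1), of fst "%z. c1 (fst z)"])
 show "fst p < fst z & fst z < fst q" if "z : box p q" for p q z :: "real3"
  using that by (simp add: box_prod mem_Times_iff)
 show "continuous_on {z::real3. b^2 <= fst z} (%z. c1 (fst z))" by (rule cont_fst[OF cont_c1])
 show "0 < c1 (fst z)" if "z : Box" for z unfolding c1_def using that xi_pos eta_pos rho_pos by (simp add: Box_iff)
 fix p q :: "real3" and k assume R: "box p q <= Box" "box p q ~= {}"
 obtain t1 c t2 d where pq: "p = (t1, c)" "q = (t2, d)" by (cases p, cases q)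
 have t: "b^2 <= t1" "t1 < t2" "t2 <= L"
 proof -
  show t12: "t1 < t2" using R(2) unfolding pq by (auto simp: box_prod)
  have "cbox p q ~= {}" using R(2) box_subset_cbox[of p q] by blast
  hence "p : cbox p q" "q : cbox p q" by (simp_all add: mem_box box_ne_empty)
  hence "p : cbox (b^2, - pi, - pi) (L, pi, pi)" "q : cbox (b^2, - pi, - pi) (L, pi, pi)" using cbox_le[OF R] by auto
  thus "b^2 <= t1" "t2 <= L" unfolding pq by (auto simp: cbox_prod cbox_interval)
 qed
 obtain psi' where psi': "continuous_on UNIV psi'" "!!s. (bump k t1 t2 has_real_derivative psi' s) (at s)" using bump_derivative by blast
 have cb: "continuous_on S (bump k t1 t2)" for S unfolding bump_def[abs_def] by (intro continuous_intros)
 have K: "continuous_on {t1..t2} (%t. 6 * m t * bump k t1 t2 t + psi' t * F t)"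
  by (intro continuous_intros cb continuous_on_subset[OF psi'(1)] continuous_on_subset[OF profile_continuous(1)] continuous_on_subset[OF profile_continuous(2)]) (use t in auto)
 show "EX h1. continuous_on (cbox p q) h1 & (ALL f. smooth_on UNIV f -->
   integral (cbox p q) (%z. h1 z * f (Psi3 z) + bump k (fst p) (fst q) (fst z) * c1 (fst z) * Dir e1 f z) = 0)"
 proof (intro exI[of _ "%z. 6 * m (fst z) * bump k t1 t2 (fst z) + psi' (fst z) * F (fst z)"] conjI allI impI)
  show "continuous_on (cbox p q) (%z. 6 * m (fst z) * bump k t1 t2 (fst z) + psi' (fst z) * F (fst z))"
   unfolding pq by (rule cont_profile_slab[OF K])
  fix f :: "real^4 => real" assume f: "smooth_on UNIV f"
  show "integral (cbox p q) (%z. (6 * m (fst z) * bump k t1 t2 (fst z) + psi' (fst z) * F (fst z)) * f (Psi3 z) +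
    bump k (fst p) (fst q) (fst z) * c1 (fst z) * Dir e1 f z) = 0"
   unfolding pq fst_conv
   by (subst radial_identity[OF f t cb K])
    (use t DERIV_mult[OF profile_eqs(1) psi'(2)] in "auto simp: bump_ends")
 qed
qed (intro continuous_intros)

text \<open>Along the orbit circles the radii are constant, so \<open>h1\<close> is simply the
  derivative of a cut-off in the angle.\<close>

lemma angular_unique:
 assumes data: "H1_data Sig u X tau" "H1_data Sig u X' tau'"
 shows "AE z in BB. X (Psi3 z) \<bullet> e2 z = X' (Psi3 z) \<bullet> e2 z" "AE z in BB. X (Psi3 z) \<bullet> e3 z = X' (Psi3 z) \<bullet> e3 z"
proof -
 have cx: "continuous_on {b^2..} (%t. xi t / rho)" "continuous_on {b^2..} (%t. eta t / rho)"
  using rho_pos by (intro continuous_intros profile_cont; simp)+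
 have cb: "continuous_on S (bump k a c)" for S k a c unfolding bump_def[abs_def] by (intro continuous_intros)
 have cs: "continuous_on UNIV (%z::real3. fst (snd z))" "continuous_on UNIV (%z::real3. snd (snd z))"
  by (intro continuous_intros)+
 show "AE z in BB. X (Psi3 z) \<bullet> e2 z = X' (Psi3 z) \<bullet> e2 z"
 proof (rule direction_unique[OF data frame_fields(2) cs(1), of "%z. xi (fst z) / rho"])
  show "fst (snd p) < fst (snd z) & fst (snd z) < fst (snd q)" if "z : box p q" for p q z :: "real3"
   using that by (simp add: box_prod mem_Times_iff)
  show "continuous_on {z::real3. b^2 <= fst z} (%z. xi (fst z) / rho)" by (rule cont_fst[OF cx(1)])
  show "0 < xi (fst z) / rho" if "z : Box" for z using that xi_pos rho_pos by (simp add: Box_iff)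
  fix p q :: "real3" and k assume R: "box p q <= Box" "box p q ~= {}"
  obtain t1 s1 c t2 s2 d where pq: "p = (t1, s1, c)" "q = (t2, s2, d)" by (cases p, cases q)
  have sub: "cbox p q <= {z. b^2 <= fst z}" using cbox_le[OF R] cbox_Box by blast
  have s: "s1 <= s2" using R(2) unfolding pq by (auto simp: box_prod)
  obtain psi' where psi': "continuous_on UNIV psi'" "!!s. (bump k s1 s2 has_real_derivative psi' s) (at s)" using bump_derivative by blast
  have h: "continuous_on (cbox p q) (%z. psi' (fst (snd z)))"
   by (rule continuous_on_compose2[OF psi'(1)]) (auto intro!: continuous_intros)
  show "EX h1. continuous_on (cbox p q) h1 & (ALL f. smooth_on UNIV f -->
    integral (cbox p q) (%z. h1 z * f (Psi3 z) + bump k (fst (snd p)) (fst (snd q)) (fst (snd z)) * (xi (fst z) / rho) * Dir e2 f z) = 0)"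
  proof (intro exI[of _ "%z. psi' (fst (snd z))"] conjI allI impI h)
   fix f :: "real^4 => real" assume f: "smooth_on UNIV f"
   have cf: "continuous_on (cbox p q) (%z. f (Psi3 z))" by (rule continuous_on_subset[OF smooth_Psi3_continuous[OF f] sub])
   let ?P = "%z. psi' (fst (snd z)) * f (Psi3 z) + bump k s1 s2 (fst (snd z)) * (xi (fst z) / rho) * Dir e2 f z" and ?Q = "%z. bump k s1 s2 (fst (snd z)) * f (Psi3 z)"
   have P: "continuous_on (cbox p q) ?P"
    by (intro continuous_on_add continuous_on_mult h cf continuous_on_compose2[OF cb cs(1)[THEN continuous_on_subset]]
      continuous_on_subset[OF cont_fst[OF cx(1)] sub] continuous_on_subset[OF Dir_continuous[OF f frame_fields(2)] sub]) auto
   have "integral (cbox p q) ?P = 0"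
    unfolding pq
   proof (rule integral_second_direction[OF s P[unfolded pq], where Q="?Q"])
    fix t y
    have D: "((%s. bump k s1 s2 s * f (Psi3 (t, s, y))) has_real_derivative
      psi' s * f (Psi3 (t, s, y)) + xi t / rho * Dir e2 f (t, s, y) * bump k s1 s2 s) (at s)" for s
     by (rule DERIV_mult[OF psi'(2) smooth_Psi3_derivatives(2)[OF f]])
    thus "continuous_on {s1..s2} (%s. ?Q (t, s, y))"
     by (auto intro!: DERIV_isCont continuous_at_imp_continuous_on)
    show "((%s. ?Q (t, s, y)) has_real_derivative
      ?P (t, s, y)) (at s)" for s
     using D[of s] by (simp add: mult_ac)
   qed (simp_all add: bump_ends)
   thus "integral (cbox p q) (%z. psi' (fst (snd z)) * f (Psi3 z) + bump k (fst (snd p)) (fst (snd q)) (fst (snd z)) * (xi (fst z) / rho) * Dir e2 f z) = 0"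
    by (simp add: pq)
  qed
 qed
 show "AE z in BB. X (Psi3 z) \<bullet> e3 z = X' (Psi3 z) \<bullet> e3 z"
 proof (rule direction_unique[OF data frame_fields(3) cs(2), of "%z. eta (fst z) / rho"])
  show "snd (snd p) < snd (snd z) & snd (snd z) < snd (snd q)" if "z : box p q" for p q z :: "real3"
   using that by (simp add: box_prod mem_Times_iff)
  show "continuous_on {z::real3. b^2 <= fst z} (%z. eta (fst z) / rho)" by (rule cont_fst[OF cx(2)])
  show "0 < eta (fst z) / rho" if "z : Box" for z using that eta_pos rho_pos by (simp add: Box_iff)
  fix p q :: "real3" and k assume R: "box p q <= Box" "box p q ~= {}"
  obtain t1 s1 c t2 s2 d where pq: "p = (t1, c, s1)" "q = (t2, d, s2)" by (cases p, cases q)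
  have sub: "cbox p q <= {z. b^2 <= fst z}" using cbox_le[OF R] cbox_Box by blast
  have s: "s1 <= s2" using R(2) unfolding pq by (auto simp: box_prod)
  obtain psi' where psi': "continuous_on UNIV psi'" "!!s. (bump k s1 s2 has_real_derivative psi' s) (at s)" using bump_derivative by blast
  have h: "continuous_on (cbox p q) (%z. psi' (snd (snd z)))"
   by (rule continuous_on_compose2[OF psi'(1)]) (auto intro!: continuous_intros)
  show "EX h1. continuous_on (cbox p q) h1 & (ALL f. smooth_on UNIV f -->
    integral (cbox p q) (%z. h1 z * f (Psi3 z) + bump k (snd (snd p)) (snd (snd q)) (snd (snd z)) * (eta (fst z) / rho) * Dir e3 f z) = 0)"
  proof (intro exI[of _ "%z. psi' (snd (snd z))"] conjI allI impI h)
   fix f :: "real^4 => real" assume f: "smooth_on UNIV f"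
   have cf: "continuous_on (cbox p q) (%z. f (Psi3 z))" by (rule continuous_on_subset[OF smooth_Psi3_continuous[OF f] sub])
   let ?P = "%z. psi' (snd (snd z)) * f (Psi3 z) + bump k s1 s2 (snd (snd z)) * (eta (fst z) / rho) * Dir e3 f z" and ?Q = "%z. bump k s1 s2 (snd (snd z)) * f (Psi3 z)"
   have P: "continuous_on (cbox p q) ?P"
    by (intro continuous_on_add continuous_on_mult h cf continuous_on_compose2[OF cb cs(2)[THEN continuous_on_subset]]
      continuous_on_subset[OF cont_fst[OF cx(2)] sub] continuous_on_subset[OF Dir_continuous[OF f frame_fields(3)] sub]) auto
   have "integral (cbox p q) ?P = 0"
    unfolding pq
   proof (rule integral_third_direction[OF s P[unfolded pq], where Q="?Q"])
    fix t y
    have D: "((%s. bump k s1 s2 s * f (Psi3 (t, y, s))) has_real_derivative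
      psi' s * f (Psi3 (t, y, s)) + eta t / rho * Dir e3 f (t, y, s) * bump k s1 s2 s) (at s)" for s
     by (rule DERIV_mult[OF psi'(2) smooth_Psi3_derivatives(3)[OF f]])
    thus "continuous_on {s1..s2} (%s. ?Q (t, y, s))"
     by (auto intro!: DERIV_isCont continuous_at_imp_continuous_on)
    show "((%s. ?Q (t, y, s)) has_real_derivative
      ?P (t, y, s)) (at s)" for s
     using D[of s] by (simp add: mult_ac)
   qed (simp_all add: bump_ends)
   thus "integral (cbox p q) (%z. psi' (snd (snd z)) * f (Psi3 z) + bump k (snd (snd p)) (snd (snd q)) (snd (snd z)) * (eta (fst z) / rho) * Dir e3 f z) = 0"
    by (simp add: pq)
  qed
 qed
qed

text \<open>\<open>F (b^2) = 0\<close> removes the inner boundary term: the circular orbit imposes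
  no condition, and only the boundary torus contributes.\<close>

lemma radial_boundary_identity:
 assumes f: "smooth_on UNIV f" and R: "box c d <= Box2"
  and k: "continuous_on {b^2..L} k" "continuous_on {b^2..L} K'"
   "!!t. b^2 < t ==> t < L ==> ((%t. F t * k t) has_real_derivative K' t) (at t)"
 shows "integral (cbox (b^2, c) (L, d)) (%z. K' (fst z) * f (Psi3 z) + k (fst z) * c1 (fst z) * Dir e1 f z) =
  F L * k L * (LINT y|BB2. indicator (box c d) y * f (Psi2 y))"
proof -
 have "continuous_on (cbox c d) (%y. f (Psi2 y))"
  using continuous_on_compose2[OF smooth_on_continuous[OF f] cont_Psi2] continuous_on_subset by blast
 from box_integral_restrict[OF this R open_Boxes(2)]
 have "(LINT y|BB2. indicator (box c d) y * f (Psi2 y)) = integral (cbox c d) (%y. f (Psi2 y))" .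
 moreover have "Psi3 (L, y) = Psi2 y" for y unfolding Psi3_def Psi2_def by simp
 moreover have "integral (cbox (b^2, c) (L, d)) (%z. K' (fst z) * f (Psi3 z) + k (fst z) * c1 (fst z) * Dir e1 f z) =
  integral (cbox c d) (%y. F L * k L * f (Psi3 (L, y)) - F (b^2) * k (b^2) * f (Psi3 (b^2, y)))"
  by (rule radial_identity[OF f order_refl L_gt order_refl k])
 ultimately show ?thesis using F_start by simp
qed

text \<open>Needed because \<open>weak_grad\<close> and \<open>bdry_trace\<close> are arbitrary
  choices. The gradient is determined component by component in the frame \<open>e1\<close>,
  \<open>e2\<close>, \<open>e3\<close> and the normal. The trace then follows from the radial
  identity with \<open>k = 1\<close>, where everything else is given by \<open>u\<close> and the
  gradient.\<close>

lemma H1_data_unique: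
 assumes data: "H1_data Sig u X tau" "H1_data Sig u X' tau'"
 shows "AE p in vol Sig. X p = X' p" "AE p in bdry_area Sig. tau p = tau' p"
proof -
 have mX: "X : borel_measurable (vol Sig)" "X' : borel_measurable (vol Sig)" and mt: "tau : borel_measurable (bdry_area Sig)" "tau' : borel_measurable (bdry_area Sig)"
  using data unfolding H1_data_def L2_tendsto_def by auto
 have n: "AE z in BB. X (Psi3 z) \<bullet> nuSig (Psi3 z) = 0" "AE z in BB. X' (Psi3 z) \<bullet> nuSig (Psi3 z) = 0"
  using H1_data_facts(4)[OF data(1)] H1_data_facts(4)[OF data(2)] by auto
 have eq: "X (Psi3 z) = X' (Psi3 z)" if z: "z : Box" and i: "X (Psi3 z) \<bullet> e1 z = X' (Psi3 z) \<bullet> e1 z"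
  "X (Psi3 z) \<bullet> e2 z = X' (Psi3 z) \<bullet> e2 z" "X (Psi3 z) \<bullet> e3 z = X' (Psi3 z) \<bullet> e3 z"
  "X (Psi3 z) \<bullet> nuSig (Psi3 z) = 0" "X' (Psi3 z) \<bullet> nuSig (Psi3 z) = 0" for z
 proof -
  have t: "b^2 <= fst z" using z by (simp add: Box_iff)
  have N: "N2 (fst z) * N2 (fst z) + N1 (fst z) * N1 (fst z) = 1" "N1 (fst z) * N1 (fst z) + N2 (fst z) * N2 (fst z) = 1"
   using N_unit[OF t] by (simp_all add: power2_eq_square)
  have "y = (y \<bullet> e1 z) *\<^sub>R e1 z + (y \<bullet> e2 z) *\<^sub>R e2 z + (y \<bullet> e3 z) *\<^sub>R e3 z + (y \<bullet> nuSig (Psi3 z)) *\<^sub>R nuSig (Psi3 z)" for y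
   by (rule orthonormal_expansion4) (simp_all add: nu_Psi3[OF t] e1_def e2_def e3_def cyl_inner N)
  from this[of "X (Psi3 z)"] this[of "X' (Psi3 z)"] show ?thesis using i by simp
 qed
 have "AE z in BB. X (Psi3 z) = X' (Psi3 z)"
  using direction1_unique[OF data] angular_unique[OF data] n AE_space
  by eventually_elim (use eq in simp)
 moreover have "{p : space (vol Sig). X p = X' p} : sets (vol Sig)" using mX by measurable
 ultimately show "AE p in vol Sig. X p = X' p" using vol_facts(4)[of "%p. X p = X' p"] by blast
 have it: "integrable BB2 (%y. tau (Psi2 y))" "integrable BB2 (%y. tau' (Psi2 y))"
  using H1_data_facts(3)[OF data(1)] H1_data_facts(3)[OF data(2)] by auto
 have "AE y in BB2. tau (Psi2 y) - tau' (Psi2 y) = 0"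
  unfolding Box2_def
 proof (rule AE_zero_of_box_integrals)
  show "integrable (restrict_space lborel (box (- pi, - pi) (pi, pi))) (%y. tau (Psi2 y) - tau' (Psi2 y))"
   using it unfolding Box2_def by simp
  fix c d :: "real \<times> real" assume "box c d <= box (- pi, - pi) (pi, pi)"
  hence R: "box c d <= Box2" unfolding Box2_def .
  show "(LINT z|restrict_space lborel (box (- pi, - pi) (pi, pi)). indicator (box c d) z * (tau (Psi2 z) - tau' (Psi2 z))) = 0"
   unfolding Box2_def[symmetric]
  proof (cases "box c d = {}")
   case False
   let ?S = "box (b^2, c) (L, d)" and ?C = "cbox (b^2, c) (L, d)"
   let ?I = "%Y z. indicator ?S z * (6 * m (fst z) * u (Psi3 z) + 1 * c1 (fst z) * (Y (Psi3 z) \<bullet> e1 z))"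
   have ne: "?S ~= {}" "?S <= Box"
    using False L_gt R unfolding Box2_def Box_def by (auto simp: box_prod)
   have k: "continuous_on {b^2..L} (%t. 6 * m t)" "continuous_on {b^2..L} (%_. 1::real)"
    by (intro continuous_intros continuous_on_subset[OF profile_continuous(1)]; simp)+
   have k': "((%t. F t * 1) has_real_derivative 6 * m t) (at t)" if "b^2 < t" for t using profile_eqs(1)[OF that] by simp
   have h: "continuous_on ?C (%z. 6 * m (fst z))" "continuous_on ?C (%z. 1 * c1 (fst z))"
    by (intro cont_profile_slab k continuous_intros continuous_on_subset[OF cont_c1]; simp)+
   note I = H1_data_identity(1)[OF _ frame_fields(1) ne(2,1) h radial_boundary_identity[OF _ R k(2,1) k']]
   have "(LINT z|BB. ?I X z) =
    (LINT z|BB. ?I X' z)"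
   proof (rule integral_cong_AE)
    note J = H1_data_identity(2,3)[OF _ frame_fields(1) ne(2,1) h radial_boundary_identity[OF _ R k(2,1) k']]
    show "?I X : borel_measurable BB"
     "?I X' : borel_measurable BB"
     unfolding distrib_left using J[OF data(1)] J[OF data(2)] by (intro borel_measurable_add borel_measurable_integrable; simp)+
    show "AE z in BB. ?I X z =
     ?I X' z"
     using direction1_unique[OF data] by eventually_elim simp
   qed
   hence "F L * (LINT y|BB2. indicator (box c d) y * tau (Psi2 y)) = F L * (LINT y|BB2. indicator (box c d) y * tau' (Psi2 y))"
    using I[OF data(1)] I[OF data(2)] by simp
   moreover have "F L ~= 0" using F_eq[OF L_gt] xi_pos[OF L_gt] eta_pos[OF less_imp_le[OF L_gt]] D_pos'[OF L_gt] by simp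
   ultimately have "(LINT y|BB2. indicator (box c d) y * tau (Psi2 y)) = (LINT y|BB2. indicator (box c d) y * tau' (Psi2 y))" by simp
   moreover have "integrable BB2 (%y. indicator (box c d) y * s y)" if "integrable BB2 s" for s :: "_ => real"
    using integrable_bounded_mult[OF that, of "%y. indicator (box c d) y * 1" 1] box_coefficient(1)[of c d "%_. 1" Box2]
    by (auto split: split_indicator)
   ultimately show "(LINT z|BB2. indicator (box c d) z * (tau (Psi2 z) - tau' (Psi2 z))) = 0"
    using it by (simp add: right_diff_distrib)
  qed simp
 qed
 hence "AE y in BB2. tau (Psi2 y) = tau' (Psi2 y)" by simp
 moreover have "{p : space (bdry_area Sig). tau p = tau' p} : sets (bdry_area Sig)" using mt by measurable
 ultimately show "AE p in bdry_area Sig. tau p = tau' p" using bdry_facts(4)[of "%p. tau p = tau' p"] by blast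
qed

end

lemma L2_tendsto_uniform:
 assumes fin: "emeasure M (space M) < top" and u: "u : borel_measurable M"
  and bd: "!!n z. z : space M ==> norm (f n z - u z) <= eps n" and eps: "eps \<longlonglongrightarrow> (0::real)"
 shows "L2_tendsto M f u"
 unfolding L2_tendsto_def
proof (intro conjI u)
 have le: "(\<integral>\<^sup>+z. ennreal ((norm (f n z - u z))^2) \<partial>M) <= emeasure M (space M) * ennreal ((eps n)^2)" for n
 proof -
  have "(\<integral>\<^sup>+z. ennreal ((norm (f n z - u z))^2) \<partial>M) <= (\<integral>\<^sup>+z. ennreal ((eps n)^2) \<partial>M)"
   using bd by (intro nn_integral_mono ennreal_leI power_mono) auto
  thus ?thesis by (simp add: mult.commute)
 qed
 have "(%n. ennreal ((eps n)^2)) \<longlonglongrightarrow> ennreal (0^2)" by (intro tendsto_intros eps)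
 hence lim: "(%n. emeasure M (space M) * ennreal ((eps n)^2)) \<longlonglongrightarrow> 0" using ennreal_tendsto_cmult[OF fin] by fastforce
 show "(%n. \<integral>\<^sup>+z. ennreal ((norm (f n z - u z))^2) \<partial>M) \<longlonglongrightarrow> 0"
  by (rule tendsto_sandwich[OF _ _ tendsto_const lim]) (intro always_eventually allI le zero_le)+
qed

section \<open>Radial functions: membership in \<open>H1\<close> and the Jacobi form\<close>

context truncated_profile begin

lemma L_pos: "0 < L" using L_gt bpos2 by linarith

lemma finite_vol: "emeasure (vol Sig) (space (vol Sig)) < top" "emeasure (bdry_area Sig) (space (bdry_area Sig)) < top"
proof -
 have fin: "emeasure BB Box < top" "emeasure BB2 Box2 < top"
  using finite_measure.emeasure_finite[OF finite_BB(1), of Box] finite_measure.emeasure_finite[OF finite_BB(2), of Box2]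
  by (simp_all add: less_top)
 obtain w0 w1 where w: "!!z. z : Box ==> w3 z <= w1" using w_bounds by metis
 have "emeasure (vol Sig) (space (vol Sig)) = (\<integral>\<^sup>+z. ennreal (w3 z) * 1 \<partial>BB)"
  using vol_facts(2)[of "%_. 1"] by simp
 also have "... <= (\<integral>\<^sup>+z. ennreal w1 \<partial>BB)" using w by (intro nn_integral_mono) (auto intro: ennreal_leI)
 also have "... < top" using fin by (simp add: ennreal_mult_less_top)
 finally show "emeasure (vol Sig) (space (vol Sig)) < top" .
 have "emeasure (bdry_area Sig) (space (bdry_area Sig)) = (\<integral>\<^sup>+z. ennreal area2 * 1 \<partial>BB2)"
  using bdry_facts(2)[of "%_. 1"] by simp
 also have "... < top" using fin by (simp add: ennreal_mult_less_top)
 finally show "emeasure (bdry_area Sig) (space (bdry_area Sig)) < top" .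
qed

lemma interior_norm:
 assumes "p : mfd_int Sig"
 shows "L * (norm p)^2 : {b^2..L}" "norm p <= 1"
proof -
 obtain t al be where p: "p = Psi t al be" "b^2 <= t" "t < L" using assms unfolding interior_Sig by auto
 show "L * (norm p)^2 : {b^2..L}" unfolding p(1) Psi_norm[OF p(2)] using p by simp
 hence "L * (norm p)^2 <= L * 1" by simp
 from mult_left_le_imp_le[OF this L_pos] have "(norm p)^2 <= 1^2" by simp
 thus "norm p <= 1" by (rule power2_le_imp_le) simp
qed

lemma space_vol: "space (vol Sig) = mfd_int Sig" "space (bdry_area Sig) <= {p. L * (norm p)^2 = L}"
proof -
 show "space (vol Sig) = mfd_int Sig"
  using sets_eq_imp_space_eq[OF sets_area_measure[of "TYPE(3)" Sig]] by (simp add: space_restrict_space)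
 have "space (bdry_area Sig) = mfd_interior TYPE(2) (mfd_boundary TYPE(3) Sig)"
  using sets_eq_imp_space_eq[OF sets_area_measure[of "TYPE(2)" "mfd_boundary TYPE(3) Sig"]] by (simp add: space_restrict_space)
 also have "... <= mfd_boundary TYPE(3) Sig" unfolding mfd_interior_def local_param_def using openin_imp_subset by blast
 also have "... <= {p. L * (norm p)^2 = L}" unfolding boundary_Sig using Psi_norm[OF less_imp_le[OF L_gt]] by blast
 finally show "space (bdry_area Sig) <= {p. L * (norm p)^2 = L}" .
qed

definition proj :: "real^4 => real^4" where "proj p = p - (p \<bullet> nuSig p) *\<^sub>R nuSig p"

lemma nu_interior_continuous: "continuous_on (mfd_int Sig) nuSig"
proof -
 have "mfd_int Sig <= Sig" unfolding mfd_interior_def local_param_def using openin_imp_subset by blast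
 thus ?thesis using unit_normal_Sig continuous_on_subset unfolding unit_normal_def by blast
qed

lemma radial_measurable:
 fixes h :: "real => 'z::euclidean_space"
 assumes "continuous_on {b^2..L} h"
 shows "continuous_on (mfd_int Sig) (%p. h (L * (norm p)^2))"
 by (rule continuous_on_compose2[OF assms]) (use interior_norm(1) in "auto intro!: continuous_intros")

text \<open>A polynomial in \<open>L * (norm p)^2\<close> is a polynomial on the whole space, hence
  an admissible approximant, and closeness in C1 on \<open>{b^2..L}\<close> is uniform closeness of
  functions and gradients. On the hypersurface \<open>L * (norm p)^2\<close> recovers the parameter
  \<open>t\<close>.\<close>

lemma radial_H1_data:
 assumes dU: "!!t. t : {b^2..L} ==> (U has_real_derivative U' t) (at t within {b^2..L})" and cU: "continuous_on {b^2..L} U'"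
 shows "H1_data Sig (%p. U (L * (norm p)^2)) (%p. (2 * L * U' (L * (norm p)^2)) *\<^sub>R proj p) (%p. U L)"
proof -
 have "EX p p'. real_polynomial_function p & (ALL t. (p has_real_derivative p' t) (at t)) &
   (ALL t:{b^2..L}. abs (U t - p t) <= 1 / real (Suc n) & abs (U' t - p' t) <= 1 / real (Suc n))" for n
  by (rule polynomial_C1_approximation[OF L_gt dU cU, of "1 / real (Suc n)"]) (assumption, simp, blast)
 then obtain P P' where P: "!!n. real_polynomial_function (P n)" "!!n t. (P n has_real_derivative P' n t) (at t)"
  "!!n t. t : {b^2..L} ==> abs (U t - P n t) <= 1 / real (Suc n)" "!!n t. t : {b^2..L} ==> abs (U' t - P' n t) <= 1 / real (Suc n)"
  by metis
 define f where "f = (%n p::real^4. P n (L * (norm p)^2))"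
 have "real_polynomial_function (f n)" for n
 proof -
  have "polynomial_function (%p::real^4. L * (norm p)^2)"
   unfolding real_polynomial_function_eq[symmetric]
   by (intro real_polynomial_function.intros(4) real_polynomial_function_norm_square real_polynomial_function.intros(2))
  from real_polynomial_function_compose[OF this P(1)[of n]] show ?thesis unfolding f_def o_def .
 qed
 hence sm: "smooth_on UNIV (f n)" for n by (rule smooth_on_real_polynomial_function)
 have df: "(f n has_derivative (%v. P' n (L * (norm p)^2) * (2 * L * (p \<bullet> v)))) (at p)" for n p
 proof -
  have "((%p::real^4. L * (p \<bullet> p)) has_derivative (%v. L * (p \<bullet> v + v \<bullet> p))) (at p)" by (intro has_derivative_mult_right has_derivative_inner has_derivative_ident)
  hence "((%p::real^4. L * (norm p)^2) has_derivative (%v. 2 * L * (p \<bullet> v))) (at p)"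
   by (simp add: power2_norm_eq_inner inner_commute mult_ac)
  from has_derivative_compose[OF this P(2)[of n "L * (norm p)^2", unfolded has_field_derivative_def]] show ?thesis unfolding f_def .
 qed
 have gr: "tangential_grad Sig (f n) p = (2 * L * P' n (L * (norm p)^2)) *\<^sub>R proj p" if p: "p : mfd_int Sig" for n p
 proof -
  have "tangential_grad Sig (f n) p \<bullet> v = ((2 * L * P' n (L * (norm p)^2)) *\<^sub>R proj p) \<bullet> v" for v
   unfolding tangential_grad_inner[OF df p] proj_def by (simp add: inner_diff inner_commute mult_ac)
  thus ?thesis using vector_eq_rdot by blast
 qed
 have e0: "(%n. 1 / real (Suc n)) \<longlonglongrightarrow> 0" using LIMSEQ_inverse_real_of_nat by (simp add: inverse_eq_divide)
 have cU0: "continuous_on {b^2..L} U" unfolding continuous_on_eq_continuous_within using dU DERIV_continuous by blast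
 show ?thesis unfolding H1_data_def
 proof (intro exI[of _ f] conjI allI sm)
  show "L2_tendsto (vol Sig) f (%p. U (L * (norm p)^2))"
   by (rule L2_tendsto_uniform[OF finite_vol(1) vol_measurable(1)[OF radial_measurable[OF cU0]] _ e0])
    (use P(3) interior_norm(1) in "auto simp: f_def space_vol abs_minus_commute")
  show "L2_tendsto (bdry_area Sig) f (%p. U L)"
   by (rule L2_tendsto_uniform[OF finite_vol(2) borel_measurable_const _ e0])
    (use P(3)[of L] space_vol(2) L_gt in "auto simp: f_def abs_minus_commute dest!: subsetD")
  show "L2_tendsto (vol Sig) (%n. tangential_grad Sig (f n)) (%p. (2 * L * U' (L * (norm p)^2)) *\<^sub>R proj p)"
  proof (rule L2_tendsto_uniform[OF finite_vol(1) vol_measurable(1)])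
   show "continuous_on (mfd_int Sig) (%p. (2 * L * U' (L * (norm p)^2)) *\<^sub>R proj p)"
    unfolding proj_def by (intro continuous_intros radial_measurable[OF cU] nu_interior_continuous)
   show "(%n. 2 * L * (1 / real (Suc n)) * 2) \<longlonglongrightarrow> 0" using tendsto_mult_left[OF e0, of "2 * L * 2"] by (simp add: mult_ac)
   fix n p assume "p : space (vol Sig)"
   hence p: "p : mfd_int Sig" by (simp add: space_vol)
   have n1: "norm (nuSig p) = 1" using normal_tangential_deriv(5)[OF p unit_normal_Sig] .
   have "norm (proj p) <= norm p + norm ((p \<bullet> nuSig p) *\<^sub>R nuSig p)" unfolding proj_def by (rule norm_triangle_ineq4)
   also have "... <= 2" using interior_norm(2)[OF p] Cauchy_Schwarz_ineq2[of p "nuSig p"] n1 by simp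
   finally have pr: "norm (proj p) <= 2" .
   have "tangential_grad Sig (f n) p - (2 * L * U' (L * (norm p)^2)) *\<^sub>R proj p =
     (2 * L * (P' n (L * (norm p)^2) - U' (L * (norm p)^2))) *\<^sub>R proj p"
    unfolding gr[OF p] by (simp add: algebra_simps)
   moreover have "norm ... = 2 * L * abs (P' n (L * (norm p)^2) - U' (L * (norm p)^2)) * norm (proj p)"
    using L_pos by (simp add: abs_mult)
   moreover have "... <= 2 * L * (1 / real (Suc n)) * 2"
    using P(4)[OF interior_norm(1)[OF p]] pr L_pos by (intro mult_mono) (auto simp: abs_minus_commute)
   ultimately show "norm (tangential_grad Sig (f n) p - (2 * L * U' (L * (norm p)^2)) *\<^sub>R proj p) <= 2 * L * (1 / real (Suc n)) * 2"
    by (simp only:)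
  qed
 qed
qed

text \<open>The tangential part of the position points along the meridian, so gradients of radial
  functions have an \<open>e1\<close> component only.\<close>

lemma proj_Psi3:
 assumes z: "z : Box"
 shows "proj (Psi3 z) = (D (fst z) / rho) *\<^sub>R e1 z"
proof -
 have t: "b^2 <= fst z" using z by (simp add: Box_iff)
 have N: "N1 (fst z) * N1 (fst z) = 1 - N2 (fst z) * N2 (fst z)" using N_unit[OF t] by (simp add: power2_eq_square)
 have N': "N2 (fst z) * N2 (fst z) = 1 - N1 (fst z) * N1 (fst z)" using N by simp
 have "proj (Psi3 z) = cyl (xi (fst z) / rho - (xi (fst z) / rho * N1 (fst z) + eta (fst z) / rho * N2 (fst z)) * N1 (fst z))
   (eta (fst z) / rho - (xi (fst z) / rho * N1 (fst z) + eta (fst z) / rho * N2 (fst z)) * N2 (fst z)) (fst (snd z)) (snd (snd z))"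
  unfolding proj_def nu_Psi3[OF t] unfolding Psi3_def Psi_def cyl_inner unfolding cyl_def by (simp add: algebra_simps)
 also have "xi (fst z) / rho - (xi (fst z) / rho * N1 (fst z) + eta (fst z) / rho * N2 (fst z)) * N1 (fst z) = D (fst z) / rho * - N2 (fst z)"
  unfolding D_def using N rho_pos by (simp add: field_simps) algebra
 also have "eta (fst z) / rho - (xi (fst z) / rho * N1 (fst z) + eta (fst z) / rho * N2 (fst z)) * N2 (fst z) = D (fst z) / rho * N1 (fst z)"
  unfolding D_def using N' rho_pos by (simp add: field_simps) algebra
 finally show ?thesis unfolding e1_def cyl_scale .
qed

lemma second_ff_radial: "p : mfd_int Sig ==> second_ff_norm2 Sig nuSig p = rho^2 * W (L * (norm p)^2)"
 unfolding interior_Sig using second_ff_Sig Psi_norm by auto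

text \<open>Green's identity with \<open>k = U'\<close>. The equation turns the interior integral
  into the eigenvalue term, and the boundary term is cancelled by the trace term through
  \<open>F L * U' L = c1 L * U L\<close>, since \<open>c1 L / rho = area2\<close>. The factor
  \<open>rho^2\<close> reflects the dilation by \<open>1 / rho\<close>.\<close>

lemma jacobi_form_radial:
 assumes dU: "!!t. t : {b^2..L} ==> (U has_real_derivative U' t) (at t within {b^2..L})" and cU: "continuous_on {b^2..L} U'"
  and ode: "!!t. t : {b^2..L} ==> ((%t. F t * U' t) has_real_derivative - (m t * ((W t + Lam) * U t))) (at t within {b^2..L})"
  and robin: "F L * U' L = c1 L * U L" and v: "v : H1 Sig"
 shows "jacobi_form Sig nuSig (%p. U (L * (norm p)^2)) v = Lam * rho^2 * (LINT p|vol Sig. U (L * (norm p)^2) * v p)"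
proof -
 let ?u = "%p::real^4. U (L * (norm p)^2)" and ?X = "%p. (2 * L * U' (L * (norm p)^2)) *\<^sub>R proj p"
 note du = radial_H1_data[OF dU cU]
 have some: "EX tau. H1_data Sig u (weak_grad Sig u) tau" "EX X. H1_data Sig u X (bdry_trace Sig u)" if "H1_data Sig u X tau" for u X tau
  unfolding weak_grad_def bdry_trace_def
  by (rule someI[of "%X. EX tau. H1_data Sig u X tau"], use that in blast) (rule someI[of "%tau. EX X. H1_data Sig u X tau"], use that in blast)
 obtain X0 tau0 where v0: "H1_data Sig v X0 tau0" using v unfolding H1_def by blast
 define X where "X = weak_grad Sig v"
 obtain tau where dv: "H1_data Sig v X tau" using some(1)[OF v0] unfolding X_def by blast
 \<comment> \<open>\<open>X\<close> and \<open>tau\<close> belong to one common datum of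
   \<open>v\<close>, whereas \<open>weak_grad\<close> and \<open>bdry_trace\<close> are chosen
   independently of each other; uniqueness links them.\<close>
 have AEs: "AE p in vol Sig. weak_grad Sig ?u p = ?X p" "AE p in bdry_area Sig. bdry_trace Sig ?u p = U L"
   "AE p in bdry_area Sig. bdry_trace Sig v p = tau p"
  using H1_data_unique(1)[OF _ du] H1_data_unique(2)[OF _ du] H1_data_unique(2)[OF _ dv] some[OF du] some[OF v0] by blast+
 have meas: "weak_grad Sig ?u : borel_measurable (vol Sig)" "X : borel_measurable (vol Sig)" "?X : borel_measurable (vol Sig)"
   "?u : borel_measurable (vol Sig)" "v : borel_measurable (vol Sig)" "bdry_trace Sig ?u : borel_measurable (bdry_area Sig)"
   "bdry_trace Sig v : borel_measurable (bdry_area Sig)" "tau : borel_measurable (bdry_area Sig)"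
  using some[OF du] some[OF v0] dv du unfolding H1_data_def L2_tendsto_def by blast+
 have mW: "second_ff_norm2 Sig nuSig : borel_measurable (vol Sig)"
 proof (rule vol_measurable(1), rule continuous_on_eq)
  show "continuous_on (mfd_int Sig) (%p. rho^2 * W (L * (norm p)^2))"
   by (intro continuous_intros radial_measurable continuous_on_subset[OF profile_continuous(3)]) auto
 qed (simp add: second_ff_radial)
 define V where "V z = v (Psi3 z)" for z
 define P where "P z = X (Psi3 z) \<bullet> e1 z" for z
 let ?T = "LINT y|BB2. tau (Psi2 y)"
 have uPsi: "L * (norm (Psi3 z))^2 = fst z" if "z : Box" for z
  unfolding Psi3_def using that Psi_norm by (simp add: Box_iff)
 have cU0: "continuous_on {b^2..L} U" unfolding continuous_on_eq_continuous_within using dU DERIV_continuous by blast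
 have boxes: "box (b^2, - pi, - pi) (L, pi, pi) <= Box" "box (b^2, - pi, - pi) (L, pi, pi) ~= {}" "box (- pi, - pi) (pi, pi) <= Box2"
  unfolding Box_def Box2_def using L_gt pi_gt_zero by (auto simp: box_prod simp del: pi_gt_zero)
 have k: "continuous_on {b^2..L} (%t. - (m t * ((W t + Lam) * U t)))" "continuous_on {b^2..L} (%t. m t * U t)"
  by (intro continuous_intros cU0 continuous_on_subset[OF profile_continuous(1)] continuous_on_subset[OF profile_continuous(3)]; simp)+
 have ode': "((%t. F t * U' t) has_real_derivative - (m t * ((W t + Lam) * U t))) (at t)" if "b^2 < t" "t < L" for t
  using ode[of t] that by (simp add: at_within_Icc_at)
 have h: "continuous_on (cbox (b^2, - pi, - pi) (L, pi, pi)) (%z. - (m (fst z) * ((W (fst z) + Lam) * U (fst z))))"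
  "continuous_on (cbox (b^2, - pi, - pi) (L, pi, pi)) (%z. U' (fst z) * c1 (fst z))"
  by (intro cont_profile_slab k continuous_on_mult cU continuous_on_subset[OF cont_c1]; simp)+
 let ?h = "%z. - (m (fst z) * ((W (fst z) + Lam) * U (fst z)))"
 note green0 = H1_data_identity[OF dv frame_fields(1) boxes(1,2) h radial_boundary_identity[OF _ boxes(3) cU k(1) ode'], folded Box_def Box2_def V_def P_def]
 have green: "(LINT z|BB. indicator Box z * (?h z * V z + U' (fst z) * c1 (fst z) * P z)) = F L * U' L * (LINT y|BB2. indicator Box2 y * tau (Psi2 y))"
  "integrable BB (%z. indicator Box z * (?h z * V z))" "integrable BB (%z. indicator Box z * (U' (fst z) * c1 (fst z) * P z))"
  by (rule green0; assumption)+
 have iV: "integrable BB (%z. indicator Box z * (m (fst z) * U (fst z)) * V z)"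
 proof -
  have c: "continuous_on (cbox (b^2, - pi, - pi) (L, pi, pi)) (%z. m (fst z) * U (fst z))" by (rule cont_profile_slab[OF k(2)])
  obtain C where "!!z. abs (indicator Box z * (m (fst z) * U (fst z))) <= C" using box_coefficient(2)[OF c] unfolding Box_def by blast
  thus ?thesis unfolding V_def
   by (intro integrable_bounded_mult[OF H1_data_facts(1)[OF dv] box_coefficient(1)[OF c, folded Box_def]])
 qed
 \<comment> \<open>The term with \<open>Lam\<close> is added and subtracted so that the first
   summand becomes the integrand of \<open>green\<close>; the powers of \<open>rho\<close> combine
   through \<open>w3 = m / rho ^ 3\<close> and \<open>L = rho^2\<close>.\<close>
 have I1: "(LINT p|vol Sig. weak_grad Sig ?u p \<bullet> weak_grad Sig v p - second_ff_norm2 Sig nuSig p * ?u p * v p) =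
  (LINT z|BB. (1 / rho) * (indicator Box z * (- (m (fst z) * ((W (fst z) + Lam) * U (fst z))) * V z + U' (fst z) * c1 (fst z) * P z)
    + Lam * (indicator Box z * (m (fst z) * U (fst z)) * V z)))"
 proof -
  have "(LINT p|vol Sig. weak_grad Sig ?u p \<bullet> weak_grad Sig v p - second_ff_norm2 Sig nuSig p * ?u p * v p) =
    (LINT p|vol Sig. ?X p \<bullet> X p - second_ff_norm2 Sig nuSig p * ?u p * v p)"
  proof (rule integral_cong_AE)
   show "AE p in vol Sig. weak_grad Sig ?u p \<bullet> weak_grad Sig v p - second_ff_norm2 Sig nuSig p * ?u p * v p = ?X p \<bullet> X p - second_ff_norm2 Sig nuSig p * ?u p * v p"
    using AEs(1) unfolding X_def by eventually_elim simp
  qed (intro borel_measurable_diff borel_measurable_times borel_measurable_inner meas mW meas(2)[unfolded X_def])+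
  also have "... = (LINT z|BB. w3 z * (?X (Psi3 z) \<bullet> X (Psi3 z) - second_ff_norm2 Sig nuSig (Psi3 z) * ?u (Psi3 z) * v (Psi3 z)))"
   by (rule vol_facts(3)) (intro borel_measurable_diff borel_measurable_times borel_measurable_inner meas mW)
  also have "... = (LINT z|BB. (1 / rho) * (indicator Box z * (- (m (fst z) * ((W (fst z) + Lam) * U (fst z))) * V z + U' (fst z) * c1 (fst z) * P z)
    + Lam * (indicator Box z * (m (fst z) * U (fst z)) * V z)))"
  proof (intro Bochner_Integration.integral_cong refl)
   fix z assume "z : space BB"
   hence z: "z : Box" by simp
   have t: "b^2 < fst z" using z by (simp add: Box_iff)
   have md: "xi (fst z) * eta (fst z) = 2 * m (fst z) * D (fst z)" unfolding m_eq[OF t] using D_pos'[OF t] by simp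
   show "w3 z * (?X (Psi3 z) \<bullet> X (Psi3 z) - second_ff_norm2 Sig nuSig (Psi3 z) * ?u (Psi3 z) * v (Psi3 z)) =
    (1 / rho) * (indicator Box z * (- (m (fst z) * ((W (fst z) + Lam) * U (fst z))) * V z + U' (fst z) * c1 (fst z) * P z)
    + Lam * (indicator Box z * (m (fst z) * U (fst z)) * V z))"
    unfolding w3_Box[OF z] uPsi[OF z] proj_Psi3[OF z] second_ff_radial[OF Psi3_interior[OF z]] V_def[symmetric] c1_def md
    using z rho_pos by (simp add: P_def L_def inner_commute field_simps power2_eq_square power3_eq_cube)
  qed
  finally show ?thesis .
 qed
 have I2: "(LINT p|bdry_area Sig. bdry_trace Sig ?u p * bdry_trace Sig v p) = area2 * U L * ?T"
 proof -
  have "(LINT p|bdry_area Sig. bdry_trace Sig ?u p * bdry_trace Sig v p) = (LINT p|bdry_area Sig. U L * tau p)"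
  proof (rule integral_cong_AE)
   show "AE p in bdry_area Sig. bdry_trace Sig ?u p * bdry_trace Sig v p = U L * tau p"
    using AEs(2,3) by eventually_elim simp
  qed (intro borel_measurable_times borel_measurable_const meas)+
  also have "... = (LINT y|BB2. area2 * (U L * tau (Psi2 y)))"
   by (rule bdry_facts(3)) (intro borel_measurable_times borel_measurable_const meas)
  finally show ?thesis by simp
 qed
 have I3: "(LINT p|vol Sig. ?u p * v p) = (LINT z|BB. (1 / rho ^ 3) * (indicator Box z * (m (fst z) * U (fst z)) * V z))"
 proof -
  have "(LINT p|vol Sig. ?u p * v p) = (LINT z|BB. w3 z * (?u (Psi3 z) * v (Psi3 z)))"
   by (rule vol_facts(3)) (intro borel_measurable_times meas)
  also have "... = (LINT z|BB. (1 / rho ^ 3) * (indicator Box z * (m (fst z) * U (fst z)) * V z))"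
   by (intro Bochner_Integration.integral_cong refl) (simp add: w3_Box uPsi V_def)
  finally show ?thesis .
 qed
 have T: "(LINT y|BB2. indicator Box2 y * tau (Psi2 y)) = ?T" by (intro Bochner_Integration.integral_cong refl) simp
 have ig: "integrable BB (%z. indicator Box z * (- (m (fst z) * ((W (fst z) + Lam) * U (fst z))) * V z + U' (fst z) * c1 (fst z) * P z))"
  unfolding distrib_left by (intro Bochner_Integration.integrable_add green(2,3))
 have "jacobi_form Sig nuSig ?u v = (1 / rho) * (F L * U' L * ?T + Lam * (LINT z|BB. indicator Box z * (m (fst z) * U (fst z)) * V z)) - area2 * U L * ?T"
  unfolding jacobi_form_def I1 I2 using ig iV green(1) T by simp
 also have "... = Lam * rho^2 * (LINT p|vol Sig. ?u p * v p)"
  unfolding I3 robin c1_def area2_def using rho_pos by (simp add: field_simps power2_eq_square power3_eq_cube)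
 finally show ?thesis .
qed

end

section \<open>Sign of the normal, equivariance and the lower bound for the index\<close>

lemma tangential_deriv_normal_minus:
 assumes p: "p : mfd_int M" and nu: "unit_normal M nu"
 shows "tangential_deriv M (%x. - nu x) p = (%v. - tangential_deriv M nu p v)"
proof (rule tangential_deriv_eqI[OF p])
 note n = normal_tangential_deriv[OF p nu]
 show "((%x. - nu x) has_derivative (%v. - tangential_deriv M nu p v)) (at p within M)" by (rule has_derivative_minus[OF n(1)])
 fix w assume w: "!!v. v : tangent_space M p ==> w \<bullet> v = 0"
 have n1: "nu p \<bullet> nu p = 1" using n(5) by (simp add: norm_eq_1)
 let ?w = "w - (w \<bullet> nu p) *\<^sub>R nu p"
 have "?w : tangent_space M p" unfolding n(4) by (simp add: inner_diff_right inner_commute n1)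
 hence "w \<bullet> ?w = 0" "nu p \<bullet> ?w = 0" using w n(4) by auto
 hence "?w \<bullet> ?w = 0" by (simp add: inner_diff_left)
 hence w: "w = (w \<bullet> nu p) *\<^sub>R nu p" by simp
 show "- tangential_deriv M nu p w = 0" by (subst w) (simp add: linear_scale[OF n(3)] n(2))
qed

lemma normal_minus:
 assumes p: "p : mfd_int M" and nu: "unit_normal M nu"
 shows "mean_curvature M (%x. - nu x) p = - mean_curvature M nu p" "second_ff_norm2 M (%x. - nu x) p = second_ff_norm2 M nu p"
 unfolding mean_curvature_def second_ff_norm2_def second_ff_def tangential_deriv_normal_minus[OF assms]
 by (simp_all add: sum_negf)

lemma unit_normal_minus: "unit_normal M nu ==> unit_normal M (%x. - nu x)"
 unfolding unit_normal_def by (auto intro: continuous_on_minus)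

context plane_frame begin

lemma G_plane_split:
 assumes g: "g : G" and x: "g (cmb a1 a2 c1 c2) = cmb a1' a2' c1' c2'"
 shows "g (cmb a1 a2 0 0) = cmb a1' a2' 0 0" "g (cmb 0 0 c1 c2) = cmb 0 0 c1' c2'"
proof -
 note o = G_orthogonal[OF g]
 have "linear g" using o(1) by (simp add: orthogonal_transformation_linear)
 hence "g (cmb a1 a2 c1 c2) = g (cmb a1 a2 0 0) + g (cmb 0 0 c1 c2)" by (metis linear_add cmb_arith(1) add_0 add_0_right)
 hence "cmb a1' a2' c1' c2' = cmb (g (cmb a1 a2 0 0) \<bullet> f1) (g (cmb a1 a2 0 0) \<bullet> f2) (g (cmb 0 0 c1 c2) \<bullet> f3) (g (cmb 0 0 c1 c2) \<bullet> f4)"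
  unfolding x using o(4)[of a1 a2] o(5)[of c1 c2] by (metis cmb_arith(1) add_0 add_0_right)
 thus "g (cmb a1 a2 0 0) = cmb a1' a2' 0 0" "g (cmb 0 0 c1 c2) = cmb 0 0 c1' c2'"
  using o(4)[of a1 a2] o(5)[of c1 c2] by auto
qed

end

context truncated_profile begin

text \<open>In each of the two planes the normal is a multiple of the position, with a factor
  depending on \<open>t\<close> only, and \<open>g\<close> acts linearly on each plane. So
  reflections are covered as well as rotations, and \<open>normal_sgn\<close> is 1 on all of
  \<open>G\<close>.\<close>

lemma normal_equivariant:
 assumes g: "g : G" and p: "p : Sig"
 shows "g (nuSig (inv g p)) = nuSig p"
proof -
 note o = G_orthogonal[OF g]
 have lin: "linear g" using o(1) by (simp add: orthogonal_transformation_linear)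
 obtain t al be where t: "p = Psi t al be" "b^2 <= t" unfolding Sig_eq using p Sig_eq by auto
 obtain x y al' be' where q: "inv g p = cyl x y al' be'" "x >= 0" "y >= 0" using cyl_cases by metis
 have "g (cyl x y al' be') = Psi t al be" using o(3) q(1) t(1) by (metis bij_inv_eq_iff)
 note sp = G_plane_split[OF g this[unfolded Psi_def cyl_def]]
 have x: "x = xi t / rho"
 proof -
  have "norm (cyl x 0 al' 0) = norm (cyl (xi t / rho) 0 al 0)"
   using arg_cong[OF sp(1), of norm] unfolding o(2) cyl_def by simp
  hence "x^2 = (xi t / rho)^2" using cyl_norm[of x 0 al' 0] cyl_norm[of "xi t / rho" 0 al 0] by simp
  moreover have "0 <= xi t / rho" using xi_pos[of t] t(2) start rho_pos by (cases "t = b^2") auto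
  ultimately show ?thesis using q(2) by (simp add: power2_eq_iff_nonneg)
 qed
 have y: "y = eta t / rho"
 proof -
  have "norm (cyl 0 y 0 be') = norm (cyl 0 (eta t / rho) 0 be)"
   using arg_cong[OF sp(2), of norm] unfolding o(2) cyl_def by simp
  hence "y^2 = (eta t / rho)^2" using cyl_norm[of 0 y 0 be'] cyl_norm[of 0 "eta t / rho" 0 be] by simp
  moreover have "0 <= eta t / rho" using eta_pos[OF t(2)] rho_pos by simp
  ultimately show ?thesis using q(3) by (simp add: power2_eq_iff_nonneg)
 qed
 have n: "nuSig (inv g p) = cyl (N1 t) (N2 t) al' be'" unfolding q(1) x y using nu_Psi[OF t(2)] unfolding Psi_def .
 have scale: "g (cmb (k * a1) (k * a2) (l * c1) (l * c2)) = k *\<^sub>R g (cmb a1 a2 0 0) + l *\<^sub>R g (cmb 0 0 c1 c2)" for k l a1 a2 c1 c2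
 proof -
  have "cmb (k * a1) (k * a2) (l * c1) (l * c2) = k *\<^sub>R cmb a1 a2 0 0 + l *\<^sub>R cmb 0 0 c1 c2" by simp
  thus ?thesis using lin by (simp add: linear_add linear_scale del: cmb_arith)
 qed
 \<comment> \<open>On the circular orbit both \<open>xi\<close> and \<open>N1\<close> vanish, so any
   factor would do; 0 avoids the division.\<close>
 define k l where "k = (if t = b^2 then 0 else N1 t * rho / xi t)" "l = N2 t * rho / eta t"
 have kl: "N1 t = k * x" "N2 t = l * y"
  using xi_pos[of t] eta_pos[OF t(2)] t(2) start rho_pos unfolding k_l_def x y by auto
 have "g (nuSig (inv g p)) = k *\<^sub>R g (cmb (x * cos al') (x * sin al') 0 0) + l *\<^sub>R g (cmb 0 0 (y * cos be') (y * sin be'))"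
  unfolding n kl cyl_def scale[symmetric] by (simp add: mult.assoc)
 also have "... = cyl (N1 t) (N2 t) al be" unfolding sp unfolding kl cyl_def x y by (simp add: mult.assoc)
 finally show ?thesis unfolding t(1) nu_Psi[OF t(2)] .
qed

lemma radial_eigenfunction:
 assumes dU: "!!t. t : {b^2..L} ==> (U has_real_derivative U' t) (at t within {b^2..L})" and cU: "continuous_on {b^2..L} U'"
  and ode: "!!t. t : {b^2..L} ==> ((%t. F t * U' t) has_real_derivative - (m t * ((W t + Lam) * U t))) (at t within {b^2..L})"
  and robin: "F L * U' L = c1 L * U L"
 shows "(%p. U (L * (norm p)^2)) : eigenspace G Sig nuSig (Lam * rho^2)"
proof -
 have "normal_sgn Sig nuSig g * U (L * (norm (inv g p))^2) = U (L * (norm p)^2)" if g: "g : G" for g p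
 proof -
  have "norm (inv g p) = norm p" using G_orthogonal(2,3)[OF g] by (metis bij_inv_eq_iff)
  thus ?thesis unfolding normal_sgn_def using normal_equivariant[OF g] by simp
 qed
 hence "(%p. U (L * (norm p)^2)) : equivariant_H1 G Sig nuSig"
  unfolding equivariant_H1_def H1_def using radial_H1_data[OF dU cU] by auto
 thus ?thesis
  unfolding eigenspace_def using jacobi_form_radial[OF dU cU ode robin] by (auto simp: equivariant_H1_def)
qed

text \<open>By continuity and \<open>U (b^2) = 1\<close> the function is nonzero on a nonempty open
  part of \<open>Box\<close>, which is not a null set; so it is nonzero as a class.\<close>

lemma radial_AE_dim:
 assumes U: "continuous_on {b^2..L} U" "U (b^2) = 1" and V: "(%p. U (L * (norm p)^2)) : S"
 shows "1 <= AE_dim (vol Sig) S"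
proof -
 let ?u = "%p::real^4. U (L * (norm p)^2)"
 have "AE_independent (vol Sig) {?u}"
  unfolding AE_independent_def
 proof (intro allI impI ballI)
  fix c :: "(real^4 => real) => real" and u
  assume z: "AE p in vol Sig. (\<Sum>u\<in>{?u}. c u * u p) = 0" and u: "u : {?u}"
  show "c u = 0"
  proof (rule ccontr)
   assume "c u ~= 0"
   hence "AE p in vol Sig. ?u p = 0" using z u by simp
   moreover have "?u : borel_measurable (vol Sig)" by (rule vol_measurable(1)[OF radial_measurable[OF U(1)]])
   hence "{p : space (vol Sig). ?u p = 0} : sets (vol Sig)" by measurable
   ultimately have "AE z in BB. ?u (Psi3 z) = 0" using vol_facts(4)[of "%p. ?u p = 0"] by blast
   hence ae: "AE z in lborel. z : Box --> ?u (Psi3 z) = 0" by (subst (asm) AE_restrict_space_iff) (auto simp: open_Boxes borel_open)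
   obtain d where d: "0 < d" "!!t. t : {b^2..L} ==> dist t (b^2) < d ==> dist (U t) (U (b^2)) < 1"
    using U(1) L_gt unfolding continuous_on_iff by (metis atLeastAtMost_iff less_imp_le order_refl zero_less_one)
   let ?R = "Box Int {z. fst z < b^2 + d}"
   have "AE z in lborel. z ~: ?R"
    using ae
   proof eventually_elim
    case (elim z)
    show ?case
    proof
     assume z: "z : ?R"
     hence "?u (Psi3 z) = U (fst z)" unfolding Psi3_def using Psi_norm by (simp add: Box_iff)
     hence "U (fst z) = 0" using elim z by simp
     thus False using d(2)[of "fst z"] z U(2) by (auto simp: Box_iff dist_real_def)
    qed
   qed
   moreover have oR: "open ?R" by (intro open_Int open_Boxes open_Collect_less continuous_intros)
   ultimately have "?R : null_sets lborel" by (subst (asm) AE_iff_null_sets[symmetric]) auto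
   hence "negligible ?R" using oR by (simp add: negligible_iff_null_sets null_sets_completion_iff)
   moreover have "(b^2 + min d (L - b^2) / 2, 0, 0) : ?R" using d(1) L_gt by (auto simp: Box_iff min_def field_simps)
   ultimately show False using open_not_negligible[OF oR] by blast
  qed
 qed
 hence "enat (card {?u}) <= AE_dim (vol Sig) S" unfolding AE_dim_def by (intro SUP_upper) (use V in auto)
 thus ?thesis by (simp add: one_enat_def)
qed

text \<open>The \<open>l\<close> Robin eigenvalues are distinct and negative, and each contributes
  at least 1 through its radial eigenfunction; multiplicities need not be known.\<close>

lemma equivariant_index_ge:
 assumes s: "s 0 = b^2" "!!i. i < l ==> s i < s (Suc i)" "s l = L" "!!i. 1 <= i ==> i <= l ==> u0 (s i) = 0"
 shows "enat l <= equivariant_index G Sig nuSig"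
proof -
 interpret S: sturm_data "b^2" L F m W by (rule profile_sturm_data[OF L_gt])
 have c: "continuous_on {b^2..L} u0" "continuous_on {b^2..L} Y0"
  using continuous_on_subset[OF profile_continuous(4)] continuous_on_subset[OF profile_continuous(5)] by auto
 have st: "u0 (b^2) ~= 0" "Y0 (b^2) = 0" unfolding u0_def Y0_def by (simp_all add: start) (use b_pos in simp)
 have c1: "0 < c1 L" unfolding c1_def using xi_pos[OF L_gt] eta_pos[OF less_imp_le[OF L_gt]] rho_pos by simp
 obtain Lam U U' where U: "inj_on Lam {..<l}" "!!j. j < l ==> Lam j < (0::real)" "!!j. j < l ==> U j (b^2) = (1::real)"
  "!!j. j < l ==> continuous_on {b^2..L} (U' j)"
  "!!j t. j < l ==> t : {b^2..L} ==> (U j has_real_derivative U' j t) (at t within {b^2..L})"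
  "!!j t. j < l ==> t : {b^2..L} ==>
   ((%t. F t * U' j t) has_real_derivative - (m t * ((W t + Lam j) * U j t))) (at t within {b^2..L})"
  "!!j. j < l ==> F L * U' j L = c1 L * U j L"
  apply (rule S.negative_robin_eigenvalues[of u0 Y0 s l "c1 L"])
  subgoal by (rule c(1))
  subgoal by (rule st(1))
  subgoal by (rule c(2))
  subgoal by (rule st(2))
  subgoal by (rule profile_eqs(2))
  subgoal by (rule profile_eqs(3))
  subgoal by (rule s(1))
  subgoal by (rule s(2))
  subgoal by (rule s(3))
  subgoal by (rule s(4))
  subgoal by (rule c1)
  subgoal premises prems for Lam U U' by (rule prems(1)[of Lam U U']) (fact prems)+
  done
 define kap where "kap j = Lam j * rho^2" for j
 let ?d = "%kap. AE_dim (vol Sig) (eigenspace G Sig nuSig kap)"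
 have inj: "inj_on kap {..<l}" using U(1) rho_pos unfolding kap_def inj_on_def by simp
 have neg: "kap ` {..<l} <= {..<0}" using U(2) rho_pos by (auto simp: kap_def mult_neg_pos)
 have d1: "1 <= ?d (kap j)" if j: "j < l" for j
  unfolding kap_def
 proof (rule radial_AE_dim[of "U j"])
  show "continuous_on {b^2..L} (U j)"
   unfolding continuous_on_eq_continuous_within using U(5)[OF j] DERIV_continuous by blast
  show "(%p. U j (L * (norm p)^2)) : eigenspace G Sig nuSig (Lam j * rho^2)"
   by (rule radial_eigenfunction[where U'="U' j"]) (use U(4-7)[OF j] in auto)
 qed (rule U(3)[OF j])
 have "enat l = (\<Sum>j<l. 1)" by (simp add: of_nat_eq_enat)
 also have "... <= (\<Sum>j<l. ?d (kap j))" by (intro sum_mono d1) simp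
 also have "... = (\<Sum>kap\<in>kap ` {..<l}. ?d kap)" by (simp add: sum.reindex[OF inj])
 \<comment> \<open>The infinite sum of extended naturals is the supremum of its finite partial
   sums.\<close>
 also have "... <= equivariant_index G Sig nuSig"
  unfolding equivariant_index_def using neg by (subst nonneg_infsum_complete) (auto intro!: SUP_upper)
 finally show ?thesis .
qed

text \<open>The normal enters only through \<open>normal_sgn\<close> and
  \<open>second_ff_norm2\<close>, and both are unchanged when it is reversed.\<close>

lemma equivariant_index_minus: "equivariant_index G Sig (%x. - nuSig x) = equivariant_index G Sig nuSig"
proof -
 have 1: "normal_sgn Sig (%x. - nuSig x) g = normal_sgn Sig nuSig g" if "g : G" for g
 proof -
  have "linear g" using G_orthogonal(1)[OF that] by (simp add: orthogonal_transformation_linear)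
  thus ?thesis unfolding normal_sgn_def by (simp add: linear_neg)
 qed
 hence e: "equivariant_H1 G Sig (%x. - nuSig x) = equivariant_H1 G Sig nuSig" unfolding equivariant_H1_def by auto
 have "jacobi_form Sig (%x. - nuSig x) u v = jacobi_form Sig nuSig u v" for u v
 proof -
  have "(LINT p|vol Sig. weak_grad Sig u p \<bullet> weak_grad Sig v p - second_ff_norm2 Sig (%x. - nuSig x) p * u p * v p) =
    (LINT p|vol Sig. weak_grad Sig u p \<bullet> weak_grad Sig v p - second_ff_norm2 Sig nuSig p * u p * v p)"
   by (intro Bochner_Integration.integral_cong refl) (simp add: space_vol normal_minus(2) unit_normal_Sig)
  thus ?thesis unfolding jacobi_form_def by simp
 qed
 thus ?thesis unfolding equivariant_index_def eigenspace_def e by simp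
qed

end

text \<open>By uniqueness of the circular orbit the points of \<open>A\<close> in the coordinate
  planes form one orbit, which stays in one plane and has constant norm; the frame is chosen so that
  this is the plane of \<open>f3\<close> and \<open>f4\<close>. Connectedness comes from the
  homeomorphism type, and unboundedness from meeting the cone outside every ball.\<close>

lemma alencar_invariant_minimal:
 assumes A: "alencar_hypersurface A nu"
 obtains f1 f2 f3 f4 b where "invariant_minimal f1 f2 f3 f4 A nu b"
proof -
 note a = A[unfolded alencar_hypersurface_def]
 have emb: "embedded_submanifold TYPE(3) A" using a by (elim conjE)
 have un: "unit_normal A nu" using a by (elim conjE)
 have Ginv: "ALL g:G. g ` A = A" using a by (elim conjE)
 have min: "ALL p:A. mean_curvature A nu p = 0" using a by (elim conjE)
 have hom: "A homeomorphic ((UNIV :: (real^2) set) \<times> sphere (0::real^2) 1)" using a by (elim conjE)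
 have ex1: "EX! S. circular_orbit S & S <= A" using a by (elim conjE)
 have cone: "ALL K. compact K --> A Int Ccone - K ~= {}" using a by (elim conjE)
 have z: "0 ~: A" using a by (elim conjE)
 have id: "(%x. x) : G" unfolding G_def by auto
 have orb: "G_orbit x <= A" if "x : A" for x unfolding G_orbit_def using Ginv that by blast
 have self: "x : G_orbit x" for x unfolding G_orbit_def using id by auto
 obtain S where S: "circular_orbit S & S <= A" "ALL T. circular_orbit T & T <= A --> T = S" using ex1 by (rule ex1E)
 then obtain p where p: "p : plane12 Un plane34" "p ~= 0" "S = G_orbit p" unfolding circular_orbit_def by blast
 have pA: "p : A" using S(1) p(3) self by blast
 have same: "EX g:G. x = g p" if x: "x : A" "x : plane12 Un plane34" for x
 proof -
  have "x ~= 0" using x(1) z by auto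
  hence "circular_orbit (G_orbit x)" unfolding circular_orbit_def using x(2) by (intro bexI[of _ x] conjI refl)
  hence "G_orbit x = S" using S(2) orb[OF x(1)] by simp
  thus ?thesis using self[of x] p(3) unfolding G_orbit_def by auto
 qed
 have "EX f1 f2 f3 f4. plane_frame f1 f2 f3 f4 & p \<bullet> f1 = 0 & p \<bullet> f2 = 0"
 proof (cases "p : plane34")
  case True
  thus ?thesis
   by (intro exI[of _ "axis 1 1"] exI[of _ "axis 2 1"] exI[of _ "axis 3 1"] exI[of _ "axis 4 1"])
    (auto simp: plane34_def plane_frame_def inner_axis)
 next
  case False
  hence "p : plane12" using p(1) by blast
  thus ?thesis
   by (intro exI[of _ "axis 3 1"] exI[of _ "axis 4 1"] exI[of _ "axis 1 1"] exI[of _ "axis 2 1"])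
    (auto simp: plane12_def plane_frame_def inner_axis)
 qed
 then obtain f1 f2 f3 f4 where f: "plane_frame f1 f2 f3 f4" "p \<bullet> f1 = 0" "p \<bullet> f2 = 0" by blast
 interpret plane_frame f1 f2 f3 f4 by (rule f(1))
 have planes: "x : plane12 Un plane34 \<longleftrightarrow> (x \<bullet> f3 = 0 & x \<bullet> f4 = 0) \<or> (x \<bullet> f1 = 0 & x \<bullet> f2 = 0)" for x
  using frame unfolding plane12_def plane34_def by (auto simp: inner_axis)
 have "invariant_minimal f1 f2 f3 f4 A nu (norm p)"
 proof (unfold_locales)
  show "connected A"
  proof -
   have "connected ((UNIV :: (real^2) set) \<times> sphere (0::real^2) 1)"
    by (intro connected_Times connected_UNIV connected_sphere) simp
   thus ?thesis using hom homeomorphic_connectedness by blast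
  qed
  show "EX x:A. norm x >= r" for r
   using spec[OF cone, of "cball 0 r"] by (force simp: dist_norm)
  show "0 < norm p" using p(2) by simp
  obtain x y al be where c: "p = cyl x y al be" "x >= 0" "y >= 0" using cyl_cases by metis
  have "x * cos al = 0" "x * sin al = 0" using f(2,3) unfolding c cyl_def by auto
  hence x: "x = 0" using sin_zero_abs_cos_one[of al] by auto
  hence "(norm p)^2 = y^2" unfolding c cyl_norm by simp
  hence y: "norm p = y" using c(3) by (simp add: power2_eq_iff_nonneg)
  have "rot 0 (- be) p = cyl 0 y al 0" unfolding c x rot_cyl by simp
  also have "... = cmb 0 0 (norm p) 0" unfolding y cyl_def by simp
  finally show "cmb 0 0 (norm p) 0 : A" using bspec[OF Ginv rot_in_G] pA by (metis imageI)
  show "norm x = norm p" if x: "x : A" "x \<bullet> f1 = 0" "x \<bullet> f2 = 0" for x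
  proof -
   obtain g where "g : G" "x = g p" using same[OF x(1)] planes x by blast
   thus ?thesis using G_orthogonal(2) by simp
  qed
  show "\<not> (x \<bullet> f3 = 0 & x \<bullet> f4 = 0)" if x: "x : A" for x
  proof
   assume x34: "x \<bullet> f3 = 0 & x \<bullet> f4 = 0"
   obtain g where g: "g : G" "x = g p" using same[OF x] planes x34 by blast
   have "x : {x. x \<bullet> f1 = 0 & x \<bullet> f2 = 0}" using g f(2,3) G_frame by blast
   hence "x = cmb 0 0 0 0" using cmb_expand[of x] x34 by auto
   thus False using x z cmb_zero by simp
  qed
 qed (use emb Ginv un min in auto)
 thus thesis by (rule that)
qed

theorem theorem4p5:
  fixes A :: "(real^4) set" and \<nu> :: "real^4 \<Rightarrow> real^4"
    and r :: "nat \<Rightarrow> real" and l :: nat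
  assumes "alencar_hypersurface A \<nu>"
    and "\<And>m. m \<ge> 1 \<Longrightarrow> r m > 0"
    and "strict_mono_on {1..} r"
    and "filterlim r at_top sequentially"
    and "{x \<in> A. (\<Sum>k\<in>UNIV. x $ k * \<nu> x $ k) = 0} = (\<Union>m\<in>{1..}. {x \<in> A. norm x = r m})"
    and "\<And>m. m \<ge> 1 \<Longrightarrow> toral_orbit {x \<in> A. norm x = r m}"
    and "l \<ge> 1"
  shows "equivariant_index G (truncation A (r l)) (\<lambda>x. \<nu> (r l *\<^sub>R x)) \<ge> enat l"
proof -
 obtain f1 f2 f3 f4 b where im: "invariant_minimal f1 f2 f3 f4 A \<nu> b" using alencar_invariant_minimal[OF assms(1)] by blast
 interpret M: invariant_minimal f1 f2 f3 f4 A \<nu> b by (rule im)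
 \<comment> \<open>On the circular orbit \<open>n_base\<close> leaves two possibilities; the sign is
   chosen so that the normal points to the origin.\<close>
 obtain n where n: "normalised_minimal f1 f2 f3 f4 A n b" "n = \<nu> \<or> n = (%x. - \<nu> x)"
 proof (cases "\<nu> (M.cmb 0 0 b 0) = M.cmb 0 0 (-1) 0")
  case True
  have "normalised_minimal f1 f2 f3 f4 A \<nu> b" by unfold_locales (rule True)
  thus ?thesis using that by blast
 next
  case False
  hence "- \<nu> (M.cmb 0 0 b 0) = M.cmb 0 0 (-1) 0" using M.n_base by auto
  hence "normalised_minimal f1 f2 f3 f4 A (%x. - \<nu> x) b"
   by unfold_locales (use M.emb M.Ginv M.conn M.unbounded M.b M.base M.axis_norm M.off_plane unit_normal_minus[OF M.un]
     normal_minus(1)[OF M.mfdA M.un] M.minimal in auto)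
  thus ?thesis using that by blast
 qed
 interpret N: normalised_minimal f1 f2 f3 f4 A n b by (rule n(1))
 interpret P: rotational_profile f1 f2 f3 f4 A n b "%t. N.Gam t \<bullet> f1" "%t. N.Gam t \<bullet> f3" "%t. n (N.Gam t) \<bullet> f1" "%t. n (N.Gam t) \<bullet> f3"
  by (rule N.rotational_profile_Gam)
 \<comment> \<open>The slice of norm \<open>r i\<close> is a toral orbit. If \<open>b = r i\<close>,
   it would contain a point of the circular orbit, and an element of \<open>G\<close> would carry a
   point off the coordinate planes into one of them.\<close>
 have sphere: "b < r i & P.u0 ((r i)^2) = 0" if i: "i >= 1" for i
 proof -
  obtain q where q: "q ~: plane12 Un plane34" "{x : A. norm x = r i} = G_orbit q" using assms(6)[OF i] unfolding toral_orbit_def by blast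
  have "(%x. x) : G" unfolding G_def by auto
  hence qA: "q : A" "norm q = r i" using q(2) unfolding G_orbit_def by auto
  then obtain t al be where t: "q = M.cyl (N.Gam t \<bullet> f1) (N.Gam t \<bullet> f3) al be" "b^2 <= t"
   using subsetD[OF equalityD1[OF P.A_eq]] by blast
  have tr: "t = (r i)^2" using M.cyl_norm P.radius[OF t(2)] qA(2) unfolding t(1) by metis
  have "b <= r i" by (rule power2_le_imp_le) (use t(2) less_imp_le[OF assms(2)[OF i]] in \<open>simp_all only: tr\<close>)
  moreover have "b ~= r i"
  proof
   assume "b = r i"
   hence "M.cmb 0 0 b 0 : {x : A. norm x = r i}" using M.base M.axis_norm[OF M.base] by simp
   then obtain g where g: "g : G" "M.cmb 0 0 b 0 = g q" unfolding q(2) G_orbit_def by auto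
   have "g q : g ` {x. x \<bullet> f1 = 0 & x \<bullet> f2 = 0}" using g M.G_frame[of g] by (metis (mono_tags, lifting) M.cmb_coords(1,2) mem_Collect_eq)
   hence "q \<bullet> f1 = 0 & q \<bullet> f2 = 0" using M.G_orthogonal(3)[OF g(1)] by (auto simp: bij_def inj_def)
   thus False using q(1) M.frame unfolding plane12_def plane34_def by (auto simp: inner_axis)
  qed
  moreover have "P.u0 ((r i)^2) = 0"
  proof -
   have "q : {x : A. (\<Sum>k\<in>UNIV. x $ k * \<nu> x $ k) = 0}" unfolding assms(5) using qA i by auto
   hence "q \<bullet> \<nu> q = 0" by (simp add: inner_vec_def)
   hence "q \<bullet> n q = 0" using n(2) by auto
   thus ?thesis unfolding P.u0_def tr[symmetric] unfolding t(1) P.n_eq[OF t(2)] by (simp add: M.cyl_inner)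
  qed
  ultimately show ?thesis by simp
 qed
 interpret T: truncated_profile f1 f2 f3 f4 A n b "%t. N.Gam t \<bullet> f1" "%t. N.Gam t \<bullet> f3" "%t. n (N.Gam t) \<bullet> f1" "%t. n (N.Gam t) \<bullet> f3" "r l"
  by unfold_locales (use sphere[OF assms(7)] in simp)
 \<comment> \<open>The zeros are numbered from 1; index 0 is given to the parameter
   \<open>b^2\<close> of the circular orbit, where the angle starts.\<close>
 have step: "(if i = 0 then b^2 else (r i)^2) < (if Suc i = 0 then b^2 else (r (Suc i))^2)" for i
 proof (cases "i = 0")
  case True
  thus ?thesis using sphere[of 1] M.b by (simp add: power_strict_mono)
 next
  case False
  hence "r i < r (Suc i)" using assms(3) by (simp add: strict_mono_on_def)
  thus ?thesis using False assms(2)[of i] by (simp add: power_strict_mono)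
 qed
 have idx: "enat l <= equivariant_index G T.Sig T.nuSig"
  by (rule T.equivariant_index_ge[of "%i. if i = 0 then b^2 else (r i)^2"])
   (use step sphere assms(7) in \<open>auto simp: T.L_def\<close>)
 have "equivariant_index G T.Sig (%x. \<nu> (r l *\<^sub>R x)) = equivariant_index G T.Sig T.nuSig"
  using n(2)
 proof
  assume "n = \<nu>"
  thus ?thesis unfolding T.nuSig_def[abs_def] by simp
 next
  assume "n = (%x. - \<nu> x)"
  thus ?thesis using T.equivariant_index_minus unfolding T.nuSig_def by simp
 qed
 thus ?thesis using idx unfolding T.Sig_def by simp
qed

end
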